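(* For any VC class $\mathbb C$, there exists a passive learning algorithm $\mathcal A_p$ such that the active learning algorithm obtained by running Meta-Algorithm 3 with $\mathcal A_p$ as its passive-algorithm input achieves a label complexity $\Lambda_a$ satisfying, for every $f\in\mathbb C$ and every distribution $\mathcal P$ on $\mathcal X$ (as $\varepsilon\to0^+$), $$\Lambda_a(\varepsilon,f,\mathcal P)=O\left(\tilde\theta_f(\varepsilon)\log^2(1/\varepsilon)\right).$$
   Context: Setting. $(\mathcal X,\mathcal F)$ is a standard Borel space; a classifier is a measurable $h:\mathcal X\to\{-1,+1\}$; a concept space $\mathbb C$ is a set of classifiers; a VC class is a concept space whose VC dimension $d$ satisfies $0<d<\infty$. All sets arising are implicitly assumed measurable. For a probability measure ("distribution") $\mathcal P$ on $\mathcal X$ and a target function $f\in\mathbb C$: $X_1,X_2,\ldots$ are i.i.d. $\mathcal P$, $Y_i=f(X_i)$, and $\mathrm{er}(h)=\mathcal P(x:h(x)\ne f(x))$. A passive learning algorithm is a (possibly randomized) map $\mathcal A$ from finite sequences $\mathcal L\in\bigcup_n(\mathcal X\times\{-1,+1\})^n$ to classifiers. An active learning algorithm (possibly randomized) gets a label budget $n\in\mathbb N$ and access to the unlabeled data; it sequentially requests labels $Y_i$ of indices of its choice (choices may depend on labels already seen), at most $n$ in total, and returns a classifier $\mathcal A(n)$. An active algorithm achieves label complexity $\Lambda$ if for every $f\in\mathbb C$, distribution $\mathcal P$, $\varepsilon\in(0,1)$ and integer $n\ge\Lambda(\varepsilon,f,\mathcal P)$, $\mathbb E[\mathrm{er}(\mathcal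 A(n))]\le\varepsilon$. Label complexities take values in $\{1,2,\ldots\}\cup\{\infty\}$. Shattering. $\mathcal H$ shatters $S=(x_1,\ldots,x_k)\in\mathcal X^k$ if for all $(y_1,\ldots,y_k)\in\{-1,+1\}^k$ some $h\in\mathcal H$ has $h(x_i)=y_i$ for all $i$. $\mathcal X^0=\{\varnothing\}$, $\mathcal P^0(\mathcal X^0)=1$, and $\mathcal H$ shatters $\varnothing$ iff $\mathcal H\neq\emptyset$. $S\cup\{x\}$ denotes the tuple $S$ extended by $x$. $\mathcal H[(x,y)]=\{h\in\mathcal H:h(x)=y\}$. $\mathrm{DIS}(\mathcal H)=\{x:\exists h_1,h_2\in\mathcal H,h_1(x)\neq h_2(x)\}$. For a finite labeled sequence $Q$, $\mathrm{er}_Q(h)$ is the fraction of $(x,y)\in Q$ with $h(x)\neq y$, and $\mathrm{er}_\emptyset(h)=0$. The quantity $\tilde\theta_f$ (with respect to $\mathbb C,\mathcal P$). $\mathrm B(f,r)=\{g\in\mathbb C:\mathcal P(x:g(x)\ne f(x))\le r\}$. The $k$-dimensional shatter core is $\partial^kf=\lim_{r\to0^+}\{S\in\mathcal X^k:\mathrm B(f,r)\text{ shatters }S\}$ (decreasing limit). For $k\in\mathbb N$, $\varepsilon\ge0$, $\theta_f^{(k)}(\varepsilon)=1\vee\sup_{r>\varepsilon}\mathcal P^k(S\in\mathcal X^k:\mathrm B(f,r)\text{ shatters }S)/r$. $\tilde d_f=\min\{k\in\mathbb N:\mathcal P^k(\partial^kf)=0\}$ (at most $d+1$), and $\tilde\theta_f(\varepsilon)=\theta_f^{(\tilde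 d_f)}(\varepsilon)$. Estimators. The algorithm also has access to two further unlabeled i.i.d.-$\mathcal P$ sequences $W_1=(w_1,w_2,\ldots)$ and $W_2=(w_1',w_2',\ldots)$, independent of each other and of $X_1,X_2,\ldots$ (e.g. obtained by splitting the unlabeled data stream in three). For $k\ge2$ let $S_i^{(k)}=(w'_{1+(i-1)(k-1)},\ldots,w'_{i(k-1)})\in\mathcal X^{k-1}$. For $\mathcal H\subseteq\mathbb C$, $x\in\mathcal X$, $y\in\{-1,+1\}$, $m\in\mathbb N$: for $k=1$, $\hat\Gamma_m^{(1)}(x,y,\mathcal H)=\mathbb 1[\forall h\in\mathcal H,\ h(x)=y]$ and $\hat\Delta_m^{(1)}(x,\mathcal H)=\mathbb 1[x\in\mathrm{DIS}(\mathcal H)]$; for $k\ge2$, $M_m^{(k)}(\mathcal H)=\max\{1,\#\{i\le m^3:\mathcal H\text{ shatters }S_i^{(k)}\}\}$, $\hat\Gamma_m^{(k)}(x,y,\mathcal H)=\frac{1}{M_m^{(k)}(\mathcal H)}\#\{i\le m^3:\mathcal H\text{ shatters }S_i^{(k)},\ \mathcal H[(x,-y)]\text{ does not shatter }S_i^{(k)}\}$, $\hat\Delta_m^{(k)}(x,\mathcal H)=\frac{1}{M_m^{(k)}(\mathcal H)}\#\{i\le m^3:\mathcal H\text{ shatters }S_i^{(k)}\cup\{x\}\}$; and for all $k\geq 1$, $\hat\Delta_m^{(k)}(\mathcal H)=\frac2m+\frac1{m^3}\#\{i\le m^3:\hat\Delta_m^{(k)}(w_i,\mathcal H)\ge 1/8\}$.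 Meta-Algorithm 3 (input: passive algorithm $\mathcal A_p$, budget $n$). 0. $V\gets V_0=\mathbb C$, $T_0\gets\lceil2n/3\rceil$, $t\gets0$, $m\gets0$. 1. For $k=1,\ldots,d+1$: 2. $\mathcal L_k\gets()$, $T_k\gets T_{k-1}-t$, then $t\gets0$. 3. While $t<\lceil T_k/4\rceil$ and $m\le k\cdot2^n$: 4. $m\gets m+1$; 5. if $\hat\Delta_m^{(k)}(X_m,V)\ge1/2$, 6. request $Y_m$, let $\hat y\gets Y_m$, $t\gets t+1$; 7. else $\hat y\gets\arg\max_{y\in\{-1,+1\}}\hat\Gamma_m^{(k)}(X_m,y,V)$; 8. $V\gets V_m=V_{m-1}[(X_m,\hat y)]$. 9. (after the while loop) $\hat\Delta^{(k)}\gets\hat\Delta_m^{(k)}(V)$. 10. Do $\lfloor T_k/(3\hat\Delta^{(k)})\rfloor$ times: 11. $m\gets m+1$; 12. if $\hat\Delta_m^{(k)}(X_m,V)\ge1/2$ and $t<\lfloor3T_k/4\rfloor$, 13. request $Y_m$, let $\hat y\gets Y_m$, $t\gets t+1$; 14. else $\hat y\gets\arg\max_{y}\hat\Gamma_m^{(k)}(X_m,y,V)$; 15. append $(X_m,\hat y)$ to $\mathcal L_k$ and let $V\gets V_m=V_{m-1}[(X_m,\hat y)]$. 16. Return $\mathrm{ActiveSelect}(\{\mathcal A_p(\mathcal L_1),\ldots,\mathcal A_p(\mathcal L_{d+1})\},\lfloor n/3\rfloor,\{X_{m+1},X_{m+2},\ldots\})$. ActiveSelect (input: classifiers $h_1,\ldots,h_N$,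 budget $m$, unlabeled sequence $\mathcal U$): for each $1\le j<k\le N$, let $R_{jk}$ be the first $\lfloor\frac{m}{j(N-j)\ln(eN)}\rfloor$ points of $\mathcal U$ in $\{x:h_j(x)\ne h_k(x)\}$ (if they exist), request their labels, let $Q_{jk}$ be the resulting labeled set, and let $m_{kj}=\mathrm{er}_{Q_{jk}}(h_k)$. Return $h_{\hat k}$ with $\hat k=\max\{k\in\{1,\ldots,N\}:\max_{j<k}m_{kj}\le7/12\}$ (the condition is vacuous for $k=1$). *)

theory Defs
  imports "HOL-Probability.Probability" "HOL-Library.While_Combinator"
begin

text \<open>Labels are booleans: \<open>True\<close> is +1, \<open>False\<close> is -1, and negation flips the sign. Instance
  and label sequences are indexed from 1; index 0 exists but is never looked at. A \<open>k\<close>-tuple of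
  points is a function of which only the values at \<open>0, \<dots>, k - 1\<close> matter.\<close>

definition standard_borel :: "'a measure \<Rightarrow> bool" where
  "standard_borel M \<longleftrightarrow>
     (\<exists>T. completely_metrizable_space T \<and> second_countable T \<and> topspace T = space M \<and>
          sets M = sigma_sets (space M) {A. openin T A})"

definition classifiers :: "'a measure \<Rightarrow> ('a \<Rightarrow> bool) set" where
  "classifiers M = measurable M (count_space UNIV)"

definition distributions :: "'a measure \<Rightarrow> 'a measure set" where
  "distributions M = {P. prob_space P \<and> sets P = sets M}"

definition shatters :: "('a \<Rightarrow> bool) set \<Rightarrow> nat \<Rightarrow> (nat \<Rightarrow> 'a) \<Rightarrow> bool" where
  "shatters H k S \<longleftrightarrow> (\<forall>y :: nat \<Rightarrow> bool. \<exists>h\<in>H. \<forall>i<k. h (S i) = y i)"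

definition vc_dim :: "'a measure \<Rightarrow> ('a \<Rightarrow> bool) set \<Rightarrow> enat" where
  "vc_dim M H = (SUP k \<in> {k. \<exists>S \<in> {..<k} \<rightarrow>\<^sub>E space M. shatters H k S}. enat k)"

definition vc_class :: "'a measure \<Rightarrow> ('a \<Rightarrow> bool) set \<Rightarrow> bool" where
  "vc_class M C \<longleftrightarrow> C \<subseteq> classifiers M \<and> 0 < vc_dim M C \<and> vc_dim M C < \<infinity>"

definition err :: "'a measure \<Rightarrow> ('a \<Rightarrow> bool) \<Rightarrow> ('a \<Rightarrow> bool) \<Rightarrow> real" where
  "err P f h = measure P {x \<in> space P. h x \<noteq> f x}"

definition concept_ball ::
  "'a measure \<Rightarrow> ('a \<Rightarrow> bool) set \<Rightarrow> ('a \<Rightarrow> bool) \<Rightarrow> real \<Rightarrow> ('a \<Rightarrow> bool) set" where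
  "concept_ball P C f r = {g \<in> C. err P f g \<le> r}"

definition power_measure :: "nat \<Rightarrow> 'a measure \<Rightarrow> (nat \<Rightarrow> 'a) measure" where
  "power_measure k P = Pi\<^sub>M {..<k} (\<lambda>_. P)"

definition shattered_tuples ::
  "'a measure \<Rightarrow> ('a \<Rightarrow> bool) set \<Rightarrow> nat \<Rightarrow> (nat \<Rightarrow> 'a) set" where
  "shattered_tuples P H k = {S \<in> space (power_measure k P). shatters H k S}"

definition shatter_core ::
  "'a measure \<Rightarrow> ('a \<Rightarrow> bool) set \<Rightarrow> ('a \<Rightarrow> bool) \<Rightarrow> nat \<Rightarrow> (nat \<Rightarrow> 'a) set" where
  "shatter_core P C f k = (\<Inter>r\<in>{0<..}. shattered_tuples P (concept_ball P C f r) k)"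

text \<open>Extended reals, because the supremum may be infinite when \<open>\<epsilon> = 0\<close>.\<close>

definition theta ::
  "'a measure \<Rightarrow> ('a \<Rightarrow> bool) set \<Rightarrow> ('a \<Rightarrow> bool) \<Rightarrow> nat \<Rightarrow> real \<Rightarrow> ereal" where
  "theta P C f k \<epsilon> =
     max 1 (SUP r\<in>{\<epsilon><..}.
       ereal (measure (power_measure k P) (shattered_tuples P (concept_ball P C f r) k) / r))"

definition d_tilde :: "'a measure \<Rightarrow> ('a \<Rightarrow> bool) set \<Rightarrow> ('a \<Rightarrow> bool) \<Rightarrow> nat" where
  "d_tilde P C f = (LEAST k. measure (power_measure k P) (shatter_core P C f k) = 0)"

definition theta_tilde ::
  "'a measure \<Rightarrow> ('a \<Rightarrow> bool) set \<Rightarrow> ('a \<Rightarrow> bool) \<Rightarrow> real \<Rightarrow> ereal" where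
  "theta_tilde P C f = theta P C f (d_tilde P C f)"

text \<open>The blanket assumption that the sets involved are measurable, made explicit. The class itself
  is covered too, as the ball of radius 1. Without it \<^const>\<open>measure\<close> and the Bochner integral would
  return the default value 0 on non-measurable arguments.\<close>

definition measurable_realizations :: "'a measure \<Rightarrow> ('a \<Rightarrow> bool) set \<Rightarrow> bool" where
  "measurable_realizations M C \<longleftrightarrow>
     (\<forall>P\<in>distributions M. \<forall>f\<in>C. \<forall>r k. \<forall>y :: nat \<Rightarrow> bool.
        {S \<in> space (power_measure k M). \<exists>h\<in>concept_ball P C f r. \<forall>i<k. h (S i) = y i}
          \<in> sets (power_measure k M))"

text \<open>Internal randomness is a seed, uniformly distributed on the unit interval.\<close>

definition seed_measure :: "real measure" where
  "seed_measure = uniform_measure lborel {0..1}"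

type_synonym 'a passive_learner = "real \<Rightarrow> ('a \<times> bool) list \<Rightarrow> 'a \<Rightarrow> bool"

text \<open>Joint measurability makes every output a classifier and its error a random variable.\<close>

definition passive_algorithm :: "'a measure \<Rightarrow> 'a passive_learner \<Rightarrow> bool" where
  "passive_algorithm M A \<longleftrightarrow>
     (\<forall>n. \<forall>y :: nat \<Rightarrow> bool.
        (\<lambda>(u, S, x). A u (map (\<lambda>i. (S i, y i)) [0..<n]) x)
          \<in> measurable (seed_measure \<Otimes>\<^sub>M power_measure n M \<Otimes>\<^sub>M M) (count_space UNIV))"

text \<open>The sequences \<open>X\<close>, \<open>W\<^sub>1\<close>, \<open>W\<^sub>2\<close> of unlabeled points, and a sequence of independent seeds.\<close>

type_synonym 'a source = "(nat \<Rightarrow> 'a) \<times> (nat \<Rightarrow> 'a) \<times> (nat \<Rightarrow> 'a) \<times> (nat \<Rightarrow> real)"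

definition source_measure :: "'a measure \<Rightarrow> 'a source measure" where
  "source_measure P =
     Pi\<^sub>M UNIV (\<lambda>_. P) \<Otimes>\<^sub>M Pi\<^sub>M UNIV (\<lambda>_. P) \<Otimes>\<^sub>M Pi\<^sub>M UNIV (\<lambda>_. P) \<Otimes>\<^sub>M
     Pi\<^sub>M UNIV (\<lambda>_. seed_measure)"

text \<open>The arguments are the label budget, the unlabeled data with the seeds, and the label oracle. The
  type does not enforce the budget; the algorithm below respects it by counting its requests.\<close>

type_synonym 'a active_learner = "nat \<Rightarrow> 'a source \<Rightarrow> (nat \<Rightarrow> bool) \<Rightarrow> 'a \<Rightarrow> bool"

definition achieves_label_complexity ::
  "'a measure \<Rightarrow> ('a \<Rightarrow> bool) set \<Rightarrow> 'a active_learner \<Rightarrow>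
   (real \<Rightarrow> ('a \<Rightarrow> bool) \<Rightarrow> 'a measure \<Rightarrow> enat) \<Rightarrow> bool" where
  "achieves_label_complexity M C A \<Lambda> \<longleftrightarrow>
     (\<forall>\<epsilon> f P. 1 \<le> \<Lambda> \<epsilon> f P) \<and>
     (\<forall>f\<in>C. \<forall>P\<in>distributions M. \<forall>\<epsilon>\<in>{0<..<1}. \<forall>n. \<Lambda> \<epsilon> f P \<le> enat n \<longrightarrow>
        (let er_n = (\<lambda>\<omega>. err P f (A n \<omega> (\<lambda>i. f (fst \<omega> i))))
         in er_n \<in> borel_measurable (source_measure P) \<and>
            integral\<^sup>L (source_measure P) er_n \<le> \<epsilon>))"

definition DIS :: "('a \<Rightarrow> bool) set \<Rightarrow> 'a set" where
  "DIS H = {x. \<exists>h\<^sub>1\<in>H. \<exists>h\<^sub>2\<in>H. h\<^sub>1 x \<noteq> h\<^sub>2 x}"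

definition constrain :: "('a \<Rightarrow> bool) set \<Rightarrow> 'a \<Rightarrow> bool \<Rightarrow> ('a \<Rightarrow> bool) set" where
  "constrain H x y = {h \<in> H. h x = y}"

text \<open>The tuple of length \<open>k - 1\<close>, for \<open>k \<ge> 2\<close> and \<open>i \<ge> 1\<close>.\<close>

definition sample_tuple :: "(nat \<Rightarrow> 'a) \<Rightarrow> nat \<Rightarrow> nat \<Rightarrow> nat \<Rightarrow> 'a" where
  "sample_tuple W2 k i = (\<lambda>j. W2 (1 + (i - 1) * (k - 1) + j))"

definition M_hat :: "(nat \<Rightarrow> 'a) \<Rightarrow> nat \<Rightarrow> nat \<Rightarrow> ('a \<Rightarrow> bool) set \<Rightarrow> nat" where
  "M_hat W2 k m H = max 1 (card {i\<in>{1..m^3}. shatters H (k - 1) (sample_tuple W2 k i)})"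

definition Gamma_hat ::
  "(nat \<Rightarrow> 'a) \<Rightarrow> nat \<Rightarrow> nat \<Rightarrow> 'a \<Rightarrow> bool \<Rightarrow> ('a \<Rightarrow> bool) set \<Rightarrow> real" where
  "Gamma_hat W2 k m x y H =
     (if k = 1 then of_bool (\<forall>h\<in>H. h x = y)
      else real (card {i\<in>{1..m^3}. shatters H (k - 1) (sample_tuple W2 k i) \<and>
                         \<not> shatters (constrain H x (\<not> y)) (k - 1) (sample_tuple W2 k i)})
           / real (M_hat W2 k m H))"

definition Delta_hat ::
  "(nat \<Rightarrow> 'a) \<Rightarrow> nat \<Rightarrow> nat \<Rightarrow> 'a \<Rightarrow> ('a \<Rightarrow> bool) set \<Rightarrow> real" where
  "Delta_hat W2 k m x H =
     (if k = 1 then of_bool (x \<in> DIS H)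
      else real (card {i\<in>{1..m^3}. shatters H k ((sample_tuple W2 k i)(k - 1 := x))})
           / real (M_hat W2 k m H))"

definition Delta_hat_set ::
  "(nat \<Rightarrow> 'a) \<Rightarrow> (nat \<Rightarrow> 'a) \<Rightarrow> nat \<Rightarrow> nat \<Rightarrow> ('a \<Rightarrow> bool) set \<Rightarrow> real" where
  "Delta_hat_set W1 W2 k m H =
     2 / real m + real (card {i\<in>{1..m^3}. Delta_hat W2 k m (W1 i) H \<ge> 1/8}) / real m ^ 3"

text \<open>Indices of the first \<open>q\<close> points beyond \<open>X\<^sub>s\<close> on which two classifiers differ, or of all such
  points if there are fewer than \<open>q\<close>.\<close>

definition first_disagreements ::
  "(nat \<Rightarrow> 'a) \<Rightarrow> nat \<Rightarrow> nat \<Rightarrow> ('a \<Rightarrow> bool) \<Rightarrow> ('a \<Rightarrow> bool) \<Rightarrow> nat set" where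
  "first_disagreements X s q g h =
     {i. s < i \<and> g (X i) \<noteq> h (X i) \<and> card {i'. s < i' \<and> i' < i \<and> g (X i') \<noteq> h (X i')} < q}"

text \<open>Equal to 0 on the empty sample, as division by 0 yields 0.\<close>

definition empirical_err ::
  "(nat \<Rightarrow> 'a) \<Rightarrow> (nat \<Rightarrow> bool) \<Rightarrow> nat set \<Rightarrow> ('a \<Rightarrow> bool) \<Rightarrow> real" where
  "empirical_err X Y I h = real (card {i\<in>I. h (X i) \<noteq> Y i}) / real (card I)"

text \<open>The candidates are \<open>hs 1, \<dots>, hs N\<close>, the budget is \<open>b\<close>, and the unlabeled sequence consists of
  the points after \<open>X\<^sub>s\<close>.\<close>

definition active_select ::
  "(nat \<Rightarrow> 'a) \<Rightarrow> (nat \<Rightarrow> bool) \<Rightarrow> nat \<Rightarrow> nat \<Rightarrow> nat \<Rightarrow> (nat \<Rightarrow> 'a \<Rightarrow> bool) \<Rightarrow> 'a \<Rightarrow> bool" where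
  "active_select X Y s N b hs =
     (let q = (\<lambda>j. nat \<lfloor>real b / (real j * real (N - j) * ln (exp 1 * real N))\<rfloor>);
          e = (\<lambda>k j. empirical_err X Y (first_disagreements X s (q j) (hs j) (hs k)) (hs k))
      in hs (Max {k\<in>{1..N}. \<forall>j\<in>{1..<k}. e k j \<le> 7/12}))"

record 'a learner_state =
  pos :: nat                     \<comment> \<open>\<open>m\<close>, the number of points of \<open>X\<close> processed so far\<close>
  used :: nat                    \<comment> \<open>\<open>t\<close>, the number of labels requested in this round\<close>
  vspace :: "('a \<Rightarrow> bool) set"   \<comment> \<open>\<open>V\<close>\<close>
  labeled :: "('a \<times> bool) list"  \<comment> \<open>\<open>\<L>\<^sub>k\<close>\<close>

context
  fixes X W1 W2 :: "nat \<Rightarrow> 'a"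
    and Y :: "nat \<Rightarrow> bool"
    and n :: nat
begin

text \<open>One pass through either loop body; \<open>ok\<close> says whether a label may still be requested. Ties of
  the maximum are broken arbitrarily, by the choice operator in \<^const>\<open>arg_max\<close>.\<close>

definition process_point :: "nat \<Rightarrow> bool \<Rightarrow> 'a learner_state \<Rightarrow> 'a learner_state \<times> ('a \<times> bool)" where
  "process_point k ok s =
     (let m = pos s + 1;
          V = vspace s;
          query = (Delta_hat W2 k m (X m) V \<ge> 1/2 \<and> ok);
          y = (if query then Y m else arg_max (\<lambda>y. Gamma_hat W2 k m (X m) y V) (\<lambda>_. True))
      in (s\<lparr>pos := m, used := (if query then used s + 1 else used s),
            vspace := constrain V (X m) y\<rparr>,
          (X m, y)))"

definition explore_step :: "nat \<Rightarrow> 'a learner_state \<Rightarrow> 'a learner_state" where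
  "explore_step k s = fst (process_point k True s)"

definition collect_step :: "nat \<Rightarrow> nat \<Rightarrow> 'a learner_state \<Rightarrow> 'a learner_state" where
  "collect_step k T s =
     (let (s', xy) = process_point k (int (used s) < \<lfloor>3 * real T / 4\<rfloor>) s
      in s'\<lparr>labeled := labeled s @ [xy]\<rparr>)"

definition meta_round :: "nat \<Rightarrow> nat \<Rightarrow> 'a learner_state \<Rightarrow> 'a learner_state" where
  "meta_round k T s\<^sub>0 =
     (let s\<^sub>1 = while (\<lambda>s. int (used s) < \<lceil>real T / 4\<rceil> \<and> pos s \<le> k * 2 ^ n) (explore_step k)
                 (s\<^sub>0\<lparr>used := 0, labeled := []\<rparr>);
          \<Delta> = Delta_hat_set W1 W2 k (pos s\<^sub>1) (vspace s\<^sub>1)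
      in (collect_step k T ^^ nat \<lfloor>real T / (3 * \<Delta>)\<rfloor>) s\<^sub>1)"

text \<open>The first component is \<open>T\<^sub>k\<close>; the truncated subtraction is exact since \<open>t \<le> T\<^sub>k\<close> throughout.\<close>

primrec meta_rounds :: "('a \<Rightarrow> bool) set \<Rightarrow> nat \<Rightarrow> nat \<times> 'a learner_state" where
  "meta_rounds C 0 = (nat \<lceil>2 * real n / 3\<rceil>, \<lparr>pos = 0, used = 0, vspace = C, labeled = []\<rparr>)"
| "meta_rounds C (Suc k) =
     (let (T, s) = meta_rounds C k;
          T' = T - used s
      in (T', meta_round (Suc k) T' s))"

end

text \<open>Each invocation of the passive algorithm uses a fresh seed.\<close>

definition meta_algorithm :: "'a measure \<Rightarrow> ('a \<Rightarrow> bool) set \<Rightarrow> 'a passive_learner \<Rightarrow> 'a active_learner" where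
  "meta_algorithm M C A n = (\<lambda>(X, W1, W2, U) Y.
     let N = the_enat (vc_dim M C) + 1;
         final = (\<lambda>k. snd (meta_rounds X W1 W2 Y n C k))
     in active_select X Y (pos (final N)) N (n div 3) (\<lambda>k. A (U k) (labeled (final k))))"

end

theory Submission
  imports Defs
begin

text \<open>The passive algorithm is a transductive halving learner: it makes at most \<open>log\<^sub>2\<close> of the number
  of realized patterns many mistakes, so by exchangeability and the Sauer--Shelah bound its expected
  error on \<open>J\<close> labeled points is \<open>O(d log J / J)\<close>.

  Let \<open>k\<close> be at most the critical dimension. With exponentially small failure probability, the
  estimators of round \<open>k\<close> compare the probability that a random \<open>(k-1)\<close>-tuple extended by \<open>x\<close> is
  shattered by the version space with the positive mass of the \<open>(k-1)\<close>-dimensional shatter core;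
  hence a label that is not requested is inferred correctly. The points that trigger a request have a
  density which the estimate of step 9 bounds from above, so the second loop does not exhaust the
  quota and its labels are all correct.

  In the critical round, after \<open>j\<close> points the version space has radius \<open>O(log(1/\<epsilon>) / j)\<close>, so by Markov's
  inequality the request probability is \<open>O(\<theta> log(1/\<epsilon>) / j)\<close>. Summing over \<open>j\<close>, the first loop reaches
  \<open>log(1/\<epsilon>) / \<epsilon>\<close> points with \<open>O(\<theta> log\<^sup>2(1/\<epsilon>))\<close> requests; then the density is \<open>O(\<theta> \<epsilon>)\<close> and the second loop
  collects of order \<open>log(1/\<epsilon>) / \<epsilon>\<close> labeled points, enough for error \<open>\<epsilon>\<close>. ActiveSelect loses a factor
  of at most two.\<close>

section \<open>Patterns and the Sauer--Shelah bound\<close>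

text \<open>The obstacle is adaptivity: requests, inferred labels and sample sizes all depend on the
  data. Two independences remove it. \<open>W1\<close> and \<open>W2\<close> are independent of
  \<open>X\<close>, so once \<open>X\<close> is fixed the version space is a fixed class and
  Hoeffding's inequality applies to the estimators. And the state after a loop depends on no point
  of \<open>X\<close> beyond its position, so the points behind it are fresh; the second loop is
  compared with the learner on J correctly labeled fresh points, where J is known when the loop
  starts. Failure probabilities of the form K exp (- g n), with K and g depending on f and P, fall
  below a multiple of \<epsilon>^2 once n is a large multiple of log(1/\<epsilon>). Events that
  involve \<epsilon> itself are bounded with constants free of \<epsilon>. One logarithm stems from
  the radius, the other from the harmonic sum over j in the first loop; the second loop alone would
  be content with n of order \<theta> log(1/\<epsilon>). Rounds after the critical one may infer
  wrong labels; the selection step makes their output harmless, so the critical dimension need not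
  be known.\<close>

definition shattered_by :: "'i set set \<Rightarrow> 'i set \<Rightarrow> bool" where
  "shattered_by F T \<longleftrightarrow> (\<forall>U\<subseteq>T. \<exists>v\<in>F. v \<inter> T = U)"

text \<open>Split \<open>F\<close> at the new element \<open>a\<close> into the sets without
  \<open>a\<close> and the sets with \<open>a\<close> removed. Then |F| = |F0| + |F1| = |F0 \<union>
  F1| + |F0 \<inter> F1|. A set shattered by the union is shattered by \<open>F\<close>; a set
  shattered by the intersection stays shattered when \<open>a\<close> is added. The two kinds of
  sets differ in whether they contain \<open>a\<close>, so they are counted separately.\<close>

theorem pajor:
  assumes "finite I" "F \<subseteq> Pow I"
  shows "card F \<le> card {T. T \<subseteq> I \<and> shattered_by F T}"
  using assms
proof (induction I arbitrary: F rule: finite_induct)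
  case empty
  then consider "F = {}" | "F = {{}}" by auto
  then show ?case
  proof cases
    case 2
    then have "{T. T \<subseteq> {} \<and> shattered_by F T} = {{}}" by (auto simp: shattered_by_def)
    then show ?thesis using 2 by simp
  qed simp
next
  case (insert a I)
  define F0 where "F0 = {v\<in>F. a \<notin> v}"
  define F1 where "F1 = (\<lambda>v. v - {a}) ` {v\<in>F. a \<in> v}"
  have fin: "finite F" using insert by (meson finite_Pow_iff finite_insert finite_subset)
  have F01: "F0 \<subseteq> Pow I" "F1 \<subseteq> Pow I" using insert.prems by (auto simp: F0_def F1_def)
  have fin01: "finite F0" "finite F1" using fin by (auto simp: F0_def F1_def)
  have inj: "inj_on (\<lambda>v. v - {a}) {v\<in>F. a \<in> v}"
    by (auto simp: inj_on_def)
  have "card F = card F0 + card {v\<in>F. a \<in> v}"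
    unfolding F0_def using fin by (subst card_Un_disjoint[symmetric]) (auto intro: arg_cong[where f=card])
  also have "card {v\<in>F. a \<in> v} = card F1" unfolding F1_def using inj by (simp add: card_image)
  finally have "card F = card F0 + card F1" .
  also have "\<dots> = card (F0 \<union> F1) + card (F0 \<inter> F1)" using card_Un_Int[OF fin01] .
  also have "\<dots> \<le> card {T. T \<subseteq> I \<and> shattered_by (F0 \<union> F1) T} + card {T. T \<subseteq> I \<and> shattered_by (F0 \<inter> F1) T}"
    using insert.IH[of "F0 \<union> F1"] insert.IH[of "F0 \<inter> F1"] F01 by (meson Un_least add_mono inf.coboundedI1)
  also have "card {T. T \<subseteq> I \<and> shattered_by (F0 \<inter> F1) T}
     = card (insert a ` {T. T \<subseteq> I \<and> shattered_by (F0 \<inter> F1) T})"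
    using insert.hyps by (subst card_image) (auto simp: inj_on_def)
  also have "card {T. T \<subseteq> I \<and> shattered_by (F0 \<union> F1) T} + \<dots> =
     card ({T. T \<subseteq> I \<and> shattered_by (F0 \<union> F1) T} \<union> insert a ` {T. T \<subseteq> I \<and> shattered_by (F0 \<inter> F1) T})"
    using insert.hyps by (subst card_Un_disjoint) auto
  also have "\<dots> \<le> card {T. T \<subseteq> insert a I \<and> shattered_by F T}"
  proof (rule card_mono)
    show "finite {T. T \<subseteq> insert a I \<and> shattered_by F T}" using insert.hyps by simp
    have 1: "shattered_by F T" if T: "T \<subseteq> I" "shattered_by (F0 \<union> F1) T" for T
      unfolding shattered_by_def
    proof (intro allI impI)
      fix U assume "U \<subseteq> T"
      then obtain v where v: "v \<in> F0 \<union> F1" "v \<inter> T = U" using T(2) unfolding shattered_by_def by meson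
      from T(1) insert.hyps have a: "a \<notin> T" by auto
      show "\<exists>v\<in>F. v \<inter> T = U"
      proof (cases "v \<in> F0")
        case True then show ?thesis using v by (auto simp: F0_def)
      next
        case False
        then obtain w where "w \<in> F" "a \<in> w" "v = w - {a}" using v by (auto simp: F1_def)
        then show ?thesis using v a by (intro bexI[of _ w]) auto
      qed
    qed
    have 2: "shattered_by F (insert a T)" if T: "T \<subseteq> I" "shattered_by (F0 \<inter> F1) T" for T
      unfolding shattered_by_def
    proof (intro allI impI)
      fix U assume U: "U \<subseteq> insert a T"
      from T(1) insert.hyps have a: "a \<notin> T" by auto
      have "U - {a} \<subseteq> T" using U by auto
      then obtain v where v: "v \<in> F0" "v \<in> F1" "v \<inter> T = U - {a}"
        using T(2) unfolding shattered_by_def by (meson IntD1 IntD2)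
      show "\<exists>v\<in>F. v \<inter> insert a T = U"
      proof (cases "a \<in> U")
        case False then show ?thesis using v a by (intro bexI[of _ v]) (auto simp: F0_def)
      next
        case True
        obtain w where w: "w \<in> F" "a \<in> w" "v = w - {a}" using v by (auto simp: F1_def)
        then show ?thesis using v a True by (intro bexI[of _ w]) auto
      qed
    qed
    show "{T. T \<subseteq> I \<and> shattered_by (F0 \<union> F1) T} \<union> insert a ` {T. T \<subseteq> I \<and> shattered_by (F0 \<inter> F1) T}
      \<subseteq> {T. T \<subseteq> insert a I \<and> shattered_by F T}" using 1 2 by auto
  qed
  finally show ?case .
qed

text \<open>Such a subset is the range of a \<open>d\<close>-tuple whose entries are elements of
  \<open>I\<close> or blank (\<open>None\<close>).\<close>

lemma card_subsets_card_le:
  fixes I :: "'i set"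
  assumes "finite I"
  shows "card {T. T \<subseteq> I \<and> card T \<le> d} \<le> (card I + 1) ^ d"
proof -
  define D where "D = PiE {..<d} (\<lambda>_. insert None (Some ` I))"
  define g where "g = (\<lambda>p :: nat \<Rightarrow> 'i option. {x. \<exists>i<d. p i = Some x})"
  have "{T. T \<subseteq> I \<and> card T \<le> d} \<subseteq> g ` D"
  proof
    fix T assume "T \<in> {T. T \<subseteq> I \<and> card T \<le> d}"
    then have T: "T \<subseteq> I" "card T \<le> d" by auto
    have "finite T" using T assms finite_subset by auto
    then obtain e where e: "bij_betw e {..<card T} T"
      using ex_bij_betw_nat_finite[of T] by (auto simp: atLeast0LessThan)
    define p where "p = (\<lambda>i\<in>{..<d}. if i < card T then Some (e i) else None)"
    have "g p = e ` {..<card T}" using T by (auto simp: g_def p_def split: if_splits)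
    then have "g p = T" using e by (simp add: bij_betw_def)
    moreover have "p \<in> D"
      unfolding D_def p_def using T bij_betwE[OF e] by (intro restrict_PiE_iff[THEN iffD2]) auto
    ultimately show "T \<in> g ` D" by blast
  qed
  moreover have fD: "finite D" using assms by (auto simp: D_def intro: finite_PiE)
  ultimately have "card {T. T \<subseteq> I \<and> card T \<le> d} \<le> card D"
    using surj_card_le by blast
  also have "card D = card (insert None (Some ` I)) ^ d" by (simp add: D_def card_PiE)
  also have "card (insert None (Some ` I)) = card I + 1" using assms by (simp add: card_image)
  finally show ?thesis .
qed

text \<open>The trace of \<open>H\<close> on a sample, as sets of indices rather than of points:
  repeated points do no harm, and the finite family can be handed to \<open>pajor\<close>.\<close>

definition patterns :: "('a \<Rightarrow> bool) set \<Rightarrow> nat \<Rightarrow> (nat \<Rightarrow> 'a) \<Rightarrow> nat set set" where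
  "patterns H N z = {w. w \<subseteq> {..<N} \<and> (\<exists>h\<in>H. \<forall>i<N. h (z i) = (i \<in> w))}"

lemma patterns_subset: "patterns H N z \<subseteq> Pow {..<N}"
  by (auto simp: patterns_def)

lemma finite_patterns: "finite (patterns H N z)"
  using patterns_subset finite_subset by (metis finite_Pow_iff finite_lessThan)

lemma pattern_in_patterns: "h \<in> H \<Longrightarrow> {i. i < N \<and> h (z i)} \<in> patterns H N z"
  by (auto simp: patterns_def)

text \<open>Quantifying over patterns instead of \<open>y :: nat \<Rightarrow> bool\<close> makes the quantifier finite.\<close>

lemma shatters_alt: "shatters H k S \<longleftrightarrow> (\<forall>w\<in>Pow {..<k}. \<exists>h\<in>H. \<forall>i<k. h (S i) = (i \<in> w))"
proof
  assume "shatters H k S"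
  then show "\<forall>w\<in>Pow {..<k}. \<exists>h\<in>H. \<forall>i<k. h (S i) = (i \<in> w)"
    by (auto simp: shatters_def dest: spec[of _ "\<lambda>i. i \<in> _"])
next
  assume *: "\<forall>w\<in>Pow {..<k}. \<exists>h\<in>H. \<forall>i<k. h (S i) = (i \<in> w)"
  show "shatters H k S" unfolding shatters_def
  proof
    fix y :: "nat \<Rightarrow> bool"
    have "{i. i < k \<and> y i} \<in> Pow {..<k}" by auto
    with * obtain h where "h \<in> H" "\<forall>i<k. h (S i) = (i \<in> {i. i < k \<and> y i})" by blast
    then show "\<exists>h\<in>H. \<forall>i<k. h (S i) = y i" by auto
  qed
qed

lemma shatters_cong: "(\<And>i. i < k \<Longrightarrow> S i = S' i) \<Longrightarrow> shatters H k S = shatters H k S'"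
  by (simp add: shatters_def)

lemma shatters_mono: "H \<subseteq> H' \<Longrightarrow> shatters H k S \<Longrightarrow> shatters H' k S"
  unfolding shatters_alt
proof
  fix w :: "nat set"
  assume "H \<subseteq> H'" "\<forall>w\<in>Pow {..<k}. \<exists>h\<in>H. \<forall>i<k. h (S i) = (i \<in> w)" "w \<in> Pow {..<k}"
  then obtain h where "h \<in> H" "\<forall>i<k. h (S i) = (i \<in> w)" by (elim ballE) auto
  with \<open>H \<subseteq> H'\<close> show "\<exists>h\<in>H'. \<forall>i<k. h (S i) = (i \<in> w)" by auto
qed

lemma shatters_0: "shatters H 0 S \<longleftrightarrow> H \<noteq> {}"
  by (auto simp: shatters_def)

lemma vc_dim_le:
  assumes "vc_class M C" "shatters C k S" "\<And>i. i < k \<Longrightarrow> S i \<in> space M"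
  shows "k \<le> the_enat (vc_dim M C)"
proof -
  have "restrict S {..<k} \<in> {..<k} \<rightarrow>\<^sub>E space M" using assms by auto
  moreover have "shatters C k (restrict S {..<k})"
    using assms(2) by (subst shatters_cong[of _ _ S]) auto
  ultimately have "k \<in> {k. \<exists>S \<in> {..<k} \<rightarrow>\<^sub>E space M. shatters C k S}" by blast
  then have "enat k \<le> vc_dim M C" unfolding vc_dim_def by (intro SUP_upper)
  moreover have "vc_dim M C \<noteq> \<infinity>" using assms by (auto simp: vc_class_def)
  ultimately show ?thesis by (cases "vc_dim M C") auto
qed

text \<open>Listing a shattered index set by \<open>e\<close> gives a tuple shattered by
  \<open>C\<close>, so the index set has at most d elements. \<open>pajor\<close> reduces the count
  of patterns to the count of such sets.\<close>

lemma card_patterns_le: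
  assumes "vc_class M C" "\<And>i. i < N \<Longrightarrow> z i \<in> space M"
  shows "card (patterns C N z) \<le> (N + 1) ^ the_enat (vc_dim M C)"
proof -
  let ?d = "the_enat (vc_dim M C)"
  have "card (patterns C N z) \<le> card {T. T \<subseteq> {..<N} \<and> shattered_by (patterns C N z) T}"
    by (rule pajor) (auto simp: patterns_def)
  also have "\<dots> \<le> card {T. T \<subseteq> {..<N} \<and> card T \<le> ?d}"
  proof (rule card_mono)
    show "{T. T \<subseteq> {..<N} \<and> shattered_by (patterns C N z) T} \<subseteq> {T. T \<subseteq> {..<N} \<and> card T \<le> ?d}"
    proof safe
      fix T assume T: "T \<subseteq> {..<N}" "shattered_by (patterns C N z) T"
      then have "finite T" using finite_subset by auto
      then obtain e where e: "bij_betw e {..<card T} T"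
        using ex_bij_betw_nat_finite[of T] by (auto simp: atLeast0LessThan)
      then have eT: "\<And>i. i < card T \<Longrightarrow> e i \<in> T" by (auto simp: bij_betw_def)
      have inj: "inj_on e {..<card T}" using e by (auto simp: bij_betw_def)
      have "shatters C (card T) (\<lambda>i. z (e i))" unfolding shatters_def
      proof
        fix y :: "nat \<Rightarrow> bool"
        have "e ` {i. i < card T \<and> y i} \<subseteq> T" using eT by auto
        then obtain v where v: "v \<in> patterns C N z" "v \<inter> T = e ` {i. i < card T \<and> y i}"
          using T unfolding shattered_by_def by blast
        then obtain h where h: "h \<in> C" "\<forall>i<N. h (z i) = (i \<in> v)" by (auto simp: patterns_def)
        have "h (z (e i)) = y i" if i: "i < card T" for i
        proof -
          have "e i < N" using eT[OF i] T by auto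
          then have "h (z (e i)) = (e i \<in> v)" using h by auto
          also have "\<dots> = (e i \<in> v \<inter> T)" using eT[OF i] by auto
          also have "\<dots> = y i" unfolding v(2) using i inj by (auto simp: inj_on_def)
          finally show ?thesis .
        qed
        then show "\<exists>h\<in>C. \<forall>i<card T. h (z (e i)) = y i" using h by auto
      qed
      moreover have "z (e i) \<in> space M" if "i < card T" for i
        using assms(2) eT[OF that] T by auto
      ultimately show "card T \<le> ?d" using vc_dim_le[OF assms(1)] by blast
    qed
  qed simp
  also have "\<dots> \<le> (card {..<N} + 1) ^ ?d" by (rule card_subsets_card_le) simp
  finally show ?thesis by simp
qed

section \<open>A transductive halving learner\<close>

definition halving :: "nat set set \<Rightarrow> nat \<Rightarrow> (nat \<Rightarrow> bool) \<Rightarrow> bool" where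
  "halving F t y \<longleftrightarrow>
     card {w\<in>F. (\<forall>i<t. (i \<in> w) = y i) \<and> t \<notin> w} \<le> card {w\<in>F. (\<forall>i<t. (i \<in> w) = y i) \<and> t \<in> w}"

lemma halving_cong: "(\<And>i. i < t \<Longrightarrow> y i = y' i) \<Longrightarrow> halving F t y = halving F t y'"
  by (simp add: halving_def)

text \<open>Every mistake halves the set of patterns consistent with the labels seen so far.\<close>

lemma halving_mistakes:
  assumes "finite F"
  shows "2 ^ card {t. t < n \<and> halving F t y \<noteq> y t} * card {w\<in>F. \<forall>i<n. (i \<in> w) = y i} \<le> card F"
proof (induction n)
  case 0
  then show ?case by simp
next
  case (Suc n)
  define A where "A = (\<lambda>b. {w\<in>F. (\<forall>i<n. (i \<in> w) = y i) \<and> (n \<in> w) = b})"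
  have fin: "finite (A b)" for b using assms by (auto simp: A_def)
  have "{w\<in>F. \<forall>i<n. (i \<in> w) = y i} = A True \<union> A False" by (auto simp: A_def)
  moreover have "A True \<inter> A False = {}" by (auto simp: A_def)
  ultimately have un: "card {w\<in>F. \<forall>i<n. (i \<in> w) = y i} = card (A True) + card (A False)"
    using fin by (simp add: card_Un_disjoint)
  have S: "{w\<in>F. \<forall>i<Suc n. (i \<in> w) = y i} = A (y n)" by (auto simp: A_def less_Suc_eq)
  have hal: "halving F n y \<longleftrightarrow> card (A False) \<le> card (A True)"
    by (simp add: halving_def A_def)
  show ?case
  proof (cases "halving F n y = y n")
    case True
    then have "{t. t < Suc n \<and> halving F t y \<noteq> y t} = {t. t < n \<and> halving F t y \<noteq> y t}"
      by (auto simp: less_Suc_eq)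
    moreover have "card (A (y n)) \<le> card (A True) + card (A False)" by (cases "y n") auto
    ultimately show ?thesis using Suc un S by (metis (no_types, lifting) le_trans mult_le_mono2)
  next
    case False
    then have *: "{t. t < Suc n \<and> halving F t y \<noteq> y t} = insert n {t. t < n \<and> halving F t y \<noteq> y t}"
      by (auto simp: less_Suc_eq)
    have "2 * card (A (y n)) \<le> card (A True) + card (A False)"
      using False hal by (cases "y n") auto
    then have "2 ^ card {t. t < n \<and> halving F t y \<noteq> y t} * (2 * card (A (y n))) \<le> card F"
      using Suc un by (metis (no_types, lifting) le_trans mult_le_mono2)
    then show ?thesis unfolding * S by simp
  qed
qed

text \<open>The pattern of \<open>h\<close> itself is consistent with all labels, so at least one
  pattern survives every halving.\<close>

corollary card_halving_mistakes_le:
  assumes "h \<in> H"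
  shows "real (card {t. t < n \<and> halving (patterns H n z) t (\<lambda>i. h (z i)) \<noteq> h (z t)}) \<le> log 2 (card (patterns H n z))"
proof -
  let ?F = "patterns H n z" and ?y = "\<lambda>i. h (z i)"
  have "{i. i < n \<and> h (z i)} \<in> {w\<in>?F. \<forall>i<n. (i \<in> w) = ?y i}"
    using pattern_in_patterns[OF assms] by auto
  moreover have "finite {w\<in>?F. \<forall>i<n. (i \<in> w) = ?y i}"
    using finite_patterns[of H n z] by (rule rev_finite_subset) auto
  ultimately have "1 \<le> card {w\<in>?F. \<forall>i<n. (i \<in> w) = ?y i}"
    using card_gt_0_iff[of "{w\<in>?F. \<forall>i<n. (i \<in> w) = ?y i}"] by force
  then have "2 ^ card {t. t < n \<and> halving ?F t ?y \<noteq> ?y t} \<le> card ?F"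
    using halving_mistakes[OF finite_patterns, of n H n z ?y]
    by (metis (no_types, lifting) le_trans mult.right_neutral mult_le_mono2)
  then have "2 ^ card {t. t < n \<and> halving ?F t ?y \<noteq> ?y t} \<le> real (card ?F)"
    by (metis of_nat_le_iff of_nat_numeral of_nat_power)
  then show ?thesis by (simp add: le_log_of_power)
qed

definition insert_at :: "nat \<Rightarrow> 'a \<Rightarrow> (nat \<Rightarrow> 'a) \<Rightarrow> nat \<Rightarrow> 'a" where
  "insert_at t x S i = (if i < t then S i else if i = t then x else S (i - 1))"

text \<open>For every \<open>t\<close> the test point is placed after the first \<open>t\<close> training points and classified by
  halving from their labels alone; the learner takes the majority over \<open>t\<close>. For an i.i.d. sample
  the errors at the different positions are the mistakes of one halving run. The seed is ignored.\<close>

definition halving_learner :: "('a \<Rightarrow> bool) set \<Rightarrow> 'a passive_learner" where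
  "halving_learner C u L x \<longleftrightarrow>
     (let n = length L in
      Suc n \<le> 2 * card {t\<in>{..n}.
        halving (patterns C (Suc n) (insert_at t x (\<lambda>i. fst (L ! i)))) t (\<lambda>i. snd (L ! i))})"

lemma patterns_cong: "(\<And>i. i < N \<Longrightarrow> z i = z' i) \<Longrightarrow> patterns C N z = patterns C N z'"
  by (simp add: patterns_def)

lemma halving_learner_map:
  "halving_learner C u (map (\<lambda>i. (S i, y i)) [0..<n]) x \<longleftrightarrow>
     Suc n \<le> 2 * card {t\<in>{..n}. halving (patterns C (Suc n) (insert_at t x S)) t y}"
proof -
  have "halving (patterns C (Suc n) (insert_at t x (\<lambda>i. fst (map (\<lambda>i. (S i, y i)) [0..<n] ! i)))) t
      (\<lambda>i. snd (map (\<lambda>i. (S i, y i)) [0..<n] ! i)) = halving (patterns C (Suc n) (insert_at t x S)) t y"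
    if "t \<le> n" for t
  proof -
    have "patterns C (Suc n) (insert_at t x (\<lambda>i. fst (map (\<lambda>i. (S i, y i)) [0..<n] ! i))) =
       patterns C (Suc n) (insert_at t x S)"
      by (rule patterns_cong) (use that in \<open>auto simp: insert_at_def\<close>)
    then show ?thesis using that by (auto intro!: halving_cong)
  qed
  then have "{t\<in>{..n}. halving (patterns C (Suc n) (insert_at t x (\<lambda>i. fst (map (\<lambda>i. (S i, y i)) [0..<n] ! i)))) t
      (\<lambda>i. snd (map (\<lambda>i. (S i, y i)) [0..<n] ! i))} = {t\<in>{..n}. halving (patterns C (Suc n) (insert_at t x S)) t y}"
    by auto
  then show ?thesis by (simp add: halving_learner_def Let_def)
qed

text \<open>A wrong majority means that at least half of the n + 1 positions vote wrongly. A tie is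
  resolved to \<open>True\<close>, which is an error only if \<open>g x\<close> is false, and then
  exactly half of the votes are wrong.\<close>

lemma halving_learner_error:
  assumes "halving_learner C u (map (\<lambda>i. (S i, g (S i))) [0..<n]) x \<noteq> g x"
  shows "Suc n \<le> 2 * card {t\<in>{..n}. halving (patterns C (Suc n) (insert_at t x S)) t (\<lambda>i. g (S i)) \<noteq> g x}"
proof -
  let ?P = "\<lambda>t. halving (patterns C (Suc n) (insert_at t x S)) t (\<lambda>i. g (S i))"
  have "{..n} = {t\<in>{..n}. ?P t} \<union> {t\<in>{..n}. \<not> ?P t}" by auto
  then have "card {t\<in>{..n}. ?P t} + card {t\<in>{..n}. \<not> ?P t} = Suc n"
    by (subst card_Un_disjoint[symmetric]) (auto simp flip: card_atMost)
  then show ?thesis using assms[unfolded halving_learner_map] by (cases "g x") auto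
qed

section \<open>Measurability of finite patterns\<close>

text \<open>The values are finite subsets of a countable set. There are only countably many of
  these, so every preimage is a countable union of level sets.\<close>

lemma measurable_Collect_finite:
  assumes "countable I" and [measurable]: "\<And>i. i \<in> I \<Longrightarrow> Measurable.pred N (Q i)"
    and fin: "\<And>\<omega>. \<omega> \<in> space N \<Longrightarrow> finite {i\<in>I. Q i \<omega>}"
  shows "(\<lambda>\<omega>. {i\<in>I. Q i \<omega>}) \<in> measurable N (count_space UNIV)"
proof (rule measurableI)
  fix A :: "'a set set"
  have "countable {B. finite B \<and> B \<subseteq> I}" using countable_Collect_finite_subset[OF assms(1)] .
  then have c: "countable ({B. finite B \<and> B \<subseteq> I} \<inter> A)" by (rule countable_Int1)
  have "{\<omega>\<in>space N. {i\<in>I. Q i \<omega>} = B} \<in> sets N" if "B \<subseteq> I" for B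
  proof -
    have "{\<omega>\<in>space N. {i\<in>I. Q i \<omega>} = B} = {\<omega>\<in>space N. \<forall>i\<in>I. Q i \<omega> = (i \<in> B)}" using that by auto
    also have "\<dots> \<in> sets N" using assms(1) by measurable
    finally show ?thesis .
  qed
  then have "(\<Union>B\<in>{B. finite B \<and> B \<subseteq> I} \<inter> A. {\<omega>\<in>space N. {i\<in>I. Q i \<omega>} = B}) \<in> sets N"
    using c by (intro sets.countable_UN'') auto
  also have "(\<Union>B\<in>{B. finite B \<and> B \<subseteq> I} \<inter> A. {\<omega>\<in>space N. {i\<in>I. Q i \<omega>} = B})
      = (\<lambda>\<omega>. {i\<in>I. Q i \<omega>}) -` A \<inter> space N"
    using fin by auto
  finally show "(\<lambda>\<omega>. {i\<in>I. Q i \<omega>}) -` A \<inter> space N \<in> sets N" .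
qed auto

lemma measurable_card_Collect[measurable (raw)]:
  assumes "finite I" "\<And>i. i \<in> I \<Longrightarrow> Measurable.pred N (Q i)"
  shows "(\<lambda>\<omega>. card {i\<in>I. Q i \<omega>}) \<in> measurable N (count_space UNIV)"
  using assms by (intro measurable_compose[OF measurable_Collect_finite])
    (auto simp: countable_finite intro!: measurable_count_space_const)

locale vc_setting =
  fixes M :: "'a measure" and C :: "('a \<Rightarrow> bool) set"
  assumes vc: "vc_class M C" and mr: "measurable_realizations M C"
begin

definition d :: nat where "d = the_enat (vc_dim M C)"

lemma classifier[measurable]: "h \<in> C \<Longrightarrow> h \<in> measurable M (count_space UNIV)"
  using vc by (auto simp: vc_class_def classifiers_def)

text \<open>The standing measurability assumption speaks of the coordinates of a tuple and of
  constant labels. Random points enter by composition with the tuple that they form; random labels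
  are split into the finitely many vectors that they can form.\<close>

lemma pred_realizable_ball:
  assumes P: "P \<in> distributions M" "f \<in> C" and I: "finite I"
    and z: "\<And>i. i \<in> I \<Longrightarrow> z i \<in> measurable N M"
    and y: "\<And>i. i \<in> I \<Longrightarrow> Measurable.pred N (y i)"
  shows "Measurable.pred N (\<lambda>\<omega>. \<exists>h\<in>concept_ball P C f r. \<forall>i\<in>I. h (z i \<omega>) = y i \<omega>)"
proof -
  obtain e where e: "bij_betw e {..<card I} I"
    using ex_bij_betw_nat_finite[OF I] by (auto simp: atLeast0LessThan)
  define k where "k = card I"
  have eI: "i < k \<Longrightarrow> e i \<in> I" for i using e by (auto simp: bij_betw_def k_def)
  have Ie: "I = e ` {..<k}" using bij_betw_imp_surj_on[OF e] by (simp add: k_def)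
  have eq: "(\<forall>i\<in>I. Q i) \<longleftrightarrow> (\<forall>i<k. Q (e i))" for Q
    by (subst Ie) auto
  have 1: "Measurable.pred N (\<lambda>\<omega>. \<exists>h\<in>concept_ball P C f r. \<forall>i<k. h (z (e i) \<omega>) = (i \<in> w))" for w
  proof -
    define T where "T = {S \<in> space (power_measure k M). \<exists>h\<in>concept_ball P C f r. \<forall>i<k. h (S i) = (i \<in> w)}"
    have T: "T \<in> sets (power_measure k M)"
      using mr P unfolding measurable_realizations_def T_def by simp
    have m: "(\<lambda>\<omega>. \<lambda>i\<in>{..<k}. z (e i) \<omega>) \<in> measurable N (power_measure k M)"
      unfolding power_measure_def using z eI by (intro measurable_restrict) auto
    have "{\<omega>\<in>space N. \<exists>h\<in>concept_ball P C f r. \<forall>i<k. h (z (e i) \<omega>) = (i \<in> w)}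
       = (\<lambda>\<omega>. \<lambda>i\<in>{..<k}. z (e i) \<omega>) -` T \<inter> space N"
      using measurable_space[OF m] by (auto simp: T_def)
    also have "\<dots> \<in> sets N" using m T by (rule measurable_sets)
    finally show ?thesis by (simp add: pred_def)
  qed
  have "(\<lambda>\<omega>. \<exists>h\<in>concept_ball P C f r. \<forall>i\<in>I. h (z i \<omega>) = y i \<omega>) =
    (\<lambda>\<omega>. \<exists>w\<in>Pow {..<k}. (\<forall>i<k. y (e i) \<omega> = (i \<in> w)) \<and>
       (\<exists>h\<in>concept_ball P C f r. \<forall>i<k. h (z (e i) \<omega>) = (i \<in> w)))" (is "?L = ?R")
  proof (rule ext, rule iffI)
    fix \<omega> assume "?L \<omega>"
    then show "?R \<omega>" unfolding eq by (intro bexI[of _ "{i. i < k \<and> y (e i) \<omega>}"]) auto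
  next
    fix \<omega> assume "?R \<omega>"
    then show "?L \<omega>" unfolding eq by auto
  qed
  also have "Measurable.pred N \<dots>"
  proof -
    note 1[measurable]
    have [measurable]: "i < k \<Longrightarrow> Measurable.pred N (y (e i))" for i using y eI by simp
    have [measurable]: "Measurable.pred N (\<lambda>\<omega>. \<forall>i\<in>{..<k}. y (e i) \<omega> = (i \<in> w))" for w
      by (intro pred_intros_finite) auto
    then have A: "Measurable.pred N (\<lambda>\<omega>. \<forall>i<k. y (e i) \<omega> = (i \<in> w))" for w
      by (simp add: Ball_def lessThan_iff)
    show ?thesis by (rule pred_intros_finite(4), simp, rule pred_intros_logic(3), rule A, rule 1)
  qed
  finally show ?thesis .
qed

text \<open>The constraints and the pattern demanded on the tuple form one realizability problem,
  indexed by a disjoint sum. Shattering is a finite conjunction of such problems.\<close>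

lemma pred_shatters_ball:
  assumes P: "P \<in> distributions M" "f \<in> C" and I: "finite I"
    and z: "\<And>i. i \<in> I \<Longrightarrow> z i \<in> measurable N M"
    and y: "\<And>i. i \<in> I \<Longrightarrow> Measurable.pred N (y i)"
    and s: "\<And>j. j < k \<Longrightarrow> s j \<in> measurable N M"
  shows "Measurable.pred N (\<lambda>\<omega>. shatters {h\<in>concept_ball P C f r. \<forall>i\<in>I. h (z i \<omega>) = y i \<omega>} k (\<lambda>j. s j \<omega>))"
proof -
  have "Measurable.pred N (\<lambda>\<omega>. \<exists>h\<in>concept_ball P C f r. \<forall>i\<in>I <+> {..<k}.
      h (case i of Inl a \<Rightarrow> z a \<omega> | Inr b \<Rightarrow> s b \<omega>) = (case i of Inl a \<Rightarrow> y a \<omega> | Inr b \<Rightarrow> b \<in> w))" for w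
  proof (rule pred_realizable_ball[OF P])
    show "finite (I <+> {..<k})" using I by simp
  qed (use z y s in \<open>auto split: sum.split\<close>)
  moreover have "(\<forall>i\<in>I <+> {..<k}.
      h (case i of Inl a \<Rightarrow> z a \<omega> | Inr b \<Rightarrow> s b \<omega>) = (case i of Inl a \<Rightarrow> y a \<omega> | Inr b \<Rightarrow> b \<in> w)) \<longleftrightarrow>
      (\<forall>i\<in>I. h (z i \<omega>) = y i \<omega>) \<and> (\<forall>j<k. h (s j \<omega>) = (j \<in> w))" for h \<omega> w
    by (simp add: Plus_def ball_Un) (simp add: Ball_def lessThan_iff)
  ultimately have "Measurable.pred N (\<lambda>\<omega>. \<exists>h\<in>concept_ball P C f r.
      (\<forall>i\<in>I. h (z i \<omega>) = y i \<omega>) \<and> (\<forall>j<k. h (s j \<omega>) = (j \<in> w)))" for w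
    by simp
  then have "Measurable.pred N (\<lambda>\<omega>. \<forall>w\<in>Pow {..<k}. \<exists>h\<in>concept_ball P C f r.
      (\<forall>i\<in>I. h (z i \<omega>) = y i \<omega>) \<and> (\<forall>j<k. h (s j \<omega>) = (j \<in> w)))"
    by (intro pred_intros_finite(3)) auto
  then show ?thesis
    by (simp add: shatters_alt Bex_def conj_assoc)
qed

lemma space_nonempty: "space M \<noteq> {}" and C_nonempty: "C \<noteq> {}"
proof -
  have "0 < vc_dim M C" using vc by (simp add: vc_class_def)
  then obtain k S where "0 < k" "S \<in> {..<k} \<rightarrow>\<^sub>E space M" "shatters C k S"
    unfolding vc_dim_def less_SUP_iff by (auto simp: zero_enat_def)
  then show "space M \<noteq> {}" "C \<noteq> {}" by (auto simp: shatters_def)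
qed

lemma concept_ball_1:
  assumes "P \<in> distributions M" shows "concept_ball P C f 1 = C"
proof -
  interpret prob_space P using assms by (simp add: distributions_def)
  show ?thesis by (auto simp: concept_ball_def err_def)
qed

text \<open>Under any distribution the whole class is the ball of radius 1 around any of its
  members; a point mass provides a distribution.\<close>

lemma pred_realizable:
  assumes I: "finite I"
    and z: "\<And>i. i \<in> I \<Longrightarrow> z i \<in> measurable N M"
    and y: "\<And>i. i \<in> I \<Longrightarrow> Measurable.pred N (y i)"
  shows "Measurable.pred N (\<lambda>\<omega>. \<exists>h\<in>C. \<forall>i\<in>I. h (z i \<omega>) = y i \<omega>)"
proof -
  obtain x f where "x \<in> space M" "f \<in> C" using space_nonempty C_nonempty by auto
  then have P: "return M x \<in> distributions M" by (auto simp: distributions_def intro: prob_space_return)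
  show ?thesis using pred_realizable_ball[OF P \<open>f \<in> C\<close> assms, where r = 1] by (simp add: concept_ball_1[OF P])
qed

lemma pred_shatters:
  assumes I: "finite I"
    and z: "\<And>i. i \<in> I \<Longrightarrow> z i \<in> measurable N M"
    and y: "\<And>i. i \<in> I \<Longrightarrow> Measurable.pred N (y i)"
    and s: "\<And>j. j < k \<Longrightarrow> s j \<in> measurable N M"
  shows "Measurable.pred N (\<lambda>\<omega>. shatters {h\<in>C. \<forall>i\<in>I. h (z i \<omega>) = y i \<omega>} k (\<lambda>j. s j \<omega>))"
proof -
  obtain x f where "x \<in> space M" "f \<in> C" using space_nonempty C_nonempty by auto
  then have P: "return M x \<in> distributions M" by (auto simp: distributions_def intro: prob_space_return)
  show ?thesis using pred_shatters_ball[OF P \<open>f \<in> C\<close> assms, where r = 1] by (simp add: concept_ball_1[OF P])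
qed

lemma measurable_patterns:
  assumes z: "\<And>i. i < n \<Longrightarrow> z i \<in> measurable N M"
  shows "(\<lambda>\<omega>. patterns C n (\<lambda>i. z i \<omega>)) \<in> measurable N (count_space UNIV)"
proof -
  have "(\<lambda>\<omega>. {w\<in>Pow {..<n}. \<exists>h\<in>C. \<forall>i\<in>{..<n}. h (z i \<omega>) = (i \<in> w)}) \<in> measurable N (count_space UNIV)"
    using assms by (intro measurable_Collect_finite pred_realizable) (auto intro: countable_finite)
  then show ?thesis by (simp add: patterns_def Ball_def lessThan_iff)
qed

text \<open>Both the family of patterns and the labels are random. The former takes values in a
  discrete space; the latter are split over the finitely many label vectors of length
  \<open>t\<close>.\<close>

lemma pred_halving:
  assumes z: "\<And>i. i < n \<Longrightarrow> z i \<in> measurable N M"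
    and y[measurable]: "\<And>i. i < t \<Longrightarrow> Measurable.pred N (y i)"
  shows "Measurable.pred N (\<lambda>\<omega>. halving (patterns C n (\<lambda>i. z i \<omega>)) t (\<lambda>i. y i \<omega>))"
proof -
  have *: "halving F t (\<lambda>i. y i \<omega>) = (\<exists>w\<in>Pow {..<t}. (\<forall>i<t. y i \<omega> = (i \<in> w)) \<and> halving F t (\<lambda>i. i \<in> w))" for F \<omega>
  proof
    assume "halving F t (\<lambda>i. y i \<omega>)"
    then have "halving F t (\<lambda>i. i \<in> {i. i < t \<and> y i \<omega>})" by (subst halving_cong[of _ _ "\<lambda>i. y i \<omega>"]) auto
    then show "\<exists>w\<in>Pow {..<t}. (\<forall>i<t. y i \<omega> = (i \<in> w)) \<and> halving F t (\<lambda>i. i \<in> w)"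
      by (intro bexI[of _ "{i. i < t \<and> y i \<omega>}"]) auto
  next
    assume "\<exists>w\<in>Pow {..<t}. (\<forall>i<t. y i \<omega> = (i \<in> w)) \<and> halving F t (\<lambda>i. i \<in> w)"
    then obtain w where "\<forall>i<t. y i \<omega> = (i \<in> w)" "halving F t (\<lambda>i. i \<in> w)" by blast
    then show "halving F t (\<lambda>i. y i \<omega>)" using halving_cong[of t "\<lambda>i. y i \<omega>" "\<lambda>i. i \<in> w"] by simp
  qed
  have [measurable]: "Measurable.pred N (\<lambda>\<omega>. halving (patterns C n (\<lambda>i. z i \<omega>)) t (\<lambda>i. i \<in> w))" for w
    by (rule measurable_compose[OF measurable_patterns[OF z]]) auto
  have "Measurable.pred N (\<lambda>\<omega>. \<forall>i\<in>{..<t}. y i \<omega> = (i \<in> w))" for w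
    by (intro pred_intros_finite) (auto intro: y)
  then have [measurable]: "Measurable.pred N (\<lambda>\<omega>. \<forall>i<t. y i \<omega> = (i \<in> w))" for w
    by (simp add: Ball_def lessThan_iff)
  show ?thesis unfolding * by (intro pred_intros_finite) auto
qed

lemma pred_halving_learner:
  assumes S: "\<And>i. i < n \<Longrightarrow> S i \<in> measurable N M" and x: "x \<in> measurable N M"
    and y: "\<And>i. i < n \<Longrightarrow> Measurable.pred N (y i)"
  shows "Measurable.pred N (\<lambda>\<omega>. halving_learner C u (map (\<lambda>i. (S i \<omega>, y i \<omega>)) [0..<n]) (x \<omega>))"
proof -
  have ia: "insert_at t (x \<omega>) (\<lambda>i. S i \<omega>) = (\<lambda>i. insert_at t x S i \<omega>)" for t \<omega> by (simp add: insert_at_def fun_eq_iff)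
  have "Measurable.pred N (\<lambda>\<omega>. halving (patterns C (Suc n) (\<lambda>i. insert_at t x S i \<omega>)) t (\<lambda>i. y i \<omega>))" if "t \<le> n" for t
    using assms that by (intro pred_halving) (auto simp: insert_at_def)
  then have "(\<lambda>\<omega>. card {t\<in>{..n}. halving (patterns C (Suc n) (\<lambda>i. insert_at t x S i \<omega>)) t (\<lambda>i. y i \<omega>)}) \<in> measurable N (count_space UNIV)"
    by (intro measurable_card_Collect) auto
  then have "Measurable.pred N (\<lambda>\<omega>. Suc n \<le> 2 * card {t\<in>{..n}. halving (patterns C (Suc n) (\<lambda>i. insert_at t x S i \<omega>)) t (\<lambda>i. y i \<omega>)})"
    by (rule measurable_compose) auto
  then show ?thesis unfolding halving_learner_map ia .
qed

lemma passive_halving_learner: "passive_algorithm M (halving_learner C)"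
  unfolding passive_algorithm_def
proof (intro allI)
  fix n and y :: "nat \<Rightarrow> bool"
  have "(\<lambda>S. S i) \<in> measurable (power_measure n M) M" if "i < n" for i
    using that unfolding power_measure_def by (intro measurable_component_singleton) auto
  then have [measurable]: "(\<lambda>\<omega>. fst (snd \<omega>) i) \<in> measurable (seed_measure \<Otimes>\<^sub>M power_measure n M \<Otimes>\<^sub>M M) M" if "i < n" for i
    using that by measurable
  have "Measurable.pred (seed_measure \<Otimes>\<^sub>M power_measure n M \<Otimes>\<^sub>M M)
     (\<lambda>\<omega>. halving_learner C 0 (map (\<lambda>i. (fst (snd \<omega>) i, y i)) [0..<n]) (snd (snd \<omega>)))"
    by (rule pred_halving_learner) auto
  moreover have "(\<lambda>(u, S, x). halving_learner C u (map (\<lambda>i. (S i, y i)) [0..<n]) x) =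
     (\<lambda>\<omega>. halving_learner C 0 (map (\<lambda>i. (fst (snd \<omega>) i, y i)) [0..<n]) (snd (snd \<omega>)))"
    by (simp add: fun_eq_iff halving_learner_map)
  ultimately show "(\<lambda>(u, S, x). halving_learner C u (map (\<lambda>i. (S i, y i)) [0..<n]) x)
       \<in> measurable (seed_measure \<Otimes>\<^sub>M power_measure n M \<Otimes>\<^sub>M M) (count_space UNIV)"
    by simp
qed

end

section \<open>Infinite i.i.d. sequences\<close>

locale target = vc_setting +
  fixes f :: "'a \<Rightarrow> bool" and P :: "'a measure"
  assumes fC: "f \<in> C" and PD: "P \<in> distributions M"

sublocale target \<subseteq> P: prob_space P
  using PD by (simp add: distributions_def)

sublocale target \<subseteq> seq: sequence_space P
  by unfold_locales

context target
begin

abbreviation "S \<equiv> Pi\<^sub>M (UNIV :: nat set) (\<lambda>_. P)"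

lemma sets_P[measurable_cong, simp]: "sets P = sets M"
  using PD by (simp add: distributions_def)

lemma space_P[simp]: "space P = space M"
  using sets_eq_imp_space_eq[OF sets_P] .

lemma measurable_P[simp]: "measurable N P = measurable N M"
  by (rule measurable_cong_sets) auto

lemma measurable_P1[simp]: "measurable P N = measurable M N"
  by (rule measurable_cong_sets) auto

lemma f_measurable[measurable]: "f \<in> measurable M (count_space UNIV)"
  using fC by (rule classifier)

lemma prob_space_S: "prob_space S" by (rule seq.P.prob_space_axioms)

lemma space_S: "\<omega> \<in> space S \<Longrightarrow> \<omega> i \<in> space M"
  by (auto simp: space_PiM)

lemma measurable_coord[measurable]: "(\<lambda>\<omega>. \<omega> i) \<in> measurable S M"
  using measurable_component_singleton[of i UNIV "\<lambda>_. P"] by simp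

lemma measurable_S_I:
  assumes "\<And>i. (\<lambda>x. g x i) \<in> measurable N M"
  shows "g \<in> measurable N S"
proof -
  have "g \<in> space N \<rightarrow> UNIV \<rightarrow> space M" using measurable_space[OF assms] by auto
  then show ?thesis
    using measurable_PiM_single'[of UNIV "\<lambda>i x. g x i" N "\<lambda>_. P"] assms by (simp add: PiE_def)
qed

lemma real_card_eq_sum_indicator:
  assumes "finite I"
  shows "real (card {t\<in>I. Q t}) = (\<Sum>t\<in>I. of_bool (Q t))"
  using assms by (simp add: of_bool_def sum.If_cases Int_def)

text \<open>\<open>comb_seq i\<close> continues the first \<open>i\<close> coordinates of one
  sequence by an independent second sequence, and the result has the same law. This is the form in
  which the independence of past and future is used throughout.\<close>

lemma nn_integral_comb_seq:
  assumes [measurable]: "g \<in> borel_measurable S"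
  shows "(\<integral>\<^sup>+\<omega>. g \<omega> \<partial>S) = (\<integral>\<^sup>+\<omega>. (\<integral>\<^sup>+\<omega>'. g (comb_seq i \<omega> \<omega>') \<partial>S) \<partial>S)"
proof -
  have "(\<integral>\<^sup>+\<omega>. g \<omega> \<partial>S) = (\<integral>\<^sup>+\<omega>. g \<omega> \<partial>distr (S \<Otimes>\<^sub>M S) S (\<lambda>(\<omega>, \<omega>'). comb_seq i \<omega> \<omega>'))"
    by (simp only: seq.PiM_comb_seq)
  also have "\<dots> = (\<integral>\<^sup>+x. g (comb_seq i (fst x) (snd x)) \<partial>(S \<Otimes>\<^sub>M S))"
    by (subst nn_integral_distr) (auto simp: case_prod_beta intro: measurable_comb_seq)
  also have "\<dots> = (\<integral>\<^sup>+\<omega>. (\<integral>\<^sup>+\<omega>'. g (comb_seq i \<omega> \<omega>') \<partial>S) \<partial>S)"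
    by (subst seq.P.nn_integral_fst[symmetric]) auto
  finally show ?thesis .
qed

lemma distr_reindex:
  assumes "inj \<pi>"
  shows "distr S S (\<lambda>\<omega> i. \<omega> (\<pi> i)) = S"
  using distr_PiM_reindex[of UNIV "\<lambda>_. P" \<pi> UNIV] assms P.prob_space_axioms
  by (simp add: restrict_def)

lemma measurable_reindex[measurable]: "(\<lambda>\<omega> i. \<omega> (\<pi> i)) \<in> measurable S S"
  by (rule measurable_S_I) measurable

lemma nn_integral_reindex:
  assumes "inj \<pi>" "g \<in> borel_measurable S"
  shows "(\<integral>\<^sup>+\<omega>. g (\<lambda>i. \<omega> (\<pi> i)) \<partial>S) = (\<integral>\<^sup>+\<omega>. g \<omega> \<partial>S)"
proof -
  have "(\<integral>\<^sup>+\<omega>. g \<omega> \<partial>S) = (\<integral>\<^sup>+\<omega>. g \<omega> \<partial>distr S S (\<lambda>\<omega> i. \<omega> (\<pi> i)))" using assms by (simp add: distr_reindex)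
  also have "\<dots> = (\<integral>\<^sup>+\<omega>. g (\<lambda>i. \<omega> (\<pi> i)) \<partial>S)"
    by (rule nn_integral_distr) (use assms in auto)
  finally show ?thesis by simp
qed

lemma nn_integral_coord:
  assumes "g \<in> borel_measurable M"
  shows "(\<integral>\<^sup>+\<omega>. g (\<omega> i) \<partial>S) = (\<integral>\<^sup>+x. g x \<partial>P)"
proof -
  have "distr S P (\<lambda>\<omega>. \<omega> i) = P"
    using distr_PiM_component[of UNIV "\<lambda>_. P" i] P.prob_space_axioms by auto
  then have "(\<integral>\<^sup>+x. g x \<partial>P) = (\<integral>\<^sup>+x. g x \<partial>distr S P (\<lambda>\<omega>. \<omega> i))" by simp
  also have "\<dots> = (\<integral>\<^sup>+\<omega>. g (\<omega> i) \<partial>S)" by (rule nn_integral_distr) (use assms in auto)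
  finally show ?thesis by simp
qed

lemma distr_coord: "distr S P (\<lambda>\<omega>. \<omega> i) = P"
  using distr_PiM_component[of UNIV "\<lambda>_. P" i] P.prob_space_axioms by auto

text \<open>\<open>g\<close> sees only the coordinates below \<open>n\<close>, so after gluing at
  \<open>n\<close> the coordinate \<open>n\<close> is the first one of an independent tail.\<close>

lemma nn_integral_fresh_coord:
  assumes g[measurable]: "g \<in> borel_measurable (S \<Otimes>\<^sub>M M)"
    and dep: "\<And>\<omega> \<omega>' x. (\<And>i. i < n \<Longrightarrow> \<omega> i = \<omega>' i) \<Longrightarrow> g (\<omega>, x) = g (\<omega>', x)"
  shows "(\<integral>\<^sup>+\<omega>. (\<integral>\<^sup>+x. g (\<omega>, x) \<partial>P) \<partial>S) = (\<integral>\<^sup>+\<omega>. g (\<omega>, \<omega> n) \<partial>S)"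
proof -
  have "(\<integral>\<^sup>+\<omega>. g (\<omega>, \<omega> n) \<partial>S) = (\<integral>\<^sup>+\<omega>. (\<integral>\<^sup>+\<omega>'. g (comb_seq n \<omega> \<omega>', comb_seq n \<omega> \<omega>' n) \<partial>S) \<partial>S)"
    by (rule nn_integral_comb_seq) measurable
  also have "\<dots> = (\<integral>\<^sup>+\<omega>. (\<integral>\<^sup>+\<omega>'. g (\<omega>, \<omega>' 0) \<partial>S) \<partial>S)"
    by (intro nn_integral_cong) (auto simp: comb_seq_def intro!: dep)
  also have "\<dots> = (\<integral>\<^sup>+\<omega>. (\<integral>\<^sup>+x. g (\<omega>, x) \<partial>P) \<partial>S)"
    by (intro nn_integral_cong nn_integral_coord) measurable
  finally show ?thesis by simp
qed

text \<open>Take \<open>X n\<close> as the test point. If the majority errs, then halving errs at no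
  fewer than half of the n + 1 insertion positions. Moving \<open>X n\<close> to position t
  preserves the law of the sequence, so the expected number of wrong positions equals the expected
  number of mistakes in a single halving run over n + 1 points, which is at most d log2 (n +
  2).\<close>

lemma halving_error:
  shows "(\<integral>\<^sup>+X. emeasure P {x\<in>space P. halving_learner C u (map (\<lambda>i. (X i, f (X i))) [0..<n]) x \<noteq> f x} \<partial>S)
    \<le> ennreal (2 * d * log 2 (n + 2) / (n + 1))"
proof -
  define G where "G = (\<lambda>(X, x). indicator {(X, x). halving_learner C u (map (\<lambda>i. (X i, f (X i))) [0..<n]) x \<noteq> f x} (X, x) :: ennreal)"
  define B where "B = (\<lambda>t z. halving (patterns C (Suc n) z) t (\<lambda>i. f (z i)) \<noteq> f (z t))"
  \<comment> \<open>The index map of \<open>insert_at t\<close> with coordinate n as the inserted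
    point. Beyond n it is the identity, so for t up to n it is injective on all indices.\<close>
  define \<pi> where "\<pi> = (\<lambda>t i. if i < t then i else if i = t then n else if i \<le> n then i - 1 else i)"
  have inj: "inj (\<pi> t)" if "t \<le> n" for t
    using that unfolding inj_on_def \<pi>_def by auto
  have [measurable]: "Measurable.pred (S \<Otimes>\<^sub>M M) (\<lambda>p. halving_learner C u (map (\<lambda>i. (fst p i, f (fst p i))) [0..<n]) (snd p))"
    by (rule pred_halving_learner) measurable
  have G_meas[measurable]: "G \<in> borel_measurable (S \<Otimes>\<^sub>M M)"
    unfolding G_def case_prod_beta by (auto simp: case_prod_beta intro!: borel_measurable_indicator')
  have B_meas[measurable]: "Measurable.pred S (B t)" if "t \<le> n" for t
  proof -
    have [measurable]: "Measurable.pred S (\<lambda>z. halving (patterns C (Suc n) z) t (\<lambda>i. f (z i)))"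
      by (rule pred_halving) measurable
    show ?thesis unfolding B_def by measurable
  qed
  have "(\<integral>\<^sup>+X. emeasure P {x\<in>space P. halving_learner C u (map (\<lambda>i. (X i, f (X i))) [0..<n]) x \<noteq> f x} \<partial>S)
     = (\<integral>\<^sup>+X. (\<integral>\<^sup>+x. G (X, x) \<partial>P) \<partial>S)"
  proof (rule nn_integral_cong)
    fix X assume X: "X \<in> space S"
    have [measurable]: "Measurable.pred M (\<lambda>x. halving_learner C u (map (\<lambda>i. (X i, f (X i))) [0..<n]) x)"
      by (rule pred_halving_learner) (auto simp: space_S[OF X])
    have "Measurable.pred M (\<lambda>x. halving_learner C u (map (\<lambda>i. (X i, f (X i))) [0..<n]) x \<noteq> f x)"
      by measurable
    then have "{x\<in>space P. halving_learner C u (map (\<lambda>i. (X i, f (X i))) [0..<n]) x \<noteq> f x} \<in> sets P"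
      by (simp add: pred_def)
    then have "emeasure P {x\<in>space P. halving_learner C u (map (\<lambda>i. (X i, f (X i))) [0..<n]) x \<noteq> f x}
      = (\<integral>\<^sup>+x. indicator {x\<in>space P. halving_learner C u (map (\<lambda>i. (X i, f (X i))) [0..<n]) x \<noteq> f x} x \<partial>P)"
      by simp
    also have "\<dots> = (\<integral>\<^sup>+x. G (X, x) \<partial>P)"
      by (intro nn_integral_cong) (auto simp: G_def indicator_def)
    finally show "emeasure P {x\<in>space P. halving_learner C u (map (\<lambda>i. (X i, f (X i))) [0..<n]) x \<noteq> f x} = (\<integral>\<^sup>+x. G (X, x) \<partial>P)" .
  qed
  also have "\<dots> = (\<integral>\<^sup>+X. G (X, X n) \<partial>S)"
  proof (rule nn_integral_fresh_coord)
    fix \<omega> \<omega>' :: "nat \<Rightarrow> 'a" and x assume "\<And>i. i < n \<Longrightarrow> \<omega> i = \<omega>' i"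
    then have "map (\<lambda>i. (\<omega> i, f (\<omega> i))) [0..<n] = map (\<lambda>i. (\<omega>' i, f (\<omega>' i))) [0..<n]" by auto
    then show "G (\<omega>, x) = G (\<omega>', x)" unfolding G_def by (simp only: indicator_def mem_Collect_eq case_prod_conv)
  qed measurable
  also have "\<dots> \<le> (\<integral>\<^sup>+X. ennreal (2 / (n + 1)) * (\<Sum>t\<le>n. indicator {z. B t z} (\<lambda>i. X (\<pi> t i))) \<partial>S)"
  proof (rule nn_integral_mono)
    fix X assume X: "X \<in> space S"
    show "G (X, X n) \<le> ennreal (2 / (n + 1)) * (\<Sum>t\<le>n. indicator {z. B t z} (\<lambda>i. X (\<pi> t i)))"
    proof (cases "halving_learner C u (map (\<lambda>i. (X i, f (X i))) [0..<n]) (X n) = f (X n)")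
      case False
      have eq: "(halving (patterns C (Suc n) (insert_at t (X n) X)) t (\<lambda>i. f (X i)) \<noteq> f (X n)) = B t (\<lambda>i. X (\<pi> t i))" if "t \<le> n" for t
      proof -
        have "patterns C (Suc n) (insert_at t (X n) X) = patterns C (Suc n) (\<lambda>i. X (\<pi> t i))"
          by (rule patterns_cong) (auto simp: insert_at_def \<pi>_def)
        moreover have "halving F t (\<lambda>i. f (X i)) = halving F t (\<lambda>i. f (X (\<pi> t i)))" for F
          by (rule halving_cong) (auto simp: \<pi>_def)
        ultimately show ?thesis by (simp add: B_def \<pi>_def)
      qed
      have "Suc n \<le> 2 * card {t\<in>{..n}. halving (patterns C (Suc n) (insert_at t (X n) X)) t (\<lambda>i. f (X i)) \<noteq> f (X n)}"
        using halving_learner_error[OF False] .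
      also have "{t\<in>{..n}. halving (patterns C (Suc n) (insert_at t (X n) X)) t (\<lambda>i. f (X i)) \<noteq> f (X n)} = {t\<in>{..n}. B t (\<lambda>i. X (\<pi> t i))}"
        using eq by auto
      finally have "real (Suc n) \<le> 2 * real (card {t\<in>{..n}. B t (\<lambda>i. X (\<pi> t i))})" by linarith
      also have "real (card {t\<in>{..n}. B t (\<lambda>i. X (\<pi> t i))}) = (\<Sum>t\<le>n. indicator {z. B t z} (\<lambda>i. X (\<pi> t i)))"
        using real_card_eq_sum_indicator[of "{..n}" "\<lambda>t. B t (\<lambda>i. X (\<pi> t i))"]
        by (simp add: indicator_def of_bool_def)
      finally have "real (Suc n) \<le> 2 * (\<Sum>t\<le>n. indicator {z. B t z} (\<lambda>i. X (\<pi> t i)))" .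
      then have "1 \<le> (2 / (n + 1)) * (\<Sum>t\<le>n. indicator {z. B t z} (\<lambda>i. X (\<pi> t i)))"
        by (simp add: field_simps)
      then have "ennreal 1 \<le> ennreal ((2 / (n + 1)) * (\<Sum>t\<le>n. indicator {z. B t z} (\<lambda>i. X (\<pi> t i))))"
        by (intro ennreal_leI)
      also have "\<dots> = ennreal (2 / (n + 1)) * (\<Sum>t\<le>n. indicator {z. B t z} (\<lambda>i. X (\<pi> t i)))"
        by (subst ennreal_mult') (auto simp: sum_ennreal[symmetric] ennreal_indicator intro!: sum_nonneg)
      finally have "1 \<le> ennreal (2 / (n + 1)) * (\<Sum>t\<le>n. indicator {z. B t z} (\<lambda>i. X (\<pi> t i)))" by simp
      then show ?thesis using False by (simp add: G_def)
    qed (simp add: G_def)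
  qed
  also have "\<dots> = ennreal (2 / (n + 1)) * (\<Sum>t\<le>n. (\<integral>\<^sup>+X. indicator {z. B t z} (\<lambda>i. X (\<pi> t i)) \<partial>S))"
    by (subst nn_integral_cmult, measurable, subst nn_integral_sum, measurable)
  also have "(\<Sum>t\<le>n. (\<integral>\<^sup>+X. indicator {z. B t z} (\<lambda>i. X (\<pi> t i)) \<partial>S)) = (\<Sum>t\<le>n. (\<integral>\<^sup>+X. indicator {z. B t z} X \<partial>S))"
    by (intro sum.cong refl nn_integral_reindex inj) (auto intro!: borel_measurable_indicator')
  also have "\<dots> = (\<integral>\<^sup>+X. (\<Sum>t\<le>n. indicator {z. B t z} X) \<partial>S)"
    by (subst nn_integral_sum) (auto intro!: borel_measurable_indicator')
  also have "\<dots> \<le> (\<integral>\<^sup>+X. ennreal (d * log 2 (n + 2)) \<partial>S)"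
  proof (rule nn_integral_mono)
    fix X assume X: "X \<in> space S"
    have "(\<Sum>t\<le>n. indicator {z. B t z} X) = real (card {t. t < Suc n \<and> B t X})"
      using real_card_eq_sum_indicator[of "{..n}" "\<lambda>t. B t X"] by (simp add: less_Suc_eq_le indicator_def of_bool_def)
    also have "\<dots> \<le> log 2 (card (patterns C (Suc n) X))"
      unfolding B_def by (rule card_halving_mistakes_le[OF fC])
    also have "\<dots> \<le> log 2 (real ((Suc n + 1) ^ d))"
    proof (rule log_mono)
      show "0 < real (card (patterns C (Suc n) X))"
        using pattern_in_patterns[OF fC] finite_patterns by (metis card_gt_0_iff empty_iff of_nat_0_less_iff)
      show "real (card (patterns C (Suc n) X)) \<le> real ((Suc n + 1) ^ d)"
        using card_patterns_le[OF vc, of "Suc n" X] space_S[OF X] by (simp add: d_def del: of_nat_power)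
    qed simp
    also have "\<dots> = d * log 2 (n + 2)" by (simp add: log_nat_power)
    finally have *: "(\<Sum>t\<le>n. indicator {z. B t z} X) \<le> d * log 2 (n + 2)" .
    have "(\<Sum>t\<le>n. indicator {z. B t z} X) = ennreal (\<Sum>t\<le>n. indicator {z. B t z} X)"
      by (simp add: sum_ennreal[symmetric] ennreal_indicator)
    also have "\<dots> \<le> ennreal (d * log 2 (n + 2))" using * by (rule ennreal_leI)
    finally show "(\<Sum>t\<le>n. indicator {z. B t z} X) \<le> ennreal (d * log 2 (n + 2))" .
  qed
  also have "\<dots> = ennreal (d * log 2 (n + 2))" using seq.P.emeasure_space_1 by simp
  finally have "(\<integral>\<^sup>+X. emeasure P {x\<in>space P. halving_learner C u (map (\<lambda>i. (X i, f (X i))) [0..<n]) x \<noteq> f x} \<partial>S)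
    \<le> ennreal (2 / (n + 1)) * ennreal (d * log 2 (n + 2))" by (simp add: mult_left_mono)
  also have "\<dots> = ennreal (2 * d * log 2 (n + 2) / (n + 1))"
    by (subst ennreal_mult'[symmetric]) (auto simp: field_simps)
  finally show ?thesis by (simp add: add.commute)
qed

end

section \<open>Concentration\<close>

context target
begin

text \<open>The exponential Markov inequality. On a set outside the sigma-algebra
  \<open>emeasure\<close> has the default value 0, so the bound extends to such events.\<close>

lemma exp_markov:
  assumes "(\<integral>\<^sup>+X. ennreal (exp (h X)) \<partial>S) \<le> ennreal (exp b)"
    and [measurable]: "h \<in> borel_measurable S"
    and "\<And>X. X \<in> space S \<Longrightarrow> Q X \<Longrightarrow> a \<le> h X"
  shows "emeasure S {X\<in>space S. Q X} \<le> ennreal (exp (b - a))"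
proof (cases "{X\<in>space S. Q X} \<in> sets S")
  case True
  have "emeasure S {X\<in>space S. Q X} = (\<integral>\<^sup>+X. indicator {X\<in>space S. Q X} X \<partial>S)" using True by simp
  also have "\<dots> \<le> (\<integral>\<^sup>+X. ennreal (exp (- a)) * ennreal (exp (h X)) \<partial>S)"
  proof (rule nn_integral_mono)
    fix X assume "X \<in> space S"
    then have "Q X \<Longrightarrow> ennreal 1 \<le> ennreal (exp (- a) * exp (h X))"
      using assms(3)[of X] by (intro ennreal_leI) (simp flip: exp_add)
    then show "indicator {X\<in>space S. Q X} X \<le> ennreal (exp (- a)) * ennreal (exp (h X))"
      by (auto simp: indicator_def ennreal_mult')
  qed
  also have "\<dots> = ennreal (exp (- a)) * (\<integral>\<^sup>+X. ennreal (exp (h X)) \<partial>S)"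
    by (rule nn_integral_cmult) measurable
  also have "\<dots> \<le> ennreal (exp (- a)) * ennreal (exp b)" using assms(1) by (rule mult_left_mono) simp
  also have "\<dots> = ennreal (exp (b - a))" by (simp flip: ennreal_mult' exp_add)
  finally show ?thesis .
qed (simp add: emeasure_notin_sets)

lemma indep_coord: "prob_space.indep_vars S (\<lambda>_. P) (\<lambda>i \<omega>. \<omega> i) UNIV"
proof -
  have "distr S S (\<lambda>x. x) = S" by (rule distr_id)
  then show ?thesis
    by (subst prob_space.indep_vars_iff_distr_eq_PiM'[OF prob_space_S]) (auto simp: distr_coord restrict_UNIV)
qed

lemma measurable_card_hits[measurable]:
  assumes "finite I" "\<And>i. i \<in> I \<Longrightarrow> D i \<in> sets M"
  shows "(\<lambda>X. card {i\<in>I. X i \<in> D i}) \<in> measurable S (count_space UNIV)"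
  using assms by (intro measurable_card_Collect) auto

lemma prod_mono_ennreal:
  fixes g h :: "'i \<Rightarrow> ennreal"
  assumes "\<And>i. i \<in> I \<Longrightarrow> g i \<le> h i"
  shows "prod g I \<le> prod h I"
  using assms by (induction I rule: infinite_finite_induct) (auto intro!: mult_mono)

text \<open>Independence gives a product of factors 1 + (exp l - 1) p, each at most exp ((exp l - 1)
  p). The sets may vary with the coordinate, and \<open>l\<close> may have either sign, which serves
  both tails.\<close>

lemma chernoff_mgf:
  assumes I: "finite I" and D[measurable]: "\<And>i. i \<in> I \<Longrightarrow> D i \<in> sets M"
  shows "(\<integral>\<^sup>+X. ennreal (exp (l * real (card {i\<in>I. X i \<in> D i}))) \<partial>S)
     \<le> ennreal (exp ((exp l - 1) * (\<Sum>i\<in>I. measure P (D i))))"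
proof -
  have "ennreal (exp (l * real (card {i\<in>I. X i \<in> D i}))) = (\<Prod>i\<in>I. ennreal (exp (l * indicator (D i) (X i))))" for X :: "nat \<Rightarrow> 'a"
  proof -
    have "exp (l * real (card {i\<in>I. X i \<in> D i})) = (\<Prod>i\<in>I. exp (l * indicator (D i) (X i)))"
      using I real_card_eq_sum_indicator[OF I, of "\<lambda>i. X i \<in> D i"]
      by (simp add: sum_distrib_left indicator_def of_bool_def flip: exp_sum)
    then show ?thesis by (simp add: prod_ennreal)
  qed
  then have "(\<integral>\<^sup>+X. ennreal (exp (l * real (card {i\<in>I. X i \<in> D i}))) \<partial>S)
    = (\<integral>\<^sup>+X. (\<Prod>i\<in>I. ennreal (exp (l * indicator (D i) (X i)))) \<partial>S)" by simp
  also have "\<dots> = (\<Prod>i\<in>I. \<integral>\<^sup>+X. ennreal (exp (l * indicator (D i) (X i))) \<partial>S)"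
  proof (rule prob_space.indep_vars_nn_integral[OF prob_space_S I])
    have "prob_space.indep_vars S (\<lambda>_. P) (\<lambda>i \<omega>. \<omega> i) I"
      using prob_space.indep_vars_subset[OF prob_space_S indep_coord] by auto
    from prob_space.indep_vars_compose2[OF prob_space_S this,
        where N = "\<lambda>_. borel" and Y = "\<lambda>i x. ennreal (exp (l * indicator (D i) x))"]
    show "prob_space.indep_vars S (\<lambda>_. borel) (\<lambda>i X. ennreal (exp (l * indicator (D i) (X i)))) I"
      by simp
  qed simp
  also have "\<dots> \<le> (\<Prod>i\<in>I. ennreal (exp ((exp l - 1) * measure P (D i))))"
  proof (rule prod_mono_ennreal)
    fix i assume i: "i \<in> I"
    have "(\<integral>\<^sup>+X. ennreal (exp (l * indicator (D i) (X i))) \<partial>S) = (\<integral>\<^sup>+x. ennreal (exp (l * indicator (D i) x)) \<partial>P)"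
      using i by (intro nn_integral_coord) measurable
    also have "\<dots> = (\<integral>\<^sup>+x. ennreal (exp l) * indicator (D i) x + indicator (space P - D i) x \<partial>P)"
      by (intro nn_integral_cong) (auto simp: indicator_def)
    also have "\<dots> = ennreal (exp l) * emeasure P (D i) + emeasure P (space P - D i)"
      using i by (subst nn_integral_add) (auto simp: nn_integral_cmult)
    also have "\<dots> = ennreal (exp l * measure P (D i) + (1 - measure P (D i)))"
    proof -
      have "measure P (space P - D i) = 1 - measure P (D i)" using i by (subst P.prob_compl) auto
      then show ?thesis by (simp add: P.emeasure_eq_measure ennreal_mult' ennreal_plus del: space_P)
    qed
    also have "\<dots> \<le> ennreal (exp ((exp l - 1) * measure P (D i)))"
      using exp_ge_add_one_self[of "(exp l - 1) * measure P (D i)"] by (intro ennreal_leI) (simp add: algebra_simps)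
    finally show "(\<integral>\<^sup>+X. ennreal (exp (l * indicator (D i) (X i))) \<partial>S) \<le> ennreal (exp ((exp l - 1) * measure P (D i)))" .
  qed
  also have "\<dots> = ennreal (exp ((exp l - 1) * (\<Sum>i\<in>I. measure P (D i))))"
    using I by (simp add: prod_ennreal sum_distrib_left exp_sum)
  finally show ?thesis .
qed

lemma chernoff_upper:
  assumes I: "finite I" and D[measurable]: "\<And>i. i \<in> I \<Longrightarrow> D i \<in> sets M" and l: "l \<ge> 0"
    and b: "(\<Sum>i\<in>I. measure P (D i)) \<le> b"
  shows "emeasure S {X\<in>space S. a \<le> real (card {i\<in>I. X i \<in> D i})} \<le> ennreal (exp ((exp l - 1) * b - l * a))"
proof (rule exp_markov)
  have "exp ((exp l - 1) * (\<Sum>i\<in>I. measure P (D i))) \<le> exp ((exp l - 1) * b)"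
    using b l by (auto intro: mult_left_mono)
  then show "(\<integral>\<^sup>+X. ennreal (exp (l * real (card {i\<in>I. X i \<in> D i}))) \<partial>S) \<le> ennreal (exp ((exp l - 1) * b))"
    using chernoff_mgf[OF I D, where l = l] by (meson ennreal_leI order_trans)
  show "(\<lambda>X. l * real (card {i\<in>I. X i \<in> D i})) \<in> borel_measurable S" using I by measurable
qed (use l in \<open>auto intro: mult_left_mono\<close>)

lemma chernoff_lower:
  assumes I: "finite I" and D[measurable]: "\<And>i. i \<in> I \<Longrightarrow> D i \<in> sets M" and l: "l \<ge> 0"
    and b: "b \<le> (\<Sum>i\<in>I. measure P (D i))"
  shows "emeasure S {X\<in>space S. real (card {i\<in>I. X i \<in> D i}) \<le> a} \<le> ennreal (exp (l * a - (1 - exp (- l)) * b))"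
proof -
  have "emeasure S {X\<in>space S. real (card {i\<in>I. X i \<in> D i}) \<le> a} \<le> ennreal (exp ((exp (- l) - 1) * b - (- l * a)))"
  proof (rule exp_markov)
    have "exp ((exp (- l) - 1) * (\<Sum>i\<in>I. measure P (D i))) \<le> exp ((exp (- l) - 1) * b)"
      using b l by (auto intro: mult_left_mono_neg)
    then show "(\<integral>\<^sup>+X. ennreal (exp (- l * real (card {i\<in>I. X i \<in> D i}))) \<partial>S) \<le> ennreal (exp ((exp (- l) - 1) * b))"
      using chernoff_mgf[OF I D, where l = "- l"] by (meson ennreal_leI order_trans)
    show "(\<lambda>X. - l * real (card {i\<in>I. X i \<in> D i})) \<in> borel_measurable S" using I by measurable
  qed (use l in \<open>auto intro: mult_left_mono\<close>)
  then show ?thesis by (simp add: algebra_simps)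
qed

section \<open>Hoeffding bounds for coordinates and for blocks of coordinates\<close>

lemma hoeffding_indicator:
  assumes ind: "prob_space.indep_vars S (\<lambda>_. N) Y I" and B[measurable]: "B \<in> sets N"
    and I: "finite I" "I \<noteq> {}" and p: "\<And>i. i \<in> I \<Longrightarrow> measure S {W\<in>space S. Y i W \<in> B} = p" and e: "(e::real) \<ge> 0"
  shows "emeasure S {W\<in>space S. e * card I \<le> \<bar>real (card {i\<in>I. Y i W \<in> B}) - p * card I\<bar>} \<le> ennreal (2 * exp (- 2 * e\<^sup>2 * card I))"
proof -
  define Z where "Z = (\<lambda>i W. indicator B (Y i W) :: real)"
  have Y[measurable]: "i \<in> I \<Longrightarrow> Y i \<in> measurable S N" for i using ind by (auto simp: seq.P.indep_vars_def)
  have indZ: "seq.P.indep_vars (\<lambda>_. borel) Z I"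
    unfolding Z_def by (rule seq.P.indep_vars_compose2[OF ind, where Y = "\<lambda>_. indicator B"]) measurable
  have ex: "seq.P.expectation (Z i) = p" if i: "i \<in> I" for i
  proof -
    have "Z i = indicator {W. Y i W \<in> B}" by (auto simp: Z_def indicator_def)
    then have "seq.P.expectation (Z i) = seq.P.prob ({W. Y i W \<in> B} \<inter> space S)" by simp
    also have "{W. Y i W \<in> B} \<inter> space S = {W\<in>space S. Y i W \<in> B}" by auto
    finally show ?thesis using p[OF i] by simp
  qed
  interpret H: Hoeffding_ineq S I Z "\<lambda>_. 0" "\<lambda>_. 1" "\<Sum>i\<in>I. seq.P.expectation (Z i)"
    by unfold_locales (use I indZ in \<open>auto simp: Z_def indicator_def\<close>)
  have sumZ: "(\<Sum>i\<in>I. Z i W) = real (card {i\<in>I. Y i W \<in> B})" for W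
    using I by (simp add: real_card_eq_sum_indicator Z_def indicator_def of_bool_def)
  have c: "0 < card I" using I by (simp add: card_gt_0_iff)
  have "seq.P.prob {W\<in>space S. \<bar>(\<Sum>i\<in>I. Z i W) - (\<Sum>i\<in>I. seq.P.expectation (Z i))\<bar> \<ge> e * card I}
     \<le> 2 * exp (-2 * (e * card I)\<^sup>2 / (\<Sum>i\<in>I. (1 - 0)\<^sup>2))"
    by (rule H.Hoeffding_ineq_abs_ge) (use e c in auto)
  also have "-2 * (e * card I)\<^sup>2 / (\<Sum>i\<in>I. (1 - 0)\<^sup>2) = - 2 * e\<^sup>2 * card I"
    using c by (simp add: power2_eq_square field_simps)
  also have "(\<Sum>i\<in>I. seq.P.expectation (Z i)) = p * card I" using ex by simp
  finally have "seq.P.prob {W\<in>space S. e * card I \<le> \<bar>real (card {i\<in>I. Y i W \<in> B}) - p * card I\<bar>} \<le> 2 * exp (- 2 * e\<^sup>2 * card I)"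
    by (simp only: sumZ)
  then show ?thesis by (simp add: seq.P.emeasure_eq_measure ennreal_leI)
qed

lemma hoeffding_coord:
  assumes B[measurable]: "B \<in> sets M" and e: "(e::real) \<ge> 0" and Q: "(Q::nat) \<ge> 1"
  shows "emeasure S {W\<in>space S. e * Q \<le> \<bar>real (card {i\<in>{1..Q}. W i \<in> B}) - measure P B * Q\<bar>} \<le> ennreal (2 * exp (- 2 * e\<^sup>2 * Q))"
proof -
  have "measure S {W\<in>space S. W i \<in> B} = measure P B" for i
  proof -
    have "measure P B = measure (distr S P (\<lambda>\<omega>. \<omega> i)) B" by (simp add: distr_coord)
    also have "\<dots> = measure S ((\<lambda>\<omega>. \<omega> i) -` B \<inter> space S)" by (rule measure_distr) simp_all
    also have "(\<lambda>\<omega>. \<omega> i) -` B \<inter> space S = {W\<in>space S. W i \<in> B}" by auto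
    finally show ?thesis by simp
  qed
  moreover have "prob_space.indep_vars S (\<lambda>_. P) (\<lambda>i \<omega>. \<omega> i) {1..Q}"
    using prob_space.indep_vars_subset[OF prob_space_S indep_coord] by auto
  ultimately show ?thesis
    using hoeffding_indicator[of P "\<lambda>i \<omega>. \<omega> i" "{1..Q}" B "measure P B" e] assms by simp
qed

text \<open>For i at least 1 this is the tuple that the estimators read off \<open>W2\<close> when
  tuples have length \<open>j\<close>, restricted to \<open>{..<j}\<close> in order to be a point of
  the product space.\<close>

definition block :: "nat \<Rightarrow> nat \<Rightarrow> (nat \<Rightarrow> 'a) \<Rightarrow> nat \<Rightarrow> 'a" where
  "block j i W = (\<lambda>l\<in>{..<j}. W (1 + (i - 1) * j + l))"

lemma measurable_block[measurable]: "block j i \<in> measurable S (power_measure j P)"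
  unfolding block_def power_measure_def by (intro measurable_restrict) simp

lemma distr_block: "distr S (power_measure j P) (block j i) = power_measure j P"
  using distr_PiM_reindex[of UNIV "\<lambda>_. P" "\<lambda>l. 1 + (i - 1) * j + l" "{..<j}"] P.prob_space_axioms
  unfolding power_measure_def block_def by (simp add: inj_on_def)

lemma hoeffding_block:
  assumes B[measurable]: "B \<in> sets (power_measure j P)" and e: "(e::real) \<ge> 0" and Q: "(Q::nat) \<ge> 1"
  shows "emeasure S {W\<in>space S. e * Q \<le> \<bar>real (card {i\<in>{1..Q}. block j i W \<in> B}) - measure (power_measure j P) B * Q\<bar>}
    \<le> ennreal (2 * exp (- 2 * e\<^sup>2 * Q))"
proof -
  have "measure S {W\<in>space S. block j i W \<in> B} = measure (power_measure j P) B" for i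
  proof -
    have "measure (power_measure j P) B = measure (distr S (power_measure j P) (block j i)) B" by (simp add: distr_block)
    also have "\<dots> = measure S (block j i -` B \<inter> space S)" by (rule measure_distr) simp_all
    also have "block j i -` B \<inter> space S = {W\<in>space S. block j i W \<in> B}" by auto
    finally show ?thesis by simp
  qed
  moreover have "prob_space.indep_vars S (\<lambda>_. power_measure j P) (block j) {1..Q}"
  proof -
    \<comment> \<open>The indices read by the i-th block. These intervals are disjoint, which makes
      the blocks independent.\<close>
    define K where "K = (\<lambda>i. {1 + (i - 1) * j ..< 1 + i * j})"
    have disj: "disjoint_family_on K {1..Q}"
      unfolding disjoint_family_on_def
    proof (intro ballI impI)
      fix a b assume *: "a \<in> {1..Q}" "b \<in> {1..Q}" "a \<noteq> b"
      have "K a \<inter> K b = {}" if "a < b" "1 \<le> a" for a b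
      proof -
        have "a * j \<le> (b - 1) * j" using that by (intro mult_right_mono) auto
        then show ?thesis by (auto simp: K_def)
      qed
      then show "K a \<inter> K b = {}" using * by (metis atLeastAtMost_iff inf_commute nat_neq_iff)
    qed
    have "prob_space.indep_vars S (\<lambda>i. PiM (K i) (\<lambda>_. P)) (\<lambda>i \<omega>. restrict (\<lambda>l. \<omega> l) (K i)) {1..Q}"
      by (rule prob_space.indep_vars_restrict[OF prob_space_S indep_coord _ disj]) simp
    then have "prob_space.indep_vars S (\<lambda>_. power_measure j P)
       (\<lambda>i \<omega>. (\<lambda>l\<in>{..<j}. restrict (\<lambda>l. \<omega> l) (K i) (1 + (i - 1) * j + l))) {1..Q}"
    proof (rule prob_space.indep_vars_compose2[OF prob_space_S, where N = "\<lambda>_. power_measure j P"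
          and Y = "\<lambda>i w. \<lambda>l\<in>{..<j}. w (1 + (i - 1) * j + l)"])
      fix i assume i: "i \<in> {1..Q}"
      have K: "1 + (i - 1) * j + l \<in> K i" if "l < j" for l
        using that i by (cases i) (auto simp: K_def)
      show "(\<lambda>w. \<lambda>l\<in>{..<j}. w (1 + (i - 1) * j + l)) \<in> measurable (PiM (K i) (\<lambda>_. P)) (power_measure j P)"
        unfolding power_measure_def by (intro measurable_restrict measurable_component_singleton) (use K in auto)
    qed
    moreover have "(\<lambda>l\<in>{..<j}. restrict (\<lambda>l. \<omega> l) (K i) (1 + (i - 1) * j + l)) = block j i \<omega>" if i: "i \<in> {1..Q}" for i \<omega>
    proof -
      have K: "1 + (i - 1) * j + l \<in> K i" if "l < j" for l
        using that i by (cases i) (auto simp: K_def)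
      then show ?thesis unfolding block_def by (intro restrict_ext) auto
    qed
    ultimately show ?thesis
      by (subst prob_space.indep_vars_cong[OF prob_space_S refl _ refl]) auto
  qed
  ultimately show ?thesis
    using hoeffding_indicator[of "power_measure j P" "block j" "{1..Q}" B "measure (power_measure j P) B" e] assms by simp
qed

end

lemma emeasure_pred:
  assumes "Measurable.pred N Q"
  shows "emeasure N {x\<in>space N. Q x} = (\<integral>\<^sup>+x. indicator {x. Q x} x \<partial>N)"
proof -
  have "{x\<in>space N. Q x} \<in> sets N" using assms by (simp add: pred_def)
  then have "emeasure N {x\<in>space N. Q x} = (\<integral>\<^sup>+x. indicator {x\<in>space N. Q x} x \<partial>N)" by simp
  also have "\<dots> = (\<integral>\<^sup>+x. indicator {x. Q x} x \<partial>N)" by (intro nn_integral_cong) (auto simp: indicator_def)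
  finally show ?thesis .
qed

section \<open>Version spaces are small\<close>

context target
begin

definition Vs :: "(nat \<Rightarrow> 'a) \<Rightarrow> nat \<Rightarrow> ('a \<Rightarrow> bool) set" where
  "Vs X m = {h\<in>C. \<forall>i\<in>{1..m}. h (X i) = f (X i)}"

lemma f_in_Vs: "f \<in> Vs X m"
  using fC by (simp add: Vs_def)

lemma Vs_antimono: "m \<le> m' \<Longrightarrow> Vs X m' \<subseteq> Vs X m"
  by (auto simp: Vs_def)

lemma Vs_0: "Vs X 0 = C"
  by (simp add: Vs_def)

lemma Vs_Suc: "Vs X (Suc m) = constrain (Vs X m) (X (Suc m)) (f (X (Suc m)))"
  by (auto simp: Vs_def constrain_def atLeastAtMostSuc_conv)

lemma Vs_cong: "(\<And>i. i \<le> m \<Longrightarrow> X i = X' i) \<Longrightarrow> Vs X m = Vs X' m"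
  by (simp add: Vs_def)

section \<open>Symmetrization with a ghost sample\<close>

definition swap :: "nat \<Rightarrow> nat set \<Rightarrow> nat \<Rightarrow> nat" where
  "swap m \<sigma> i = (if i \<in> \<sigma> then i + m else if m < i \<and> i - m \<in> \<sigma> then i - m else i)"

lemma inj_swap: "\<sigma> \<subseteq> {1..m} \<Longrightarrow> inj (swap m \<sigma>)"
proof (rule inj_on_inverseI[of _ "swap m \<sigma>"])
  fix i assume "\<sigma> \<subseteq> {1..m}"
  then show "swap m \<sigma> (swap m \<sigma> i) = i" by (auto simp: swap_def)
qed

text \<open>Coordinates 1 to m are the sample and m + 1 to 2 m the ghost sample; \<open>swap\<close>
  exchanges the members of selected pairs (i, i + m).\<close>

definition ghost_error :: "nat \<Rightarrow> nat \<Rightarrow> (nat \<Rightarrow> 'a) \<Rightarrow> bool" where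
  "ghost_error m K z \<longleftrightarrow> (\<exists>h\<in>C. (\<forall>i\<in>{1..m}. h (z i) = f (z i)) \<and>
      K \<le> card {i\<in>{1..m}. h (z (i + m)) \<noteq> f (z (i + m))})"

lemma pred_ghost_error[measurable]: "Measurable.pred S (ghost_error m K)"
proof -
  have "ghost_error m K z \<longleftrightarrow> (\<exists>w\<in>{w\<in>Pow {1..m}. K \<le> card w}.
      \<exists>h\<in>C. \<forall>i\<in>{1..2*m}. h (z i) = (if i \<le> m \<or> i - m \<notin> w then f (z i) else \<not> f (z i)))" for z
  proof
    assume "ghost_error m K z"
    then obtain h where h: "h \<in> C" "\<forall>i\<in>{1..m}. h (z i) = f (z i)"
      "K \<le> card {i\<in>{1..m}. h (z (i + m)) \<noteq> f (z (i + m))}" by (auto simp: ghost_error_def)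
    define w where "w = {i\<in>{1..m}. h (z (i + m)) \<noteq> f (z (i + m))}"
    have "h (z i) = (if i \<le> m \<or> i - m \<notin> w then f (z i) else \<not> f (z i))" if i: "i \<in> {1..2*m}" for i
    proof (cases "i \<le> m")
      case False
      then obtain j where "i = j + m" "j \<in> {1..m}" using i by (intro that[of "i - m"]) auto
      then show ?thesis by (auto simp: w_def)
    qed (use h i in auto)
    then show "\<exists>w\<in>{w\<in>Pow {1..m}. K \<le> card w}.
      \<exists>h\<in>C. \<forall>i\<in>{1..2*m}. h (z i) = (if i \<le> m \<or> i - m \<notin> w then f (z i) else \<not> f (z i))"
      using h by (intro bexI[of _ w] bexI[of _ h]) (auto simp: w_def)
  next
    assume "\<exists>w\<in>{w\<in>Pow {1..m}. K \<le> card w}.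
      \<exists>h\<in>C. \<forall>i\<in>{1..2*m}. h (z i) = (if i \<le> m \<or> i - m \<notin> w then f (z i) else \<not> f (z i))"
    then obtain w h where w: "w \<subseteq> {1..m}" "K \<le> card w" and h: "h \<in> C"
      "\<And>i. i \<in> {1..2*m} \<Longrightarrow> h (z i) = (if i \<le> m \<or> i - m \<notin> w then f (z i) else \<not> f (z i))" by auto
    have "w \<subseteq> {i\<in>{1..m}. h (z (i + m)) \<noteq> f (z (i + m))}"
    proof
      fix i assume "i \<in> w"
      then have "i \<in> {1..m}" "i + m \<in> {1..2*m}" "\<not> i + m \<le> m" using w by force+
      then show "i \<in> {i\<in>{1..m}. h (z (i + m)) \<noteq> f (z (i + m))}" using h(2)[of "i + m"] \<open>i \<in> w\<close> by auto
    qed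
    then have "card w \<le> card {i\<in>{1..m}. h (z (i + m)) \<noteq> f (z (i + m))}" by (intro card_mono) auto
    then show "ghost_error m K z" using w h unfolding ghost_error_def by (intro bexI[of _ h]) auto
  qed
  moreover have "Measurable.pred S (\<lambda>z. \<exists>w\<in>{w\<in>Pow {1..m}. K \<le> card w}.
      \<exists>h\<in>C. \<forall>i\<in>{1..2*m}. h (z i) = (if i \<le> m \<or> i - m \<notin> w then f (z i) else \<not> f (z i)))"
    by (intro pred_intros_finite(4) pred_realizable) auto
  ultimately show ?thesis by (simp cong: measurable_cong)
qed

text \<open>Here the error pattern is fixed. A good swap moves every error into the ghost half,
  which determines it on the set \<open>E\<close> of pairs that contain an error. There are at least
  K such pairs, so at most 2 ^ (m - K) swaps are good.\<close>

lemma card_good_swaps: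
  assumes G: "G = {\<sigma>. \<sigma> \<subseteq> {1..m} \<and> (\<forall>i\<in>{1..m}. \<not> e (swap m \<sigma> i)) \<and> K \<le> card {i\<in>{1..m}. e (swap m \<sigma> (i + m))}}"
  shows "card G * 2 ^ K \<le> 2 ^ m"
proof (cases "G = {}")
  case False
  define E where "E = {i\<in>{1..m}. e i \<or> e (i + m)}"
  have E: "E \<subseteq> {1..m}" "finite E" by (auto simp: E_def)
  have sub: "{i\<in>{1..m}. e (swap m \<sigma> (i + m))} \<subseteq> E" if "\<sigma> \<in> G" for \<sigma>
    using that by (auto simp: G E_def swap_def split: if_splits)
  have KE: "K \<le> card E"
  proof -
    obtain \<sigma> where "\<sigma> \<in> G" using False by auto
    then show ?thesis using card_mono[OF E(2) sub[of \<sigma>]] by (auto simp: G)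
  qed
  have det: "\<sigma> \<inter> E = {i\<in>E. e i}" if "\<sigma> \<in> G" for \<sigma>
  proof -
    have *: "\<And>i. i \<in> {1..m} \<Longrightarrow> \<not> e (swap m \<sigma> i)" using that by (auto simp: G)
    show ?thesis
    proof (intro set_eqI iffI)
      fix i assume "i \<in> \<sigma> \<inter> E"
      then show "i \<in> {i\<in>E. e i}" using *[of i] by (auto simp: E_def swap_def)
    next
      fix i assume "i \<in> {i\<in>E. e i}"
      then show "i \<in> \<sigma> \<inter> E" using *[of i] by (auto simp: E_def swap_def split: if_splits)
    qed
  qed
  have "inj_on (\<lambda>\<sigma>. \<sigma> - E) G"
  proof (rule inj_onI)
    fix \<sigma> \<tau> assume "\<sigma> \<in> G" "\<tau> \<in> G" "\<sigma> - E = \<tau> - E"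
    then show "\<sigma> = \<tau>" using det by blast
  qed
  moreover have "(\<lambda>\<sigma>. \<sigma> - E) ` G \<subseteq> Pow ({1..m} - E)" by (auto simp: G)
  ultimately have "card G \<le> card (Pow ({1..m} - E))" by (intro card_inj_on_le) auto
  also have "\<dots> = 2 ^ (m - card E)" using E by (simp add: card_Pow card_Diff_subset)
  finally have "card G * 2 ^ K \<le> 2 ^ (m - card E) * 2 ^ card E"
    using KE by (intro mult_mono power_increasing) auto
  also have "\<dots> = 2 ^ m" using E card_mono[of "{1..m}" E] by (simp flip: power_add)
  finally show ?thesis .
qed simp

text \<open>A union bound over the patterns on the coordinates 0 to 2 m, of which there are at most
  (2 m + 2) ^ d; each pattern is handled by \<open>card_good_swaps\<close>.\<close>

lemma ghost_error_swaps:
  assumes z: "\<And>i. z i \<in> space M"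
  shows "card {\<sigma>\<in>Pow {1..m}. ghost_error m K (\<lambda>i. z (swap m \<sigma> i))} * 2 ^ K \<le> (2 * m + 2) ^ d * 2 ^ m"
proof -
  define F where "F = patterns C (2 * m + 1) z"
  define e where "e = (\<lambda>w i. (i \<in> w) \<noteq> f (z i))"
  define G where "G = (\<lambda>w. {\<sigma>. \<sigma> \<subseteq> {1..m} \<and> (\<forall>i\<in>{1..m}. \<not> e w (swap m \<sigma> i)) \<and> K \<le> card {i\<in>{1..m}. e w (swap m \<sigma> (i + m))}})"
  have fin: "finite F" "finite (G w)" for w
    using finite_subset[of "G w" "Pow {1..m}"] by (auto simp: F_def G_def finite_patterns)
  have sw: "swap m \<sigma> i < 2 * m + 1" "swap m \<sigma> (i + m) < 2 * m + 1" if "\<sigma> \<subseteq> {1..m}" "i \<in> {1..m}" for \<sigma> i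
    using that by (auto simp: swap_def)
  have "{\<sigma>\<in>Pow {1..m}. ghost_error m K (\<lambda>i. z (swap m \<sigma> i))} \<subseteq> (\<Union>w\<in>F. G w)"
  proof safe
    fix \<sigma> assume \<sigma>: "\<sigma> \<subseteq> {1..m}" "ghost_error m K (\<lambda>i. z (swap m \<sigma> i))"
    then obtain h where h: "h \<in> C" "\<forall>i\<in>{1..m}. h (z (swap m \<sigma> i)) = f (z (swap m \<sigma> i))"
      "K \<le> card {i\<in>{1..m}. h (z (swap m \<sigma> (i + m))) \<noteq> f (z (swap m \<sigma> (i + m)))}"
      by (auto simp: ghost_error_def)
    define w where "w = {i. i < 2 * m + 1 \<and> h (z i)}"
    have ew: "e w i \<longleftrightarrow> h (z i) \<noteq> f (z i)" if "i < 2 * m + 1" for i using that by (simp add: e_def w_def)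
    have "w \<in> F" unfolding w_def F_def using h by (intro pattern_in_patterns)
    moreover have "\<sigma> \<in> G w"
    proof -
      have "{i\<in>{1..m}. e w (swap m \<sigma> (i + m))} = {i\<in>{1..m}. h (z (swap m \<sigma> (i + m))) \<noteq> f (z (swap m \<sigma> (i + m)))}"
        using ew sw[OF \<sigma>(1)] by blast
      then show ?thesis using h ew sw[OF \<sigma>(1)] \<sigma>(1) by (simp add: G_def)
    qed
    ultimately show "\<sigma> \<in> (\<Union>w\<in>F. G w)" by auto
  qed
  then have "card {\<sigma>\<in>Pow {1..m}. ghost_error m K (\<lambda>i. z (swap m \<sigma> i))} \<le> (\<Sum>w\<in>F. card (G w))"
    using card_mono[OF finite_UN_I[OF fin(1), of G, OF fin(2)]] card_UN_le[OF fin(1), of G] by (meson order_trans)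
  then have "card {\<sigma>\<in>Pow {1..m}. ghost_error m K (\<lambda>i. z (swap m \<sigma> i))} * 2 ^ K \<le> (\<Sum>w\<in>F. card (G w)) * 2 ^ K"
    by simp
  also have "\<dots> = (\<Sum>w\<in>F. card (G w) * 2 ^ K)" by (rule sum_distrib_right)
  also have "\<dots> \<le> (\<Sum>w\<in>F. 2 ^ m)" by (intro sum_mono card_good_swaps) (simp add: G_def)
  also have "\<dots> \<le> (2 * m + 2) ^ d * 2 ^ m"
    using card_patterns_le[OF vc, of "2 * m + 1" z] z by (simp add: F_def d_def)
  finally show ?thesis .
qed

text \<open>Every swap preserves the law, so the probability equals its average over all 2 ^ m
  swaps; with the points held fixed that average is a matter of counting.\<close>

lemma ghost_error_prob:
  "emeasure S {z\<in>space S. ghost_error m K z} \<le> ennreal (real ((2 * m + 2) ^ d) / 2 ^ K)"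
proof -
  have [measurable]: "{z\<in>space S. ghost_error m K z} \<in> sets S"
    using pred_ghost_error by (simp add: pred_def)
  define g where "g = (\<lambda>z. indicator {z. ghost_error m K z} z :: ennreal)"
  have g[measurable]: "g \<in> borel_measurable S" unfolding g_def by (auto intro!: borel_measurable_indicator')
  have pe: "emeasure S {z\<in>space S. ghost_error m K z} = (\<integral>\<^sup>+z. g z \<partial>S)"
    unfolding g_def by (rule emeasure_pred) measurable
  have "2 ^ m * (\<integral>\<^sup>+z. g z \<partial>S) = (\<Sum>\<sigma>\<in>Pow {1..m}. (\<integral>\<^sup>+z. g z \<partial>S))" by (simp add: card_Pow)
  also have "\<dots> = (\<Sum>\<sigma>\<in>Pow {1..m}. (\<integral>\<^sup>+z. g (\<lambda>i. z (swap m \<sigma> i)) \<partial>S))"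
    by (intro sum.cong refl nn_integral_reindex[symmetric] inj_swap g) auto
  also have "\<dots> = (\<integral>\<^sup>+z. (\<Sum>\<sigma>\<in>Pow {1..m}. g (\<lambda>i. z (swap m \<sigma> i))) \<partial>S)"
    by (rule nn_integral_sum[symmetric]) measurable
  also have "\<dots> \<le> (\<integral>\<^sup>+z. ennreal (real ((2 * m + 2) ^ d) * 2 ^ m / 2 ^ K) \<partial>S)"
  proof (rule nn_integral_mono)
    fix z assume z: "z \<in> space S"
    have "(\<Sum>\<sigma>\<in>Pow {1..m}. g (\<lambda>i. z (swap m \<sigma> i))) = (\<Sum>\<sigma>\<in>Pow {1..m}. ennreal (of_bool (ghost_error m K (\<lambda>i. z (swap m \<sigma> i)))))"
      by (intro sum.cong refl) (simp add: g_def indicator_def)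
    also have "\<dots> = ennreal (real (card {\<sigma>\<in>Pow {1..m}. ghost_error m K (\<lambda>i. z (swap m \<sigma> i))}))"
      by (subst real_card_eq_sum_indicator, simp, rule sum_ennreal) simp
    also have "\<dots> \<le> ennreal (real ((2 * m + 2) ^ d) * 2 ^ m / 2 ^ K)"
    proof (rule ennreal_leI)
      have "real (card {\<sigma>\<in>Pow {1..m}. ghost_error m K (\<lambda>i. z (swap m \<sigma> i))} * 2 ^ K) \<le> real ((2 * m + 2) ^ d * 2 ^ m)"
        using ghost_error_swaps[of z m K] space_S[OF z] by (simp only: of_nat_le_iff)
      then show "real (card {\<sigma>\<in>Pow {1..m}. ghost_error m K (\<lambda>i. z (swap m \<sigma> i))}) \<le> real ((2 * m + 2) ^ d) * 2 ^ m / 2 ^ K"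
        by (simp add: field_simps)
    qed
    finally show "(\<Sum>\<sigma>\<in>Pow {1..m}. g (\<lambda>i. z (swap m \<sigma> i))) \<le> ennreal (real ((2 * m + 2) ^ d) * 2 ^ m / 2 ^ K)" .
  qed
  also have "\<dots> = ennreal (real ((2 * m + 2) ^ d) * 2 ^ m / 2 ^ K)" using seq.P.emeasure_space_1 by simp
  finally have *: "2 ^ m * (\<integral>\<^sup>+z. g z \<partial>S) \<le> ennreal (real ((2 * m + 2) ^ d) * 2 ^ m / 2 ^ K)" .
  have "(\<integral>\<^sup>+z. g z \<partial>S) = ennreal (1 / 2 ^ m) * (2 ^ m * (\<integral>\<^sup>+z. g z \<partial>S))"
  proof -
    have "ennreal (1 / 2 ^ m) * 2 ^ m = ennreal (1 / 2 ^ m) * ennreal (2 ^ m)" by (simp add: ennreal_power[symmetric])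
    also have "\<dots> = 1" by (subst ennreal_mult'[symmetric]) auto
    finally show ?thesis by (simp flip: mult.assoc)
  qed
  also have "\<dots> \<le> ennreal (1 / 2 ^ m) * ennreal (real ((2 * m + 2) ^ d) * 2 ^ m / 2 ^ K)"
    using * by (rule mult_left_mono) simp
  also have "\<dots> = ennreal (real ((2 * m + 2) ^ d) / 2 ^ K)"
    by (subst ennreal_mult'[symmetric]) auto
  finally show ?thesis using pe by simp
qed

text \<open>The mean number of errors of \<open>h\<close> on m fresh points exceeds r m, and a
  Chernoff bound keeps the number above r m / 2 with probability at least 1/2. Gluing at
  \<open>Suc m\<close> retains the coordinates 0 to m of \<open>X\<close> and makes the ghost half
  fresh.\<close>

lemma ghost_detects:
  assumes X: "X \<in> space S" and h: "h \<in> Vs X m" and err: "r < err P f h" and rm: "10 \<le> r * m"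
  shows "1 / 2 \<le> emeasure S {X'\<in>space S. ghost_error m (nat \<lceil>r * m / 2\<rceil>) (comb_seq (Suc m) X X')}"
proof -
  define K where "K = nat \<lceil>r * m / 2\<rceil>"
  have [measurable]: "h \<in> measurable M (count_space UNIV)" using h by (intro classifier) (simp add: Vs_def)
  define D where "D = {x\<in>space P. h x \<noteq> f x}"
  have D[measurable]: "D \<in> sets M" unfolding D_def by (simp add: pred_def[symmetric])
  have pD: "r < measure P D" using err by (simp add: err_def D_def)
  have "emeasure S {X'\<in>space S. real (card {i\<in>{..<m}. X' i \<in> D}) \<le> r * m / 2}
    \<le> ennreal (exp (1 * (r * m / 2) - (1 - exp (- 1)) * (r * m)))"
  proof (rule chernoff_lower)
    show "r * real m \<le> (\<Sum>i<m. P.prob D)" using mult_left_mono[of r "P.prob D" "real m"] pD by (simp add: mult.commute)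
  qed auto
  also have "\<dots> \<le> ennreal (exp (-1))"
  proof (intro ennreal_leI, simp only: exp_le_cancel_iff)
    \<comment> \<open>With exp (-1) at most 2/5 the exponent is at most (1/2 - 3/5) r m = - r m /
      10, and the assumption 10 \<le> r m brings it down to -1.\<close>
    have "exp (1::real) \<ge> 5 / 2" using exp_lower_Taylor_quadratic[of 1] by simp
    then have "exp (- 1 :: real) \<le> 2 / 5" by (simp add: exp_minus field_simps)
    then have "exp (- 1) * (r * m) \<le> 2 / 5 * (r * m)" using rm by (intro mult_right_mono) auto
    then show "1 * (r * m / 2) - (1 - exp (- 1)) * (r * m) \<le> -1" using rm by (simp add: algebra_simps)
  qed
  also have "\<dots> \<le> ennreal (1 / 2)"
  proof (rule ennreal_leI)
    have "exp (1::real) \<ge> 2" using exp_ge_add_one_self[of 1] by simp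
    then show "exp (- 1 :: real) \<le> 1 / 2" by (simp add: exp_minus field_simps)
  qed
  finally have low: "emeasure S {X'\<in>space S. real (card {i\<in>{..<m}. X' i \<in> D}) \<le> r * m / 2} \<le> ennreal (1 / 2)" .
  define A where "A = {X'\<in>space S. real (card {i\<in>{..<m}. X' i \<in> D}) \<le> r * m / 2}"
  have Am[measurable]: "A \<in> sets S"
  proof -
    have [measurable]: "(\<lambda>X. card {i\<in>{..<m}. X i \<in> D}) \<in> measurable S (count_space UNIV)"
      by (rule measurable_card_hits) auto
    show ?thesis unfolding A_def by measurable
  qed
  have "(1 / 2 :: ennreal) = ennreal (1 / 2)" using ennreal_divide_numeral[of 1 num.One] divide_ennreal[of 1 2] by simp
  also have "\<dots> = 1 - ennreal (1 / 2)" using ennreal_minus[of "1/2" 1] by simp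
  also have "\<dots> \<le> 1 - emeasure S A" using low unfolding A_def by (rule ennreal_mono_minus)
  also have "\<dots> = emeasure S (space S - A)"
    using emeasure_compl[OF Am] seq.P.emeasure_space_1 by simp
  also have "\<dots> \<le> emeasure S {X'\<in>space S. ghost_error m K (comb_seq (Suc m) X X')}"
  proof (rule emeasure_mono)
    have [measurable]: "X \<in> space S" by fact
    have "Measurable.pred S (\<lambda>X'. ghost_error m K (comb_seq (Suc m) X X'))"
      by (rule measurable_compose[OF _ pred_ghost_error]) (use X in measurable)
    then show "{X'\<in>space S. ghost_error m K (comb_seq (Suc m) X X')} \<in> sets S" by (simp add: pred_def)
    show "space S - A \<subseteq> {X'\<in>space S. ghost_error m K (comb_seq (Suc m) X X')}"
    proof safe
      fix X' assume X': "X' \<in> space S" "X' \<notin> A"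
      then have "r * m / 2 < real (card {i\<in>{..<m}. X' i \<in> D})" by (simp add: A_def)
      then have K: "K \<le> card {i\<in>{..<m}. X' i \<in> D}" unfolding K_def by linarith
      let ?z = "comb_seq (Suc m) X X'"
      have "card {i\<in>{..<m}. X' i \<in> D} = card (Suc ` {i\<in>{..<m}. X' i \<in> D})" by (simp add: card_image)
      also have "\<dots> \<le> card {i\<in>{1..m}. h (?z (i + m)) \<noteq> f (?z (i + m))}"
        by (rule card_mono) (auto simp: D_def comb_seq_def)
      finally have "K \<le> card {i\<in>{1..m}. h (?z (i + m)) \<noteq> f (?z (i + m))}" using K by simp
      moreover have "\<forall>i\<in>{1..m}. h (?z i) = f (?z i)" using h by (auto simp: Vs_def comb_seq_def)
      ultimately show "ghost_error m K ?z" using h unfolding ghost_error_def Vs_def by (intro bexI[of _ h]) auto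
    qed
  qed
  finally show ?thesis by (simp add: K_def)
qed

text \<open>\<open>N\<close> collects the samples for which a ghost error has conditional
  probability at least 1/2; by Markov's inequality its measure is at most twice that of
  \<open>ghost_error\<close>. Outside \<open>N\<close> no consistent concept has error above r, by
  \<open>ghost_detects\<close>. A measurable exceptional set is produced because the event itself
  quantifies over all concepts.\<close>

theorem version_space_radius:
  assumes rm: "10 \<le> r * m"
  obtains N where "N \<in> sets S" "emeasure S N \<le> ennreal (2 * real ((2 * m + 2) ^ d) * exp (- r * m / 4))"
    "\<And>X. X \<in> space S \<Longrightarrow> X \<notin> N \<Longrightarrow> Vs X m \<subseteq> concept_ball P C f r"
proof -
  define K where "K = nat \<lceil>r * m / 2\<rceil>"
  define p where "p = (\<lambda>X. emeasure S {X'\<in>space S. ghost_error m K (comb_seq (Suc m) X X')})"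
  define g where "g = (\<lambda>z. indicator {z. ghost_error m K z} z :: ennreal)"
  have g[measurable]: "g \<in> borel_measurable S" unfolding g_def by (auto intro!: borel_measurable_indicator')
  have p_eq: "p X = (\<integral>\<^sup>+X'. g (comb_seq (Suc m) X X') \<partial>S)" if X: "X \<in> space S" for X
  proof -
    have "Measurable.pred S (\<lambda>X'. ghost_error m K (comb_seq (Suc m) X X'))"
      by (rule measurable_compose[OF _ pred_ghost_error]) (use X in measurable)
    then have "p X = (\<integral>\<^sup>+X'. indicator {X'. ghost_error m K (comb_seq (Suc m) X X')} X' \<partial>S)"
      unfolding p_def by (rule emeasure_pred)
    also have "\<dots> = (\<integral>\<^sup>+X'. g (comb_seq (Suc m) X X') \<partial>S)"
      by (intro nn_integral_cong) (simp add: g_def indicator_def)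
    finally show ?thesis .
  qed
  define N where "N = {X\<in>space S. 1 / 2 \<le> (\<integral>\<^sup>+X'. g (comb_seq (Suc m) X X') \<partial>S)}"
  have [measurable]: "(\<lambda>X. \<integral>\<^sup>+X'. g (comb_seq (Suc m) X X') \<partial>S) \<in> borel_measurable S"
    by measurable
  have Nm: "N \<in> sets S" unfolding N_def by measurable
  have "emeasure S N = (\<integral>\<^sup>+X. indicator N X \<partial>S)" using Nm by simp
  also have "\<dots> \<le> (\<integral>\<^sup>+X. 2 * (\<integral>\<^sup>+X'. g (comb_seq (Suc m) X X') \<partial>S) \<partial>S)"
  proof (rule nn_integral_mono)
    fix X
    have "1 \<le> 2 * c" if "1 / 2 \<le> c" for c :: ennreal
    proof -
      have "(1 / 2 :: ennreal) = ennreal (1 / 2)" using divide_ennreal[of 1 2] by simp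
      then have "(1::ennreal) = 2 * (1 / 2)" using ennreal_mult'[of 2 "1 / 2"] by simp
      also have "\<dots> \<le> 2 * c" using that by (rule mult_left_mono) simp
      finally show ?thesis .
    qed
    then show "indicator N X \<le> 2 * (\<integral>\<^sup>+X'. g (comb_seq (Suc m) X X') \<partial>S)"
      by (auto simp: N_def indicator_def)
  qed
  also have "\<dots> = 2 * (\<integral>\<^sup>+X. g X \<partial>S)"
    by (subst nn_integral_cmult) (auto simp: nn_integral_comb_seq[OF g, of "Suc m"])
  also have "(\<integral>\<^sup>+X. g X \<partial>S) = emeasure S {z\<in>space S. ghost_error m K z}"
    unfolding g_def by (rule emeasure_pred[symmetric]) measurable
  also have "2 * \<dots> \<le> 2 * ennreal (real ((2 * m + 2) ^ d) / 2 ^ K)"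
    by (intro mult_left_mono ghost_error_prob) simp
  also have "\<dots> = ennreal (2 * real ((2 * m + 2) ^ d) / 2 ^ K)"
    using ennreal_mult'[of 2 "real ((2 * m + 2) ^ d) / 2 ^ K"] by simp
  also have "\<dots> \<le> ennreal (2 * real ((2 * m + 2) ^ d) * exp (- r * m / 4))"
  proof (rule ennreal_leI)
    have "exp (r * m / 4) \<le> 2 ^ K"
    proof -
      \<comment> \<open>As K is at least r m / 2 and 2 at least exp (1/2), the denominator 2 ^ K is
        at least exp (r m / 4).\<close>
      have "exp (1 / 2 :: real) \<le> 2"
        using exp_bound_half[of "1/2 :: real"] by simp
      then have "exp (1 / 2) ^ K \<le> (2::real) ^ K" by (intro power_mono) auto
      moreover have "exp (r * m / 4) \<le> exp (1 / 2) ^ K"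
      proof -
        have "r * m / 2 \<le> K" unfolding K_def by linarith
        then show ?thesis by (simp flip: exp_of_nat_mult)
      qed
      ultimately show ?thesis by simp
    qed
    then have "1 / 2 ^ K \<le> 1 / exp (r * m / 4)" by (intro divide_left_mono) auto
    also have "1 / exp (r * m / 4) = exp (- r * m / 4)" by (simp add: exp_minus field_simps)
    finally have "(2 * real ((2 * m + 2) ^ d)) * (1 / 2 ^ K) \<le> (2 * real ((2 * m + 2) ^ d)) * exp (- r * m / 4)"
      by (intro mult_left_mono) auto
    then show "2 * real ((2 * m + 2) ^ d) / 2 ^ K \<le> 2 * real ((2 * m + 2) ^ d) * exp (- r * m / 4)" by simp
  qed
  finally have 1: "emeasure S N \<le> ennreal (2 * real ((2 * m + 2) ^ d) * exp (- r * m / 4))" .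
  have 2: "Vs X m \<subseteq> concept_ball P C f r" if X: "X \<in> space S" "X \<notin> N" for X
  proof
    fix h assume h: "h \<in> Vs X m"
    show "h \<in> concept_ball P C f r"
    proof (rule ccontr)
      assume "h \<notin> concept_ball P C f r"
      then have "r < err P f h" using h by (auto simp: concept_ball_def Vs_def)
      then have "1 / 2 \<le> p X" unfolding p_def K_def using X h rm by (intro ghost_detects)
      then show False using X p_eq by (auto simp: N_def)
    qed
  qed
  show ?thesis using that[OF Nm 1 2] .
qed

end

section \<open>The probability space of the algorithm\<close>

lemma emeasure_pair_le_fst:
  assumes A: "prob_space A" and B: "prob_space B" and Q[measurable]: "Measurable.pred (A \<Otimes>\<^sub>M B) Q"
    and le: "\<And>a. a \<in> space A \<Longrightarrow> emeasure B {b\<in>space B. Q (a, b)} \<le> \<delta>"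
  shows "emeasure (A \<Otimes>\<^sub>M B) {p\<in>space (A \<Otimes>\<^sub>M B). Q p} \<le> \<delta>"
proof -
  interpret A: prob_space A by fact
  interpret B: prob_space B by fact
  have "emeasure (A \<Otimes>\<^sub>M B) {p\<in>space (A \<Otimes>\<^sub>M B). Q p} = (\<integral>\<^sup>+a. emeasure B (Pair a -` {p\<in>space (A \<Otimes>\<^sub>M B). Q p}) \<partial>A)"
    by (rule B.emeasure_pair_measure_alt) measurable
  also have "\<dots> \<le> (\<integral>\<^sup>+a. \<delta> \<partial>A)"
  proof (rule nn_integral_mono)
    fix a assume a: "a \<in> space A"
    have "Pair a -` {p\<in>space (A \<Otimes>\<^sub>M B). Q p} = {b\<in>space B. Q (a, b)}" using a by (auto simp: space_pair_measure)
    then show "emeasure B (Pair a -` {p\<in>space (A \<Otimes>\<^sub>M B). Q p}) \<le> \<delta>" using le[OF a] by simp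
  qed
  finally show ?thesis using A.emeasure_space_1 by simp
qed

lemma emeasure_pair_le_snd:
  assumes A: "prob_space A" and B: "prob_space B" and Q[measurable]: "Measurable.pred (A \<Otimes>\<^sub>M B) Q"
    and le: "\<And>b. b \<in> space B \<Longrightarrow> emeasure A {a\<in>space A. Q (a, b)} \<le> \<delta>"
  shows "emeasure (A \<Otimes>\<^sub>M B) {p\<in>space (A \<Otimes>\<^sub>M B). Q p} \<le> \<delta>"
proof -
  interpret A: prob_space A by fact
  interpret B: prob_space B by fact
  interpret AB: pair_sigma_finite A B ..
  have "emeasure (A \<Otimes>\<^sub>M B) {p\<in>space (A \<Otimes>\<^sub>M B). Q p} = (\<integral>\<^sup>+b. emeasure A ((\<lambda>a. (a, b)) -` {p\<in>space (A \<Otimes>\<^sub>M B). Q p}) \<partial>B)"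
    by (rule AB.emeasure_pair_measure_alt2) measurable
  also have "\<dots> \<le> (\<integral>\<^sup>+b. \<delta> \<partial>B)"
  proof (rule nn_integral_mono)
    fix b assume b: "b \<in> space B"
    have "(\<lambda>a. (a, b)) -` {p\<in>space (A \<Otimes>\<^sub>M B). Q p} = {a\<in>space A. Q (a, b)}" using b by (auto simp: space_pair_measure)
    then show "emeasure A ((\<lambda>a. (a, b)) -` {p\<in>space (A \<Otimes>\<^sub>M B). Q p}) \<le> \<delta>" using le[OF b] by simp
  qed
  finally show ?thesis using B.emeasure_space_1 by simp
qed

context target
begin

text \<open>A stopping time looks at \<open>X\<close> only up to its own value; after it the sequence starts afresh.\<close>

lemma nn_integral_restart:
  fixes \<tau> :: "(nat \<Rightarrow> 'a) \<times> 'c \<Rightarrow> nat"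
  assumes R: "prob_space R"
    and \<tau>[measurable]: "\<tau> \<in> measurable (S \<Otimes>\<^sub>M R) (count_space UNIV)"
    and causal: "\<And>X X' y. (\<And>i. i \<le> \<tau> (X, y) \<Longrightarrow> X i = X' i) \<Longrightarrow> \<tau> (X', y) = \<tau> (X, y)"
    and g[measurable]: "g \<in> borel_measurable (S \<Otimes>\<^sub>M R)"
    and le: "\<And>X y. X \<in> space S \<Longrightarrow> y \<in> space R \<Longrightarrow> (\<integral>\<^sup>+X'. g (comb_seq (Suc (\<tau> (X, y))) X X', y) \<partial>S) \<le> \<delta>"
  shows "(\<integral>\<^sup>+p. g p \<partial>(S \<Otimes>\<^sub>M R)) \<le> \<delta>"
proof -
  interpret R: prob_space R by fact
  interpret SR: pair_sigma_finite S R ..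
  \<comment> \<open>The integrand is split by the value of \<open>\<tau>\<close>; on each piece the
    sequence is cut at a constant index.\<close>
  define h where "h = (\<lambda>m p. g p * indicator {p. \<tau> p = m} p)"
  have [measurable]: "(\<lambda>p. indicator {p. \<tau> p = m} p :: ennreal) \<in> borel_measurable (S \<Otimes>\<^sub>M R)" for m
    by (rule borel_measurable_indicator') measurable
  have hm[measurable]: "h m \<in> borel_measurable (S \<Otimes>\<^sub>M R)" for m
    unfolding h_def by measurable
  \<comment> \<open>The glued sequence agrees with \<open>X\<close> up to index m, so causality,
    applied in both directions, shows that the tail cannot change whether \<open>\<tau>\<close>
    equals m.\<close>
  have cs: "\<tau> (comb_seq (Suc m) X X', y) = m \<longleftrightarrow> \<tau> (X, y) = m" for m X X' y
    using causal[of "comb_seq (Suc m) X X'" y X] causal[of X y "comb_seq (Suc m) X X'"]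
    by (auto simp: comb_seq_def)
  have bound: "(\<integral>\<^sup>+p. h m p \<partial>(S \<Otimes>\<^sub>M R)) \<le> (\<integral>\<^sup>+p. \<delta> * indicator {p. \<tau> p = m} p \<partial>(S \<Otimes>\<^sub>M R))" for m
  proof -
    have "(\<integral>\<^sup>+p. h m p \<partial>(S \<Otimes>\<^sub>M R)) = (\<integral>\<^sup>+y. (\<integral>\<^sup>+X. h m (X, y) \<partial>S) \<partial>R)"
      by (rule SR.nn_integral_snd[symmetric]) measurable
    also have "\<dots> = (\<integral>\<^sup>+y. (\<integral>\<^sup>+X. (\<integral>\<^sup>+X'. h m (comb_seq (Suc m) X X', y) \<partial>S) \<partial>S) \<partial>R)"
      by (intro nn_integral_cong nn_integral_comb_seq) measurable
    also have "\<dots> \<le> (\<integral>\<^sup>+y. (\<integral>\<^sup>+X. \<delta> * indicator {p. \<tau> p = m} (X, y) \<partial>S) \<partial>R)"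
    proof (intro nn_integral_mono)
      fix y X assume y: "y \<in> space R" and X: "X \<in> space S"
      show "(\<integral>\<^sup>+X'. h m (comb_seq (Suc m) X X', y) \<partial>S) \<le> \<delta> * indicator {p. \<tau> p = m} (X, y)"
        using le[OF X y] by (cases "\<tau> (X, y) = m") (auto simp: h_def cs indicator_def)
    qed
    also have "\<dots> = (\<integral>\<^sup>+p. \<delta> * indicator {p. \<tau> p = m} p \<partial>(S \<Otimes>\<^sub>M R))"
      by (rule SR.nn_integral_snd) measurable
    finally show ?thesis .
  qed
  have sum_ind: "(\<Sum>m. c * indicator {p. \<tau> p = m} p) = c" for c :: ennreal and p
  proof -
    have "(\<Sum>m. c * indicator {p. \<tau> p = m} p) = (\<Sum>m\<in>{\<tau> p}. c * indicator {p. \<tau> p = m} p)"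
      by (rule suminf_finite) (auto simp: indicator_def)
    then show ?thesis by simp
  qed
  have "(\<integral>\<^sup>+p. g p \<partial>(S \<Otimes>\<^sub>M R)) = (\<integral>\<^sup>+p. (\<Sum>m. h m p) \<partial>(S \<Otimes>\<^sub>M R))"
    by (simp only: h_def sum_ind)
  also have "\<dots> = (\<Sum>m. (\<integral>\<^sup>+p. h m p \<partial>(S \<Otimes>\<^sub>M R)))" by (rule nn_integral_suminf) measurable
  also have "\<dots> \<le> (\<Sum>m. (\<integral>\<^sup>+p. \<delta> * indicator {p. \<tau> p = m} p \<partial>(S \<Otimes>\<^sub>M R)))"
    by (intro suminf_le bound) auto
  also have "\<dots> = (\<integral>\<^sup>+p. (\<Sum>m. \<delta> * indicator {p. \<tau> p = m} p) \<partial>(S \<Otimes>\<^sub>M R))"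
    by (rule nn_integral_suminf[symmetric]) measurable
  also have "\<dots> = (\<integral>\<^sup>+p. \<delta> \<partial>(S \<Otimes>\<^sub>M R))" by (simp only: sum_ind)
  also have "\<dots> = \<delta>" using prob_space.emeasure_space_1[OF prob_space_pair[OF prob_space_S R]] by simp
  finally show ?thesis .
qed

abbreviation "\<Omega> \<equiv> source_measure P"

lemma prob_space_seeds: "prob_space (Pi\<^sub>M (UNIV :: nat set) (\<lambda>_. seed_measure))"
  by (intro prob_space_PiM) (auto simp: seed_measure_def intro!: prob_space_uniform_measure)

lemma prob_space_\<Omega>: "prob_space \<Omega>"
  unfolding source_measure_def by (intro prob_space_pair prob_space_S prob_space_seeds)

lemma measurable_source:
  "fst \<in> measurable \<Omega> S" "(\<lambda>\<omega>. fst (snd \<omega>)) \<in> measurable \<Omega> S" "(\<lambda>\<omega>. fst (snd (snd \<omega>))) \<in> measurable \<Omega> S"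
  "(\<lambda>\<omega>. fst \<omega> i) \<in> measurable \<Omega> M" "(\<lambda>\<omega>. fst (snd \<omega>) i) \<in> measurable \<Omega> M" "(\<lambda>\<omega>. fst (snd (snd \<omega>)) i) \<in> measurable \<Omega> M"
  unfolding source_measure_def by measurable

lemma space_\<Omega>:
  "(X, W1, W2, U) \<in> space \<Omega> \<longleftrightarrow> X \<in> space S \<and> W1 \<in> space S \<and> W2 \<in> space S \<and> U \<in> space (Pi\<^sub>M (UNIV :: nat set) (\<lambda>_. seed_measure))"
  by (simp add: source_measure_def space_pair_measure)

text \<open>By Tonelli's theorem it suffices to bound every section in which all other components
  are held fixed. The three versions leave \<open>X\<close>, \<open>W1\<close> and \<open>W2\<close>
  random, respectively.\<close>

lemma section_X:
  assumes "Measurable.pred \<Omega> Q"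
    and "\<And>W1 W2 U. W1 \<in> space S \<Longrightarrow> W2 \<in> space S \<Longrightarrow> emeasure S {X\<in>space S. Q (X, W1, W2, U)} \<le> \<delta>"
  shows "emeasure \<Omega> {\<omega>\<in>space \<Omega>. Q \<omega>} \<le> \<delta>"
  using assms unfolding source_measure_def
  by (intro emeasure_pair_le_snd prob_space_pair prob_space_S prob_space_seeds) (auto simp: space_pair_measure)

lemma section_W1:
  assumes "Measurable.pred \<Omega> Q"
    and "\<And>X W2 U. X \<in> space S \<Longrightarrow> W2 \<in> space S \<Longrightarrow> emeasure S {W1\<in>space S. Q (X, W1, W2, U)} \<le> \<delta>"
  shows "emeasure \<Omega> {\<omega>\<in>space \<Omega>. Q \<omega>} \<le> \<delta>"
  unfolding source_measure_def
proof (rule emeasure_pair_le_fst)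
  fix X assume X: "X \<in> space S"
  show "emeasure (S \<Otimes>\<^sub>M S \<Otimes>\<^sub>M Pi\<^sub>M UNIV (\<lambda>_. seed_measure)) {b \<in> space (S \<Otimes>\<^sub>M S \<Otimes>\<^sub>M Pi\<^sub>M UNIV (\<lambda>_. seed_measure)). Q (X, b)} \<le> \<delta>"
  proof (rule emeasure_pair_le_snd)
    show "Measurable.pred (S \<Otimes>\<^sub>M S \<Otimes>\<^sub>M Pi\<^sub>M UNIV (\<lambda>_. seed_measure)) (\<lambda>b. Q (X, b))"
      using measurable_compose[OF measurable_Pair1' assms(1)[unfolded source_measure_def]] X by simp
    fix b assume b: "b \<in> space (S \<Otimes>\<^sub>M Pi\<^sub>M (UNIV :: nat set) (\<lambda>_. seed_measure))"
    obtain W2 U where "b = (W2, U)" by (cases b)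
    then show "emeasure S {a \<in> space S. Q (X, a, b)} \<le> \<delta>"
      using assms(2)[OF X, of W2 U] b by (simp add: space_pair_measure)
  qed (intro prob_space_pair prob_space_S prob_space_seeds)+
qed (use assms in \<open>auto simp: source_measure_def intro!: prob_space_pair prob_space_S prob_space_seeds\<close>)

lemma section_W2:
  assumes "Measurable.pred \<Omega> Q"
    and "\<And>X W1 U. X \<in> space S \<Longrightarrow> W1 \<in> space S \<Longrightarrow> emeasure S {W2\<in>space S. Q (X, W1, W2, U)} \<le> \<delta>"
  shows "emeasure \<Omega> {\<omega>\<in>space \<Omega>. Q \<omega>} \<le> \<delta>"
  unfolding source_measure_def
proof (rule emeasure_pair_le_fst)
  fix X assume X: "X \<in> space S"
  have mX: "Measurable.pred (S \<Otimes>\<^sub>M S \<Otimes>\<^sub>M Pi\<^sub>M UNIV (\<lambda>_. seed_measure)) (\<lambda>b. Q (X, b))"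
    using measurable_compose[OF measurable_Pair1' assms(1)[unfolded source_measure_def]] X by simp
  show "emeasure (S \<Otimes>\<^sub>M S \<Otimes>\<^sub>M Pi\<^sub>M UNIV (\<lambda>_. seed_measure)) {b \<in> space (S \<Otimes>\<^sub>M S \<Otimes>\<^sub>M Pi\<^sub>M UNIV (\<lambda>_. seed_measure)). Q (X, b)} \<le> \<delta>"
  proof (rule emeasure_pair_le_fst)
    show "Measurable.pred (S \<Otimes>\<^sub>M S \<Otimes>\<^sub>M Pi\<^sub>M UNIV (\<lambda>_. seed_measure)) (\<lambda>b. Q (X, b))" by (rule mX)
    fix W1 assume W1: "W1 \<in> space S"
    show "emeasure (S \<Otimes>\<^sub>M Pi\<^sub>M UNIV (\<lambda>_. seed_measure)) {b \<in> space (S \<Otimes>\<^sub>M Pi\<^sub>M UNIV (\<lambda>_. seed_measure)). Q (X, W1, b)} \<le> \<delta>"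
    proof (rule emeasure_pair_le_snd)
      show "Measurable.pred (S \<Otimes>\<^sub>M Pi\<^sub>M UNIV (\<lambda>_. seed_measure)) (\<lambda>b. Q (X, W1, b))"
        using measurable_compose[OF measurable_Pair1' mX] W1 by simp
    qed (use assms(2)[OF X W1] in \<open>auto intro!: prob_space_S prob_space_seeds\<close>)
  qed (intro prob_space_pair prob_space_S prob_space_seeds)+
qed (use assms in \<open>auto simp: source_measure_def intro!: prob_space_pair prob_space_S prob_space_seeds\<close>)

end

section \<open>Shatter cores\<close>

context target
begin

abbreviation ball :: "real \<Rightarrow> ('a \<Rightarrow> bool) set" where
  "ball r \<equiv> concept_ball P C f r"

definition core :: "nat \<Rightarrow> (nat \<Rightarrow> 'a) \<Rightarrow> bool" where
  "core j T \<longleftrightarrow> (\<forall>r>0. shatters (ball r) j T)"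

definition core_mass :: "nat \<Rightarrow> real" where
  "core_mass j = measure (power_measure j P) (shatter_core P C f j)"

definition shatter_mass :: "nat \<Rightarrow> real \<Rightarrow> real" where
  "shatter_mass j r = measure (power_measure j P) (shattered_tuples P (ball r) j)"

text \<open>\<open>k\<close> is the number of the round; the shattered tuple has length \<open>k\<close>, with \<open>x\<close> in last position.\<close>

definition link_mass :: "nat \<Rightarrow> ('a \<Rightarrow> bool) set \<Rightarrow> 'a \<Rightarrow> real" where
  "link_mass k H x = measure (power_measure (k - 1) P)
     {T \<in> space (power_measure (k - 1) P). shatters H k (T(k - 1 := x))}"

lemma ball_mono: "r \<le> r' \<Longrightarrow> ball r \<subseteq> ball r'"
  by (auto simp: concept_ball_def)

lemma f_in_ball: "r \<ge> 0 \<Longrightarrow> f \<in> ball r"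
  using fC by (simp add: concept_ball_def err_def)

lemma ball_subset: "ball r \<subseteq> C"
  by (auto simp: concept_ball_def)

lemma prob_space_power: "prob_space (power_measure j P)"
  unfolding power_measure_def by (rule prob_space_PiM) unfold_locales

lemma space_power: "T \<in> space (power_measure j P) \<Longrightarrow> i < j \<Longrightarrow> T i \<in> space M"
  by (auto simp: power_measure_def space_PiM)

lemma measurable_power_coord: "i < j \<Longrightarrow> (\<lambda>T. T i) \<in> measurable (power_measure j P) M"
proof -
  assume "i < j"
  then have "(\<lambda>T. T i) \<in> measurable (Pi\<^sub>M {..<j} (\<lambda>_. P)) P" by (intro measurable_component_singleton) simp
  then show ?thesis by (simp only: power_measure_def measurable_P)
qed

lemma pred_shatters_ball0:
  assumes "\<And>j. j < k \<Longrightarrow> s j \<in> measurable N M"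
  shows "Measurable.pred N (\<lambda>\<omega>. shatters (ball r) k (\<lambda>j. s j \<omega>))"
proof -
  have "Measurable.pred N (\<lambda>\<omega>. shatters {h\<in>ball r. \<forall>i\<in>{} :: nat set. h undefined = True} k (\<lambda>j. s j \<omega>))"
  proof (rule pred_shatters_ball[OF PD fC, where z = "\<lambda>_ _. undefined" and y = "\<lambda>_ _. True" and s = s])
    show "s j \<in> measurable N M" if "j < k" for j using assms[OF that] .
  qed (erule emptyE | rule finite.emptyI)+
  then show ?thesis by simp
qed

lemma sets_shattered_ball[measurable]: "shattered_tuples P (ball r) j \<in> sets (power_measure j P)"
proof -
  have "Measurable.pred (power_measure j P) (\<lambda>T. shatters (ball r) j (\<lambda>i. T i))"
    by (rule pred_shatters_ball0) (rule measurable_power_coord)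
  then show ?thesis by (simp only: shattered_tuples_def pred_def)
qed

text \<open>Balls grow with the radius, so the radii 1 / (n + 1) suffice. The countable form yields
  measurability and continuity from above.\<close>

lemma core_iff: "core j T \<longleftrightarrow> (\<forall>n::nat. shatters (ball (1 / Suc n)) j T)"
proof
  assume *: "\<forall>n::nat. shatters (ball (1 / Suc n)) j T"
  show "core j T" unfolding core_def
  proof (intro allI impI)
    fix r :: real assume "r > 0"
    then obtain n where "1 / Suc n < r" using nat_approx_posE by blast
    then show "shatters (ball r) j T" using * ball_mono[of "1 / Suc n" r] shatters_mono by (meson less_imp_le)
  qed
qed (simp add: core_def)

lemma shatter_core_eq: "shatter_core P C f j = {T\<in>space (power_measure j P). core j T}"
proof -
  have "T \<in> space (power_measure j P)" if "T \<in> shatter_core P C f j" for T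
    using that unfolding shatter_core_def shattered_tuples_def by (auto dest: bspec[of _ _ 1])
  then show ?thesis unfolding shatter_core_def shattered_tuples_def core_def by auto
qed

lemma shatter_core_INT: "shatter_core P C f j = (\<Inter>n::nat. shattered_tuples P (ball (1 / Suc n)) j)"
  unfolding shatter_core_eq core_iff shattered_tuples_def by auto

lemma sets_shatter_core[measurable]: "shatter_core P C f j \<in> sets (power_measure j P)"
  unfolding shatter_core_INT by measurable

lemma shatter_mass_tendsto: "(\<lambda>n. shatter_mass j (1 / Suc n)) \<longlonglongrightarrow> core_mass j"
proof -
  interpret prob_space "power_measure j P" by (rule prob_space_power)
  have "decseq (\<lambda>n. shattered_tuples P (ball (1 / Suc n)) j)"
  proof (rule decseq_SucI)
    fix n
    have "ball (1 / Suc (Suc n)) \<subseteq> ball (1 / Suc n)" by (rule ball_mono) (simp add: frac_le)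
    then show "shattered_tuples P (ball (1 / Suc (Suc n))) j \<subseteq> shattered_tuples P (ball (1 / Suc n)) j"
      by (auto simp: shattered_tuples_def intro: shatters_mono)
  qed
  then show ?thesis unfolding shatter_mass_def core_mass_def shatter_core_INT
    by (intro finite_Lim_measure_decseq) auto
qed

text \<open>Continuity from above. The slack of one hundredth leaves another hundredth for sampling
  error, which makes up the 102/100 in \<open>accurate\<close>.\<close>

lemma core_mass_approx:
  assumes "core_mass j > 0"
  obtains r where "r > 0" "shatter_mass j r \<le> 101/100 * core_mass j"
proof -
  have "eventually (\<lambda>n. shatter_mass j (1 / Suc n) < 101/100 * core_mass j) sequentially"
    by (rule order_tendstoD(2)[OF shatter_mass_tendsto]) (use assms in simp)
  then obtain n where "shatter_mass j (1 / Suc n) < 101/100 * core_mass j" by (auto simp: eventually_sequentially)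
  then show ?thesis by (intro that[of "1 / Suc n"]) auto
qed

lemma core_mass_0: "core_mass 0 = 1"
proof -
  interpret prob_space "power_measure 0 P" by (rule prob_space_power)
  have "core 0 T" for T unfolding core_def shatters_0 using f_in_ball by (metis empty_iff less_imp_le)
  then have "shatter_core P C f 0 = space (power_measure 0 P)" by (simp add: shatter_core_eq)
  then show ?thesis using prob_space by (simp add: core_mass_def)
qed

lemma core_mass_nonneg: "core_mass j \<ge> 0"
  by (simp add: core_mass_def)

lemma core_mass_beyond_d: "core_mass (Suc d) = 0"
proof -
  have "\<not> core (Suc d) T" if "T \<in> space (power_measure (Suc d) P)" for T
  proof
    assume "core (Suc d) T"
    then have "shatters (ball 1) (Suc d) T" by (auto simp: core_def)
    then have "shatters C (Suc d) T" using shatters_mono[OF ball_subset] by blast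
    then have "Suc d \<le> d" unfolding d_def using space_power[OF that] by (intro vc_dim_le[OF vc]) (auto simp: d_def)
    then show False by simp
  qed
  then have "shatter_core P C f (Suc d) = {}" by (auto simp: shatter_core_eq)
  then show ?thesis by (simp add: core_mass_def)
qed

definition dt :: nat where "dt = d_tilde P C f"

lemma dt_eq: "dt = (LEAST k. core_mass k = 0)"
  by (simp add: dt_def d_tilde_def core_mass_def)

lemma core_mass_dt: "core_mass dt = 0"
  unfolding dt_eq using core_mass_beyond_d by (rule LeastI)

lemma dt_le: "dt \<le> Suc d"
  unfolding dt_eq using core_mass_beyond_d by (rule Least_le)

lemma dt_pos: "1 \<le> dt"
  using core_mass_dt core_mass_0 by (cases dt) auto

lemma core_mass_pos: "j < dt \<Longrightarrow> core_mass j > 0"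
  using not_less_Least[of j "\<lambda>k. core_mass k = 0"] core_mass_nonneg[of j] by (auto simp: dt_eq)

lemma measurable_upd:
  assumes "x \<in> measurable N M" "\<And>i. i < k - 1 \<Longrightarrow> T i \<in> measurable N M" "i < (k :: nat)"
  shows "(\<lambda>\<omega>. ((\<lambda>i. T i \<omega>)(k - 1 := x \<omega>)) i) \<in> measurable N M"
proof (cases "i = k - 1")
  case True
  then have "(\<lambda>\<omega>. ((\<lambda>i. T i \<omega>)(k - 1 := x \<omega>)) i) = x" by (simp only: fun_eq_iff fun_upd_same) blast
  then show ?thesis using assms(1) by (simp only:)
next
  case False
  then have "(\<lambda>\<omega>. ((\<lambda>i. T i \<omega>)(k - 1 := x \<omega>)) i) = T i" by (simp only: fun_upd_def if_False)
  moreover have "i < k - 1" using assms(3) False by linarith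
  ultimately show ?thesis using assms(2) by (simp only:)
qed

lemma pred_link:
  assumes "\<And>i. i \<in> {1..p} \<Longrightarrow> X i \<in> measurable N M" "x \<in> measurable N M" "\<And>i. i < k - 1 \<Longrightarrow> T i \<in> measurable N M"
  shows "Measurable.pred N (\<lambda>\<omega>. shatters (Vs (\<lambda>i. X i \<omega>) p) k ((\<lambda>i. T i \<omega>)(k - 1 := x \<omega>)))"
proof -
  have "Measurable.pred N (\<lambda>\<omega>. shatters {h\<in>C. \<forall>i\<in>{1..p}. h (X i \<omega>) = f (X i \<omega>)} k ((\<lambda>i. T i \<omega>)(k - 1 := x \<omega>)))"
  proof (rule pred_shatters)
    show "(\<lambda>\<omega>. f (X i \<omega>)) \<in> measurable N (count_space UNIV)" if "i \<in> {1..p}" for i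
      using assms(1)[OF that] by measurable
    show "(\<lambda>\<omega>. ((\<lambda>i. T i \<omega>)(k - 1 := x \<omega>)) i) \<in> measurable N M" if "i < k" for i
      using assms(2,3) that by (rule measurable_upd)
  qed (rule finite_atLeastAtMost, erule assms(1))
  then show ?thesis by (simp add: Vs_def)
qed

lemma measurable_link_mass:
  assumes [measurable]: "\<And>i. i \<in> {1..p} \<Longrightarrow> X i \<in> measurable N M" "x \<in> measurable N M"
  shows "(\<lambda>\<omega>. link_mass k (Vs (\<lambda>i. X i \<omega>) p) (x \<omega>)) \<in> borel_measurable N"
proof -
  interpret pw: prob_space "power_measure (k - 1) P" by (rule prob_space_power)
  have "Measurable.pred (N \<Otimes>\<^sub>M power_measure (k - 1) P)
     (\<lambda>q. shatters (Vs (\<lambda>i. X i (fst q)) p) k ((\<lambda>i. snd q i)(k - 1 := x (fst q))))"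
  proof (rule pred_link)
    show "(\<lambda>q. X i (fst q)) \<in> measurable (N \<Otimes>\<^sub>M power_measure (k - 1) P) M" if "i \<in> {1..p}" for i
      using assms(1)[OF that] by (rule measurable_compose[OF measurable_fst])
    show "(\<lambda>q. x (fst q)) \<in> measurable (N \<Otimes>\<^sub>M power_measure (k - 1) P) M"
      using assms(2) by (rule measurable_compose[OF measurable_fst])
    show "(\<lambda>q. snd q i) \<in> measurable (N \<Otimes>\<^sub>M power_measure (k - 1) P) M" if "i < k - 1" for i
      using measurable_power_coord[OF that] by (rule measurable_compose[OF measurable_snd])
  qed
  then have "{q \<in> space (N \<Otimes>\<^sub>M power_measure (k - 1) P). snd q \<in> {T \<in> space (power_measure (k - 1) P).
      shatters (Vs (\<lambda>i. X i (fst q)) p) k (T(k - 1 := x (fst q)))}} \<in> sets (N \<Otimes>\<^sub>M power_measure (k - 1) P)"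
    by (auto simp: pred_def space_pair_measure elim!: back_subst[of "\<lambda>A. A \<in> sets _"])
  then show ?thesis unfolding link_mass_def
    by (intro pw.measurable_measure) auto
qed

lemma sets_link:
  assumes "x \<in> space M" "\<And>i. X i \<in> space M"
  shows "{T \<in> space (power_measure (k - 1) P). shatters (Vs X p) k (T(k - 1 := x))} \<in> sets (power_measure (k - 1) P)"
proof -
  have "Measurable.pred (power_measure (k - 1) P) (\<lambda>T. shatters (Vs (\<lambda>i. X i) p) k ((\<lambda>i. T i)(k - 1 := x)))"
    by (rule pred_link[where X = "\<lambda>i _. X i" and x = "\<lambda>_. x" and T = "\<lambda>i T. T i"]) (use assms measurable_power_coord in \<open>simp_all only: measurable_const\<close>)
  then show ?thesis by (simp add: pred_def)
qed

lemma sets_link_ball: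
  assumes "x \<in> space M"
  shows "{T \<in> space (power_measure (k - 1) P). shatters (ball r) k (T(k - 1 := x))} \<in> sets (power_measure (k - 1) P)"
proof -
  have "Measurable.pred (power_measure (k - 1) P) (\<lambda>T. shatters (ball r) k (T(k - 1 := x)))"
  proof (rule pred_shatters_ball0)
    show "(\<lambda>T. (T(k - 1 := x)) i) \<in> measurable (power_measure (k - 1) P) M" if "i < k" for i
      by (rule measurable_upd[where x = "\<lambda>_. x" and T = "\<lambda>i T. T i", OF _ measurable_power_coord that]) (use assms in simp_all)
  qed
  then show ?thesis by (simp add: pred_def)
qed

lemma link_mass_mono_ball:
  assumes "H \<subseteq> ball r" "x \<in> space M"
  shows "link_mass k H x \<le> link_mass k (ball r) x"
proof -
  interpret pw: prob_space "power_measure (k - 1) P" by (rule prob_space_power)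
  show ?thesis unfolding link_mass_def
    using shatters_mono[OF assms(1)] by (intro pw.finite_measure_mono sets_link_ball assms) blast
qed

lemma link_mass_mono_Vs:
  assumes "p \<le> p'" "x \<in> space M" "\<And>i. X i \<in> space M"
  shows "link_mass k (Vs X p') x \<le> link_mass k (Vs X p) x"
proof -
  interpret pw: prob_space "power_measure (k - 1) P" by (rule prob_space_power)
  show ?thesis unfolding link_mass_def
    using shatters_mono[OF Vs_antimono[OF assms(1)]] by (intro pw.finite_measure_mono sets_link assms) blast
qed

lemma measurable_link_mass_ball[measurable]: "link_mass k (ball r) \<in> borel_measurable M"
proof -
  interpret pw: prob_space "power_measure (k - 1) P" by (rule prob_space_power)
  have "Measurable.pred (M \<Otimes>\<^sub>M power_measure (k - 1) P)
     (\<lambda>q. shatters (ball r) k ((snd q)(k - 1 := fst q)))"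
  proof (rule pred_shatters_ball0)
    show "(\<lambda>q. ((\<lambda>i. snd q i)(k - 1 := fst q)) i) \<in> measurable (M \<Otimes>\<^sub>M power_measure (k - 1) P) M" if "i < k" for i
      by (rule measurable_upd[where T = "\<lambda>i q. snd q i", OF measurable_fst measurable_compose[OF measurable_snd measurable_power_coord] that])
  qed
  then have "{q \<in> space (M \<Otimes>\<^sub>M power_measure (k - 1) P). snd q \<in> {T \<in> space (power_measure (k - 1) P).
      shatters (ball r) k (T(k - 1 := fst q))}} \<in> sets (M \<Otimes>\<^sub>M power_measure (k - 1) P)"
    by (auto simp: pred_def space_pair_measure elim!: back_subst[of "\<lambda>A. A \<in> sets _"])
  then show ?thesis unfolding link_mass_def
    by (intro pw.measurable_measure) auto
qed

text \<open>By Tonelli's theorem the mean of the link mass over x is the probability that a random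
  k-tuple is shattered; Markov's inequality does the rest.\<close>

lemma link_mass_markov:
  assumes a: "a > 0" and k: "k \<ge> 1"
  shows "measure P {x\<in>space P. a \<le> link_mass k (ball r) x} \<le> shatter_mass k r / a"
proof -
  obtain j where j: "k = Suc j" using k by (cases k) auto
  interpret pw: prob_space "power_measure j P" by (rule prob_space_power)
  interpret pk: prob_space "power_measure k P" by (rule prob_space_power)
  define A where "A = shattered_tuples P (ball r) k"
  have A: "A \<in> sets (Pi\<^sub>M (insert j {..<j}) (\<lambda>_. P))"
    using sets_shattered_ball[of r k] by (simp add: A_def j power_measure_def lessThan_Suc)
  have "ennreal (shatter_mass k r) = emeasure (Pi\<^sub>M (insert j {..<j}) (\<lambda>_. P)) A"
    unfolding shatter_mass_def A_def pk.emeasure_eq_measure[symmetric] by (simp add: j power_measure_def lessThan_Suc)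
  also have "\<dots> = (\<integral>\<^sup>+T. indicator A T \<partial>Pi\<^sub>M (insert j {..<j}) (\<lambda>_. P))" using A by simp
  also have "\<dots> = (\<integral>\<^sup>+x. (\<integral>\<^sup>+T. indicator A (T(j := x)) \<partial>Pi\<^sub>M {..<j} (\<lambda>_. P)) \<partial>P)"
    using A by (intro seq.product_nn_integral_insert_rev) auto
  also have "\<dots> = (\<integral>\<^sup>+x. ennreal (link_mass k (ball r) x) \<partial>P)"
  proof (rule nn_integral_cong)
    fix x assume x: "x \<in> space P"
    have "(\<integral>\<^sup>+T. indicator A (T(j := x)) \<partial>Pi\<^sub>M {..<j} (\<lambda>_. P))
       = (\<integral>\<^sup>+T. indicator {T \<in> space (power_measure j P). shatters (ball r) k (T(j := x))} T \<partial>power_measure j P)"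
      unfolding power_measure_def
    proof (rule nn_integral_cong)
      fix T assume T: "T \<in> space (Pi\<^sub>M {..<j} (\<lambda>_. P))"
      then have "T(j := x) \<in> space (power_measure k P)"
        using x by (auto simp: power_measure_def j space_PiM PiE_def extensional_def Pi_def less_Suc_eq)
      then show "indicator A (T(j := x)) = (indicator {T \<in> space (Pi\<^sub>M {..<j} (\<lambda>_. P)). shatters (ball r) k (T(j := x))} T :: ennreal)"
        using T by (simp add: A_def shattered_tuples_def indicator_def)
    qed
    also have "\<dots> = emeasure (power_measure j P) {T \<in> space (power_measure j P). shatters (ball r) k (T(j := x))}"
      using sets_link_ball[of x k r] x by (simp add: j)
    finally show "(\<integral>\<^sup>+T. indicator A (T(j := x)) \<partial>Pi\<^sub>M {..<j} (\<lambda>_. P)) = ennreal (link_mass k (ball r) x)"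
      by (simp add: link_mass_def j pw.emeasure_eq_measure)
  qed
  finally have int: "ennreal (shatter_mass k r) = (\<integral>\<^sup>+x. ennreal (link_mass k (ball r) x) \<partial>P)" .
  have "ennreal (a * measure P {x\<in>space P. a \<le> link_mass k (ball r) x}) =
     (\<integral>\<^sup>+x. ennreal a * indicator {x\<in>space P. a \<le> link_mass k (ball r) x} x \<partial>P)"
    using a by (subst nn_integral_cmult_indicator) (auto simp: P.emeasure_eq_measure ennreal_mult')
  also have "\<dots> \<le> (\<integral>\<^sup>+x. ennreal (link_mass k (ball r) x) \<partial>P)"
    by (intro nn_integral_mono) (auto simp: indicator_def ennreal_leI)
  also have "\<dots> = ennreal (shatter_mass k r)" using int by simp
  finally have "a * measure P {x\<in>space P. a \<le> link_mass k (ball r) x} \<le> shatter_mass k r"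
    by (subst (asm) ennreal_le_iff) (auto simp: shatter_mass_def)
  then show ?thesis using a by (simp add: field_simps)
qed

text \<open>Probabilities are at most 1, so the supremum over radii above e is at most 1 / e. For
  positive e the extended real is therefore finite, and all further estimates are done in the
  reals.\<close>

lemma shatter_mass_le_theta:
  assumes "r > e" "e > 0"
  shows "shatter_mass dt r \<le> real_of_ereal (theta_tilde P C f e) * r"
    and "1 \<le> real_of_ereal (theta_tilde P C f e)"
    and "ereal (real_of_ereal (theta_tilde P C f e)) = theta_tilde P C f e"
proof -
  have sm: "shatter_mass k r \<le> 1" for k r
  proof -
    interpret pk: prob_space "power_measure k P" by (rule prob_space_power)
    show ?thesis unfolding shatter_mass_def by (rule pk.prob_le_1)
  qed
  have th: "theta_tilde P C f e = max 1 (SUP r\<in>{e<..}. ereal (shatter_mass dt r / r))"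
    by (simp add: theta_tilde_def theta_def shatter_mass_def dt_def)
  have "(SUP r\<in>{e<..}. ereal (shatter_mass dt r / r)) \<le> ereal (1 / e)"
  proof (rule SUP_least)
    fix r assume "r \<in> {e<..}"
    then have "shatter_mass dt r / r \<le> 1 / e" using sm[of dt r] assms by (intro frac_le) auto
    then show "ereal (shatter_mass dt r / r) \<le> ereal (1 / e)" by simp
  qed
  then have "theta_tilde P C f e \<le> max 1 (ereal (1 / e))" unfolding th by (rule max.mono[OF order_refl])
  moreover have ge: "1 \<le> theta_tilde P C f e" unfolding th by simp
  ultimately obtain t where t: "theta_tilde P C f e = ereal t"
    by (cases "theta_tilde P C f e") (auto simp: max_def split: if_splits)
  then show "ereal (real_of_ereal (theta_tilde P C f e)) = theta_tilde P C f e" by simp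
  show "1 \<le> real_of_ereal (theta_tilde P C f e)" using ge t by (simp add: one_ereal_def)
  have "ereal (shatter_mass dt r / r) \<le> theta_tilde P C f e"
    unfolding th using assms by (intro max.coboundedI2 SUP_upper) auto
  then have "shatter_mass dt r / r \<le> t" by (simp add: t)
  then show "shatter_mass dt r \<le> real_of_ereal (theta_tilde P C f e) * r"
    using assms by (simp add: t field_simps)
qed

text \<open>Each of the 2 ^ j patterns on the fixed tuple \<open>T\<close> is realized by concepts
  arbitrarily close to f. A concept at distance at most r from f disagrees with f somewhere on m
  random points with probability at most m r, so a union bound gets below any e > 0 for small
  r.\<close>

lemma core_shattered_null:
  assumes T: "core j T"
  shows "emeasure S {X\<in>space S. \<not> shatters (Vs X m) j T} = 0"
proof -
  have "emeasure S {X\<in>space S. \<not> shatters (Vs X m) j T} \<le> ennreal e" if e: "e > 0" for e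
  proof -
    \<comment> \<open>The successor avoids a division by zero for m = 0.\<close>
    define c where "c = real (Suc m)"
    have c: "c > 0" "real m \<le> c" by (simp_all add: c_def)
    define r where "r = e / (2 ^ j * c)"
    have r: "r > 0" unfolding r_def using e c by simp
    then have "shatters (ball r) j T" using T by (simp add: core_def)
    then have "\<forall>w\<in>Pow {..<j}. \<exists>h\<in>ball r. \<forall>i<j. h (T i) = (i \<in> w)" by (simp only: shatters_alt)
    then obtain h where h: "\<And>w. w \<in> Pow {..<j} \<Longrightarrow> h w \<in> ball r" "\<And>w i. w \<in> Pow {..<j} \<Longrightarrow> i < j \<Longrightarrow> h w (T i) = (i \<in> w)"
      by metis
    define D where "D = (\<lambda>w. {x\<in>space P. h w x \<noteq> f x})"
    have hm[measurable]: "w \<in> Pow {..<j} \<Longrightarrow> h w \<in> measurable M (count_space UNIV)" for w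
      using h(1) ball_subset by (intro classifier) auto
    have D[measurable]: "D w \<in> sets M" if "w \<in> Pow {..<j}" for w
      unfolding D_def using hm[OF that] by (simp add: pred_def[symmetric])
    have pD: "emeasure P (D w) \<le> ennreal r" if "w \<in> Pow {..<j}" for w
      using h(1)[OF that] by (auto simp: concept_ball_def err_def D_def P.emeasure_eq_measure intro!: ennreal_leI)
    have hit: "emeasure S {X\<in>space S. X i \<in> D w} \<le> ennreal r" if w: "w \<in> Pow {..<j}" for w i
    proof -
      have "emeasure S {X\<in>space S. X i \<in> D w} = emeasure (distr S P (\<lambda>\<omega>. \<omega> i)) (D w)"
        using D[OF w] by (subst emeasure_distr) (auto intro!: arg_cong[where f = "emeasure S"])
      then show ?thesis using pD[OF w] by (simp add: distr_coord)
    qed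
    have "{X\<in>space S. \<not> shatters (Vs X m) j T} \<subseteq> (\<Union>w\<in>Pow {..<j}. \<Union>i\<in>{1..m}. {X\<in>space S. X i \<in> D w})"
    proof safe
      fix X assume X: "X \<in> space S" "\<not> shatters (Vs X m) j T"
      then obtain w where w: "w \<in> Pow {..<j}" "\<not> (\<exists>g\<in>Vs X m. \<forall>i<j. g (T i) = (i \<in> w))"
        unfolding shatters_alt by auto
      then have "h w \<notin> Vs X m" using h(2)[OF w(1)] by blast
      then obtain i where "i \<in> {1..m}" "h w (X i) \<noteq> f (X i)"
        using subsetD[OF ball_subset h(1)[OF w(1)]] unfolding Vs_def by blast
      then show "X \<in> (\<Union>w\<in>Pow {..<j}. \<Union>i\<in>{1..m}. {X\<in>space S. X i \<in> D w})"
        using w(1) X(1) space_S[OF X(1)] by (intro UN_I[of w] UN_I[of i]) (auto simp: D_def)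
    qed
    then have "emeasure S {X\<in>space S. \<not> shatters (Vs X m) j T} \<le> emeasure S (\<Union>w\<in>Pow {..<j}. \<Union>i\<in>{1..m}. {X\<in>space S. X i \<in> D w})"
      using D by (intro emeasure_mono sets.finite_UN) auto
    also have "\<dots> \<le> (\<Sum>w\<in>Pow {..<j}. emeasure S (\<Union>i\<in>{1..m}. {X\<in>space S. X i \<in> D w}))"
      using D by (intro emeasure_subadditive_finite) auto
    also have "\<dots> \<le> (\<Sum>w\<in>Pow {..<j}. \<Sum>i\<in>{1..m}. emeasure S {X\<in>space S. X i \<in> D w})"
      using D by (intro sum_mono emeasure_subadditive_finite) auto
    also have "\<dots> \<le> (\<Sum>w\<in>Pow {..<j}. \<Sum>i\<in>{1..m}. ennreal r)"
      by (intro sum_mono hit) auto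
    also have "\<dots> = ennreal (2 ^ j * (m * r))"
      using r by (simp add: card_Pow ennreal_mult' ennreal_of_nat_eq_real_of_nat ennreal_power[symmetric])
    also have "\<dots> \<le> ennreal e"
    proof (rule ennreal_leI)
      have "2 ^ j * (m * r) = (m / c) * e" using c by (simp add: r_def)
      also have "\<dots> \<le> 1 * e" using c e by (intro mult_right_mono) auto
      also have "\<dots> = e" by simp
      finally show "2 ^ j * (m * r) \<le> e" .
    qed
    finally show ?thesis .
  qed
  note small = this
  have "emeasure S {X\<in>space S. \<not> shatters (Vs X m) j T} \<le> 0"
  proof (rule ennreal_le_epsilon)
    fix e :: real assume "0 < e"
    from small[OF this] show "emeasure S {X\<in>space S. \<not> shatters (Vs X m) j T} \<le> 0 + ennreal e"
      by (simp only: add_0)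
  qed
  then show ?thesis by simp
qed

end

section \<open>Correctness of a round\<close>

lemma arg_max_bool:
  fixes g :: "bool \<Rightarrow> real"
  assumes "g (\<not> b) < g b"
  shows "arg_max g (\<lambda>_. True) = b"
proof -
  have *: "is_arg_max g (\<lambda>_. True) x \<longleftrightarrow> x = b" for x
  proof
    assume "is_arg_max g (\<lambda>_. True) x"
    then show "x = b" using assms by (cases "x = b") (auto simp: is_arg_max_def)
  next
    assume "x = b"
    moreover have "\<not> g b < g y" for y using assms by (cases y; cases b) auto
    ultimately show "is_arg_max g (\<lambda>_. True) x" by (auto simp: is_arg_max_def)
  qed
  then have "is_arg_max g (\<lambda>_. True) = (\<lambda>x. x = b)" by (intro ext)
  then show ?thesis by (simp add: arg_max_def)
qed

text \<open>Replaces the loop by a fixed number of guarded steps, so that correctness, measurability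
  and causality become inductions on that number.\<close>

lemma while_funpow:
  assumes "\<not> b (((\<lambda>s. if b s then c s else s) ^^ N) s)"
  shows "while b c s = ((\<lambda>s. if b s then c s else s) ^^ N) s"
  using assms
proof (induction N arbitrary: s)
  case 0
  then show ?case by (subst while_unfold) simp
next
  case (Suc N)
  let ?g = "\<lambda>s. if b s then c s else s"
  have eq: "(?g ^^ Suc N) s = (?g ^^ N) (?g s)" by (simp only: funpow_Suc_right o_apply)
  show ?case
  proof (cases "b s")
    case True
    then have "while b c s = while b c (c s)" by (subst while_unfold) simp
    also have "\<dots> = (?g ^^ N) (c s)" by (rule Suc.IH) (use Suc.prems True eq in simp)
    finally show ?thesis using True eq by simp
  next
    case False
    have "(?g ^^ N) s = s" for N using False by (induction N) auto
    then show ?thesis using False eq by (subst while_unfold) simp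
  qed
qed

lemma shatters_extend:
  assumes "k \<ge> 1" "shatters (constrain H x True) (k - 1) T" "shatters (constrain H x False) (k - 1) T"
  shows "shatters H k (T(k - 1 := x))"
  unfolding shatters_def
proof
  fix y :: "nat \<Rightarrow> bool"
  have "shatters (constrain H x (y (k - 1))) (k - 1) T" using assms by (cases "y (k - 1)") auto
  then obtain h where h: "h \<in> constrain H x (y (k - 1))" "\<forall>i<k - 1. h (T i) = y i" unfolding shatters_def by metis
  have "h ((T(k - 1 := x)) i) = y i" if "i < k" for i
  proof (cases "i = k - 1")
    case False
    then have "i < k - 1" using that by linarith
    then show ?thesis using h(2) False by simp
  qed (use h(1) in \<open>simp add: constrain_def\<close>)
  then show "\<exists>h\<in>H. \<forall>i<k. h ((T(k - 1 := x)) i) = y i" using h(1) by (intro bexI[of _ h]) (auto simp: constrain_def)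
qed

lemma shatters_1: "shatters H 1 (T(0 := x)) \<longleftrightarrow> x \<in> DIS H"
proof
  assume *: "shatters H 1 (T(0 := x))"
  have "\<exists>h\<in>H. h x = b" for b
  proof -
    from *[unfolded shatters_def, THEN spec, of "\<lambda>_. b"]
    obtain h where "h \<in> H" "\<forall>i<1. h ((T(0 := x)) i) = b" by (elim bexE)
    then show ?thesis by (intro bexI[of _ h]) auto
  qed
  from this[of True] this[of False] obtain h1 h2 where "h1 \<in> H" "h1 x = True" "h2 \<in> H" "h2 x = False"
    by (elim bexE)
  then show "x \<in> DIS H" unfolding DIS_def by (intro CollectI bexI[of _ h1] bexI[of _ h2]) auto
next
  assume "x \<in> DIS H"
  then have *: "\<exists>h\<in>H. h x = b" for b by (cases b) (auto simp: DIS_def)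
  show "shatters H 1 (T(0 := x))" unfolding shatters_def
  proof
    fix y :: "nat \<Rightarrow> bool"
    obtain h where "h \<in> H" "h x = y 0" using *[of "y 0"] by auto
    then show "\<exists>h\<in>H. \<forall>i<1. h ((T(0 := x)) i) = y i" by (intro bexI[of _ h]) auto
  qed
qed

lemma card_ge_1[simp]: "card {i. Suc 0 \<le> i \<and> i \<le> N} = N"
  using card_atLeastAtMost[of 1 N] by (simp add: atLeastAtMost_def atLeast_def atMost_def Int_def)

lemma M_hat_1:
  assumes "m \<ge> 1" "H \<noteq> {}"
  shows "M_hat W2 1 m H = m ^ 3"
proof -
  have "{i\<in>{1..m^3}. shatters H (1 - 1) (sample_tuple W2 1 i)} = {1..m^3}" using assms by (auto simp: shatters_0)
  then show ?thesis using assms by (simp add: M_hat_def)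
qed

text \<open>For k = 1 the tuples are empty and a nonempty \<open>H\<close> shatters all of them, so
  the general ratio takes just the values 0 and 1 of the separate definition. This merges round 1
  with the other rounds.\<close>

lemma Delta_hat_alt:
  assumes "k \<ge> 1" "m \<ge> 1" "H \<noteq> {}"
  shows "Delta_hat W2 k m x H = real (card {i\<in>{1..m^3}. shatters H k ((sample_tuple W2 k i)(k - 1 := x))}) / real (M_hat W2 k m H)"
proof (cases "k = 1")
  case True
  then show ?thesis using assms M_hat_1[OF assms(2,3)] by (cases "x \<in> DIS H") (simp_all add: Delta_hat_def shatters_1[simplified])
qed (simp add: Delta_hat_def)

lemma Gamma_hat_alt:
  assumes "k \<ge> 1" "m \<ge> 1" "H \<noteq> {}"
  shows "Gamma_hat W2 k m x y H = real (card {i\<in>{1..m^3}. shatters H (k - 1) (sample_tuple W2 k i) \<and>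
     \<not> shatters (constrain H x (\<not> y)) (k - 1) (sample_tuple W2 k i)}) / real (M_hat W2 k m H)"
proof (cases "k = 1")
  case True
  have "(\<forall>h\<in>H. h x = y) \<longleftrightarrow> constrain H x (\<not> y) = {}" by (auto simp: constrain_def)
  then show ?thesis using assms True M_hat_1[OF assms(2,3)] by (cases "constrain H x (\<not> y) = {}") (simp_all add: Gamma_hat_def shatters_0)
qed (simp add: Gamma_hat_def)

context target
begin

abbreviation lab :: "(nat \<Rightarrow> 'a) \<Rightarrow> nat \<Rightarrow> bool" where
  "lab X \<equiv> (\<lambda>i. f (X i))"

text \<open>The counts that the estimators of round \<open>k\<close> with sample index \<open>q\<close> are based on, for the version
  space after \<open>p\<close> points.\<close>

definition count_core :: "(nat \<Rightarrow> 'a) \<Rightarrow> nat \<Rightarrow> nat \<Rightarrow> real" where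
  "count_core W2 k q = real (card {i\<in>{1..q^3}. core (k - 1) (sample_tuple W2 k i)})"

definition count_shattered :: "(nat \<Rightarrow> 'a) \<Rightarrow> nat \<Rightarrow> nat \<Rightarrow> ('a \<Rightarrow> bool) set \<Rightarrow> real" where
  "count_shattered W2 k q H = real (card {i\<in>{1..q^3}. shatters H (k - 1) (sample_tuple W2 k i)})"

definition count_link :: "(nat \<Rightarrow> 'a) \<Rightarrow> nat \<Rightarrow> nat \<Rightarrow> ('a \<Rightarrow> bool) set \<Rightarrow> 'a \<Rightarrow> real" where
  "count_link W2 k q H x = real (card {i\<in>{1..q^3}. shatters H k ((sample_tuple W2 k i)(k - 1 := x))})"

text \<open>The tolerances are relative to the core mass. They are small enough for 99/200 - 1/100
  \<ge> 4/10, 4/10 - 1/100 \<ge> 102/800 and 99/800 - 1/100 \<ge> 1/10, the comparisons that connect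
  the thresholds 1/2 and 1/8 of the algorithm with the levels 4/10 and 1/10 of the link
  mass.\<close>

definition accurate :: "(nat \<Rightarrow> 'a) \<Rightarrow> (nat \<Rightarrow> 'a) \<Rightarrow> nat \<Rightarrow> nat \<Rightarrow> nat \<Rightarrow> 'a \<Rightarrow> bool" where
  "accurate X W2 k p q x \<longleftrightarrow>
     99/100 * core_mass (k - 1) * real (q^3) \<le> count_core W2 k q \<and>
     count_shattered W2 k q (Vs X p) \<le> 102/100 * core_mass (k - 1) * real (q^3) \<and>
     \<bar>count_link W2 k q (Vs X p) x - link_mass k (Vs X p) x * real (q^3)\<bar> \<le> 1/100 * core_mass (k - 1) * real (q^3)"

definition cores_shattered :: "(nat \<Rightarrow> 'a) \<Rightarrow> (nat \<Rightarrow> 'a) \<Rightarrow> bool" where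
  "cores_shattered X W2 \<longleftrightarrow> (\<forall>k p. \<forall>i\<ge>1. core (k - 1) (sample_tuple W2 k i) \<longrightarrow> shatters (Vs X p) (k - 1) (sample_tuple W2 k i))"

lemma Vs_nonempty: "Vs X p \<noteq> {}" using f_in_Vs by auto

context
  fixes X W2 :: "nat \<Rightarrow> 'a" and k p q :: nat and x :: 'a
  assumes acc: "accurate X W2 k p q x" and cs: "cores_shattered X W2" and k: "k \<ge> 1" and q: "q \<ge> 1"
    and pos: "core_mass (k - 1) > 0"
begin

private definition "a = core_mass (k - 1) * real (q^3)"

private lemma a_pos: "a > 0" using pos q by (simp add: a_def)

private lemma acc':
  "99/100 * a \<le> count_core W2 k q" "count_shattered W2 k q (Vs X p) \<le> 102/100 * a"
  "\<bar>count_link W2 k q (Vs X p) x - link_mass k (Vs X p) x * real (q^3)\<bar> \<le> 1/100 * a"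
  using acc by (simp_all add: accurate_def a_def mult.assoc)

private lemma core_le: "count_core W2 k q \<le> count_shattered W2 k q (Vs X p)"
  unfolding count_core_def count_shattered_def using cs
  by (intro of_nat_mono card_mono) (auto simp: cores_shattered_def)

private lemma M_eq: "real (M_hat W2 k q (Vs X p)) = count_shattered W2 k q (Vs X p)"
proof -
  have "count_shattered W2 k q (Vs X p) > 0" using core_le acc' a_pos by linarith
  then show ?thesis by (auto simp: M_hat_def count_shattered_def max_def)
qed

private lemma Delta_eq: "Delta_hat W2 k q x (Vs X p) = count_link W2 k q (Vs X p) x / count_shattered W2 k q (Vs X p)"
  using Delta_hat_alt[OF k q Vs_nonempty] M_eq by (simp add: count_link_def)

text \<open>Requests and the density estimate use different sample sizes and different version
  spaces. The link mass, which involves no sampling, mediates between them in a chain of three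
  lemmas: a request forces the level 4/10, this level forces an estimate of at least 1/8, and that
  estimate forces the level 1/10.\<close>

lemma Delta_hat_ge_half:
  assumes "1 / 2 \<le> Delta_hat W2 k q x (Vs X p)"
  shows "4/10 * core_mass (k - 1) \<le> link_mass k (Vs X p) x"
proof -
  have "count_shattered W2 k q (Vs X p) > 0" using core_le acc' a_pos by linarith
  then have "count_shattered W2 k q (Vs X p) / 2 \<le> count_link W2 k q (Vs X p) x"
    using assms unfolding Delta_eq by (simp add: field_simps)
  then have "4/10 * a \<le> link_mass k (Vs X p) x * real (q^3)" using acc' core_le a_pos by linarith
  then have "(4/10 * core_mass (k - 1)) * real (q^3) \<le> link_mass k (Vs X p) x * real (q^3)" by (simp add: a_def)
  then show ?thesis using q by (subst (asm) mult_le_cancel_right_pos) auto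
qed

lemma Delta_hat_ge_eighth:
  assumes "4/10 * core_mass (k - 1) \<le> link_mass k (Vs X p) x"
  shows "1 / 8 \<le> Delta_hat W2 k q x (Vs X p)"
proof -
  have c: "count_shattered W2 k q (Vs X p) > 0" using core_le acc' a_pos by linarith
  have "(4/10 * core_mass (k - 1)) * real (q^3) \<le> link_mass k (Vs X p) x * real (q^3)"
    using assms by (rule mult_right_mono) simp
  then have "4/10 * a \<le> link_mass k (Vs X p) x * real (q^3)" by (simp add: a_def)
  then have "count_shattered W2 k q (Vs X p) / 8 \<le> count_link W2 k q (Vs X p) x" using acc' a_pos by linarith
  then show ?thesis using c unfolding Delta_eq by (simp add: field_simps)
qed

lemma Delta_hat_ge_eighth_imp:
  assumes "1 / 8 \<le> Delta_hat W2 k q x (Vs X p)"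
  shows "1/10 * core_mass (k - 1) \<le> link_mass k (Vs X p) x"
proof -
  have "count_shattered W2 k q (Vs X p) > 0" using core_le acc' a_pos by linarith
  then have "count_shattered W2 k q (Vs X p) / 8 \<le> count_link W2 k q (Vs X p) x"
    using assms unfolding Delta_eq by (simp add: field_simps)
  then have "1/10 * a \<le> link_mass k (Vs X p) x * real (q^3)" using acc' core_le a_pos by linarith
  then have "(1/10 * core_mass (k - 1)) * real (q^3) \<le> link_mass k (Vs X p) x * real (q^3)" by (simp add: a_def)
  then show ?thesis using q by (subst (asm) mult_le_cancel_right_pos) auto
qed

text \<open>A vote for the label y is a shattered tuple that is no longer shattered under the label
  opposite to y. Every shattered tuple either stays shattered with x appended, which happens for
  fewer than half of them, or votes. Core tuples stay shattered under the true label, because the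
  next version space shatters them, so at most the 3/100 between the two core bounds can vote for
  the wrong label. Nearly half of the tuples remain for the true one.\<close>

lemma inferred_label:
  assumes half: "Delta_hat W2 k q x (Vs X p) < 1 / 2" and x: "x = X (Suc p)"
  shows "arg_max (\<lambda>y. Gamma_hat W2 k q x y (Vs X p)) (\<lambda>_. True) = f x"
proof (rule arg_max_bool)
  let ?V = "Vs X p" and ?T = "sample_tuple W2 k"
  define A where "A = {i\<in>{1..q^3}. shatters ?V (k - 1) (?T i)}"
  define G where "G = (\<lambda>y. {i\<in>{1..q^3}. shatters ?V (k - 1) (?T i) \<and> \<not> shatters (constrain ?V x (\<not> y)) (k - 1) (?T i)})"
  define B where "B = {i\<in>{1..q^3}. shatters ?V k ((?T i)(k - 1 := x))}"
  define D where "D = {i\<in>{1..q^3}. core (k - 1) (?T i)}"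
  have fin: "finite A" "finite (G y)" "finite B" "finite D" for y by (auto simp: A_def G_def B_def D_def)
  have c: "count_shattered W2 k q ?V > 0" using core_le acc' a_pos by linarith
  have G_eq: "Gamma_hat W2 k q x y ?V = real (card (G y)) / count_shattered W2 k q ?V" for y
    using Gamma_hat_alt[OF k q Vs_nonempty] M_eq by (simp add: G_def)
  have cA: "count_shattered W2 k q ?V = card A" and cB: "count_link W2 k q ?V x = card B" and cD: "count_core W2 k q = card D"
    by (simp_all add: count_shattered_def count_link_def count_core_def A_def B_def D_def)
  have "real (card B) < real (card A) / 2"
    using half c unfolding Delta_eq cA cB by (simp add: field_simps)
  moreover have "card A \<le> card B + card (G True) + card (G False)"
  proof -
    have "A \<subseteq> B \<union> G True \<union> G False"
      using shatters_extend[OF k, of ?V x] by (auto simp: A_def B_def G_def)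
    then have "card A \<le> card (B \<union> G True \<union> G False)" using fin by (intro card_mono) auto
    also have "\<dots> \<le> card B + card (G True) + card (G False)"
      by (meson add_right_mono card_Un_le order_trans)
    finally show ?thesis .
  qed
  moreover have "card (G (\<not> f x)) + card D \<le> card A"
  proof -
    have "\<not> core (k - 1) (?T i)" if "i \<in> G (\<not> f x)" for i
    proof
      assume "core (k - 1) (?T i)"
      then have "shatters (Vs X (Suc p)) (k - 1) (?T i)"
        using that cs unfolding cores_shattered_def G_def by auto
      then show False using that by (simp add: G_def Vs_Suc x)
    qed
    then have "G (\<not> f x) \<inter> D = {}" by (auto simp: D_def)
    then have "card (G (\<not> f x)) + card D = card (G (\<not> f x) \<union> D)" using fin by (simp add: card_Un_disjoint)
    also have "\<dots> \<le> card A" using fin(1) cs by (intro card_mono) (auto simp: A_def G_def D_def cores_shattered_def)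
    finally show ?thesis .
  qed
  ultimately have "real (card (G (\<not> f x))) < real (card (G (f x)))"
    using acc'(1,2) a_pos unfolding cA cD by (cases "f x") auto
  then show "Gamma_hat W2 k q x (\<not> f x) ?V < Gamma_hat W2 k q x (f x) ?V"
    unfolding G_eq using c by (rule divide_strict_right_mono)
qed

end

lemma link_mass_1: "link_mass 1 H x = of_bool (x \<in> DIS H)"
proof -
  interpret pw: prob_space "power_measure 0 P" by (rule prob_space_power)
  have "{T \<in> space (power_measure 0 P). shatters H 1 (T(0 := x))} = (if x \<in> DIS H then space (power_measure 0 P) else {})"
    by (auto simp: shatters_1[simplified])
  then show ?thesis using pw.prob_space by (simp add: link_mass_def)
qed

text \<open>In round 1 the tuples are empty and the estimators are exact for every p. This covers
  the start of the run, where p is not yet of order n and concentration gives nothing.\<close>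

lemma accurate_1: "accurate X W2 1 p q x"
proof -
  have "core 0 T" for T unfolding core_def shatters_0 using f_in_ball by (metis empty_iff less_imp_le)
  then show ?thesis
    unfolding accurate_def count_core_def count_shattered_def count_link_def link_mass_1
    by (simp add: core_mass_0 shatters_0 Vs_nonempty shatters_1[simplified])
qed

definition queried :: "(nat \<Rightarrow> 'a) \<Rightarrow> (nat \<Rightarrow> 'a) \<Rightarrow> nat \<Rightarrow> nat \<Rightarrow> bool" where
  "queried X W2 k p \<longleftrightarrow> 1 / 2 \<le> Delta_hat W2 k (Suc p) (X (Suc p)) (Vs X p)"

text \<open>A request returns the true label, and \<open>inferred_label\<close> covers points that
  are not queried. A refused request would be inferred without that guarantee, hence the condition
  on \<open>ok\<close>.\<close>

lemma process_point_correct: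
  assumes "accurate X W2 k (pos s) (Suc (pos s)) (X (Suc (pos s)))" "cores_shattered X W2" "k \<ge> 1" "core_mass (k - 1) > 0"
    and v: "vspace s = Vs X (pos s)" and ok: "queried X W2 k (pos s) \<Longrightarrow> ok"
  shows "process_point X W2 (lab X) k ok s =
    (s\<lparr>pos := Suc (pos s), used := (if queried X W2 k (pos s) then used s + 1 else used s), vspace := Vs X (Suc (pos s))\<rparr>,
     (X (Suc (pos s)), f (X (Suc (pos s)))))"
proof -
  have q: "(1 / 2 \<le> Delta_hat W2 k (Suc (pos s)) (X (Suc (pos s))) (Vs X (pos s)) \<and> ok) = queried X W2 k (pos s)"
    using ok by (auto simp: queried_def)
  have y: "(if queried X W2 k (pos s) then f (X (Suc (pos s)))
      else arg_max (\<lambda>y. Gamma_hat W2 k (Suc (pos s)) (X (Suc (pos s))) y (Vs X (pos s))) (\<lambda>_. True)) = f (X (Suc (pos s)))"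
    using inferred_label[OF assms(1-3) _ assms(4)] by (auto simp: queried_def)
  show ?thesis
    unfolding process_point_def Let_def v Suc_eq_plus1[symmetric] q y Vs_Suc by (simp add: Vs_Suc)
qed

definition guard :: "nat \<Rightarrow> nat \<Rightarrow> nat \<Rightarrow> 'a learner_state \<Rightarrow> bool" where
  "guard n k T s \<longleftrightarrow> int (used s) < \<lceil>real T / 4\<rceil> \<and> pos s \<le> k * 2 ^ n"

definition explore_guarded :: "(nat \<Rightarrow> 'a) \<Rightarrow> (nat \<Rightarrow> 'a) \<Rightarrow> nat \<Rightarrow> nat \<Rightarrow> nat \<Rightarrow> 'a learner_state \<Rightarrow> 'a learner_state" where
  "explore_guarded X W2 n k T s = (if guard n k T s then explore_step X W2 (lab X) k s else s)"

text \<open>Every active step advances the position by one, so k * 2 ^ n + 1 guarded steps pass the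
  position limit wherever the loop starts.\<close>

definition explored :: "(nat \<Rightarrow> 'a) \<Rightarrow> (nat \<Rightarrow> 'a) \<Rightarrow> nat \<Rightarrow> nat \<Rightarrow> nat \<Rightarrow> 'a learner_state \<Rightarrow> 'a learner_state" where
  "explored X W2 n k T s = (explore_guarded X W2 n k T ^^ Suc (k * 2 ^ n)) (s\<lparr>used := 0, labeled := []\<rparr>)"

definition n_collect :: "(nat \<Rightarrow> 'a) \<Rightarrow> (nat \<Rightarrow> 'a) \<Rightarrow> nat \<Rightarrow> nat \<Rightarrow> 'a learner_state \<Rightarrow> nat" where
  "n_collect W1 W2 k T s = nat \<lfloor>real T / (3 * Delta_hat_set W1 W2 k (pos s) (vspace s))\<rfloor>"

lemma pos_process_point: "pos (fst (process_point X W2 Y k ok s)) = Suc (pos s)"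
  by (simp add: process_point_def Let_def)

lemma explore_guarded_progress:
  "pos ((explore_guarded X W2 n k T ^^ j) s) = pos s + j \<or> \<not> guard n k T ((explore_guarded X W2 n k T ^^ j) s)"
proof (induction j)
  case (Suc j)
  then show ?case by (auto simp: explore_guarded_def explore_step_def pos_process_point)
qed simp

lemma explored_stops: "\<not> guard n k T (explored X W2 n k T s)"
    using explore_guarded_progress[of "Suc (k * 2 ^ n)" X W2 n k T "s\<lparr>used := 0, labeled := []\<rparr>"]
    by (auto simp: explored_def guard_def simp del: funpow.simps)

lemma meta_round_eq:
  "meta_round X W1 W2 (lab X) n k T s =
     (collect_step X W2 (lab X) k T ^^ n_collect W1 W2 k T (explored X W2 n k T s)) (explored X W2 n k T s)"
proof -
  note stop = explored_stops[of n k T X W2 s]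
  have "while (\<lambda>s. int (used s) < \<lceil>real T / 4\<rceil> \<and> pos s \<le> k * 2 ^ n) (explore_step X W2 (lab X) k) (s\<lparr>used := 0, labeled := []\<rparr>)
      = explored X W2 n k T s"
    using while_funpow[of "guard n k T" "Suc (k * 2 ^ n)" "explore_step X W2 (lab X) k" "s\<lparr>used := 0, labeled := []\<rparr>"] stop
    unfolding explored_def explore_guarded_def guard_def by (simp only: not_False_eq_True)
  then show ?thesis by (simp add: meta_round_def n_collect_def Let_def)
qed

context
  fixes X W1 W2 :: "nat \<Rightarrow> 'a" and k :: nat and p0 :: nat
  assumes acc: "\<And>p. p \<ge> p0 \<Longrightarrow> accurate X W2 k p (Suc p) (X (Suc p))"
    and cs: "cores_shattered X W2" and k: "k \<ge> 1" and cm: "core_mass (k - 1) > 0"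
begin

lemma explore_guarded_correct:
  fixes n T j :: nat and s :: "'a learner_state"
  assumes "vspace s = Vs X (pos s)" "pos s \<ge> p0" "used s = 0" "labeled s = []"
  defines "s' \<equiv> (explore_guarded X W2 n k T ^^ j) s"
  shows "pos s \<le> pos s' \<and> vspace s' = Vs X (pos s') \<and> labeled s' = [] \<and>
    used s' = card {p\<in>{pos s..<pos s'}. queried X W2 k p} \<and> int (used s') \<le> \<lceil>real T / 4\<rceil>"
  unfolding s'_def
proof (induction j)
  case 0
  then show ?case using assms by simp
next
  case (Suc j)
  let ?s = "(explore_guarded X W2 n k T ^^ j) s"
  show ?case
  proof (cases "guard n k T ?s")
    case False
    then have eq: "(explore_guarded X W2 n k T ^^ Suc j) s = ?s" using explore_guarded_def[of X W2 n k T ?s] by simp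
    from Suc show ?thesis unfolding eq .
  next
    case True
    have ge: "p0 \<le> pos ?s" using Suc assms(2) by simp
    have step: "(explore_guarded X W2 n k T ^^ Suc j) s = ?s\<lparr>pos := Suc (pos ?s),
        used := (if queried X W2 k (pos ?s) then used ?s + 1 else used ?s), vspace := Vs X (Suc (pos ?s))\<rparr>"
      using True process_point_correct[OF acc[OF ge] cs k cm, of True] Suc explore_guarded_def[of X W2 n k T ?s]
      by (simp add: explore_step_def)
    have "{p\<in>{pos s..<Suc (pos ?s)}. queried X W2 k p} =
      (if queried X W2 k (pos ?s) then insert (pos ?s) {p\<in>{pos s..<pos ?s}. queried X W2 k p} else {p\<in>{pos s..<pos ?s}. queried X W2 k p})"
      using Suc by (auto simp: less_Suc_eq)
    moreover have "int (used ?s) < \<lceil>real T / 4\<rceil>" using True by (simp add: guard_def)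
    ultimately show ?thesis unfolding step using Suc by auto
  qed
qed

text \<open>The number of requests grows monotonically, so if all J steps together fit into the
  quota, every single request is granted and no queried point is left to inference.\<close>

lemma collect_correct:
  fixes T J j :: nat and s :: "'a learner_state"
  assumes "vspace s = Vs X (pos s)" "pos s \<ge> p0" "labeled s = []"
    and "int (used s + card {p\<in>{pos s..<pos s + J}. queried X W2 k p}) < \<lfloor>3 * real T / 4\<rfloor>"
    and "j \<le> J"
  defines "s' \<equiv> (collect_step X W2 (lab X) k T ^^ j) s"
  shows "pos s' = pos s + j \<and> vspace s' = Vs X (pos s') \<and> labeled s' = map (\<lambda>i. (X i, f (X i))) [Suc (pos s)..<Suc (pos s + j)] \<and>
    used s' = used s + card {p\<in>{pos s..<pos s + j}. queried X W2 k p}"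
  unfolding s'_def using assms(5)
proof (induction j)
  case 0
  then show ?case using assms by simp
next
  case (Suc j)
  let ?s = "(collect_step X W2 (lab X) k T ^^ j) s"
  have IH: "pos ?s = pos s + j" "vspace ?s = Vs X (pos ?s)" "labeled ?s = map (\<lambda>i. (X i, f (X i))) [Suc (pos s)..<Suc (pos s + j)]"
    "used ?s = used s + card {p\<in>{pos s..<pos s + j}. queried X W2 k p}" using Suc by auto
  have ge: "p0 \<le> pos ?s" using IH(1) assms(2) by simp
  have "card {p\<in>{pos s..<pos s + j}. queried X W2 k p} \<le> card {p\<in>{pos s..<pos s + J}. queried X W2 k p}"
    using Suc.prems by (intro card_mono) auto
  then have ok: "int (used ?s) < \<lfloor>3 * real T / 4\<rfloor>" using assms(4) IH(4) by linarith
  have step: "(collect_step X W2 (lab X) k T ^^ Suc j) s = ?s\<lparr>pos := Suc (pos ?s),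
      used := (if queried X W2 k (pos ?s) then used ?s + 1 else used ?s), vspace := Vs X (Suc (pos ?s)),
      labeled := labeled ?s @ [(X (Suc (pos ?s)), f (X (Suc (pos ?s))))]\<rparr>"
    using process_point_correct[OF acc[OF ge] cs k cm IH(2), of "int (used ?s) < \<lfloor>3 * real T / 4\<rfloor>"] ok
    by (simp add: collect_step_def)
  have "{p\<in>{pos s..<Suc (pos s + j)}. queried X W2 k p} =
      (if queried X W2 k (pos ?s) then insert (pos ?s) {p\<in>{pos s..<pos s + j}. queried X W2 k p} else {p\<in>{pos s..<pos s + j}. queried X W2 k p})"
    using IH(1) by (auto simp: less_Suc_eq)
  then show ?case unfolding step using IH by auto
qed

end

end

section \<open>Measurability and causality of the algorithm\<close>

text \<open>The state is determined by \<open>X\<close> and finitely many discrete data: the position, the number of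
  requests, the label constraints and the labeled sequence, with points replaced by their indices.\<close>

type_synonym code = "nat \<times> nat \<times> (nat \<times> bool) list \<times> (nat \<times> bool) list"

context target
begin

declare measurable_reindex[measurable del]

definition constrained :: "(nat \<Rightarrow> 'a) \<Rightarrow> (nat \<times> bool) list \<Rightarrow> ('a \<Rightarrow> bool) set" where
  "constrained X cs = {h\<in>C. \<forall>z\<in>set cs. h (X (fst z)) = snd z}"

lemma pred_shatters_constrained:
  assumes X: "\<And>i. X i \<in> measurable N M" and s: "\<And>j. j < k \<Longrightarrow> s j \<in> measurable N M"
  shows "Measurable.pred N (\<lambda>\<omega>. shatters (constrained (\<lambda>i. X i \<omega>) cs) k (\<lambda>j. s j \<omega>))"
  unfolding constrained_def by (rule pred_shatters[where y = "\<lambda>z _. snd z" and z = "\<lambda>z. X (fst z)"]) (simp_all add: X s)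

lemma pred_shatters_constrained_constrain:
  assumes X: "\<And>i. X i \<in> measurable N M" and s: "\<And>j. j < k \<Longrightarrow> s j \<in> measurable N M" and x: "x \<in> measurable N M"
  shows "Measurable.pred N (\<lambda>\<omega>. shatters (constrain (constrained (\<lambda>i. X i \<omega>) cs) (x \<omega>) b) k (\<lambda>j. s j \<omega>))"
proof -
  define Z where "Z = (\<lambda>z. case z of None \<Rightarrow> x | Some z \<Rightarrow> X (fst (z :: nat \<times> bool)))"
  define Y where "Y = (\<lambda>(z :: (nat \<times> bool) option) (\<omega> :: 'b). case z of None \<Rightarrow> b | Some z \<Rightarrow> snd z)"
  have "Measurable.pred N (\<lambda>\<omega>. shatters {h\<in>C. \<forall>i\<in>insert None (Some ` set cs). h (Z i \<omega>) = Y i \<omega>} k (\<lambda>j. s j \<omega>))"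
    by (rule pred_shatters) (auto simp: Z_def Y_def X x s split: option.split)
  moreover have "constrain (constrained (\<lambda>i. X i \<omega>) cs) (x \<omega>) b = {h\<in>C. \<forall>i\<in>insert None (Some ` set cs). h (Z i \<omega>) = Y i \<omega>}" for \<omega>
    by (auto simp: constrain_def constrained_def Z_def Y_def)
  ultimately show ?thesis by simp
qed

lemma measurable_sample_tuple:
  assumes "\<And>i. W i \<in> measurable N M"
  shows "(\<lambda>\<omega>. sample_tuple (\<lambda>i. W i \<omega>) k i j) \<in> measurable N M"
  unfolding sample_tuple_def by (rule assms)

lemma measurable_nat_ratio:
  assumes "g \<in> measurable N (count_space UNIV)" "h \<in> measurable N (count_space UNIV)"
  shows "(\<lambda>\<omega>. real (g \<omega>) / real (h \<omega>)) \<in> borel_measurable N"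
  by (intro borel_measurable_divide measurable_compose[OF assms(1)] measurable_compose[OF assms(2)]) simp_all

lemma measurable_M_hat:
  assumes X: "\<And>i. X i \<in> measurable N M" and W: "\<And>i. W i \<in> measurable N M"
  shows "(\<lambda>\<omega>. M_hat (\<lambda>i. W i \<omega>) k m (constrained (\<lambda>i. X i \<omega>) cs)) \<in> measurable N (count_space UNIV)"
proof -
  have "(\<lambda>\<omega>. card {i\<in>{1..m^3}. shatters (constrained (\<lambda>i. X i \<omega>) cs) (k - 1) (\<lambda>j. sample_tuple (\<lambda>i. W i \<omega>) k i j)}) \<in> measurable N (count_space UNIV)"
    by (intro measurable_card_Collect pred_shatters_constrained X measurable_sample_tuple W) simp
  then show ?thesis unfolding M_hat_def by (rule measurable_compose) simp
qed

lemma measurable_Delta_hat: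
  assumes X: "\<And>i. X i \<in> measurable N M" and W: "\<And>i. W i \<in> measurable N M" and x: "x \<in> measurable N M"
  shows "(\<lambda>\<omega>. Delta_hat (\<lambda>i. W i \<omega>) k m (x \<omega>) (constrained (\<lambda>i. X i \<omega>) cs)) \<in> borel_measurable N"
proof (cases "k = 1")
  case True
  have "Measurable.pred N (\<lambda>\<omega>. shatters (constrained (\<lambda>i. X i \<omega>) cs) 1 ((\<lambda>i. undefined)(0 := x \<omega>)))"
    by (intro pred_shatters_constrained X) (simp add: x)
  then have "Measurable.pred N (\<lambda>\<omega>. x \<omega> \<in> DIS (constrained (\<lambda>i. X i \<omega>) cs))" by (simp only: shatters_1)
  then have "(\<lambda>\<omega>. of_bool (x \<omega> \<in> DIS (constrained (\<lambda>i. X i \<omega>) cs)) :: real) \<in> borel_measurable N"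
    by (rule measurable_compose) simp
  then show ?thesis using True by (simp add: Delta_hat_def)
next
  case False
  have c: "(\<lambda>\<omega>. card {i\<in>{1..m^3}. shatters (constrained (\<lambda>i. X i \<omega>) cs) k ((sample_tuple (\<lambda>i. W i \<omega>) k i)(k - 1 := x \<omega>))}) \<in> measurable N (count_space UNIV)"
  proof (intro measurable_card_Collect)
    fix i
    show "Measurable.pred N (\<lambda>\<omega>. shatters (constrained (\<lambda>i. X i \<omega>) cs) k ((sample_tuple (\<lambda>i. W i \<omega>) k i)(k - 1 := x \<omega>)))"
      by (rule pred_shatters_constrained[OF X, where s = "\<lambda>j \<omega>. ((sample_tuple (\<lambda>i. W i \<omega>) k i)(k - 1 := x \<omega>)) j"],
          rule measurable_upd[OF x measurable_sample_tuple[OF W]])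
  qed simp
  show ?thesis using False unfolding Delta_hat_def
    by (simp only: if_False) (rule measurable_nat_ratio[OF c measurable_M_hat[OF X W]])
qed

lemma measurable_Gamma_hat:
  assumes X: "\<And>i. X i \<in> measurable N M" and W: "\<And>i. W i \<in> measurable N M" and x: "x \<in> measurable N M"
  shows "(\<lambda>\<omega>. Gamma_hat (\<lambda>i. W i \<omega>) k m (x \<omega>) y (constrained (\<lambda>i. X i \<omega>) cs)) \<in> borel_measurable N"
proof (cases "k = 1")
  case True
  have "Measurable.pred N (\<lambda>\<omega>. \<not> shatters (constrain (constrained (\<lambda>i. X i \<omega>) cs) (x \<omega>) (\<not> y)) 0 (\<lambda>j. x \<omega>))"
    by (intro pred_intros_logic(2) pred_shatters_constrained_constrain X x)
  moreover have "(\<not> shatters (constrain H x (\<not> y)) 0 T) = (\<forall>h\<in>H. h x = y)" for H x and T :: "nat \<Rightarrow> 'a"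
    by (auto simp: shatters_0 constrain_def)
  ultimately have "Measurable.pred N (\<lambda>\<omega>. \<forall>h\<in>constrained (\<lambda>i. X i \<omega>) cs. h (x \<omega>) = y)" by simp
  then have "(\<lambda>\<omega>. of_bool (\<forall>h\<in>constrained (\<lambda>i. X i \<omega>) cs. h (x \<omega>) = y) :: real) \<in> borel_measurable N"
    by (rule measurable_compose) simp
  then show ?thesis using True by (simp add: Gamma_hat_def)
next
  case False
  have c: "(\<lambda>\<omega>. card {i\<in>{1..m^3}. shatters (constrained (\<lambda>i. X i \<omega>) cs) (k - 1) (\<lambda>j. sample_tuple (\<lambda>i. W i \<omega>) k i j) \<and>
     \<not> shatters (constrain (constrained (\<lambda>i. X i \<omega>) cs) (x \<omega>) (\<not> y)) (k - 1) (\<lambda>j. sample_tuple (\<lambda>i. W i \<omega>) k i j)}) \<in> measurable N (count_space UNIV)"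
    by (intro measurable_card_Collect pred_intros_logic(2,3) pred_shatters_constrained_constrain pred_shatters_constrained X x
        measurable_sample_tuple W) simp
  show ?thesis using False unfolding Gamma_hat_def
    by (simp only: if_False) (rule measurable_nat_ratio[OF c measurable_M_hat[OF X W]])
qed

lemma measurable_Delta_hat_set:
  assumes X: "\<And>i. X i \<in> measurable N M" and W: "\<And>i. W i \<in> measurable N M" and W': "\<And>i. W' i \<in> measurable N M"
  shows "(\<lambda>\<omega>. Delta_hat_set (\<lambda>i. W' i \<omega>) (\<lambda>i. W i \<omega>) k m (constrained (\<lambda>i. X i \<omega>) cs)) \<in> borel_measurable N"
proof -
  have "(\<lambda>\<omega>. card {i\<in>{1..m^3}. 1 / 8 \<le> Delta_hat (\<lambda>i. W i \<omega>) k m (W' i \<omega>) (constrained (\<lambda>i. X i \<omega>) cs)}) \<in> measurable N (count_space UNIV)"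
  proof (intro measurable_card_Collect)
    fix i
    note [measurable] = measurable_Delta_hat[OF X W W']
    show "Measurable.pred N (\<lambda>\<omega>. 1 / 8 \<le> Delta_hat (\<lambda>i. W i \<omega>) k m (W' i \<omega>) (constrained (\<lambda>i. X i \<omega>) cs))" by simp
  qed simp
  from measurable_compose[OF this, of "\<lambda>c. 2 / real m + real c / real m ^ 3" borel]
  show ?thesis unfolding Delta_hat_set_def by (simp only: measurable_count_space_const measurable_count_space_eq1 UNIV_I Pi_UNIV space_borel)
qed

section \<open>Simulation of the run on discrete codes\<close>

definition decode :: "(nat \<Rightarrow> 'a) \<Rightarrow> code \<Rightarrow> 'a learner_state" where
  "decode X = (\<lambda>(p, t, cs, ls). \<lparr>pos = p, used = t, vspace = constrained X cs, labeled = map (\<lambda>z. (X (fst z), snd z)) ls\<rparr>)"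

definition query_code :: "(nat \<Rightarrow> 'a) \<Rightarrow> (nat \<Rightarrow> 'a) \<Rightarrow> nat \<Rightarrow> code \<Rightarrow> bool" where
  "query_code X W2 k = (\<lambda>(p, t, cs, ls). 1 / 2 \<le> Delta_hat W2 k (Suc p) (X (Suc p)) (constrained X cs))"

definition label_code :: "(nat \<Rightarrow> 'a) \<Rightarrow> (nat \<Rightarrow> 'a) \<Rightarrow> nat \<Rightarrow> bool \<Rightarrow> code \<Rightarrow> bool" where
  "label_code X W2 k ok = (\<lambda>(p, t, cs, ls). if query_code X W2 k (p, t, cs, ls) \<and> ok then f (X (Suc p))
     else arg_max (\<lambda>y. Gamma_hat W2 k (Suc p) (X (Suc p)) y (constrained X cs)) (\<lambda>_. True))"

definition process_code :: "(nat \<Rightarrow> 'a) \<Rightarrow> (nat \<Rightarrow> 'a) \<Rightarrow> nat \<Rightarrow> bool \<Rightarrow> code \<Rightarrow> code" where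
  "process_code X W2 k ok = (\<lambda>(p, t, cs, ls).
     (Suc p, (if query_code X W2 k (p, t, cs, ls) \<and> ok then t + 1 else t), (Suc p, label_code X W2 k ok (p, t, cs, ls)) # cs, ls))"

definition guard_code :: "nat \<Rightarrow> nat \<Rightarrow> nat \<Rightarrow> code \<Rightarrow> bool" where
  "guard_code n k T = (\<lambda>(p, t, cs, ls). int t < \<lceil>real T / 4\<rceil> \<and> p \<le> k * 2 ^ n)"

definition explore_code :: "(nat \<Rightarrow> 'a) \<Rightarrow> (nat \<Rightarrow> 'a) \<Rightarrow> nat \<Rightarrow> nat \<Rightarrow> nat \<Rightarrow> code \<Rightarrow> code" where
  "explore_code X W2 n k T c = (if guard_code n k T c then process_code X W2 k True c else c)"

definition collect_code :: "(nat \<Rightarrow> 'a) \<Rightarrow> (nat \<Rightarrow> 'a) \<Rightarrow> nat \<Rightarrow> nat \<Rightarrow> code \<Rightarrow> code" where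
  "collect_code X W2 k T = (\<lambda>(p, t, cs, ls).
     let ok = int t < \<lfloor>3 * real T / 4\<rfloor>; (p', t', cs', ls') = process_code X W2 k ok (p, t, cs, ls)
     in (p', t', cs', ls @ [(Suc p, label_code X W2 k ok (p, t, cs, ls))]))"

definition explored_code :: "(nat \<Rightarrow> 'a) \<Rightarrow> (nat \<Rightarrow> 'a) \<Rightarrow> nat \<Rightarrow> nat \<Rightarrow> nat \<Rightarrow> code \<Rightarrow> code" where
  "explored_code X W2 n k T = (\<lambda>(p, t, cs, ls). (explore_code X W2 n k T ^^ Suc (k * 2 ^ n)) (p, 0, cs, []))"

definition n_collect_code :: "(nat \<Rightarrow> 'a) \<Rightarrow> (nat \<Rightarrow> 'a) \<Rightarrow> (nat \<Rightarrow> 'a) \<Rightarrow> nat \<Rightarrow> nat \<Rightarrow> code \<Rightarrow> nat" where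
  "n_collect_code X W1 W2 k T = (\<lambda>(p, t, cs, ls). nat \<lfloor>real T / (3 * Delta_hat_set W1 W2 k p (constrained X cs))\<rfloor>)"

definition round_code :: "(nat \<Rightarrow> 'a) \<Rightarrow> (nat \<Rightarrow> 'a) \<Rightarrow> (nat \<Rightarrow> 'a) \<Rightarrow> nat \<Rightarrow> nat \<Rightarrow> nat \<Rightarrow> code \<Rightarrow> code" where
  "round_code X W1 W2 n k T c =
     (collect_code X W2 k T ^^ n_collect_code X W1 W2 k T (explored_code X W2 n k T c)) (explored_code X W2 n k T c)"

primrec rounds_code :: "(nat \<Rightarrow> 'a) \<Rightarrow> (nat \<Rightarrow> 'a) \<Rightarrow> (nat \<Rightarrow> 'a) \<Rightarrow> nat \<Rightarrow> nat \<Rightarrow> nat \<times> code" where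
  "rounds_code X W1 W2 n 0 = (nat \<lceil>2 * real n / 3\<rceil>, (0, 0, [], []))"
| "rounds_code X W1 W2 n (Suc k) =
     (let T' = fst (rounds_code X W1 W2 n k) - fst (snd (snd (rounds_code X W1 W2 n k)))
      in (T', round_code X W1 W2 n (Suc k) T' (snd (rounds_code X W1 W2 n k))))"

lemma used_decode: "used (decode X c) = fst (snd c)" "pos (decode X c) = fst c"
  by (auto simp: decode_def split: prod.split)

lemma decode_process:
  "process_point X W2 (lab X) k ok (decode X (p, t, cs, ls)) =
     (decode X (process_code X W2 k ok (p, t, cs, ls)), (X (Suc p), label_code X W2 k ok (p, t, cs, ls)))"
proof -
  have "constrain (constrained X cs) (X i) y = constrained X ((i, y) # cs)" for i y
    by (auto simp: constrained_def constrain_def)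
  then show ?thesis
    by (simp add: process_point_def decode_def process_code_def label_code_def query_code_def Let_def)
qed

lemma decode_explore: "explore_guarded X W2 n k T (decode X c) = decode X (explore_code X W2 n k T c)"
proof -
  obtain p t cs ls where c: "c = (p, t, cs, ls)" by (cases c)
  have "guard n k T (decode X c) = guard_code n k T c" by (simp add: c decode_def guard_def guard_code_def)
  then show ?thesis by (simp add: explore_guarded_def explore_code_def explore_step_def c decode_process)
qed

lemma decode_collect: "collect_step X W2 (lab X) k T (decode X c) = decode X (collect_code X W2 k T c)"
proof -
  obtain p t cs ls where c: "c = (p, t, cs, ls)" by (cases c)
  show ?thesis unfolding collect_step_def collect_code_def c prod.case Let_def decode_process used_decode
    by (simp add: decode_def process_code_def)
qed

lemma decode_funpow:
  assumes "\<And>c. g (decode X c) = decode X (g' c)"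
  shows "(g ^^ j) (decode X c) = decode X ((g' ^^ j) c)"
  by (induction j) (simp_all add: assms)

lemma decode_explored: "explored X W2 n k T (decode X c) = decode X (explored_code X W2 n k T c)"
proof -
  obtain p t cs ls where c: "c = (p, t, cs, ls)" by (cases c)
  have "(decode X c)\<lparr>used := 0, labeled := []\<rparr> = decode X (p, 0, cs, [])" by (simp add: c decode_def)
  then show ?thesis unfolding explored_def explored_code_def c prod.case
    using decode_funpow[of "explore_guarded X W2 n k T" X "explore_code X W2 n k T", OF decode_explore] by (simp only:)
qed

lemma decode_n_collect: "n_collect W1 W2 k T (decode X c) = n_collect_code X W1 W2 k T c"
  by (auto simp: n_collect_def n_collect_code_def decode_def split: prod.split)

lemma decode_round: "meta_round X W1 W2 (lab X) n k T (decode X c) = decode X (round_code X W1 W2 n k T c)"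
  unfolding meta_round_eq decode_explored decode_n_collect round_code_def
  by (rule decode_funpow) (rule decode_collect)

lemma decode_rounds:
  "meta_rounds X W1 W2 (lab X) n C k = (fst (rounds_code X W1 W2 n k), decode X (snd (rounds_code X W1 W2 n k)))"
proof (induction k)
  case 0
  then show ?case by (simp add: decode_def constrained_def)
next
  case (Suc k)
  then show ?case by (simp add: Let_def decode_round used_decode)
qed

text \<open>The quota of round \<open>k\<close> is stored with the result of that round, while the
  state at its start is the result of round \<open>k - 1\<close>; hence the two indices.\<close>

definition mid_code :: "(nat \<Rightarrow> 'a) \<Rightarrow> (nat \<Rightarrow> 'a) \<Rightarrow> (nat \<Rightarrow> 'a) \<Rightarrow> nat \<Rightarrow> nat \<Rightarrow> code" where
  "mid_code X W1 W2 n k = explored_code X W2 n k (fst (rounds_code X W1 W2 n k)) (snd (rounds_code X W1 W2 n (k - 1)))"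

context
  fixes X W1 W2 :: "nat \<Rightarrow> 'b \<Rightarrow> 'a" and N :: "'b measure"
  assumes X[measurable]: "\<And>i. X i \<in> measurable N M" and W1[measurable]: "\<And>i. W1 i \<in> measurable N M"
    and W2[measurable]: "\<And>i. W2 i \<in> measurable N M"
begin

lemma measurable_query_code:
  "(\<lambda>\<omega>. query_code (\<lambda>i. X i \<omega>) (\<lambda>i. W2 i \<omega>) k c) \<in> measurable N (count_space UNIV)"
proof -
  obtain p t cs ls where c: "c = (p, t, cs, ls)" by (cases c)
  note [measurable] = measurable_Delta_hat[OF X W2 X]
  show ?thesis by (simp add: query_code_def c)
qed

text \<open>Without a tie the label compares two measurable functions. In a tie the choice operator
  is given the same predicate whatever the common value is, so it returns one fixed label.\<close>

lemma measurable_label_code: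
  "(\<lambda>\<omega>. label_code (\<lambda>i. X i \<omega>) (\<lambda>i. W2 i \<omega>) k ok c) \<in> measurable N (count_space UNIV)"
proof -
  obtain p t cs ls where c: "c = (p, t, cs, ls)" by (cases c)
  define g where "g = (\<lambda>y \<omega>. Gamma_hat (\<lambda>i. W2 i \<omega>) k (Suc p) (X (Suc p) \<omega>) y (constrained (\<lambda>i. X i \<omega>) cs))"
  have [measurable]: "g y \<in> borel_measurable N" for y unfolding g_def by (rule measurable_Gamma_hat[OF X W2 X])
  note [measurable] = measurable_query_code
  have am: "arg_max h (\<lambda>_. True) = (if h False < h True then True else if h True < h False then False else arg_max (\<lambda>_::bool. 0::real) (\<lambda>_. True))" for h :: "bool \<Rightarrow> real"
  proof -
    consider "h False < h True" | "h True < h False" | "h False = h True" by linarith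
    then show ?thesis
    proof cases
      case 3
      then have eq: "h x = h y" for x y by (cases x; cases y) auto
      have "\<not> h x < h y" for x y using eq[of x y] by simp
      then have "is_arg_max h (\<lambda>_. True) = is_arg_max (\<lambda>_::bool. 0::real) (\<lambda>_. True)" by (auto simp: is_arg_max_def fun_eq_iff)
      then show ?thesis using 3 by (simp add: arg_max_def)
    qed (use arg_max_bool[of h True] arg_max_bool[of h False] in auto)
  qed
  have "Measurable.pred N (\<lambda>\<omega>. if g False \<omega> < g True \<omega> then True else if g True \<omega> < g False \<omega> then False
      else arg_max (\<lambda>_::bool. 0::real) (\<lambda>_. True))" by measurable
  then have "Measurable.pred N (\<lambda>\<omega>. arg_max (\<lambda>y. g y \<omega>) (\<lambda>_. True))" by (subst am)
  then have [measurable]: "Measurable.pred N (\<lambda>\<omega>. arg_max (\<lambda>y. Gamma_hat (\<lambda>i. W2 i \<omega>) k (Suc p) (X (Suc p) \<omega>) y (constrained (\<lambda>i. X i \<omega>) cs)) (\<lambda>_. True))"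
    by (simp add: g_def)
  show ?thesis unfolding label_code_def c prod.case by measurable
qed

text \<open>Codes are countable in number, so measurability can be checked with all discrete
  arguments fixed and then reassembled. The same argument leads from one step to the whole
  run.\<close>

lemma measurable_process_code:
  "(\<lambda>\<omega>. process_code (\<lambda>i. X i \<omega>) (\<lambda>i. W2 i \<omega>) k ok c) \<in> measurable N (count_space UNIV)"
proof -
  obtain p t cs ls where c: "c = (p, t, cs, ls)" by (cases c)
  have "(\<lambda>\<omega>. (\<lambda>q y. (Suc p, (if q \<and> ok then t + 1 else t), (Suc p, y) # cs, ls))
      (query_code (\<lambda>i. X i \<omega>) (\<lambda>i. W2 i \<omega>) k c) (label_code (\<lambda>i. X i \<omega>) (\<lambda>i. W2 i \<omega>) k ok c)) \<in> measurable N (count_space UNIV)"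
    by (rule measurable_compose_countable[OF measurable_compose_countable[OF _ measurable_label_code] measurable_query_code]) simp
  then show ?thesis by (simp add: process_code_def c)
qed

lemma measurable_explore_code:
  "(\<lambda>\<omega>. explore_code (\<lambda>i. X i \<omega>) (\<lambda>i. W2 i \<omega>) n k T c) \<in> measurable N (count_space UNIV)"
  unfolding explore_code_def by (cases "guard_code n k T c") (simp_all add: measurable_process_code)

lemma measurable_collect_code:
  "(\<lambda>\<omega>. collect_code (\<lambda>i. X i \<omega>) (\<lambda>i. W2 i \<omega>) k T c) \<in> measurable N (count_space UNIV)"
proof -
  obtain p t cs ls where c: "c = (p, t, cs, ls)" by (cases c)
  define ok where "ok = (int t < \<lfloor>3 * real T / 4\<rfloor>)"
  have "(\<lambda>\<omega>. (\<lambda>c' y. (fst c', fst (snd c'), fst (snd (snd c')), ls @ [(Suc p, y)]))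
      (process_code (\<lambda>i. X i \<omega>) (\<lambda>i. W2 i \<omega>) k ok c) (label_code (\<lambda>i. X i \<omega>) (\<lambda>i. W2 i \<omega>) k ok c)) \<in> measurable N (count_space UNIV)"
    by (rule measurable_compose_countable[OF measurable_compose_countable[OF _ measurable_label_code] measurable_process_code]) simp
  then show ?thesis unfolding collect_code_def c ok_def Let_def case_prod_beta prod.case fst_conv snd_conv .
qed

lemma measurable_funpow_code:
  fixes g :: "'b \<Rightarrow> code \<Rightarrow> code"
  assumes "\<And>c. (\<lambda>\<omega>. g \<omega> c) \<in> measurable N (count_space UNIV)"
  shows "(\<lambda>\<omega>. (g \<omega> ^^ j) c) \<in> measurable N (count_space UNIV)"
proof (induction j)
  case (Suc j)
  show ?case using measurable_compose_countable[OF assms Suc] by simp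
qed simp

lemma measurable_explored_code:
  "(\<lambda>\<omega>. explored_code (\<lambda>i. X i \<omega>) (\<lambda>i. W2 i \<omega>) n k T c) \<in> measurable N (count_space UNIV)"
  unfolding explored_code_def case_prod_beta by (rule measurable_funpow_code[OF measurable_explore_code])

lemma measurable_n_collect_code:
  "(\<lambda>\<omega>. n_collect_code (\<lambda>i. X i \<omega>) (\<lambda>i. W1 i \<omega>) (\<lambda>i. W2 i \<omega>) k T c) \<in> measurable N (count_space UNIV)"
proof -
  obtain p t cs ls where c: "c = (p, t, cs, ls)" by (cases c)
  note [measurable] = measurable_Delta_hat_set[OF X W2 W1]
  show ?thesis unfolding n_collect_code_def c prod.case by measurable
qed

lemma measurable_round_code:
  "(\<lambda>\<omega>. round_code (\<lambda>i. X i \<omega>) (\<lambda>i. W1 i \<omega>) (\<lambda>i. W2 i \<omega>) n k T c) \<in> measurable N (count_space UNIV)"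
proof -
  have 1: "(\<lambda>\<omega>. (collect_code (\<lambda>i. X i \<omega>) (\<lambda>i. W2 i \<omega>) k T ^^ n_collect_code (\<lambda>i. X i \<omega>) (\<lambda>i. W1 i \<omega>) (\<lambda>i. W2 i \<omega>) k T c) c) \<in> measurable N (count_space UNIV)" for c
    by (rule measurable_compose_countable[OF measurable_funpow_code[OF measurable_collect_code] measurable_n_collect_code])
  show ?thesis unfolding round_code_def
    by (rule measurable_compose_countable[OF 1 measurable_explored_code])
qed

lemma measurable_rounds_code:
  "(\<lambda>\<omega>. rounds_code (\<lambda>i. X i \<omega>) (\<lambda>i. W1 i \<omega>) (\<lambda>i. W2 i \<omega>) n k) \<in> measurable N (count_space UNIV)"
proof (induction k)
  case (Suc k)
  have "(\<lambda>\<omega>. (\<lambda>r. let T' = fst r - fst (snd (snd r)) in (T', round_code (\<lambda>i. X i \<omega>) (\<lambda>i. W1 i \<omega>) (\<lambda>i. W2 i \<omega>) n (Suc k) T' (snd r)))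
     (rounds_code (\<lambda>i. X i \<omega>) (\<lambda>i. W1 i \<omega>) (\<lambda>i. W2 i \<omega>) n k)) \<in> measurable N (count_space UNIV)"
  proof (rule measurable_compose_countable[OF _ Suc])
    fix r :: "nat \<times> code"
    show "(\<lambda>\<omega>. let T' = fst r - fst (snd (snd r)) in (T', round_code (\<lambda>i. X i \<omega>) (\<lambda>i. W1 i \<omega>) (\<lambda>i. W2 i \<omega>) n (Suc k) T' (snd r))) \<in> measurable N (count_space UNIV)"
      unfolding Let_def by (rule measurable_compose[OF measurable_round_code]) simp
  qed
  then show ?case by simp
qed simp

lemma measurable_mid_code:
  "(\<lambda>\<omega>. mid_code (\<lambda>i. X i \<omega>) (\<lambda>i. W1 i \<omega>) (\<lambda>i. W2 i \<omega>) n k) \<in> measurable N (count_space UNIV)"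
  unfolding mid_code_def
  by (rule measurable_compose_countable[OF measurable_compose_countable[OF measurable_explored_code
        measurable_compose[OF measurable_rounds_code]] measurable_compose[OF measurable_rounds_code]]) simp_all

end

text \<open>\<open>Tk\<close> is the quota of round \<open>k\<close>; \<open>mid\<close> and \<open>fin\<close> are the states after its first and second loop.\<close>

definition Tk :: "(nat \<Rightarrow> 'a) \<Rightarrow> (nat \<Rightarrow> 'a) \<Rightarrow> (nat \<Rightarrow> 'a) \<Rightarrow> nat \<Rightarrow> nat \<Rightarrow> nat" where
  "Tk X W1 W2 n k = fst (meta_rounds X W1 W2 (lab X) n C k)"

definition fin :: "(nat \<Rightarrow> 'a) \<Rightarrow> (nat \<Rightarrow> 'a) \<Rightarrow> (nat \<Rightarrow> 'a) \<Rightarrow> nat \<Rightarrow> nat \<Rightarrow> 'a learner_state" where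
  "fin X W1 W2 n k = snd (meta_rounds X W1 W2 (lab X) n C k)"

definition mid :: "(nat \<Rightarrow> 'a) \<Rightarrow> (nat \<Rightarrow> 'a) \<Rightarrow> (nat \<Rightarrow> 'a) \<Rightarrow> nat \<Rightarrow> nat \<Rightarrow> 'a learner_state" where
  "mid X W1 W2 n k = explored X W2 n k (Tk X W1 W2 n k) (fin X W1 W2 n (k - 1))"

lemma Tk_Suc: "Tk X W1 W2 n (Suc k) = Tk X W1 W2 n k - used (fin X W1 W2 n k)"
  by (simp add: Tk_def fin_def Let_def case_prod_beta)

lemma fin_Suc: "fin X W1 W2 n (Suc k) =
   (collect_step X W2 (lab X) (Suc k) (Tk X W1 W2 n (Suc k)) ^^ n_collect W1 W2 (Suc k) (Tk X W1 W2 n (Suc k)) (mid X W1 W2 n (Suc k)))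
     (mid X W1 W2 n (Suc k))"
  by (simp add: Tk_def fin_def mid_def Let_def case_prod_beta meta_round_eq)

lemma mid_decode: "mid X W1 W2 n k = decode X (mid_code X W1 W2 n k)"
  by (simp add: mid_def mid_code_def Tk_def fin_def decode_rounds decode_explored)

lemma fin_decode: "fin X W1 W2 n k = decode X (snd (rounds_code X W1 W2 n k))"
  by (simp add: fin_def decode_rounds)

lemma Tk_code: "Tk X W1 W2 n k = fst (rounds_code X W1 W2 n k)"
  by (simp add: Tk_def decode_rounds)

section \<open>Causality: positions are stopping times\<close>

lemma process_point_causal:
  "X (Suc (pos s)) = X' (Suc (pos s)) \<Longrightarrow> process_point X' W2 (lab X') k ok s = process_point X W2 (lab X) k ok s"
  by (simp add: process_point_def Let_def)

text \<open>Positions never decrease, so agreement up to the final position of the run on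
  \<open>X\<close> includes the agreement that each earlier step asks for.\<close>

lemma funpow_causal:
  fixes g g' :: "'a learner_state \<Rightarrow> 'a learner_state" and X X' :: "nat \<Rightarrow> 'a"
  assumes mono: "\<And>s. pos s \<le> pos (g s)"
    and causal: "\<And>s. (\<And>i. i \<le> pos (g s) \<Longrightarrow> X i = X' i) \<Longrightarrow> g' s = g s"
  shows "(\<And>i. i \<le> pos ((g ^^ j) s) \<Longrightarrow> X i = X' i) \<Longrightarrow> (g' ^^ j) s = (g ^^ j) s" and "pos s \<le> pos ((g ^^ j) s)"
proof -
  show "pos s \<le> pos ((g ^^ j) s)" for j
  proof (induction j)
    case (Suc j)
    then show ?case using mono[of "(g ^^ j) s"] by simp
  qed simp
  show "(\<And>i. i \<le> pos ((g ^^ j) s) \<Longrightarrow> X i = X' i) \<Longrightarrow> (g' ^^ j) s = (g ^^ j) s"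
  proof (induction j)
    case (Suc j)
    have "(g' ^^ j) s = (g ^^ j) s" by (rule Suc.IH) (use Suc.prems mono[of "(g ^^ j) s"] in auto)
    then show ?case using causal[of "(g ^^ j) s"] Suc.prems by simp
  qed simp
qed

lemma explore_guarded_causal:
  "pos s \<le> pos (explore_guarded X W2 n k T s)"
  "(\<And>i. i \<le> pos (explore_guarded X W2 n k T s) \<Longrightarrow> X i = X' i) \<Longrightarrow> explore_guarded X' W2 n k T s = explore_guarded X W2 n k T s"
proof -
  have p: "pos (explore_guarded X W2 n k T s) = (if guard n k T s then Suc (pos s) else pos s)"
    by (simp add: explore_guarded_def explore_step_def pos_process_point)
  then show "pos s \<le> pos (explore_guarded X W2 n k T s)" by simp
  assume *: "\<And>i. i \<le> pos (explore_guarded X W2 n k T s) \<Longrightarrow> X i = X' i"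
  show "explore_guarded X' W2 n k T s = explore_guarded X W2 n k T s"
  proof (cases "guard n k T s")
    case True
    then have "X (Suc (pos s)) = X' (Suc (pos s))" using * p by simp
    then have "process_point X' W2 (lab X') k True s = process_point X W2 (lab X) k True s" by (rule process_point_causal)
    then show ?thesis by (simp only: explore_guarded_def explore_step_def)
  qed (simp add: explore_guarded_def)
qed

lemma collect_step_causal:
  "pos s \<le> pos (collect_step X W2 (lab X) k T s)"
  "(\<And>i. i \<le> pos (collect_step X W2 (lab X) k T s) \<Longrightarrow> X i = X' i) \<Longrightarrow> collect_step X' W2 (lab X') k T s = collect_step X W2 (lab X) k T s"
proof -
  have p: "pos (collect_step X W2 (lab X) k T s) = Suc (pos s)"
    using pos_process_point[of X W2 "lab X" k _ s] by (simp add: collect_step_def case_prod_beta)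
  then show "pos s \<le> pos (collect_step X W2 (lab X) k T s)" by simp
  assume ag: "\<And>i. i \<le> pos (collect_step X W2 (lab X) k T s) \<Longrightarrow> X i = X' i"
  have "X (Suc (pos s)) = X' (Suc (pos s))" by (rule ag) (simp add: p)
  then have "process_point X' W2 (lab X') k ok s = process_point X W2 (lab X) k ok s" for ok by (rule process_point_causal)
  then show "collect_step X' W2 (lab X') k T s = collect_step X W2 (lab X) k T s"
    by (simp only: collect_step_def)
qed

lemma explored_causal:
  "pos s \<le> pos (explored X W2 n k T s)"
  "(\<And>i. i \<le> pos (explored X W2 n k T s) \<Longrightarrow> X i = X' i) \<Longrightarrow> explored X' W2 n k T s = explored X W2 n k T s"
proof -
  let ?s = "s\<lparr>used := 0, labeled := []\<rparr>"
  have "pos ?s \<le> pos ((explore_guarded X W2 n k T ^^ Suc (k * 2 ^ n)) ?s)"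
    by (rule funpow_causal(2)[where X = X and X' = X and g' = "explore_guarded X W2 n k T"]) (simp_all add: explore_guarded_causal(1))
  then show "pos s \<le> pos (explored X W2 n k T s)" by (simp add: explored_def del: funpow.simps)
  assume ag: "\<And>i. i \<le> pos (explored X W2 n k T s) \<Longrightarrow> X i = X' i"
  show "explored X' W2 n k T s = explored X W2 n k T s"
    unfolding explored_def
  proof (rule funpow_causal(1)[where X = X and X' = X'])
    show "pos s \<le> pos (explore_guarded X W2 n k T s)" for s by (rule explore_guarded_causal(1))
    show "explore_guarded X' W2 n k T s = explore_guarded X W2 n k T s"
      if "\<And>i. i \<le> pos (explore_guarded X W2 n k T s) \<Longrightarrow> X i = X' i" for s
      using that by (rule explore_guarded_causal(2))
    show "X i = X' i" if "i \<le> pos ((explore_guarded X W2 n k T ^^ Suc (k * 2 ^ n)) ?s)" for i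
      using ag[of i] that unfolding explored_def .
  qed
qed

text \<open>The range of agreement is measured by the run on \<open>X\<close> alone. This is the
  stopping time property that \<open>nn_integral_restart\<close> asks for.\<close>

lemma rounds_causal:
  "(\<And>i. i \<le> pos (fin X W1 W2 n k) \<Longrightarrow> X i = X' i) \<Longrightarrow>
     fin X' W1 W2 n k = fin X W1 W2 n k \<and> Tk X' W1 W2 n k = Tk X W1 W2 n k"
  "(\<And>i. i \<le> pos (mid X W1 W2 n (Suc k)) \<Longrightarrow> X i = X' i) \<Longrightarrow>
     mid X' W1 W2 n (Suc k) = mid X W1 W2 n (Suc k) \<and> Tk X' W1 W2 n (Suc k) = Tk X W1 W2 n (Suc k)"
proof -
  have mid: "mid X' W1 W2 n (Suc k) = mid X W1 W2 n (Suc k) \<and> Tk X' W1 W2 n (Suc k) = Tk X W1 W2 n (Suc k)"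
    if IH: "(\<And>i. i \<le> pos (fin X W1 W2 n k) \<Longrightarrow> X i = X' i) \<Longrightarrow>
      fin X' W1 W2 n k = fin X W1 W2 n k \<and> Tk X' W1 W2 n k = Tk X W1 W2 n k"
    and ag: "\<And>i. i \<le> pos (mid X W1 W2 n (Suc k)) \<Longrightarrow> X i = X' i" for k
  proof -
    have "pos (fin X W1 W2 n k) \<le> pos (mid X W1 W2 n (Suc k))"
      unfolding mid_def using explored_causal(1) by simp
    then have eq: "fin X' W1 W2 n k = fin X W1 W2 n k" "Tk X' W1 W2 n k = Tk X W1 W2 n k" using IH ag by auto
    then have T: "Tk X' W1 W2 n (Suc k) = Tk X W1 W2 n (Suc k)" by (simp add: Tk_Suc)
    have "explored X' W2 n (Suc k) (Tk X W1 W2 n (Suc k)) (fin X W1 W2 n k) = explored X W2 n (Suc k) (Tk X W1 W2 n (Suc k)) (fin X W1 W2 n k)"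
      by (rule explored_causal(2)) (use ag in \<open>simp add: mid_def\<close>)
    then show ?thesis using T eq by (simp add: mid_def)
  qed
  show A: "(\<And>i. i \<le> pos (fin X W1 W2 n k) \<Longrightarrow> X i = X' i) \<Longrightarrow>
     fin X' W1 W2 n k = fin X W1 W2 n k \<and> Tk X' W1 W2 n k = Tk X W1 W2 n k" for k
  proof (induction k)
    case 0
    then show ?case by (simp add: fin_def Tk_def)
  next
    case (Suc k)
    define J where "J = n_collect W1 W2 (Suc k) (Tk X W1 W2 n (Suc k)) (mid X W1 W2 n (Suc k))"
    let ?g = "\<lambda>Z. collect_step Z W2 (lab Z) (Suc k) (Tk X W1 W2 n (Suc k))"
    have "pos (mid X W1 W2 n (Suc k)) \<le> pos (fin X W1 W2 n (Suc k))"
      unfolding fin_Suc by (rule funpow_causal(2)[where X = X and X' = X and g' = "?g X"]) (simp_all add: collect_step_causal(1))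
    then have m: "mid X' W1 W2 n (Suc k) = mid X W1 W2 n (Suc k)" "Tk X' W1 W2 n (Suc k) = Tk X W1 W2 n (Suc k)"
      using mid[OF Suc.IH] Suc.prems by auto
    have "(collect_step X' W2 (lab X') (Suc k) (Tk X W1 W2 n (Suc k)) ^^ J) (mid X W1 W2 n (Suc k)) =
      (collect_step X W2 (lab X) (Suc k) (Tk X W1 W2 n (Suc k)) ^^ J) (mid X W1 W2 n (Suc k))"
    proof (rule funpow_causal(1)[where X = X and X' = X'])
      show "pos s \<le> pos (?g X s)" for s by (rule collect_step_causal(1))
      show "?g X' s = ?g X s" if "\<And>i. i \<le> pos (?g X s) \<Longrightarrow> X i = X' i" for s
        by (rule collect_step_causal(2)) (rule that)
      show "X i = X' i" if "i \<le> pos ((?g X ^^ J) (mid X W1 W2 n (Suc k)))" for i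
        using Suc.prems[of i] that unfolding fin_Suc J_def .
    qed
    then show ?case unfolding fin_Suc m J_def using m(2) by simp
  qed
  show "(\<And>i. i \<le> pos (mid X W1 W2 n (Suc k)) \<Longrightarrow> X i = X' i) \<Longrightarrow>
     mid X' W1 W2 n (Suc k) = mid X W1 W2 n (Suc k) \<and> Tk X' W1 W2 n (Suc k) = Tk X W1 W2 n (Suc k)"
    using mid[OF A] .
qed

end

section \<open>The selection step\<close>

definition hits :: "(nat \<Rightarrow> bool) \<Rightarrow> nat \<Rightarrow> nat set" where
  "hits E q = {i. E i \<and> card {i'. i' < i \<and> E i'} < q}"

lemma rank_inj:
  fixes E :: "nat \<Rightarrow> bool"
  shows "inj_on (\<lambda>i. card {i'. i' < i \<and> E i'}) {i. E i}"
proof -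
  have less: "card {i'. i' < x \<and> E i'} < card {i'. i' < y \<and> E i'}" if "x < y" "E x" for x y
  proof (rule psubset_card_mono)
    show "finite {i'. i' < y \<and> E i'}" by simp
    show "{i'. i' < x \<and> E i'} \<subset> {i'. i' < y \<and> E i'}" using that by auto
  qed
  show ?thesis
  proof (rule inj_onI, rule ccontr)
    fix x y assume "x \<in> {i. E i}" "y \<in> {i. E i}" "x \<noteq> y"
      and eq: "card {i'. i' < x \<and> E i'} = card {i'. i' < y \<and> E i'}"
    then show False using less[of x y] less[of y x] by (cases "x < y") auto
  qed
qed

lemma hits_finite: "finite (hits E q)" and card_hits_le: "card (hits E q) \<le> q"
proof -
  have inj: "inj_on (\<lambda>i. card {i'. i' < i \<and> E i'}) (hits E q)"
    by (rule inj_on_subset[OF rank_inj[of E]]) (auto simp: hits_def)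
  have im: "(\<lambda>i. card {i'. i' < i \<and> E i'}) ` hits E q \<subseteq> {..<q}" by (auto simp: hits_def)
  show "finite (hits E q)" using inj_on_finite[OF inj im] by simp
  show "card (hits E q) \<le> q" using card_inj_on_le[OF inj im] by simp
qed

lemma card_hits:
  assumes "infinite {i. E i}"
  shows "card (hits E q) = q"
proof -
  let ?e = "enumerate {i. E i}"
  have rank: "card {i'. i' < ?e n \<and> E i'} = n" for n
  proof -
    have "{i'. i' < ?e n \<and> E i'} = ?e ` {..<n}"
    proof (intro set_eqI iffI)
      fix i assume i: "i \<in> {i'. i' < ?e n \<and> E i'}"
      then obtain m where "i = ?e m" using range_enumerate[OF assms] by (metis (mono_tags, lifting) imageE mem_Collect_eq)
      moreover have "m < n" using i calculation enumerate_mono_iff[OF assms, of m n] by auto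
      ultimately show "i \<in> ?e ` {..<n}" by auto
    next
      fix i assume "i \<in> ?e ` {..<n}"
      then obtain m where "i = ?e m" "m < n" by auto
      then show "i \<in> {i'. i' < ?e n \<and> E i'}" using enumerate_in_set[OF assms, of m] enumerate_mono_iff[OF assms, of m n] by auto
    qed
    moreover have "inj_on ?e {..<n}" using enumerate_mono_iff[OF assms] by (intro linorder_inj_onI) (auto simp: less_le)
    ultimately show ?thesis by (simp add: card_image)
  qed
  have "?e ` {..<q} \<subseteq> hits E q" using enumerate_in_set[OF assms] by (auto simp: hits_def rank)
  moreover have "inj_on ?e {..<q}" using enumerate_mono_iff[OF assms] by (intro linorder_inj_onI) (auto simp: less_le)
  ultimately have "q \<le> card (hits E q)" using hits_finite[of E q] by (metis card_image card_lessThan card_mono)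
  then show ?thesis using card_hits_le[of E q] by simp
qed

section \<open>Sequential tests on disagreement points\<close>

context target
begin

text \<open>After any index, a long enough stretch of points avoids \<open>D\<close> only with
  arbitrarily small probability, by the lower Chernoff bound at the value 0.\<close>

lemma AE_infinitely_often:
  assumes D[measurable]: "D \<in> sets M" and p: "measure P D > 0"
  shows "AE X in S. infinite {i. X i \<in> D}"
proof -
  have null: "emeasure S {X\<in>space S. \<forall>i\<ge>n. X i \<notin> D} = 0" for n
  proof -
    have "emeasure S {X\<in>space S. \<forall>i\<ge>n. X i \<notin> D} \<le> 0"
    proof (rule ennreal_le_epsilon)
      fix e :: real assume e: "0 < e"
      obtain K :: nat where K: "- ln e / (1 - exp (-1)) / measure P D < K" using reals_Archimedean2 by blast
      have e1: "1 - exp (-1 :: real) > 0" by simp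
      have "emeasure S {X\<in>space S. \<forall>i\<ge>n. X i \<notin> D} \<le> emeasure S {X\<in>space S. real (card {i\<in>{n..<n+K}. X i \<in> D}) \<le> 0}"
      proof (rule emeasure_mono)
        have [measurable]: "(\<lambda>X. card {i\<in>{n..<n+K}. X i \<in> D}) \<in> measurable S (count_space UNIV)"
          by (rule measurable_card_hits) auto
        show "{X\<in>space S. real (card {i\<in>{n..<n+K}. X i \<in> D}) \<le> 0} \<in> sets S" by measurable
      qed auto
      also have "\<dots> \<le> ennreal (exp (1 * 0 - (1 - exp (- 1)) * (K * measure P D)))"
        by (rule chernoff_lower) auto
      also have "\<dots> \<le> ennreal e"
      proof (rule ennreal_leI)
        have "- ln e < (1 - exp (-1)) * (K * measure P D)"
          using K e1 p by (simp add: field_simps)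
        then have "exp (1 * 0 - (1 - exp (- 1)) * (K * measure P D)) \<le> exp (ln e)" by simp
        then show "exp (1 * 0 - (1 - exp (- 1)) * (K * measure P D)) \<le> e" using e by (simp only: exp_ln)
      qed
      finally show "emeasure S {X\<in>space S. \<forall>i\<ge>n. X i \<notin> D} \<le> 0 + ennreal e" by (simp only: add_0)
    qed
    then show ?thesis by simp
  qed
  have "AE X in S. \<exists>i\<ge>n. X i \<in> D" for n
    by (rule AE_I[OF _ null[of n]]) (auto intro: sets.sets_Collect_countable_All)
  then have "AE X in S. \<forall>n. \<exists>i\<ge>n. X i \<in> D" by (simp add: AE_all_countable)
  then show ?thesis by eventually_elim (auto simp: infinite_nat_iff_unbounded_le)
qed

context
  fixes A B :: "'a set" and u v :: real and q :: nat
  assumes A[measurable]: "A \<in> sets M" and B[measurable]: "B \<in> sets M" and AB: "A \<inter> B = {}"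
    and u: "u > 0" and v: "v > 0" and uv: "u * measure P A + v * measure P B \<le> measure P A + measure P B"
begin

private definition w :: "'a \<Rightarrow> real" where "w x = (if x \<in> A then u else if x \<in> B then v else 1)"

private definition "I X = hits (\<lambda>i. X i \<in> A \<union> B) q"

text \<open>A product of likelihood-ratio type: each of the first q hits among the first n points
  contributes u or v. The condition relating u and v says that the weight of a point has mean at
  most 1.\<close>

private definition G :: "nat \<Rightarrow> (nat \<Rightarrow> 'a) \<Rightarrow> real" where
  "G n X = (\<Prod>i<n. if i \<in> I X then w (X i) else 1)"

private lemma w_pos: "w x > 0" using u v by (simp add: w_def)

private lemma w_meas[measurable]: "w \<in> borel_measurable M" unfolding w_def by measurable

private lemma pred_I: "Measurable.pred S (\<lambda>X. i \<in> I X)"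
proof -
  have [measurable]: "(\<lambda>X. card {i'\<in>{..<i}. X i' \<in> A \<union> B}) \<in> measurable S (count_space UNIV)"
    by (rule measurable_card_hits) auto
  have "Measurable.pred S (\<lambda>X. X i \<in> A \<union> B \<and> card {i'\<in>{..<i}. X i' \<in> A \<union> B} < q)" by measurable
  then show ?thesis by (simp add: I_def hits_def)
qed

private lemma G_meas[measurable]: "G n \<in> borel_measurable S"
  unfolding G_def
proof (intro borel_measurable_prod)
  fix i
  note [measurable] = pred_I
  show "(\<lambda>X. if i \<in> I X then w (X i) else 1) \<in> borel_measurable S" by measurable
qed

private lemma int_w: "(\<integral>\<^sup>+x. ennreal (w x) \<partial>P) \<le> 1"
proof -
  have "(\<integral>\<^sup>+x. ennreal (w x) \<partial>P) = (\<integral>\<^sup>+x. ennreal u * indicator A x + (ennreal v * indicator B x + indicator (space P - (A \<union> B)) x) \<partial>P)"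
    using AB sets.sets_into_space[OF A] sets.sets_into_space[OF B] by (intro nn_integral_cong) (auto simp: w_def indicator_def)
  also have "\<dots> = ennreal u * emeasure P A + (ennreal v * emeasure P B + emeasure P (space P - (A \<union> B)))"
    by (simp add: nn_integral_add nn_integral_cmult)
  also have "\<dots> = ennreal (u * measure P A + (v * measure P B + (1 - (measure P A + measure P B))))"
  proof -
    have "measure P (space P - (A \<union> B)) = 1 - measure P (A \<union> B)" by (subst P.prob_compl) auto
    also have "measure P (A \<union> B) = measure P A + measure P B" using AB by (intro P.finite_measure_Union) auto
    finally have m: "measure P (space P - (A \<union> B)) = 1 - (measure P A + measure P B)" .
    moreover have "0 \<le> 1 - (measure P A + measure P B)" using m by (metis measure_nonneg)
    ultimately show ?thesis using u v by (simp add: P.emeasure_eq_measure ennreal_mult' ennreal_plus del: space_P)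
  qed
  also have "\<dots> \<le> ennreal 1" using uv by (intro ennreal_leI) simp
  finally show ?thesis by simp
qed

text \<open>A supermartingale step: whether a further hit still counts is decided by the first n
  points, and the weight of the next point is independent of these with mean at most 1.\<close>

private lemma G_le: "(\<integral>\<^sup>+X. ennreal (G n X) \<partial>S) \<le> 1"
proof (induction n)
  case 0
  then show ?case using seq.P.emeasure_space_1 by (simp add: G_def)
next
  case (Suc n)
  have I_cong: "i \<in> I (comb_seq n X X') \<longleftrightarrow> i \<in> I X" if "i < n" for i X X'
  proof -
    have "{i'. i' < i \<and> comb_seq n X X' i' \<in> A \<union> B} = {i'. i' < i \<and> X i' \<in> A \<union> B}"
      using that by (auto simp: comb_seq_def)
    then show ?thesis using that by (simp add: I_def hits_def comb_seq_less)
  qed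
  have I_n: "n \<in> I (comb_seq n X X') \<longleftrightarrow> X' 0 \<in> A \<union> B \<and> card {i'. i' < n \<and> X i' \<in> A \<union> B} < q" for X X'
  proof -
    have "{i'. i' < n \<and> comb_seq n X X' i' \<in> A \<union> B} = {i'. i' < n \<and> X i' \<in> A \<union> B}" by (auto simp: comb_seq_def)
    then show ?thesis using comb_seq_add[of n X X' 0] by (simp add: I_def hits_def)
  qed
  have GS: "G (Suc n) (comb_seq n X X') = G n X * (if card {i'. i' < n \<and> X i' \<in> A \<union> B} < q then w (X' 0) else 1)" for X X'
  proof -
    have "(\<Prod>i<n. if i \<in> I (comb_seq n X X') then w (comb_seq n X X' i) else 1) = G n X"
      unfolding G_def by (intro prod.cong refl) (auto simp: I_cong comb_seq_less)
    moreover have "(if n \<in> I (comb_seq n X X') then w (comb_seq n X X' n) else 1) = (if card {i'. i' < n \<and> X i' \<in> A \<union> B} < q then w (X' 0) else 1)"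
      using comb_seq_add[of n X X' 0] by (auto simp: I_n w_def)
    ultimately show ?thesis by (simp add: G_def)
  qed
  have "(\<integral>\<^sup>+X. ennreal (G (Suc n) X) \<partial>S) = (\<integral>\<^sup>+X. (\<integral>\<^sup>+X'. ennreal (G (Suc n) (comb_seq n X X')) \<partial>S) \<partial>S)"
    by (rule nn_integral_comb_seq) measurable
  also have "\<dots> \<le> (\<integral>\<^sup>+X. ennreal (G n X) \<partial>S)"
  proof (rule nn_integral_mono)
    fix X
    have G0: "0 \<le> G n X" unfolding G_def using w_pos by (intro prod_nonneg) (auto intro: less_imp_le)
    show "(\<integral>\<^sup>+X'. ennreal (G (Suc n) (comb_seq n X X')) \<partial>S) \<le> ennreal (G n X)"
    proof (cases "card {i'. i' < n \<and> X i' \<in> A \<union> B} < q")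
      case True
      then have "(\<integral>\<^sup>+X'. ennreal (G (Suc n) (comb_seq n X X')) \<partial>S) = (\<integral>\<^sup>+X'. ennreal (G n X) * ennreal (w (X' 0)) \<partial>S)"
        using G0 by (simp add: GS ennreal_mult')
      also have "\<dots> = ennreal (G n X) * (\<integral>\<^sup>+X'. ennreal (w (X' 0)) \<partial>S)" by (rule nn_integral_cmult) measurable
      also have "(\<integral>\<^sup>+X'. ennreal (w (X' 0)) \<partial>S) = (\<integral>\<^sup>+x. ennreal (w x) \<partial>P)"
        by (rule nn_integral_coord) measurable
      also have "ennreal (G n X) * \<dots> \<le> ennreal (G n X) * 1" by (intro mult_left_mono int_w) simp
      finally show ?thesis by simp
    next
      case False
      then show ?thesis using seq.P.emeasure_space_1 by (simp add: GS)
    qed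
  qed
  finally show ?case using Suc by (rule order_trans)
qed

text \<open>Fatou's lemma carries the bound over to the full product, whose logarithm is the
  right-hand side in the assumption on \<open>Q\<close>; Markov's inequality follows. Since the
  union has positive mass, almost surely there are q hits.\<close>

lemma hits_tail:
  fixes g :: real
  assumes p: "measure P (A \<union> B) > 0"
    and Q: "\<And>X. X \<in> space S \<Longrightarrow> Q X \<Longrightarrow> card (hits (\<lambda>i. X i \<in> A \<union> B) q) = q \<Longrightarrow>
       g * real q \<le> card {i\<in>hits (\<lambda>i. X i \<in> A \<union> B) q. X i \<in> A} * ln u + card {i\<in>hits (\<lambda>i. X i \<in> A \<union> B) q. X i \<in> B} * ln v"
  shows "emeasure S {X\<in>space S. Q X} \<le> ennreal (exp (- g * q))"
proof (cases "{X\<in>space S. Q X} \<in> sets S")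
  case True
  define Ginf where "Ginf X = (\<Prod>i\<in>I X. w (X i))" for X
  have lim: "liminf (\<lambda>n. ennreal (G n X)) = ennreal (Ginf X)" for X
  proof -
    have finI: "finite (I X)" unfolding I_def by (rule hits_finite)
    have "G n X = Ginf X" if "n > Max (insert 0 (I X))" for n
    proof -
      have "I X \<subseteq> {..<n}" using that finI by (auto simp: Max_less_iff)
      then have "{..<n} \<inter> I X = I X" by auto
      then show ?thesis unfolding G_def Ginf_def by (simp add: prod.If_cases)
    qed
    then have "\<forall>\<^sub>F n in sequentially. ennreal (G n X) = ennreal (Ginf X)"
      by (intro eventually_mono[OF eventually_gt_at_top[of "Max (insert 0 (I X))"]]) simp
    then have "(\<lambda>n. ennreal (G n X)) \<longlonglongrightarrow> ennreal (Ginf X)" by (rule tendsto_eventually)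
    then show ?thesis by (intro lim_imp_Liminf) auto
  qed
  have "(\<integral>\<^sup>+X. ennreal (Ginf X) \<partial>S) = (\<integral>\<^sup>+X. liminf (\<lambda>n. ennreal (G n X)) \<partial>S)" by (simp only: lim)
  also have "\<dots> \<le> liminf (\<lambda>n. \<integral>\<^sup>+X. ennreal (G n X) \<partial>S)" by (rule nn_integral_liminf) measurable
  also have "\<dots> \<le> liminf (\<lambda>n::nat. 1)" by (intro Liminf_mono) (simp add: G_le)
  also have "\<dots> = 1" by (simp add: Liminf_const)
  finally have int: "(\<integral>\<^sup>+X. ennreal (Ginf X) \<partial>S) \<le> 1" .
  have GinfM[measurable]: "(\<lambda>X. ennreal (Ginf X)) \<in> borel_measurable S"
    unfolding lim[symmetric] by measurable
  have Ginf_eq: "Ginf X = exp (card {i\<in>I X. X i \<in> A} * ln u + card {i\<in>I X. X i \<in> B} * ln v)" for X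
  proof -
    have f: "finite (I X)" unfolding I_def by (rule hits_finite)
    have sp: "I X = {i\<in>I X. X i \<in> A} \<union> {i\<in>I X. X i \<in> B}" by (auto simp: I_def hits_def)
    have "Ginf X = (\<Prod>i\<in>{i\<in>I X. X i \<in> A}. w (X i)) * (\<Prod>i\<in>{i\<in>I X. X i \<in> B}. w (X i))"
      unfolding Ginf_def by (subst sp, rule prod.union_disjoint) (use f AB in auto)
    also have "(\<Prod>i\<in>{i\<in>I X. X i \<in> A}. w (X i)) = u ^ card {i\<in>I X. X i \<in> A}"
      by (simp add: w_def)
    also have "(\<Prod>i\<in>{i\<in>I X. X i \<in> B}. w (X i)) = (\<Prod>i\<in>{i\<in>I X. X i \<in> B}. v)"
      using AB by (intro prod.cong) (auto simp: w_def)
    finally show ?thesis using u v by (simp add: exp_add exp_of_nat_mult)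
  qed
  have "emeasure S {X\<in>space S. Q X} = (\<integral>\<^sup>+X. indicator {X\<in>space S. Q X} X \<partial>S)" using True by simp
  also have "\<dots> \<le> (\<integral>\<^sup>+X. ennreal (exp (- g * q)) * ennreal (Ginf X) \<partial>S)"
  proof (rule nn_integral_mono_AE)
    have "AE X in S. infinite {i. X i \<in> A \<union> B}" using p by (intro AE_infinitely_often) auto
    then show "AE X in S. indicator {X\<in>space S. Q X} X \<le> ennreal (exp (- g * q)) * ennreal (Ginf X)"
    proof eventually_elim
      case (elim X)
      then have c: "card (I X) = q" unfolding I_def by (rule card_hits)
      show ?case
      proof (cases "X \<in> space S \<and> Q X")
        case True
        then have "g * q \<le> card {i\<in>I X. X i \<in> A} * ln u + card {i\<in>I X. X i \<in> B} * ln v"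
          using Q[of X] c by (simp add: I_def)
        then have "1 \<le> exp (- g * q) * Ginf X" unfolding Ginf_eq by (simp flip: exp_add)
        then have "ennreal 1 \<le> ennreal (exp (- g * q) * Ginf X)" by (rule ennreal_leI)
        then show ?thesis using True by (simp add: ennreal_mult')
      qed simp
    qed
  qed
  also have "\<dots> = ennreal (exp (- g * q)) * (\<integral>\<^sup>+X. ennreal (Ginf X) \<partial>S)" by (rule nn_integral_cmult) measurable
  also have "\<dots> \<le> ennreal (exp (- g * q)) * 1" using int by (rule mult_left_mono) simp
  finally show ?thesis by simp
qed (simp add: emeasure_notin_sets)

end

text \<open>The two constants are the logarithms of \<open>(7/6)\<^sup>7 (5/6)\<^sup>5\<close> and \<open>(11/12)\<^sup>7 (7/6)\<^sup>5\<close>, per twelve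
  requests: the weights \<open>1 \<plusminus> t\<close> balance error rate 1/2, and \<open>1 - t\<close>, \<open>1 + 2 t\<close> balance 2/3.\<close>

definition rate :: real where
  "rate = min (7 * ln (7/6) + 5 * ln (5/6)) (7 * ln (11/12) + 5 * ln (7/6)) / 12"

lemma rate_pos: "rate > 0"
proof -
  have "7 * ln (7/6) + 5 * ln (5/6) = ln ((7/6)^7 * (5/6)^5 :: real)" by (simp add: ln_mult ln_realpow)
  also have "\<dots> > 0" by (rule ln_gt_zero) (simp add: power_divide)
  finally have 1: "7 * ln (7/6) + 5 * ln (5/6) > (0::real)" .
  have "7 * ln (11/12) + 5 * ln (7/6) = ln ((11/12)^7 * (7/6)^5 :: real)" by (simp add: ln_mult ln_realpow)
  also have "\<dots> > 0" by (rule ln_gt_zero) (simp add: power_divide)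
  finally show ?thesis using 1 by (simp add: rate_def)
qed

text \<open>Gluing right after index s turns the points used by a test into the first hits of the
  fresh sequence, shifted in index.\<close>

lemma first_disagreements_comb:
  assumes "Suc s = s'"
  shows "first_disagreements (comb_seq s' Xp X) s q g h = (\<lambda>i. i + s') ` hits (\<lambda>i. g (X i) \<noteq> h (X i)) q"
proof -
  let ?Z = "comb_seq s' Xp X"
  have Z: "?Z (i + s') = X i" for i by (rule comb_seq_add)
  have card: "card {i'. s < i' \<and> i' < i + s' \<and> g (?Z i') \<noteq> h (?Z i')} = card {i'. i' < i \<and> g (X i') \<noteq> h (X i')}" for i
  proof -
    have "{i'. s < i' \<and> i' < i + s' \<and> g (?Z i') \<noteq> h (?Z i')} = (\<lambda>i. i + s') ` {i'. i' < i \<and> g (X i') \<noteq> h (X i')}"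
    proof (intro set_eqI iffI)
      fix j assume j: "j \<in> {i'. s < i' \<and> i' < i + s' \<and> g (?Z i') \<noteq> h (?Z i')}"
      then have "j = (j - s') + s'" using assms by auto
      then show "j \<in> (\<lambda>i. i + s') ` {i'. i' < i \<and> g (X i') \<noteq> h (X i')}"
        using j Z[of "j - s'"] by (intro image_eqI[of _ _ "j - s'"]) auto
    qed (use Z assms in auto)
    then show ?thesis by (simp add: card_image)
  qed
  show ?thesis
  proof (intro set_eqI iffI)
    fix j assume j: "j \<in> first_disagreements ?Z s q g h"
    then have eq: "j = (j - s') + s'" using assms by (auto simp: first_disagreements_def)
    then have "j - s' \<in> hits (\<lambda>i. g (X i) \<noteq> h (X i)) q"
      using j Z[of "j - s'"] card[of "j - s'"] by (auto simp: first_disagreements_def hits_def)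
    then show "j \<in> (\<lambda>i. i + s') ` hits (\<lambda>i. g (X i) \<noteq> h (X i)) q" using eq by blast
  next
    fix j assume "j \<in> (\<lambda>i. i + s') ` hits (\<lambda>i. g (X i) \<noteq> h (X i)) q"
    then obtain i where i: "j = i + s'" "i \<in> hits (\<lambda>i. g (X i) \<noteq> h (X i)) q" by auto
    then show "j \<in> first_disagreements ?Z s q g h"
      using card[of i] assms by (auto simp: first_disagreements_def hits_def Z)
  qed
qed

text \<open>The integer form also agrees with the convention that the empty sample has error
  0.\<close>

lemma empirical_err_le:
  assumes "finite I"
  shows "empirical_err X Y I h \<le> 7/12 \<longleftrightarrow> 12 * card {i\<in>I. h (X i) \<noteq> Y i} \<le> 7 * card I"
proof (cases "card I = 0")
  case True
  then have "I = {}" using assms by simp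
  then show ?thesis by (simp add: empirical_err_def)
next
  case False
  then have "empirical_err X Y I h \<le> 7/12 \<longleftrightarrow> real (12 * card {i\<in>I. h (X i) \<noteq> Y i}) \<le> real (7 * card I)"
    by (simp add: empirical_err_def field_simps)
  then show ?thesis by (simp only: of_nat_le_iff)
qed

definition test :: "(nat \<Rightarrow> 'a) \<Rightarrow> nat \<Rightarrow> nat \<Rightarrow> ('a \<Rightarrow> bool) \<Rightarrow> ('a \<Rightarrow> bool) \<Rightarrow> bool" where
  "test X s q g h \<longleftrightarrow> empirical_err X (lab X) (first_disagreements X s q g h) h \<le> 7/12"

text \<open>Only clearly wrong verdicts count: if the error of \<open>h\<close> lies above that of
  \<open>g\<close> but within twice that value, either verdict is tolerated.\<close>

definition misjudged :: "(nat \<Rightarrow> 'a) \<Rightarrow> nat \<Rightarrow> nat \<Rightarrow> ('a \<Rightarrow> bool) \<Rightarrow> ('a \<Rightarrow> bool) \<Rightarrow> bool" where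
  "misjudged X s q g h \<longleftrightarrow> (err P f h \<le> err P f g \<and> \<not> test X s q g h) \<or> (2 * err P f g < err P f h \<and> test X s q g h)"

lemma test_comb:
  "test (comb_seq (Suc s) Xp X) s q g h \<longleftrightarrow>
     12 * card {i\<in>hits (\<lambda>i. g (X i) \<noteq> h (X i)) q. h (X i) \<noteq> f (X i)} \<le> 7 * card (hits (\<lambda>i. g (X i) \<noteq> h (X i)) q)"
proof -
  let ?H = "hits (\<lambda>i. g (X i) \<noteq> h (X i)) q"
  have "{i\<in>(\<lambda>i. i + Suc s) ` ?H. h (comb_seq (Suc s) Xp X i) \<noteq> lab (comb_seq (Suc s) Xp X) i} = (\<lambda>i. i + Suc s) ` {i\<in>?H. h (X i) \<noteq> f (X i)}"
    using comb_seq_add[of "Suc s" Xp X] by auto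
  moreover have "card ((\<lambda>i. i + Suc s) ` Z) = card Z" for Z by (rule card_image) (simp add: inj_on_def)
  ultimately show ?thesis unfolding test_def first_disagreements_comb[OF refl]
    by (subst empirical_err_le) (simp_all only: hits_finite finite_imageI)
qed

text \<open>Where g and h disagree, exactly one of them errs. If h is no worse than g, it errs on at
  most half of the mass of this set; if its error is more than twice that of g, on at least two
  thirds. The threshold 7/12 is the midpoint of 1/2 and 2/3, and \<open>hits_tail\<close> turns both
  gaps into exponential bounds. The set \<open>R\<close>, where both err, enters both errors
  alike.\<close>

lemma misjudged_prob:
  assumes [measurable]: "g \<in> measurable M (count_space UNIV)" "h \<in> measurable M (count_space UNIV)"
  shows "emeasure S {X\<in>space S. misjudged (comb_seq (Suc s) Xp X) s q g h} \<le> ennreal (exp (- rate * q))"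
proof -
  define A where "A = {x\<in>space M. g x \<noteq> h x \<and> h x \<noteq> f x}"
  define B where "B = {x\<in>space M. g x \<noteq> h x \<and> h x = f x}"
  define R where "R = {x\<in>space M. g x = h x \<and> h x \<noteq> f x}"
  have A[measurable]: "A \<in> sets M" and B[measurable]: "B \<in> sets M" and R[measurable]: "R \<in> sets M"
    unfolding A_def B_def R_def by measurable
  have AB: "A \<inter> B = {}" by (auto simp: A_def B_def)
  have "{x\<in>space P. h x \<noteq> f x} = A \<union> R" by (auto simp: A_def R_def)
  then have eh: "err P f h = measure P A + measure P R" unfolding err_def
    by (simp only:) (rule P.finite_measure_Union, auto simp: A_def R_def)
  have "{x\<in>space P. g x \<noteq> f x} = B \<union> R" by (auto simp: B_def R_def)
  then have eg: "err P f g = measure P B + measure P R" unfolding err_def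
    by (simp only:) (rule P.finite_measure_Union, auto simp: B_def R_def)
  have pAB: "measure P (A \<union> B) = measure P A + measure P B" using AB by (intro P.finite_measure_Union) auto
  have hit_eq: "hits (\<lambda>i. g (X i) \<noteq> h (X i)) q = hits (\<lambda>i. X i \<in> A \<union> B) q"
    and card_A: "{i\<in>hits (\<lambda>i. X i \<in> A \<union> B) q. h (X i) \<noteq> f (X i)} = {i\<in>hits (\<lambda>i. X i \<in> A \<union> B) q. X i \<in> A}" if "X \<in> space S" for X
  proof -
    have "(g (X i) \<noteq> h (X i)) = (X i \<in> A \<union> B)" for i using space_S[OF that, of i] by (auto simp: A_def B_def)
    then show "hits (\<lambda>i. g (X i) \<noteq> h (X i)) q = hits (\<lambda>i. X i \<in> A \<union> B) q" by simp
    show "{i\<in>hits (\<lambda>i. X i \<in> A \<union> B) q. h (X i) \<noteq> f (X i)} = {i\<in>hits (\<lambda>i. X i \<in> A \<union> B) q. X i \<in> A}"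
      using space_S[OF that] by (auto simp: hits_def A_def B_def)
  qed
  define a where "a X = real (card {i\<in>hits (\<lambda>i. X i \<in> A \<union> B) q. X i \<in> A})" for X
  define b where "b X = real (card {i\<in>hits (\<lambda>i. X i \<in> A \<union> B) q. X i \<in> B})" for X
  have ab: "a X + b X = q" if "card (hits (\<lambda>i. X i \<in> A \<union> B) q) = q" for X
  proof -
    have "hits (\<lambda>i. X i \<in> A \<union> B) q = {i\<in>hits (\<lambda>i. X i \<in> A \<union> B) q. X i \<in> A} \<union> {i\<in>hits (\<lambda>i. X i \<in> A \<union> B) q. X i \<in> B}"
      by (auto simp: hits_def)
    then have "card (hits (\<lambda>i. X i \<in> A \<union> B) q) = card {i\<in>hits (\<lambda>i. X i \<in> A \<union> B) q. X i \<in> A} + card {i\<in>hits (\<lambda>i. X i \<in> A \<union> B) q. X i \<in> B}"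
      using AB hits_finite by (subst card_Un_disjoint[symmetric]) auto
    then show ?thesis using that by (simp add: a_def b_def)
  qed
  have test_ab: "test (comb_seq (Suc s) Xp X) s q g h \<longleftrightarrow> 12 * a X \<le> 7 * q"
    if "X \<in> space S" "card (hits (\<lambda>i. X i \<in> A \<union> B) q) = q" for X
    unfolding test_comb hit_eq[OF that(1)] card_A[OF that(1)] that(2) a_def by linarith
  have l1: "ln (7/6) > (0::real)" and l2: "ln (5/6) < (0::real)" and l3: "ln (11/12) < (0::real)"
    by (auto intro: ln_gt_zero ln_less_zero)
  consider "measure P (A \<union> B) = 0" | "measure P (A \<union> B) > 0" "err P f h \<le> err P f g"
    | "measure P (A \<union> B) > 0" "2 * err P f g < err P f h" | "\<not> err P f h \<le> err P f g" "\<not> 2 * err P f g < err P f h"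
    by (metis measure_nonneg order_less_le)
  then show ?thesis
  proof cases
    \<comment> \<open>The two classifiers agree almost everywhere: their errors are equal, the
      sample is almost surely empty, and an empty sample passes the test.\<close>
    case 1
    then have 0: "measure P A = 0" "measure P B = 0" using pAB by (metis add_nonneg_eq_0_iff measure_nonneg)+
    have "AE x in P. x \<notin> A \<union> B"
      using 1 by (intro AE_not_in) (auto simp: null_sets_def P.emeasure_eq_measure)
    then have "AE x in distr S P (\<lambda>X. X i). x \<notin> A \<union> B" for i by (simp only: distr_coord)
    then have AEi: "AE X in S. X i \<notin> A \<union> B" for i by (rule AE_distrD[rotated]) simp
    have all: "AE X in S. \<forall>i. X i \<notin> A \<union> B" unfolding AE_all_countable using AEi by (rule allI)
    have "AE X in S. \<not> misjudged (comb_seq (Suc s) Xp X) s q g h"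
      using all AE_space[of S]
    proof eventually_elim
      case (elim X)
      then have e: "hits (\<lambda>i. X i \<in> A \<union> B) q = {}" by (auto simp: hits_def)
      have "test (comb_seq (Suc s) Xp X) s q g h" unfolding test_comb hit_eq[OF elim(2)] e by simp
      then show ?case using 0 eh eg by (simp add: misjudged_def)
    qed
    then have "emeasure S {X\<in>space S. misjudged (comb_seq (Suc s) Xp X) s q g h} = 0"
    proof (cases "{X\<in>space S. misjudged (comb_seq (Suc s) Xp X) s q g h} \<in> sets S")
      case True
      then show ?thesis using \<open>AE X in S. \<not> misjudged (comb_seq (Suc s) Xp X) s q g h\<close> by (subst (asm) AE_iff_measurable) auto
    qed (simp add: emeasure_notin_sets)
    then show ?thesis by simp
  next
    case 2
    then have le: "measure P A \<le> measure P B" using eh eg by simp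
    show ?thesis
    proof (rule hits_tail[where A = A and B = B and u = "7/6" and v = "5/6"])
      show "7/6 * measure P A + 5/6 * measure P B \<le> measure P A + measure P B" using le by simp
      fix X assume X: "X \<in> space S" "misjudged (comb_seq (Suc s) Xp X) s q g h" "card (hits (\<lambda>i. X i \<in> A \<union> B) q) = q"
      have "0 \<le> err P f h" by (simp add: err_def)
      then have "\<not> test (comb_seq (Suc s) Xp X) s q g h" using X(2) 2 measure_nonneg[of P A] eh eg measure_nonneg[of P B] measure_nonneg[of P R]
        by (auto simp: misjudged_def)
      then have a: "7 * real q < 12 * a X" using test_ab[OF X(1,3)] by simp
      have "12 * rate * q \<le> (7 * ln (7/6) + 5 * ln (5/6)) * q" by (intro mult_right_mono) (auto simp: rate_def)
      also have "\<dots> = 7 * real q * ln (7/6) + 5 * real q * ln (5/6)" by (simp add: algebra_simps)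
      also have "\<dots> \<le> 12 * a X * ln (7/6) + 12 * b X * ln (5/6)"
        using a ab[OF X(3)] l1 l2 by (intro add_mono mult_right_mono mult_right_mono_neg) auto
      finally show "rate * real q \<le> real (card {i\<in>hits (\<lambda>i. X i \<in> A \<union> B) q. X i \<in> A}) * ln (7/6) +
          real (card {i\<in>hits (\<lambda>i. X i \<in> A \<union> B) q. X i \<in> B}) * ln (5/6)"
        by (simp add: a_def b_def)
    qed (use 2 AB in auto)
  next
    case 3
    then have le: "2 * measure P B \<le> measure P A" using eh eg measure_nonneg[of P R] by linarith
    show ?thesis
    proof (rule hits_tail[where A = A and B = B and u = "11/12" and v = "7/6"])
      show "11/12 * measure P A + 7/6 * measure P B \<le> measure P A + measure P B" using le by simp
      fix X assume X: "X \<in> space S" "misjudged (comb_seq (Suc s) Xp X) s q g h" "card (hits (\<lambda>i. X i \<in> A \<union> B) q) = q"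
      have "0 \<le> err P f g" by (simp add: err_def)
      then have "test (comb_seq (Suc s) Xp X) s q g h" using X(2) 3 by (auto simp: misjudged_def)
      then have a: "12 * a X \<le> 7 * real q" using test_ab[OF X(1,3)] by simp
      have "12 * rate * q \<le> (7 * ln (11/12) + 5 * ln (7/6)) * q" by (intro mult_right_mono) (auto simp: rate_def)
      also have "\<dots> = 7 * real q * ln (11/12) + 5 * real q * ln (7/6)" by (simp add: algebra_simps)
      also have "\<dots> \<le> 12 * a X * ln (11/12) + 12 * b X * ln (7/6)"
        using a ab[OF X(3)] l1 l3 by (intro add_mono mult_right_mono mult_right_mono_neg) auto
      finally show "rate * real q \<le> real (card {i\<in>hits (\<lambda>i. X i \<in> A \<union> B) q. X i \<in> A}) * ln (11/12) +
          real (card {i\<in>hits (\<lambda>i. X i \<in> A \<union> B) q. X i \<in> B}) * ln (7/6)"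
        by (simp add: a_def b_def)
    qed (use 3 AB in auto)
  next
    case 4
    then show ?thesis by (simp add: misjudged_def)
  qed
qed

definition budget :: "nat \<Rightarrow> nat \<Rightarrow> nat \<Rightarrow> nat" where
  "budget N b j = nat \<lfloor>real b / (real j * real (N - j) * ln (exp 1 * real N))\<rfloor>"

text \<open>A best candidate \<open>ks\<close> passes all its tests, so the chosen index is at least
  \<open>ks\<close>. If it is larger, it has passed the test against \<open>ks\<close>, and its
  error is at most twice the best one.\<close>

lemma active_select_good:
  assumes N: "N \<ge> 1" and k0: "k0 \<in> {1..N}"
    and good: "\<And>j k. j \<in> {1..<k} \<Longrightarrow> k \<le> N \<Longrightarrow> \<not> misjudged X s (budget N b j) (hs j) (hs k)"
  shows "err P f (active_select X (lab X) s N b hs) \<le> 2 * err P f (hs k0)"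
proof -
  define K where "K = {k\<in>{1..N}. \<forall>j\<in>{1..<k}. test X s (budget N b j) (hs j) (hs k)}"
  have as: "active_select X (lab X) s N b hs = hs (Max K)"
    by (simp add: active_select_def K_def test_def budget_def Let_def)
  obtain ks where ks: "ks \<in> {1..N}" "\<And>k. k \<in> {1..N} \<Longrightarrow> err P f (hs ks) \<le> err P f (hs k)"
    using ex_min_if_finite[of "(\<lambda>k. err P f (hs k)) ` {1..N}"] N
    by (metis (no_types, lifting) arg_min_if_finite(1) arg_min_least atLeastAtMost_iff empty_iff finite_atLeastAtMost order_refl)
  have "ks \<in> K"
    using ks good[of _ ks] by (auto simp: K_def misjudged_def)
  define k' where "k' = Max K"
  have "finite K" by (simp add: K_def)
  then have m: "ks \<le> k'" "k' \<in> K" unfolding k'_def using \<open>ks \<in> K\<close> Max_in[of K] Max_ge[of K ks] by blast+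
  have "err P f (hs k') \<le> 2 * err P f (hs ks)"
  proof (cases "k' = ks")
    case True
    then show ?thesis by (simp add: err_def)
  next
    case False
    then have ks': "ks \<in> {1..<k'}" using m ks(1) by auto
    then have "test X s (budget N b ks) (hs ks) (hs k')" "k' \<le> N" using m(2) by (auto simp: K_def)
    then show ?thesis using good[OF ks'] by (auto simp: misjudged_def)
  qed
  also have "\<dots> \<le> 2 * err P f (hs k0)" using ks(2)[OF k0] by simp
  finally show ?thesis by (simp add: as k'_def)
qed

end

section \<open>The error of the algorithm as a random variable\<close>

context target
begin

definition hyp :: "(nat \<Rightarrow> 'a) \<Rightarrow> (nat \<times> bool) list \<Rightarrow> 'a \<Rightarrow> bool" where
  "hyp X ls = halving_learner C 0 (map (\<lambda>z. (X (fst z), snd z)) ls)"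

definition Hk :: "(nat \<Rightarrow> 'a) \<Rightarrow> (nat \<Rightarrow> 'a) \<Rightarrow> (nat \<Rightarrow> 'a) \<Rightarrow> nat \<Rightarrow> nat \<Rightarrow> 'a \<Rightarrow> bool" where
  "Hk X W1 W2 n k = halving_learner C 0 (labeled (fin X W1 W2 n k))"

lemma halving_learner_seed: "halving_learner C u = halving_learner C 0"
  by (simp add: fun_eq_iff halving_learner_def)

lemma meta_algorithm_eq:
  "meta_algorithm M C (halving_learner C) n (X, W1, W2, U) (lab X) =
     active_select X (lab X) (pos (fin X W1 W2 n (Suc d))) (Suc d) (n div 3) (Hk X W1 W2 n)"
proof -
  have "Hk X W1 W2 n = (\<lambda>k. halving_learner C (U k) (labeled (fin X W1 W2 n k)))"
    by (intro ext) (simp only: Hk_def halving_learner_seed[of "U k" for k])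
  then show ?thesis by (simp add: meta_algorithm_def Let_def fin_def d_def)
qed

lemma Hk_code: "Hk X W1 W2 n k = hyp X (snd (snd (snd (snd (rounds_code X W1 W2 n k)))))"
  by (auto simp: Hk_def hyp_def fin_decode decode_def split: prod.split)

lemma pred_hyp:
  assumes X: "\<And>i. X i \<in> measurable N M" and x: "x \<in> measurable N M"
  shows "Measurable.pred N (\<lambda>\<omega>. hyp (\<lambda>i. X i \<omega>) ls (x \<omega>))"
proof -
  have "map (\<lambda>z. (X (fst z) \<omega>, snd z)) ls = map (\<lambda>i. (X (fst (ls ! i)) \<omega>, snd (ls ! i))) [0..<length ls]" for \<omega>
    by (rule nth_equalityI) auto
  moreover have "Measurable.pred N (\<lambda>\<omega>. halving_learner C 0 (map (\<lambda>i. (X (fst (ls ! i)) \<omega>, snd (ls ! i))) [0..<length ls]) (x \<omega>))"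
    by (rule pred_halving_learner) (use X x in simp_all)
  ultimately show ?thesis by (simp only: hyp_def)
qed

lemma hyp_classifier:
  assumes "\<And>i. X i \<in> space M"
  shows "hyp X ls \<in> measurable M (count_space UNIV)"
  by (rule pred_hyp[where X = "\<lambda>i _. X i" and x = "\<lambda>x. x"]) (simp_all add: assms)

lemma Hk_classifier:
  assumes "\<And>i. X i \<in> space M"
  shows "Hk X W1 W2 n k \<in> measurable M (count_space UNIV)"
  unfolding Hk_code by (rule hyp_classifier) (rule assms)

lemma measurable_err_hyp:
  assumes X: "\<And>i. X i \<in> measurable N M"
  shows "(\<lambda>\<omega>. err P f (hyp (\<lambda>i. X i \<omega>) ls)) \<in> borel_measurable N"
proof -
  have "Measurable.pred (N \<Otimes>\<^sub>M P) (\<lambda>q. hyp (\<lambda>i. X i (fst q)) ls (snd q))"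
    by (rule pred_hyp) (use X in \<open>simp_all add: measurable_compose[OF measurable_fst]\<close>)
  moreover have "Measurable.pred (N \<Otimes>\<^sub>M P) (\<lambda>q. f (snd q))" by measurable
  ultimately have "Measurable.pred (N \<Otimes>\<^sub>M P) (\<lambda>q. hyp (\<lambda>i. X i (fst q)) ls (snd q) \<noteq> f (snd q))" by measurable
  then have "{q \<in> space (N \<Otimes>\<^sub>M P). snd q \<in> {x\<in>space P. hyp (\<lambda>i. X i (fst q)) ls x \<noteq> f x}} \<in> sets (N \<Otimes>\<^sub>M P)"
    by (auto simp: pred_def space_pair_measure elim!: back_subst[of "\<lambda>A. A \<in> sets _"])
  then show ?thesis unfolding err_def by (intro P.measurable_measure) auto
qed

lemma first_disagreements_hits:
  "first_disagreements X s q g h = hits (\<lambda>i. s < i \<and> g (X i) \<noteq> h (X i)) q"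
proof -
  have "{i'. s < i' \<and> i' < i \<and> g (X i') \<noteq> h (X i')} = {i'. i' < i \<and> s < i' \<and> g (X i') \<noteq> h (X i')}" for i by auto
  then show ?thesis by (auto simp: first_disagreements_def hits_def)
qed

lemma pred_test:
  assumes X: "\<And>i. X i \<in> measurable N M"
  shows "Measurable.pred N (\<lambda>\<omega>. test (\<lambda>i. X i \<omega>) s q (hyp (\<lambda>i. X i \<omega>) l1) (hyp (\<lambda>i. X i \<omega>) l2))"
proof -
  define D where "D \<omega> i \<longleftrightarrow> s < i \<and> hyp (\<lambda>i. X i \<omega>) l1 (X i \<omega>) \<noteq> hyp (\<lambda>i. X i \<omega>) l2 (X i \<omega>)" for \<omega> i
  define E where "E \<omega> i \<longleftrightarrow> i \<in> hits (D \<omega>) q" for \<omega> i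
  note [measurable] = pred_hyp[OF X X] X
  have D[measurable]: "Measurable.pred N (\<lambda>\<omega>. D \<omega> i)" for i unfolding D_def by measurable
  have [measurable]: "(\<lambda>\<omega>. card {i'\<in>{..<i}. D \<omega> i'}) \<in> measurable N (count_space UNIV)" for i
    by (intro measurable_card_Collect D) simp
  have "Measurable.pred N (\<lambda>\<omega>. D \<omega> i \<and> card {i'\<in>{..<i}. D \<omega> i'} < q)" for i by measurable
  then have E[measurable]: "Measurable.pred N (\<lambda>\<omega>. E \<omega> i)" for i by (simp add: E_def hits_def)
  have fE: "finite {i. E \<omega> i}" for \<omega> using hits_finite[of "D \<omega>" q] by (simp add: E_def)
  have "(\<lambda>\<omega>. {i\<in>UNIV. E \<omega> i}) \<in> measurable N (count_space UNIV)"
    by (rule measurable_Collect_finite) (use fE E in simp_all)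
  then have c1: "(\<lambda>\<omega>. card {i\<in>UNIV. E \<omega> i}) \<in> measurable N (count_space UNIV)"
    using measurable_count_space by (rule measurable_compose)
  have "(\<lambda>\<omega>. {i\<in>UNIV. E \<omega> i \<and> hyp (\<lambda>i. X i \<omega>) l2 (X i \<omega>) \<noteq> f (X i \<omega>)}) \<in> measurable N (count_space UNIV)"
  proof (rule measurable_Collect_finite)
    show "Measurable.pred N (\<lambda>\<omega>. E \<omega> i \<and> hyp (\<lambda>i. X i \<omega>) l2 (X i \<omega>) \<noteq> f (X i \<omega>))" for i by measurable
    show "finite {i \<in> UNIV. E \<omega> i \<and> hyp (\<lambda>i. X i \<omega>) l2 (X i \<omega>) \<noteq> f (X i \<omega>)}" for \<omega>
      using fE[of \<omega>] by (rule rev_finite_subset) auto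
  qed simp
  then have c2: "(\<lambda>\<omega>. card {i\<in>UNIV. E \<omega> i \<and> hyp (\<lambda>i. X i \<omega>) l2 (X i \<omega>) \<noteq> f (X i \<omega>)}) \<in> measurable N (count_space UNIV)"
    using measurable_count_space by (rule measurable_compose)
  have D_eq: "hits (\<lambda>i. s < i \<and> hyp (\<lambda>i. X i \<omega>) l1 (X i \<omega>) \<noteq> hyp (\<lambda>i. X i \<omega>) l2 (X i \<omega>)) q = {i. E \<omega> i}" for \<omega>
    by (simp add: E_def D_def[abs_def])
  have "test (\<lambda>i. X i \<omega>) s q (hyp (\<lambda>i. X i \<omega>) l1) (hyp (\<lambda>i. X i \<omega>) l2) \<longleftrightarrow>
     12 * card {i\<in>UNIV. E \<omega> i \<and> hyp (\<lambda>i. X i \<omega>) l2 (X i \<omega>) \<noteq> f (X i \<omega>)} \<le> 7 * card {i\<in>UNIV. E \<omega> i}" for \<omega>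
    unfolding test_def first_disagreements_hits D_eq by (subst empirical_err_le[OF fE]) simp
  moreover have "Measurable.pred N (\<lambda>\<omega>. (\<lambda>a b. 12 * a \<le> 7 * b) (card {i\<in>UNIV. E \<omega> i \<and> hyp (\<lambda>i. X i \<omega>) l2 (X i \<omega>) \<noteq> f (X i \<omega>)})
      (card {i\<in>UNIV. E \<omega> i}))"
    by (rule measurable_compose_countable[OF measurable_compose_countable[OF _ c1] c2]) simp
  ultimately show ?thesis by (simp only:)
qed

lemma pred_misjudged:
  assumes X: "\<And>i. X i \<in> measurable N M"
  shows "Measurable.pred N (\<lambda>\<omega>. misjudged (\<lambda>i. X i \<omega>) s q (hyp (\<lambda>i. X i \<omega>) l1) (hyp (\<lambda>i. X i \<omega>) l2))"
proof -
  note [measurable] = pred_test[OF X] measurable_err_hyp[OF X]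
  show ?thesis unfolding misjudged_def by measurable
qed

lemma measurable_map_countable:
  fixes g :: "nat \<Rightarrow> 'b \<Rightarrow> 'c :: countable"
  assumes "\<And>k. g k \<in> measurable N (count_space UNIV)"
  shows "(\<lambda>\<omega>. map (\<lambda>k. g k \<omega>) [0..<n]) \<in> measurable N (count_space UNIV)"
proof (induction n)
  case (Suc n)
  have "(\<lambda>\<omega>. (\<lambda>l y. l @ [y]) (map (\<lambda>k. g k \<omega>) [0..<n]) (g n \<omega>)) \<in> measurable N (count_space UNIV)"
    by (rule measurable_compose_countable[OF measurable_compose_countable[OF _ assms] Suc]) simp
  then show ?case by simp
qed simp

lemma measurable_err_select:
  assumes X: "\<And>i. X i \<in> measurable N M"
  shows "(\<lambda>\<omega>. err P f (active_select (\<lambda>i. X i \<omega>) (\<lambda>i. f (X i \<omega>)) s m b (\<lambda>k. hyp (\<lambda>i. X i \<omega>) (Ls k)))) \<in> borel_measurable N"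
proof -
  define K where "K \<omega> = {k\<in>{1..m}. \<forall>j\<in>{1..<k}. test (\<lambda>i. X i \<omega>) s (budget m b j) (hyp (\<lambda>i. X i \<omega>) (Ls j)) (hyp (\<lambda>i. X i \<omega>) (Ls k))}" for \<omega>
  have "K \<in> measurable N (count_space UNIV)"
    unfolding K_def by (intro measurable_Collect_finite pred_intros_finite(3) pred_test X) (auto intro: countable_finite)
  then have Max: "(\<lambda>\<omega>. Max (K \<omega>)) \<in> measurable N (count_space UNIV)" by (rule measurable_compose) simp
  have "(\<lambda>\<omega>. err P f (hyp (\<lambda>i. X i \<omega>) (Ls (Max (K \<omega>))))) \<in> borel_measurable N"
    by (rule measurable_compose_countable[OF measurable_err_hyp[OF X] Max])
  then show ?thesis by (simp add: active_select_def K_def test_def budget_def Let_def)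
qed

text \<open>The list of the codes of all rounds takes countably many values. Once it is fixed, the
  candidates and the starting position of the selection are explicit in terms of
  \<open>X\<close>.\<close>

lemma measurable_err_meta:
  "(\<lambda>\<omega>. err P f (meta_algorithm M C (halving_learner C) n \<omega> (\<lambda>i. f (fst \<omega> i)))) \<in> borel_measurable \<Omega>"
proof -
  let ?X = "\<lambda>\<omega> :: 'a source. \<lambda>i. fst \<omega> i" and ?W1 = "\<lambda>\<omega> :: 'a source. \<lambda>i. fst (snd \<omega>) i" and ?W2 = "\<lambda>\<omega> :: 'a source. \<lambda>i. fst (snd (snd \<omega>)) i"
  define R where "R \<omega> = map (\<lambda>k. rounds_code (?X \<omega>) (?W1 \<omega>) (?W2 \<omega>) n k) [0..<Suc (Suc d)]" for \<omega>
  have R: "R \<in> measurable \<Omega> (count_space UNIV)"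
    unfolding R_def by (intro measurable_map_countable measurable_rounds_code measurable_source)
  have "(\<lambda>\<omega>. err P f (active_select (?X \<omega>) (\<lambda>i. f (?X \<omega> i)) (fst (snd (R \<omega> ! Suc d))) (Suc d) (n div 3)
      (\<lambda>k. hyp (?X \<omega>) (snd (snd (snd (snd (R \<omega> ! k)))))))) \<in> borel_measurable \<Omega>"
    by (rule measurable_compose_countable[OF measurable_err_select[OF measurable_source(4)] R])
  moreover have "err P f (active_select (?X \<omega>) (\<lambda>i. f (?X \<omega> i)) (fst (snd (R \<omega> ! Suc d))) (Suc d) (n div 3)
      (\<lambda>k. hyp (?X \<omega>) (snd (snd (snd (snd (R \<omega> ! k))))))) =
      err P f (meta_algorithm M C (halving_learner C) n \<omega> (\<lambda>i. f (fst \<omega> i)))" for \<omega>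
  proof -
    \<comment> \<open>Selection reads only the candidates 1 to m. This matters because list entries
      beyond \<open>Suc d\<close> are unspecified.\<close>
    have hs: "active_select X Y s m b hs = active_select X Y s m b hs'" if "\<And>k. k \<le> m \<Longrightarrow> hs k = hs' k" "m \<ge> 1"
      for X Y s m b and hs hs' :: "nat \<Rightarrow> 'a \<Rightarrow> bool"
    proof -
      have K: "{k\<in>{1..m}. \<forall>j\<in>{1..<k}. empirical_err X Y (first_disagreements X s (budget m b j) (hs j) (hs k)) (hs k) \<le> 7/12} =
        {k\<in>{1..m}. \<forall>j\<in>{1..<k}. empirical_err X Y (first_disagreements X s (budget m b j) (hs' j) (hs' k)) (hs' k) \<le> 7/12}" (is "?K = ?K'")
        using that by auto
      have "1 \<in> ?K'" using that by auto
      then have "Max ?K' \<in> ?K'" by (intro Max_in) auto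
      then have "Max ?K' \<le> m" by auto
      then show ?thesis using K that(1)[of "Max ?K'"] by (simp add: active_select_def Let_def budget_def[symmetric])
    qed
    obtain X W1 W2 U where w: "\<omega> = (X, W1, W2, U)" by (cases \<omega>) auto
    have Rk: "R \<omega> ! k = rounds_code X W1 W2 n k" if "k \<le> Suc d" for k
      using that unfolding R_def w by (subst nth_map) (auto simp del: upt_Suc)
    have "fst (snd (R \<omega> ! Suc d)) = pos (fin X W1 W2 n (Suc d))" by (simp add: Rk fin_decode used_decode)
    moreover have "active_select X (lab X) s (Suc d) b (\<lambda>k. hyp X (snd (snd (snd (snd (R \<omega> ! k)))))) =
        active_select X (lab X) s (Suc d) b (Hk X W1 W2 n)" for s b
      by (rule hs) (simp_all add: Rk Hk_code)
    ultimately show ?thesis unfolding w fst_conv meta_algorithm_eq by (simp only:)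
  qed
  ultimately show ?thesis by (simp only:)
qed

section \<open>Freshness of the points after a stage\<close>

definition rest :: "((nat \<Rightarrow> 'a) \<times> (nat \<Rightarrow> 'a) \<times> (nat \<Rightarrow> real)) measure" where
  "rest = S \<Otimes>\<^sub>M S \<Otimes>\<^sub>M Pi\<^sub>M (UNIV :: nat set) (\<lambda>_. seed_measure)"

lemma \<Omega>_rest: "\<Omega> = S \<Otimes>\<^sub>M rest"
  by (simp add: source_measure_def rest_def)

lemma prob_space_rest: "prob_space rest"
  unfolding rest_def by (intro prob_space_pair prob_space_S prob_space_seeds)

lemma pos_mono: "pos (fin X W1 W2 n k) \<le> pos (mid X W1 W2 n (Suc k))" "pos (mid X W1 W2 n (Suc k)) \<le> pos (fin X W1 W2 n (Suc k))"
proof -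
  show "pos (fin X W1 W2 n k) \<le> pos (mid X W1 W2 n (Suc k))"
    unfolding mid_def using explored_causal(1) by simp
  show "pos (mid X W1 W2 n (Suc k)) \<le> pos (fin X W1 W2 n (Suc k))"
    unfolding fin_Suc
    by (rule funpow_causal(2)[where X = X and X' = X and g' = "collect_step X W2 (lab X) (Suc k) (Tk X W1 W2 n (Suc k))"])
      (simp_all add: collect_step_causal(1))
qed

lemma pos_fin_mono: "k \<le> k' \<Longrightarrow> pos (fin X W1 W2 n k) \<le> pos (fin X W1 W2 n k')"
proof (induction k' rule: dec_induct)
  case (step m)
  then show ?case using pos_mono[of X W1 W2 n m] by linarith
qed simp

lemma comb_agrees: "i \<le> t \<Longrightarrow> X i = comb_seq (Suc t) X X' i"
  by (simp add: comb_seq_def)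

text \<open>With \<open>W1\<close> and \<open>W2\<close> fixed, candidates and final position are
  determined by the points up to that position, so the test sees a fresh sequence and
  \<open>misjudged_prob\<close> applies with the past fixed.\<close>

lemma select_misjudged_prob:
  assumes jk: "j \<le> N" "k \<le> N"
  shows "emeasure \<Omega> {\<omega>\<in>space \<Omega>. case \<omega> of (X, W1, W2, U) \<Rightarrow>
     misjudged X (pos (fin X W1 W2 n N)) q (Hk X W1 W2 n j) (Hk X W1 W2 n k)} \<le> ennreal (exp (- rate * q))"
    (is "emeasure \<Omega> {\<omega>\<in>space \<Omega>. ?Q \<omega>} \<le> _")
    and "Measurable.pred \<Omega> (\<lambda>(X, W1, W2, U). misjudged X (pos (fin X W1 W2 n N)) q (Hk X W1 W2 n j) (Hk X W1 W2 n k))"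
proof -
  let ?R = "\<lambda>\<omega> :: 'a source. \<lambda>k. rounds_code (fst \<omega>) (fst (snd \<omega>)) (fst (snd (snd \<omega>))) n k"
  have R: "(\<lambda>\<omega>. ?R \<omega> k) \<in> measurable \<Omega> (count_space UNIV)" for k
    using measurable_rounds_code[OF measurable_source(4-6)] .
  have "Measurable.pred \<Omega> (\<lambda>\<omega>. misjudged (fst \<omega>) (fst (snd (?R \<omega> N))) q
      (hyp (fst \<omega>) (snd (snd (snd (snd (?R \<omega> j)))))) (hyp (fst \<omega>) (snd (snd (snd (snd (?R \<omega> k)))))))"
    by (rule measurable_compose_countable[OF measurable_compose_countable[OF measurable_compose_countable[OF
          pred_misjudged[OF measurable_source(4)] R] R] R])
  then show Qm: "Measurable.pred \<Omega> ?Q"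
    by (simp add: case_prod_beta Hk_code fin_decode used_decode)
  define \<tau> where "\<tau> = (\<lambda>(X, W1, W2, U :: nat \<Rightarrow> real). pos (fin X W1 W2 n N))"
  have \<tau>_eq: "\<tau> \<omega> = fst (snd (?R \<omega> N))" for \<omega>
    by (simp add: \<tau>_def case_prod_beta fin_decode used_decode)
  have "\<tau> \<in> measurable \<Omega> (count_space UNIV)"
    unfolding \<tau>_eq by (rule measurable_compose[OF R]) simp
  then have \<tau>_meas: "\<tau> \<in> measurable (S \<Otimes>\<^sub>M rest) (count_space UNIV)" by (simp only: \<Omega>_rest)
  have "emeasure \<Omega> {\<omega>\<in>space \<Omega>. ?Q \<omega>} = (\<integral>\<^sup>+\<omega>. indicator {\<omega>. ?Q \<omega>} \<omega> \<partial>\<Omega>)"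
    by (rule emeasure_pred[OF Qm])
  also have "\<dots> \<le> ennreal (exp (- rate * q))"
    unfolding \<Omega>_rest
  proof (rule nn_integral_restart[OF prob_space_rest \<tau>_meas])
    fix X X' :: "nat \<Rightarrow> 'a" and y :: "(nat \<Rightarrow> 'a) \<times> (nat \<Rightarrow> 'a) \<times> (nat \<Rightarrow> real)"
    obtain W1 W2 U where y: "y = (W1, W2, U)" by (cases y) auto
    assume "\<And>i. i \<le> \<tau> (X, y) \<Longrightarrow> X i = X' i"
    then show "\<tau> (X', y) = \<tau> (X, y)" using rounds_causal(1)[of X W1 W2 n N X'] by (simp add: \<tau>_def y)
  next
    have "(\<lambda>\<omega>. indicator {\<omega>. ?Q \<omega>} \<omega> :: ennreal) \<in> borel_measurable (S \<Otimes>\<^sub>M rest)"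
      using Qm unfolding \<Omega>_rest by (intro borel_measurable_indicator') (simp add: pred_def)
    then show "(indicator {\<omega>. ?Q \<omega>} :: _ \<Rightarrow> ennreal) \<in> borel_measurable (S \<Otimes>\<^sub>M rest)" by simp
  next
    fix X y assume X: "X \<in> space S" and ys: "y \<in> space rest"
    obtain W1 W2 U where y: "y = (W1, W2, U)" by (cases y) auto
    let ?t = "pos (fin X W1 W2 n N)"
    have fin: "fin (comb_seq (Suc ?t) X X') W1 W2 n k = fin X W1 W2 n k" if "k \<le> N" for X' k
      using rounds_causal(1)[of X W1 W2 n k "comb_seq (Suc ?t) X X'"] pos_fin_mono[OF that, of X W1 W2 n]
        comb_agrees[of _ ?t X X'] by auto
    have "(\<integral>\<^sup>+X'. indicator {\<omega>. ?Q \<omega>} (comb_seq (Suc (\<tau> (X, y))) X X', y) \<partial>S) =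
      (\<integral>\<^sup>+X'. indicator {X'. misjudged (comb_seq (Suc ?t) X X') ?t q (Hk X W1 W2 n j) (Hk X W1 W2 n k)} X' \<partial>S)"
      by (intro nn_integral_cong) (simp add: \<tau>_def y Hk_def fin jk indicator_def)
    also have "\<dots> = emeasure S {X'\<in>space S. misjudged (comb_seq (Suc ?t) X X') ?t q (Hk X W1 W2 n j) (Hk X W1 W2 n k)}"
    proof (rule emeasure_pred[symmetric])
      have "Measurable.pred S (\<lambda>X'. ?Q (comb_seq (Suc ?t) X X', y))"
      proof (rule measurable_compose[OF _ Qm[unfolded \<Omega>_rest]])
        show "(\<lambda>X'. (comb_seq (Suc ?t) X X', y)) \<in> measurable S (S \<Otimes>\<^sub>M rest)"
          using X ys by (intro measurable_Pair measurable_comb_seq') auto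
      qed
      then show "Measurable.pred S (\<lambda>X'. misjudged (comb_seq (Suc ?t) X X') ?t q (Hk X W1 W2 n j) (Hk X W1 W2 n k))"
        unfolding y prod.case Hk_def fin[OF jk(1)] fin[OF jk(2)] fin[OF order_refl] .
    qed
    also have "\<dots> \<le> ennreal (exp (- rate * q))"
      by (intro misjudged_prob Hk_classifier space_S[OF X])
    finally show "(\<integral>\<^sup>+X'. indicator {\<omega>. ?Q \<omega>} (comb_seq (Suc (\<tau> (X, y))) X X', y) \<partial>S) \<le> ennreal (exp (- rate * q))" .
  qed
  finally show "emeasure \<Omega> {\<omega>\<in>space \<Omega>. ?Q \<omega>} \<le> ennreal (exp (- rate * q))" .
qed

text \<open>The number of points processed by the second loop of round \<open>k\<close>, and the learner on correctly
  labeled copies of these points.\<close>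

definition Jk :: "(nat \<Rightarrow> 'a) \<Rightarrow> (nat \<Rightarrow> 'a) \<Rightarrow> (nat \<Rightarrow> 'a) \<Rightarrow> nat \<Rightarrow> nat \<Rightarrow> nat" where
  "Jk X W1 W2 n k = n_collect W1 W2 k (Tk X W1 W2 n k) (mid X W1 W2 n k)"

definition ideal :: "(nat \<Rightarrow> 'a) \<Rightarrow> (nat \<Rightarrow> 'a) \<Rightarrow> (nat \<Rightarrow> 'a) \<Rightarrow> nat \<Rightarrow> nat \<Rightarrow> 'a \<Rightarrow> bool" where
  "ideal X W1 W2 n k = halving_learner C 0 (map (\<lambda>i. (X i, f (X i)))
     [Suc (pos (mid X W1 W2 n k))..<Suc (pos (mid X W1 W2 n k) + Jk X W1 W2 n k)])"

lemma measurable_mid: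
  "(\<lambda>\<omega>. pos (mid (fst \<omega>) (fst (snd \<omega>)) (fst (snd (snd \<omega>))) n k)) \<in> measurable \<Omega> (count_space UNIV)"
  unfolding mid_decode used_decode
  by (rule measurable_compose[OF measurable_mid_code[OF measurable_source(4-6)]]) simp

lemma measurable_Tk:
  "(\<lambda>\<omega>. Tk (fst \<omega>) (fst (snd \<omega>)) (fst (snd (snd \<omega>))) n k) \<in> measurable \<Omega> (count_space UNIV)"
  unfolding Tk_code by (rule measurable_compose[OF measurable_rounds_code[OF measurable_source(4-6)]]) simp

lemma measurable_Jk:
  "(\<lambda>\<omega>. Jk (fst \<omega>) (fst (snd \<omega>)) (fst (snd (snd \<omega>))) n k) \<in> measurable \<Omega> (count_space UNIV)"
  unfolding Jk_def mid_decode decode_n_collect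
  by (rule measurable_compose_countable[OF measurable_compose_countable[OF measurable_n_collect_code[OF measurable_source(4-6)] measurable_Tk]
        measurable_mid_code[OF measurable_source(4-6)]])

lemma mid_causal:
  assumes k: "k \<ge> 1" and ag: "\<And>i. i \<le> pos (mid X W1 W2 n k) \<Longrightarrow> X i = X' i"
  shows "mid X' W1 W2 n k = mid X W1 W2 n k" "Tk X' W1 W2 n k = Tk X W1 W2 n k" "Jk X' W1 W2 n k = Jk X W1 W2 n k"
proof -
  obtain k' where k': "k = Suc k'" using k by (cases k) auto
  then show "mid X' W1 W2 n k = mid X W1 W2 n k" "Tk X' W1 W2 n k = Tk X W1 W2 n k"
    using rounds_causal(2)[of X W1 W2 n k' X'] ag by auto
  then show "Jk X' W1 W2 n k = Jk X W1 W2 n k" by (simp add: Jk_def)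
qed

lemma measurable_err_ideal:
  "(\<lambda>\<omega>. err P f (ideal (fst \<omega>) (fst (snd \<omega>)) (fst (snd (snd \<omega>))) n k)) \<in> borel_measurable \<Omega>"
proof -
  have 1: "(\<lambda>\<omega>. err P f (halving_learner C 0 (map (\<lambda>i. (fst \<omega> i, f (fst \<omega> i))) [Suc p..<Suc (p + J)]))) \<in> borel_measurable \<Omega>" for p J
  proof -
    have "map (\<lambda>i. (X i, f (X i))) [Suc p..<Suc (p + J)] = map (\<lambda>i. (X (Suc p + i), f (X (Suc p + i)))) [0..<J]" for X :: "nat \<Rightarrow> 'a"
      by (rule nth_equalityI) (auto simp del: upt_Suc)
    moreover have "Measurable.pred (\<Omega> \<Otimes>\<^sub>M P) (\<lambda>q. halving_learner C 0 (map (\<lambda>i. (fst (fst q) (Suc p + i), f (fst (fst q) (Suc p + i)))) [0..<J]) (snd q))"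
    proof (rule pred_halving_learner)
      show m: "(\<lambda>q. fst (fst q) (Suc p + i)) \<in> measurable (\<Omega> \<Otimes>\<^sub>M P) M" for i
        using measurable_compose[OF measurable_fst measurable_source(4)] .
      show "Measurable.pred (\<Omega> \<Otimes>\<^sub>M P) (\<lambda>q. f (fst (fst q) (Suc p + i)))" for i
        using measurable_compose[OF m f_measurable] .
    qed simp
    moreover have "Measurable.pred (\<Omega> \<Otimes>\<^sub>M P) (\<lambda>q. f (snd q))" by measurable
    ultimately have "Measurable.pred (\<Omega> \<Otimes>\<^sub>M P) (\<lambda>q. halving_learner C 0 (map (\<lambda>i. (fst (fst q) i, f (fst (fst q) i))) [Suc p..<Suc (p + J)]) (snd q) \<noteq> f (snd q))"
      by simp
    then have "{q \<in> space (\<Omega> \<Otimes>\<^sub>M P). snd q \<in> {x\<in>space P. halving_learner C 0 (map (\<lambda>i. (fst (fst q) i, f (fst (fst q) i))) [Suc p..<Suc (p + J)]) x \<noteq> f x}} \<in> sets (\<Omega> \<Otimes>\<^sub>M P)"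
      by (auto simp: pred_def space_pair_measure elim!: back_subst[of "\<lambda>A. A \<in> sets _"])
    then show ?thesis unfolding err_def by (intro P.measurable_measure) auto
  qed
  show ?thesis unfolding ideal_def
    by (rule measurable_compose_countable[OF measurable_compose_countable[OF 1 measurable_Jk] measurable_mid])
qed

text \<open>The length of the second loop is determined by the state at its start, so its points are
  a fresh i.i.d. sample of known size. Correct labels are built into \<open>ideal\<close>; that the
  algorithm obtains them is shown separately.\<close>

lemma ideal_error:
  assumes k: "k \<ge> 1" and \<delta>: "\<And>J :: nat. J \<ge> J0 \<Longrightarrow> 2 * d * log 2 (J + 2) / (J + 1) \<le> \<delta>"
  shows "(\<integral>\<^sup>+\<omega>. (case \<omega> of (X, W1, W2, U) \<Rightarrow> ennreal (err P f (ideal X W1 W2 n k)) * indicator {J0..} (Jk X W1 W2 n k)) \<partial>\<Omega>) \<le> ennreal \<delta>"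
proof -
  define \<tau> where "\<tau> = (\<lambda>(X, W1, W2, U :: nat \<Rightarrow> real). pos (mid X W1 W2 n k))"
  define g where "g = (\<lambda>(X, W1, W2, U :: nat \<Rightarrow> real). ennreal (err P f (ideal X W1 W2 n k)) * indicator {J0..} (Jk X W1 W2 n k))"
  have "\<tau> \<in> measurable \<Omega> (count_space UNIV)"
    unfolding \<tau>_def case_prod_beta by (rule measurable_mid)
  then have \<tau>_meas: "\<tau> \<in> measurable (S \<Otimes>\<^sub>M rest) (count_space UNIV)" by (simp only: \<Omega>_rest)
  have g: "g \<in> borel_measurable \<Omega>"
  proof -
    have "(\<lambda>\<omega>. indicator {J0..} (Jk (fst \<omega>) (fst (snd \<omega>)) (fst (snd (snd \<omega>))) n k) :: ennreal) \<in> borel_measurable \<Omega>"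
      by (rule measurable_compose[OF measurable_Jk]) simp
    then show ?thesis unfolding g_def case_prod_beta
      by (intro borel_measurable_times_ennreal measurable_compose[OF measurable_err_ideal measurable_ennreal])
  qed
  have "(\<integral>\<^sup>+\<omega>. g \<omega> \<partial>(S \<Otimes>\<^sub>M rest)) \<le> ennreal \<delta>"
  proof (rule nn_integral_restart[OF prob_space_rest \<tau>_meas])
    fix X X' :: "nat \<Rightarrow> 'a" and y :: "(nat \<Rightarrow> 'a) \<times> (nat \<Rightarrow> 'a) \<times> (nat \<Rightarrow> real)"
    obtain W1 W2 U where y: "y = (W1, W2, U)" by (cases y) auto
    assume "\<And>i. i \<le> \<tau> (X, y) \<Longrightarrow> X i = X' i"
    then show "\<tau> (X', y) = \<tau> (X, y)" using mid_causal(1)[OF k, of X W1 W2 n X'] by (simp add: \<tau>_def y)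
  next
    show "g \<in> borel_measurable (S \<Otimes>\<^sub>M rest)" using g by (simp only: \<Omega>_rest)
  next
    fix X y assume X: "X \<in> space S" and ys: "y \<in> space rest"
    obtain W1 W2 U where y: "y = (W1, W2, U)" by (cases y) auto
    let ?t = "pos (mid X W1 W2 n k)" and ?J = "Jk X W1 W2 n k"
    have mid: "mid (comb_seq (Suc ?t) X X') W1 W2 n k = mid X W1 W2 n k" "Jk (comb_seq (Suc ?t) X X') W1 W2 n k = ?J" for X'
      using mid_causal[OF k, of X W1 W2 n "comb_seq (Suc ?t) X X'"] comb_agrees[of _ ?t X X'] by auto
    have id: "ideal (comb_seq (Suc ?t) X X') W1 W2 n k = halving_learner C 0 (map (\<lambda>i. (X' i, f (X' i))) [0..<?J])" for X'
    proof -
      have "map (\<lambda>i. (comb_seq (Suc ?t) X X' i, f (comb_seq (Suc ?t) X X' i))) [Suc ?t..<Suc (?t + ?J)] = map (\<lambda>i. (X' i, f (X' i))) [0..<?J]"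
        using comb_seq_add[of "Suc ?t" X X'] by (intro nth_equalityI) (auto simp: add.commute simp del: upt_Suc)
      then show ?thesis by (simp only: ideal_def mid)
    qed
    show "(\<integral>\<^sup>+X'. g (comb_seq (Suc (\<tau> (X, y))) X X', y) \<partial>S) \<le> ennreal \<delta>"
    proof (cases "J0 \<le> ?J")
      case True
      have "(\<integral>\<^sup>+X'. g (comb_seq (Suc (\<tau> (X, y))) X X', y) \<partial>S) =
        (\<integral>\<^sup>+X'. emeasure P {x\<in>space P. halving_learner C 0 (map (\<lambda>i. (X' i, f (X' i))) [0..<?J]) x \<noteq> f x} \<partial>S)"
        by (intro nn_integral_cong) (simp add: g_def \<tau>_def y id mid True err_def P.emeasure_eq_measure)
      also have "\<dots> \<le> ennreal (2 * d * log 2 (?J + 2) / (?J + 1))" using halving_error[of 0 ?J] by (simp only: of_nat_add of_nat_mult of_nat_numeral of_nat_1)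
      also have "\<dots> \<le> ennreal \<delta>" using \<delta>[OF True] by (rule ennreal_leI)
      finally show ?thesis .
    qed (simp add: g_def \<tau>_def y mid)
  qed
  then show ?thesis by (simp add: g_def \<Omega>_rest)
qed

end

section \<open>Exceptional events\<close>

lemma power_le_fact_exp: "0 \<le> x \<Longrightarrow> x ^ m \<le> fact m * exp (x :: real)"
proof -
  assume x: "0 \<le> x"
  have "(\<Sum>k\<in>{m}. x ^ k /\<^sub>R fact k) \<le> exp x"
    unfolding exp_def by (rule sum_le_suminf[OF summable_exp_generic]) (use x in auto)
  then show ?thesis by (simp add: divide_inverse[symmetric] field_simps)
qed

context target
begin

text \<open>Bounds on outer measure: the exceptional events below need not be shown measurable.\<close>

definition covered :: "'a source set \<Rightarrow> real \<Rightarrow> bool" where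
  "covered B p \<longleftrightarrow> (\<exists>N\<in>sets \<Omega>. B \<subseteq> N \<and> emeasure \<Omega> N \<le> ennreal p)"

lemma covered_mono: "covered B p \<Longrightarrow> A \<subseteq> B \<Longrightarrow> p \<le> q \<Longrightarrow> covered A q"
  unfolding covered_def by (meson ennreal_leI order_trans)

lemma coveredI:
  assumes "Measurable.pred \<Omega> Q" "emeasure \<Omega> {\<omega>\<in>space \<Omega>. Q \<omega>} \<le> ennreal p"
  shows "covered {\<omega>\<in>space \<Omega>. Q \<omega>} p"
  unfolding covered_def using assms by (intro bexI[of _ "{\<omega>\<in>space \<Omega>. Q \<omega>}"]) (auto simp: pred_def)

lemma covered_UN_countable:
  assumes "\<And>i::nat. covered (B i) (p i)" "\<And>i. 0 \<le> p i" "p sums s"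
  shows "covered (\<Union>i. B i) s"
proof -
  obtain N where N: "\<And>i. N i \<in> sets \<Omega>" "\<And>i. B i \<subseteq> N i" "\<And>i. emeasure \<Omega> (N i) \<le> ennreal (p i)"
    using assms(1) unfolding covered_def by metis
  have "emeasure \<Omega> (\<Union>i. N i) \<le> (\<Sum>i. emeasure \<Omega> (N i))"
    using N(1) by (intro emeasure_subadditive_countably) auto
  also have "\<dots> \<le> (\<Sum>i. ennreal (p i))" by (intro suminf_le N(3)) auto
  also have "\<dots> = ennreal s" using assms(2,3) by (simp add: suminf_ennreal2 sums_iff)
  finally show ?thesis unfolding covered_def using N(1,2) by (intro bexI[of _ "\<Union>i. N i"]) auto
qed

lemma covered_empty: "covered {} 0"
  unfolding covered_def by (intro bexI[of _ "{}"]) auto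

lemma covered_Un:
  assumes "covered A p" "covered B q" "0 \<le> p" "0 \<le> q"
  shows "covered (A \<union> B) (p + q)"
proof -
  obtain N1 N2 where N: "N1 \<in> sets \<Omega>" "N2 \<in> sets \<Omega>" "A \<subseteq> N1" "B \<subseteq> N2" "emeasure \<Omega> N1 \<le> ennreal p" "emeasure \<Omega> N2 \<le> ennreal q"
    using assms(1,2) unfolding covered_def by auto
  have "emeasure \<Omega> (N1 \<union> N2) \<le> emeasure \<Omega> N1 + emeasure \<Omega> N2" using N by (intro emeasure_subadditive)
  also have "\<dots> \<le> ennreal p + ennreal q" using N by (intro add_mono)
  also have "\<dots> = ennreal (p + q)" using assms by simp
  finally show ?thesis unfolding covered_def using N by (intro bexI[of _ "N1 \<union> N2"]) auto
qed

lemma covered_UN: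
  assumes "finite I" "\<And>i. i \<in> I \<Longrightarrow> covered (B i) (p i)" "\<And>i. i \<in> I \<Longrightarrow> 0 \<le> p i"
  shows "covered (\<Union>i\<in>I. B i) (\<Sum>i\<in>I. p i)"
  using assms by (induction I rule: finite_induct) (auto intro!: covered_empty covered_Un sum_nonneg)

definition rare :: "(nat \<Rightarrow> 'a source set) \<Rightarrow> bool" where
  "rare B \<longleftrightarrow> (\<exists>K g. 0 \<le> K \<and> 0 < g \<and> (\<forall>n. covered (B n) (K * exp (- g * real n))))"

lemma rareI: "0 \<le> K \<Longrightarrow> 0 < g \<Longrightarrow> (\<And>n. covered (B n) (K * exp (- g * real n))) \<Longrightarrow> rare B"
  unfolding rare_def by blast

lemma rare_mono: "rare B \<Longrightarrow> (\<And>n. A n \<subseteq> B n) \<Longrightarrow> rare A"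
  unfolding rare_def by (meson covered_mono order_refl)

lemma rare_empty: "rare (\<lambda>n. {})"
  by (rule rareI[of 1 1]) (auto intro: covered_mono[OF covered_empty])

lemma rare_Un:
  assumes "rare A" "rare B"
  shows "rare (\<lambda>n. A n \<union> B n)"
proof -
  obtain K1 g1 where 1: "0 \<le> K1" "0 < g1" "\<And>n. covered (A n) (K1 * exp (- g1 * real n))" using assms(1) by (auto simp: rare_def)
  obtain K2 g2 where 2: "0 \<le> K2" "0 < g2" "\<And>n. covered (B n) (K2 * exp (- g2 * real n))" using assms(2) by (auto simp: rare_def)
  show ?thesis
  proof (rule rareI[of "K1 + K2" "min g1 g2"])
    fix n :: nat
    have "K1 * exp (- g1 * real n) \<le> K1 * exp (- min g1 g2 * real n)" "K2 * exp (- g2 * real n) \<le> K2 * exp (- min g1 g2 * real n)"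
      using 1 2 by (auto intro!: mult_left_mono mult_right_mono)
    then show "covered (A n \<union> B n) ((K1 + K2) * exp (- min g1 g2 * real n))"
      by (intro covered_mono[OF covered_Un[OF 1(3) 2(3)]]) (use 1 2 in \<open>auto simp: algebra_simps\<close>)
  qed (use 1 2 in auto)
qed

lemma rare_UN:
  assumes "finite I" "\<And>i. i \<in> I \<Longrightarrow> rare (B i)"
  shows "rare (\<lambda>n. \<Union>i\<in>I. B i n)"
  using assms by (induction I rule: finite_induct) (auto intro!: rare_empty rare_Un)

text \<open>Half of the exponent makes the series over p converge; the other half, with p at least n
  / 6, gives the decay in n. The factor 6 is that of \<open>round_pos\<close>.\<close>

lemma covered_tail:
  assumes K: "0 \<le> K" "0 < g" and c: "\<And>p. p \<ge> 1 \<Longrightarrow> covered (B p) (K * exp (- g * real p))"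
  shows "covered (\<Union>p\<in>{p. 1 \<le> p \<and> n \<le> 6 * p}. B p) (K / (1 - exp (- g / 2)) * exp (- (g / 12) * real n))"
proof -
  have lt: "exp (- g / 2) < 1" using K by simp
  have "(\<lambda>p. exp (- g / 2) ^ p) sums (1 / (1 - exp (- g / 2)))" using lt by (intro geometric_sums) simp
  then have s: "(\<lambda>p. (K * exp (- (g / 12) * real n)) * exp (- g / 2) ^ p) sums ((K * exp (- (g / 12) * real n)) * (1 / (1 - exp (- g / 2))))"
    by (rule sums_mult)
  have "covered (\<Union>p. if 1 \<le> p \<and> n \<le> 6 * p then B p else {}) ((K * exp (- (g / 12) * real n)) * (1 / (1 - exp (- g / 2))))"
  proof (rule covered_UN_countable[OF _ _ s])
    fix p :: nat
    show "0 \<le> K * exp (- (g / 12) * real n) * exp (- g / 2) ^ p" using K by simp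
    show "covered (if 1 \<le> p \<and> n \<le> 6 * p then B p else {}) (K * exp (- (g / 12) * real n) * exp (- g / 2) ^ p)"
    proof (cases "1 \<le> p \<and> n \<le> 6 * p")
      case True
      have "real n \<le> 6 * real p" using True by linarith
      then have "- g * real p \<le> - (g / 12) * real n + real p * (- g / 2)"
        using K mult_left_mono[of "real n" "6 * real p" g] by (simp add: field_simps)
      then have "exp (- g * real p) \<le> exp (- (g / 12) * real n) * exp (- g / 2) ^ p"
        by (simp flip: exp_add exp_of_nat_mult)
      then have "K * exp (- g * real p) \<le> K * exp (- (g / 12) * real n) * exp (- g / 2) ^ p"
        using K by (simp add: mult.assoc mult_left_mono)
      then show ?thesis using True by (simp only: if_True) (intro covered_mono[OF c], auto)
    next
      case False
      then show ?thesis using K by (simp only: if_False) (intro covered_mono[OF covered_empty], auto)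
    qed
  qed
  then show ?thesis
    by (rule covered_mono) (auto split: if_splits)
qed

lemma rare_tail:
  assumes "0 \<le> K" "0 < g" and "\<And>p. p \<ge> 1 \<Longrightarrow> covered (B p) (K * exp (- g * real p))"
  shows "rare (\<lambda>n. \<Union>p\<in>{p. 1 \<le> p \<and> n \<le> 6 * p}. B p)"
  using assms by (intro rareI[of "K / (1 - exp (- g / 2))" "g / 12"] covered_tail) auto

lemma covered_X:
  assumes "N \<in> sets S" "emeasure S N \<le> ennreal p"
  shows "covered {\<omega>\<in>space \<Omega>. fst \<omega> \<in> N} p"
proof (rule coveredI)
  show m: "Measurable.pred \<Omega> (\<lambda>\<omega>. fst \<omega> \<in> N)"
    using assms(1) measurable_source(1) by (rule pred_sets2)
  show "emeasure \<Omega> {\<omega>\<in>space \<Omega>. fst \<omega> \<in> N} \<le> ennreal p"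
  proof (rule section_X[OF m])
    have "{X\<in>space S. X \<in> N} = N" using sets.sets_into_space[OF assms(1)] by auto
    then show "emeasure S {X\<in>space S. fst (X, W1, W2, U) \<in> N} \<le> ennreal p" for W1 W2 :: "nat \<Rightarrow> 'a" and U :: "nat \<Rightarrow> real"
      using assms(2) by simp
  qed
qed

abbreviation "Xc (\<omega> :: 'a source) \<equiv> fst \<omega>"
abbreviation "W1c (\<omega> :: 'a source) \<equiv> fst (snd \<omega>)"
abbreviation "W2c (\<omega> :: 'a source) \<equiv> fst (snd (snd \<omega>))"

lemma pred_core:
  assumes "\<And>i. i < j \<Longrightarrow> T i \<in> measurable N M"
  shows "Measurable.pred N (\<lambda>\<omega>. core j (\<lambda>i. T i \<omega>))"
  unfolding core_iff by (rule pred_intros_countable(1)) (rule pred_shatters_ball0[OF assms])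

text \<open>With \<open>W2\<close> fixed each core tuple is a fixed tuple, to which
  \<open>core_shattered_null\<close> applies; only countably many k, p and i occur.\<close>

lemma covered_cores: "covered {\<omega>\<in>space \<Omega>. \<not> cores_shattered (Xc \<omega>) (W2c \<omega>)} 0"
proof -
  define Q where "Q k p i \<omega> \<longleftrightarrow> core (k - 1) (sample_tuple (W2c \<omega>) k i) \<and> \<not> shatters (Vs (Xc \<omega>) p) (k - 1) (sample_tuple (W2c \<omega>) k i)" for k p i \<omega>
  have st: "(\<lambda>\<omega>. sample_tuple (W2c \<omega>) k i j) \<in> measurable \<Omega> M" for k i j
    using measurable_sample_tuple[OF measurable_source(6)] .
  have "covered {\<omega>\<in>space \<Omega>. Q k p i \<omega>} 0" for k p i
  proof (rule coveredI)
    have "Measurable.pred \<Omega> (\<lambda>\<omega>. core (k - 1) (\<lambda>j. sample_tuple (W2c \<omega>) k i j))" by (rule pred_core[OF st])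
    moreover have "Measurable.pred \<Omega> (\<lambda>\<omega>. shatters {h\<in>C. \<forall>i\<in>{1..p}. h (Xc \<omega> i) = f (Xc \<omega> i)} (k - 1) (\<lambda>j. sample_tuple (W2c \<omega>) k i j))"
      by (rule pred_shatters[OF _ measurable_source(4) measurable_compose[OF measurable_source(4) f_measurable] st]) simp
    ultimately show m: "Measurable.pred \<Omega> (Q k p i)" unfolding Q_def Vs_def by (intro pred_intros_logic(2,3))
    have "emeasure \<Omega> {\<omega>\<in>space \<Omega>. Q k p i \<omega>} \<le> 0"
    proof (rule section_X[OF m])
      fix W1 W2 U
      show "emeasure S {X\<in>space S. Q k p i (X, W1, W2, U)} \<le> 0"
        using core_shattered_null[of "k - 1" "sample_tuple W2 k i" p]
        by (cases "core (k - 1) (sample_tuple W2 k i)") (simp_all add: Q_def)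
    qed
    then show "emeasure \<Omega> {\<omega>\<in>space \<Omega>. Q k p i \<omega>} \<le> ennreal 0" by simp
  qed
  then have "covered (\<Union>i. {\<omega>\<in>space \<Omega>. Q k p i \<omega>}) 0" for k p by (rule covered_UN_countable) auto
  then have "covered (\<Union>p. \<Union>i. {\<omega>\<in>space \<Omega>. Q k p i \<omega>}) 0" for k by (rule covered_UN_countable) auto
  then have "covered (\<Union>k. \<Union>p. \<Union>i. {\<omega>\<in>space \<Omega>. Q k p i \<omega>}) 0" by (rule covered_UN_countable) auto
  then show ?thesis by (rule covered_mono) (auto simp: cores_shattered_def Q_def)
qed

section \<open>Estimator counts against population probabilities\<close>

lemma block_tuple: "i \<ge> 1 \<Longrightarrow> l < k - 1 \<Longrightarrow> block (k - 1) i W l = sample_tuple W k i l"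
  by (simp add: block_def sample_tuple_def)

lemma block_space: "W \<in> space S \<Longrightarrow> block j i W \<in> space (power_measure j P)"
  using measurable_space[OF measurable_block] by blast

lemma shatters_block: "i \<ge> 1 \<Longrightarrow> shatters H (k - 1) (block (k - 1) i W) = shatters H (k - 1) (sample_tuple W k i)"
  by (rule shatters_cong) (rule block_tuple)

lemma core_block: "i \<ge> 1 \<Longrightarrow> core (k - 1) (block (k - 1) i W) = core (k - 1) (sample_tuple W k i)"
  by (simp only: core_def shatters_block)

lemma link_block:
  assumes "i \<ge> 1"
  shows "shatters H k ((block (k - 1) i W)(k - 1 := x)) = shatters H k ((sample_tuple W k i)(k - 1 := x))"
proof (rule shatters_cong)
  fix l assume "l < k"
  then show "((block (k - 1) i W)(k - 1 := x)) l = ((sample_tuple W k i)(k - 1 := x)) l"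
    using block_tuple[OF assms, of l k W] by (cases "l = k - 1") auto
qed

context
  fixes k :: nat and \<alpha> r0 :: real
  assumes k: "k \<ge> 1" and \<alpha>: "\<alpha> = core_mass (k - 1)" "\<alpha> > 0" and r0: "r0 > 0" "shatter_mass (k - 1) r0 \<le> 101/100 * \<alpha>"
begin

private definition dev :: "nat \<Rightarrow> real" where "dev q = 2 * exp (- 2 * (\<alpha> / 100)\<^sup>2 * real (q ^ 3))"

private lemma covered_core_count:
  assumes q: "q \<ge> 1"
  shows "covered {\<omega>\<in>space \<Omega>. count_core (W2c \<omega>) k q < 99/100 * \<alpha> * real (q ^ 3)} (dev q)"
proof (rule coveredI)
  have st: "(\<lambda>\<omega>. sample_tuple (W2c \<omega>) k i j) \<in> measurable \<Omega> M" for i j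
    using measurable_sample_tuple[OF measurable_source(6)] .
  have "(\<lambda>\<omega>. card {i\<in>{1..q^3}. core (k - 1) (\<lambda>j. sample_tuple (W2c \<omega>) k i j)}) \<in> measurable \<Omega> (count_space UNIV)"
    by (intro measurable_card_Collect pred_core st) simp
  then have "Measurable.pred \<Omega> (\<lambda>\<omega>. (\<lambda>c. real c < 99/100 * \<alpha> * real (q ^ 3)) (card {i\<in>{1..q^3}. core (k - 1) (sample_tuple (W2c \<omega>) k i)}))"
    using measurable_count_space by (rule measurable_compose)
  then show m: "Measurable.pred \<Omega> (\<lambda>\<omega>. count_core (W2c \<omega>) k q < 99/100 * \<alpha> * real (q ^ 3))" by (simp only: count_core_def)
  show "emeasure \<Omega> {\<omega>\<in>space \<Omega>. count_core (W2c \<omega>) k q < 99/100 * \<alpha> * real (q ^ 3)} \<le> ennreal (dev q)"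
  proof (rule section_W2[OF m])
    fix X W1 U
    let ?B = "shatter_core P C f (k - 1)"
    have "{W2\<in>space S. count_core (W2c (X, W1, W2, U)) k q < 99/100 * \<alpha> * real (q ^ 3)} \<subseteq>
      {W\<in>space S. \<alpha> / 100 * real (q ^ 3) \<le> \<bar>real (card {i\<in>{1..q^3}. block (k - 1) i W \<in> ?B}) - measure (power_measure (k - 1) P) ?B * real (q ^ 3)\<bar>}"
    proof safe
      fix W assume W: "W \<in> space S" "count_core (W2c (X, W1, W, U)) k q < 99/100 * \<alpha> * real (q ^ 3)"
      have "{i\<in>{1..q^3}. block (k - 1) i W \<in> ?B} = {i\<in>{1..q^3}. core (k - 1) (sample_tuple W k i)}"
        using block_space[OF W(1)] core_block[of _ k W] by (auto simp: shatter_core_eq)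
      moreover have "measure (power_measure (k - 1) P) ?B = \<alpha>" by (simp add: \<alpha> core_mass_def)
      ultimately show "\<alpha> / 100 * real (q ^ 3) \<le> \<bar>real (card {i\<in>{1..q^3}. block (k - 1) i W \<in> ?B}) - measure (power_measure (k - 1) P) ?B * real (q ^ 3)\<bar>"
        using W(2) by (simp add: count_core_def)
    qed
    moreover have "{W\<in>space S. \<alpha> / 100 * real (q ^ 3) \<le> \<bar>real (card {i\<in>{1..q^3}. block (k - 1) i W \<in> ?B}) - measure (power_measure (k - 1) P) ?B * real (q ^ 3)\<bar>} \<in> sets S"
    proof -
      have [measurable]: "(\<lambda>W. card {i\<in>{1..q^3}. block (k - 1) i W \<in> ?B}) \<in> measurable S (count_space UNIV)"
        by (intro measurable_card_Collect) auto
      show ?thesis by measurable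
    qed
    ultimately have "emeasure S {W2\<in>space S. count_core (W2c (X, W1, W2, U)) k q < 99/100 * \<alpha> * real (q ^ 3)} \<le>
      emeasure S {W\<in>space S. \<alpha> / 100 * real (q ^ 3) \<le> \<bar>real (card {i\<in>{1..q^3}. block (k - 1) i W \<in> ?B}) - measure (power_measure (k - 1) P) ?B * real (q ^ 3)\<bar>}"
      by (rule emeasure_mono)
    also have "\<dots> \<le> ennreal (2 * exp (- 2 * (\<alpha> / 100)\<^sup>2 * real (q ^ 3)))"
      by (rule hoeffding_block) (use \<alpha> q in auto)
    finally show "emeasure S {W2\<in>space S. count_core (W2c (X, W1, W2, U)) k q < 99/100 * \<alpha> * real (q ^ 3)} \<le> ennreal (dev q)"
      by (simp only: dev_def)
  qed
qed

private lemma covered_shattered_count: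
  assumes q: "q \<ge> 1"
  shows "covered {\<omega>\<in>space \<Omega>. 102/100 * \<alpha> * real (q ^ 3) < count_shattered (W2c \<omega>) k q (ball r0)} (dev q)"
proof (rule coveredI)
  have st: "(\<lambda>\<omega>. sample_tuple (W2c \<omega>) k i j) \<in> measurable \<Omega> M" for i j
    using measurable_sample_tuple[OF measurable_source(6)] .
  have "(\<lambda>\<omega>. card {i\<in>{1..q^3}. shatters (ball r0) (k - 1) (\<lambda>j. sample_tuple (W2c \<omega>) k i j)}) \<in> measurable \<Omega> (count_space UNIV)"
    by (intro measurable_card_Collect pred_shatters_ball0 st) simp
  then have "Measurable.pred \<Omega> (\<lambda>\<omega>. (\<lambda>c. 102/100 * \<alpha> * real (q ^ 3) < real c) (card {i\<in>{1..q^3}. shatters (ball r0) (k - 1) (sample_tuple (W2c \<omega>) k i)}))"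
    using measurable_count_space by (rule measurable_compose)
  then show m: "Measurable.pred \<Omega> (\<lambda>\<omega>. 102/100 * \<alpha> * real (q ^ 3) < count_shattered (W2c \<omega>) k q (ball r0))" by (simp only: count_shattered_def)
  show "emeasure \<Omega> {\<omega>\<in>space \<Omega>. 102/100 * \<alpha> * real (q ^ 3) < count_shattered (W2c \<omega>) k q (ball r0)} \<le> ennreal (dev q)"
  proof (rule section_W2[OF m])
    fix X W1 U
    let ?B = "shattered_tuples P (ball r0) (k - 1)"
    have "{W2\<in>space S. 102/100 * \<alpha> * real (q ^ 3) < count_shattered (W2c (X, W1, W2, U)) k q (ball r0)} \<subseteq>
      {W\<in>space S. \<alpha> / 100 * real (q ^ 3) \<le> \<bar>real (card {i\<in>{1..q^3}. block (k - 1) i W \<in> ?B}) - measure (power_measure (k - 1) P) ?B * real (q ^ 3)\<bar>}"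
    proof safe
      fix W assume W: "W \<in> space S" "102/100 * \<alpha> * real (q ^ 3) < count_shattered (W2c (X, W1, W, U)) k q (ball r0)"
      have "{i\<in>{1..q^3}. block (k - 1) i W \<in> ?B} = {i\<in>{1..q^3}. shatters (ball r0) (k - 1) (sample_tuple W k i)}"
        using block_space[OF W(1)] shatters_block[of _ "ball r0" k W] by (auto simp: shattered_tuples_def)
      moreover have "measure (power_measure (k - 1) P) ?B * real (q ^ 3) \<le> 101/100 * \<alpha> * real (q ^ 3)"
        using r0(2) unfolding shatter_mass_def by (rule mult_right_mono) simp
      ultimately show "\<alpha> / 100 * real (q ^ 3) \<le> \<bar>real (card {i\<in>{1..q^3}. block (k - 1) i W \<in> ?B}) - measure (power_measure (k - 1) P) ?B * real (q ^ 3)\<bar>"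
        using W(2) by (simp add: count_shattered_def)
    qed
    moreover have "{W\<in>space S. \<alpha> / 100 * real (q ^ 3) \<le> \<bar>real (card {i\<in>{1..q^3}. block (k - 1) i W \<in> ?B}) - measure (power_measure (k - 1) P) ?B * real (q ^ 3)\<bar>} \<in> sets S"
    proof -
      have [measurable]: "(\<lambda>W. card {i\<in>{1..q^3}. block (k - 1) i W \<in> ?B}) \<in> measurable S (count_space UNIV)"
        by (intro measurable_card_Collect) auto
      show ?thesis by measurable
    qed
    ultimately have "emeasure S {W2\<in>space S. 102/100 * \<alpha> * real (q ^ 3) < count_shattered (W2c (X, W1, W2, U)) k q (ball r0)} \<le>
      emeasure S {W\<in>space S. \<alpha> / 100 * real (q ^ 3) \<le> \<bar>real (card {i\<in>{1..q^3}. block (k - 1) i W \<in> ?B}) - measure (power_measure (k - 1) P) ?B * real (q ^ 3)\<bar>}"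
      by (rule emeasure_mono)
    also have "\<dots> \<le> ennreal (2 * exp (- 2 * (\<alpha> / 100)\<^sup>2 * real (q ^ 3)))"
      by (rule hoeffding_block) (use \<alpha> q in auto)
    finally show "emeasure S {W2\<in>space S. 102/100 * \<alpha> * real (q ^ 3) < count_shattered (W2c (X, W1, W2, U)) k q (ball r0)} \<le> ennreal (dev q)"
      by (simp only: dev_def)
  qed
qed

text \<open>The point \<open>\<xi>\<close> may depend on everything but \<open>W2\<close>. With all
  other components fixed, the set of tuples that are counted is fixed, and Hoeffding's inequality
  applies to the blocks of \<open>W2\<close>.\<close>

private lemma covered_link_count:
  fixes \<xi> :: "'a source \<Rightarrow> 'a"
  assumes q: "q \<ge> 1" and \<xi>: "\<xi> \<in> measurable \<Omega> M" and dep: "\<And>X W1 W2 W2' U. \<xi> (X, W1, W2, U) = \<xi> (X, W1, W2', U)"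
  shows "covered {\<omega>\<in>space \<Omega>. 1/100 * \<alpha> * real (q ^ 3) < \<bar>count_link (W2c \<omega>) k q (Vs (Xc \<omega>) p) (\<xi> \<omega>) - link_mass k (Vs (Xc \<omega>) p) (\<xi> \<omega>) * real (q ^ 3)\<bar>} (dev q)"
proof (rule coveredI)
  have st: "(\<lambda>\<omega>. sample_tuple (W2c \<omega>) k i j) \<in> measurable \<Omega> M" for i j
    using measurable_sample_tuple[OF measurable_source(6)] .
  have "(\<lambda>\<omega>. card {i\<in>{1..q^3}. shatters (Vs (Xc \<omega>) p) k ((\<lambda>j. sample_tuple (W2c \<omega>) k i j)(k - 1 := \<xi> \<omega>))}) \<in> measurable \<Omega> (count_space UNIV)"
    by (intro measurable_card_Collect pred_link measurable_source(4) st \<xi>) simp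
  then have [measurable]: "(\<lambda>\<omega>. count_link (W2c \<omega>) k q (Vs (Xc \<omega>) p) (\<xi> \<omega>)) \<in> borel_measurable \<Omega>"
    unfolding count_link_def by (rule measurable_compose) simp
  have [measurable]: "(\<lambda>\<omega>. link_mass k (Vs (Xc \<omega>) p) (\<xi> \<omega>)) \<in> borel_measurable \<Omega>"
    by (rule measurable_link_mass[OF measurable_source(4) \<xi>])
  show m: "Measurable.pred \<Omega> (\<lambda>\<omega>. 1/100 * \<alpha> * real (q ^ 3) < \<bar>count_link (W2c \<omega>) k q (Vs (Xc \<omega>) p) (\<xi> \<omega>) - link_mass k (Vs (Xc \<omega>) p) (\<xi> \<omega>) * real (q ^ 3)\<bar>)"
    by measurable
  show "emeasure \<Omega> {\<omega>\<in>space \<Omega>. 1/100 * \<alpha> * real (q ^ 3) < \<bar>count_link (W2c \<omega>) k q (Vs (Xc \<omega>) p) (\<xi> \<omega>) - link_mass k (Vs (Xc \<omega>) p) (\<xi> \<omega>) * real (q ^ 3)\<bar>} \<le> ennreal (dev q)"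
  proof (rule section_W2[OF m])
    fix X W1 :: "nat \<Rightarrow> 'a" and U :: "nat \<Rightarrow> real" assume X: "X \<in> space S" and W1: "W1 \<in> space S"
    show "emeasure S {W2\<in>space S. 1/100 * \<alpha> * real (q ^ 3) < \<bar>count_link (W2c (X, W1, W2, U)) k q (Vs (Xc (X, W1, W2, U)) p) (\<xi> (X, W1, W2, U)) -
        link_mass k (Vs (Xc (X, W1, W2, U)) p) (\<xi> (X, W1, W2, U)) * real (q ^ 3)\<bar>} \<le> ennreal (dev q)" (is "emeasure S ?L \<le> _")
    proof (cases "U \<in> space (Pi\<^sub>M (UNIV :: nat set) (\<lambda>_. seed_measure))")
      case False
      then have "\<xi> (X, W1, W2, U) = \<xi> (X, W1, X, U)" for W2 using dep by blast
      have "U \<in> space (Pi\<^sub>M (UNIV :: nat set) (\<lambda>_. seed_measure))" by (simp add: space_PiM seed_measure_def)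
      then show ?thesis using False by simp
    next
      case U: True
      define x where "x = \<xi> (X, W1, X, U)"
      have \<xi>x: "\<xi> (X, W1, W2, U) = x" for W2 unfolding x_def by (rule dep)
      have x: "x \<in> space M" unfolding x_def by (rule measurable_space[OF \<xi>]) (use X W1 U in \<open>simp add: space_\<Omega>\<close>)
      let ?B = "{T \<in> space (power_measure (k - 1) P). shatters (Vs X p) k (T(k - 1 := x))}"
      have B: "?B \<in> sets (power_measure (k - 1) P)" by (rule sets_link[OF x space_S[OF X]])
      have "?L \<subseteq>
        {W\<in>space S. \<alpha> / 100 * real (q ^ 3) \<le> \<bar>real (card {i\<in>{1..q^3}. block (k - 1) i W \<in> ?B}) - measure (power_measure (k - 1) P) ?B * real (q ^ 3)\<bar>}"
      proof safe
        fix W assume W: "W \<in> space S" "1/100 * \<alpha> * real (q ^ 3) < \<bar>count_link (W2c (X, W1, W, U)) k q (Vs (Xc (X, W1, W, U)) p) (\<xi> (X, W1, W, U)) -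
        link_mass k (Vs (Xc (X, W1, W, U)) p) (\<xi> (X, W1, W, U)) * real (q ^ 3)\<bar>"
        have "{i\<in>{1..q^3}. block (k - 1) i W \<in> ?B} = {i\<in>{1..q^3}. shatters (Vs X p) k ((sample_tuple W k i)(k - 1 := x))}"
          using block_space[OF W(1)] link_block[of _ "Vs X p" k W x] by auto
        then show "\<alpha> / 100 * real (q ^ 3) \<le> \<bar>real (card {i\<in>{1..q^3}. block (k - 1) i W \<in> ?B}) - measure (power_measure (k - 1) P) ?B * real (q ^ 3)\<bar>"
          using W(2) unfolding \<xi>x fst_conv snd_conv count_link_def link_mass_def by (simp only:)
      qed
      moreover have "{W\<in>space S. \<alpha> / 100 * real (q ^ 3) \<le> \<bar>real (card {i\<in>{1..q^3}. block (k - 1) i W \<in> ?B}) - measure (power_measure (k - 1) P) ?B * real (q ^ 3)\<bar>} \<in> sets S"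
      proof -
        have [measurable]: "(\<lambda>W. card {i\<in>{1..q^3}. block (k - 1) i W \<in> ?B}) \<in> measurable S (count_space UNIV)"
          by (intro measurable_card_Collect pred_sets2[OF B measurable_block]) simp
        show ?thesis by measurable
      qed
      ultimately have "emeasure S ?L \<le>
        emeasure S {W\<in>space S. \<alpha> / 100 * real (q ^ 3) \<le> \<bar>real (card {i\<in>{1..q^3}. block (k - 1) i W \<in> ?B}) - measure (power_measure (k - 1) P) ?B * real (q ^ 3)\<bar>}"
        by (rule emeasure_mono)
      also have "\<dots> \<le> ennreal (2 * exp (- 2 * (\<alpha> / 100)\<^sup>2 * real (q ^ 3)))"
        by (rule hoeffding_block[OF B]) (use \<alpha> q in auto)
      finally show ?thesis by (simp only: dev_def)
    qed
  qed
qed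

private lemma dev_nonneg: "dev q \<ge> 0" by (simp add: dev_def)

private lemma dev_mono: "q \<le> q' \<Longrightarrow> dev q' \<le> dev q"
  by (auto simp: dev_def intro!: mult_left_mono power_mono)

text \<open>Inside \<open>ball r0\<close> the number of shattered tuples is bounded by that of a
  class independent of the sample. The estimators are evaluated in two places: at the next point of
  \<open>X\<close> with sample index p + 1, and at the points of \<open>W1\<close> with index
  p.\<close>

definition estimate_fail :: "nat \<Rightarrow> 'a source set" where
  "estimate_fail p = {\<omega>\<in>space \<Omega>. Vs (Xc \<omega>) p \<subseteq> ball r0 \<and> (\<not> accurate (Xc \<omega>) (W2c \<omega>) k p (Suc p) (Xc \<omega> (Suc p)) \<or>
     (\<exists>i\<in>{1..p^3}. \<not> accurate (Xc \<omega>) (W2c \<omega>) k p p (W1c \<omega> i)))}"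

lemma covered_estimate_fail:
  assumes p: "p \<ge> 1"
  shows "covered (estimate_fail p) ((10 + 1 / (\<alpha> / 100)\<^sup>2) * 2 * exp (- (\<alpha> / 100)\<^sup>2 * p))"
proof -
  define A1 where "A1 q = {\<omega>\<in>space \<Omega>. count_core (W2c \<omega>) k q < 99/100 * \<alpha> * real (q ^ 3)}" for q
  define A2 where "A2 q = {\<omega>\<in>space \<Omega>. 102/100 * \<alpha> * real (q ^ 3) < count_shattered (W2c \<omega>) k q (ball r0)}" for q
  define A3 where "A3 q \<xi> = {\<omega>\<in>space \<Omega>. 1/100 * \<alpha> * real (q ^ 3) < \<bar>count_link (W2c \<omega>) k q (Vs (Xc \<omega>) p) (\<xi> \<omega>) - link_mass k (Vs (Xc \<omega>) p) (\<xi> \<omega>) * real (q ^ 3)\<bar>}" for q \<xi>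
  have acc: "\<omega> \<in> A1 q \<union> A2 q \<union> A3 q \<xi>" if "\<omega> \<in> space \<Omega>" "Vs (Xc \<omega>) p \<subseteq> ball r0" "\<not> accurate (Xc \<omega>) (W2c \<omega>) k p q (\<xi> \<omega>)" for \<omega> q \<xi>
  proof -
    have "count_shattered (W2c \<omega>) k q (Vs (Xc \<omega>) p) \<le> count_shattered (W2c \<omega>) k q (ball r0)"
      unfolding count_shattered_def using shatters_mono[OF that(2)] by (intro of_nat_mono card_mono) auto
    then show ?thesis using that(1,3) unfolding accurate_def A1_def A2_def A3_def \<alpha>(1)[symmetric] by auto
  qed
  have sub: "estimate_fail p \<subseteq> ((A1 (Suc p) \<union> A2 (Suc p)) \<union> A3 (Suc p) (\<lambda>\<omega>. Xc \<omega> (Suc p))) \<union> ((A1 p \<union> A2 p) \<union> (\<Union>i\<in>{1..p^3}. A3 p (\<lambda>\<omega>. W1c \<omega> i)))"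
  proof
    fix \<omega> assume "\<omega> \<in> estimate_fail p"
    then have w: "\<omega> \<in> space \<Omega>" "Vs (Xc \<omega>) p \<subseteq> ball r0" and
      "\<not> accurate (Xc \<omega>) (W2c \<omega>) k p (Suc p) (Xc \<omega> (Suc p)) \<or> (\<exists>i\<in>{1..p^3}. \<not> accurate (Xc \<omega>) (W2c \<omega>) k p p (W1c \<omega> i))"
      by (auto simp: estimate_fail_def)
    then consider "\<not> accurate (Xc \<omega>) (W2c \<omega>) k p (Suc p) (Xc \<omega> (Suc p))" | i where "i\<in>{1..p^3}" "\<not> accurate (Xc \<omega>) (W2c \<omega>) k p p (W1c \<omega> i)"
      by blast
    then show "\<omega> \<in> ((A1 (Suc p) \<union> A2 (Suc p)) \<union> A3 (Suc p) (\<lambda>\<omega>. Xc \<omega> (Suc p))) \<union> ((A1 p \<union> A2 p) \<union> (\<Union>i\<in>{1..p^3}. A3 p (\<lambda>\<omega>. W1c \<omega> i)))"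
    proof cases
      case 1
      then show ?thesis using acc[OF w, of "Suc p" "\<lambda>\<omega>. Xc \<omega> (Suc p)"] by blast
    next
      case 2
      then show ?thesis using acc[OF w, of p "\<lambda>\<omega>. W1c \<omega> i"] by blast
    qed
  qed
  have "covered (((A1 (Suc p) \<union> A2 (Suc p)) \<union> A3 (Suc p) (\<lambda>\<omega>. Xc \<omega> (Suc p))) \<union> ((A1 p \<union> A2 p) \<union> (\<Union>i\<in>{1..p^3}. A3 p (\<lambda>\<omega>. W1c \<omega> i))))
     (((dev (Suc p) + dev (Suc p)) + dev (Suc p)) + ((dev p + dev p) + (\<Sum>i\<in>{1..p^3}. dev p)))"
    unfolding A1_def A2_def A3_def
    by (intro covered_Un covered_UN covered_core_count covered_shattered_count covered_link_count measurable_source)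
      (use p in \<open>auto intro!: dev_nonneg add_nonneg_nonneg mult_nonneg_nonneg\<close>)
  moreover have "((dev (Suc p) + dev (Suc p)) + dev (Suc p)) + ((dev p + dev p) + (\<Sum>i\<in>{1..p^3}. dev p)) \<le> (10 + 1 / (\<alpha> / 100)\<^sup>2) * 2 * exp (- (\<alpha> / 100)\<^sup>2 * p)"
  proof -
    define c where "c = (\<alpha> / 100)\<^sup>2"
    have c: "c > 0" using \<alpha>(2) by (simp add: c_def)
    define y where "y = real (p ^ 3)"
    have "p ^ 1 \<le> p ^ 3" using p by (intro power_increasing) auto
    then have y: "real p \<le> y" by (simp only: y_def of_nat_le_iff power_one_right)
    \<comment> \<open>The union bound over the points of \<open>W1\<close> costs a factor y = p^3.
      Half of the exponent absorbs it, since y exp (- c y) \<le> 1 / c.\<close>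
    have "c * y \<le> exp (c * y)" using exp_ge_add_one_self[of "c * y"] by linarith
    then have "y * exp (- (c * y)) \<le> 1 / c" using c by (simp add: exp_minus field_simps)
    then have "y * exp (- 2 * c * y) \<le> (1 / c) * exp (- (c * y))"
    proof -
      assume *: "y * exp (- (c * y)) \<le> 1 / c"
      have "y * exp (- 2 * c * y) = (y * exp (- (c * y))) * exp (- (c * y))" by (simp flip: exp_add)
      also have "\<dots> \<le> (1 / c) * exp (- (c * y))" using * by (rule mult_right_mono) simp
      finally show ?thesis .
    qed
    moreover have "10 * exp (- 2 * c * y) \<le> 10 * exp (- (c * y))" using c y by simp
    ultimately have "10 * exp (- 2 * c * y) + y * exp (- 2 * c * y) \<le> 10 * exp (- (c * y)) + (1 / c) * exp (- (c * y))"
      by (intro add_mono)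
    then have "(10 + y) * exp (- 2 * c * y) \<le> (10 + 1 / c) * exp (- (c * y))" by (simp only: distrib_right)
    also have "\<dots> \<le> (10 + 1 / c) * exp (- c * p)" using c y by (intro mult_left_mono) auto
    finally have "(10 + y) * exp (- 2 * c * y) \<le> (10 + 1 / c) * exp (- c * p)" .
    then have "2 * ((10 + y) * exp (- 2 * c * y)) \<le> 2 * ((10 + 1 / c) * exp (- c * p))" by (rule mult_left_mono) simp
    moreover have dev: "dev p = 2 * exp (- 2 * c * y)" by (simp add: dev_def c_def y_def)
    ultimately have *: "(10 + y) * dev p \<le> (10 + 1 / c) * 2 * exp (- c * p)" unfolding dev by (simp only: mult_ac)
    have "((dev (Suc p) + dev (Suc p)) + dev (Suc p)) + ((dev p + dev p) + (\<Sum>i\<in>{1..p^3}. dev p)) \<le> 5 * dev p + y * dev p"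
      using dev_mono[of p "Suc p"] by (simp add: y_def)
    also have "\<dots> \<le> (10 + y) * dev p" using dev_nonneg[of p] by (simp add: algebra_simps)
    finally show ?thesis using * by (simp add: c_def)
  qed
  ultimately show ?thesis by (rule covered_mono[OF _ sub])
qed

end

end

context target
begin

definition radius_fail :: "real \<Rightarrow> nat \<Rightarrow> 'a source set" where
  "radius_fail r p = {\<omega>\<in>space \<Omega>. \<not> Vs (Xc \<omega>) p \<subseteq> ball r}"

lemma covered_radius_fail:
  assumes "10 \<le> r * p"
  shows "covered (radius_fail r p) (2 * real ((2 * p + 2) ^ d) * exp (- r * p / 4))"
proof -
  obtain N where N: "N \<in> sets S" "emeasure S N \<le> ennreal (2 * real ((2 * p + 2) ^ d) * exp (- r * p / 4))"
    "\<And>X. X \<in> space S \<Longrightarrow> X \<notin> N \<Longrightarrow> Vs X p \<subseteq> ball r" using version_space_radius[OF assms] by blast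
  have "radius_fail r p \<subseteq> {\<omega>\<in>space \<Omega>. fst \<omega> \<in> N}"
  proof
    fix \<omega> assume w: "\<omega> \<in> radius_fail r p"
    then have "Xc \<omega> \<in> space S" using measurable_space[OF measurable_source(1)] by (simp add: radius_fail_def)
    with N(3)[of "Xc \<omega>"] w show "\<omega> \<in> {\<omega>\<in>space \<Omega>. fst \<omega> \<in> N}" by (auto simp: radius_fail_def)
  qed
  then show ?thesis by (intro covered_mono[OF covered_X[OF N(1,2)]]) auto
qed

lemma covered_trivial: "1 \<le> p \<Longrightarrow> B \<subseteq> space \<Omega> \<Longrightarrow> covered B p"
  unfolding covered_def using prob_space.emeasure_space_1[OF prob_space_\<Omega>]
  by (intro bexI[of _ "space \<Omega>"]) (auto simp flip: ennreal_1 intro: ennreal_leI)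

text \<open>For fixed r the factor (2 p + 2) ^ d is absorbed by half of the exponent r p / 4,
  through x ^ d \<le> d! exp x. If r p < 10 the bound exceeds 1 because K is at least exp
  (10/8).\<close>

lemma covered_radius_fail_exp:
  assumes r: "r > 0"
  obtains K where "K \<ge> 0" "\<And>p. covered (radius_fail r p) (K * exp (- (r / 8) * real p))"
proof -
  define K1 where "K1 = 2 * (16 / r) ^ d * fact d * exp (r / 8)"
  define K where "K = max K1 (exp (10 / 8))"
  have K1: "2 * real ((2 * p + 2) ^ d) * exp (- r * p / 4) \<le> K1 * exp (- (r / 8) * real p)" for p
  proof -
    define x where "x = (r / 16) * real (2 * p + 2)"
    have "(16 / r) * x = real (2 * p + 2)" using r by (simp add: x_def)
    then have "real ((2 * p + 2) ^ d) = (16 / r) ^ d * x ^ d" by (simp only: power_mult_distrib[symmetric] of_nat_power)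
    also have "\<dots> \<le> (16 / r) ^ d * (fact d * exp x)"
      using r by (intro mult_left_mono power_le_fact_exp) (auto simp: x_def)
    also have "x = (r / 8) * real p + r / 8" by (simp add: x_def field_simps)
    finally have "2 * real ((2 * p + 2) ^ d) * exp (- r * p / 4) \<le> 2 * ((16 / r) ^ d * (fact d * exp ((r / 8) * real p + r / 8))) * exp (- r * p / 4)"
      by (intro mult_right_mono) auto
    also have "\<dots> = K1 * (exp ((r / 8) * real p) * exp (- r * p / 4))" by (simp add: K1_def exp_add mult_ac)
    also have "exp ((r / 8) * real p) * exp (- r * p / 4) = exp (- (r / 8) * real p)" by (simp flip: exp_add)
    finally show ?thesis .
  qed
  have "covered (radius_fail r p) (K * exp (- (r / 8) * real p))" for p
  proof (cases "10 \<le> r * p")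
    case True
    have "K1 * exp (- (r / 8) * real p) \<le> K * exp (- (r / 8) * real p)" by (intro mult_right_mono) (auto simp: K_def)
    then show ?thesis using K1[of p] by (intro covered_mono[OF covered_radius_fail[OF True] order_refl]) linarith
  next
    case False
    then have "exp (10 / 8) * exp (- (r / 8) * real p) \<ge> 1" by (simp flip: exp_add)
    moreover have "exp (10 / 8) * exp (- (r / 8) * real p) \<le> K * exp (- (r / 8) * real p)" by (intro mult_right_mono) (auto simp: K_def)
    ultimately have "1 \<le> K * exp (- (r / 8) * real p)" by (rule order_trans)
    then show ?thesis by (rule covered_trivial) (auto simp: radius_fail_def)
  qed
  moreover have "K \<ge> 0" unfolding K_def by (simp add: le_max_iff_disj)
  ultimately show ?thesis using that by blast
qed

definition inaccurate :: "nat \<Rightarrow> nat \<Rightarrow> 'a source set" where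
  "inaccurate k p = {\<omega>\<in>space \<Omega>. \<not> accurate (Xc \<omega>) (W2c \<omega>) k p (Suc p) (Xc \<omega> (Suc p)) \<or>
     (\<exists>i\<in>{1..p^3}. \<not> accurate (Xc \<omega>) (W2c \<omega>) k p p (W1c \<omega> i))}"

text \<open>Inaccuracy means that the version space has not yet entered \<open>ball r0\<close> or
  that an estimate fails inside it. The radius \<open>r0\<close> depends on f, P and k only, so both
  have exponential tails.\<close>

lemma rare_inaccurate:
  assumes k: "k \<in> {1..dt}"
  shows "rare (\<lambda>n. \<Union>p\<in>{p. 1 \<le> p \<and> n \<le> 6 * p}. inaccurate k p)"
proof -
  define \<alpha> where "\<alpha> = core_mass (k - 1)"
  have \<alpha>: "\<alpha> > 0" unfolding \<alpha>_def using k by (intro core_mass_pos) auto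
  obtain r0 where r0: "r0 > 0" "shatter_mass (k - 1) r0 \<le> 101/100 * \<alpha>"
    using core_mass_approx[of "k - 1"] \<alpha> unfolding \<alpha>_def by blast
  obtain K1 where K1: "K1 \<ge> 0" "\<And>p. covered (radius_fail r0 p) (K1 * exp (- (r0 / 8) * real p))"
    using covered_radius_fail_exp[OF r0(1)] by blast
  have r1: "rare (\<lambda>n. \<Union>p\<in>{p. 1 \<le> p \<and> n \<le> 6 * p}. radius_fail r0 p)"
    using K1 r0 by (intro rare_tail[of K1 "r0 / 8"]) auto
  have r2: "rare (\<lambda>n. \<Union>p\<in>{p. 1 \<le> p \<and> n \<le> 6 * p}. estimate_fail k r0 p)"
  proof (rule rare_tail)
    show "0 \<le> (10 + 1 / (\<alpha> / 100)\<^sup>2) * 2" "0 < (\<alpha> / 100)\<^sup>2" using \<alpha> by auto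
    show "covered (estimate_fail k r0 p) ((10 + 1 / (\<alpha> / 100)\<^sup>2) * 2 * exp (- (\<alpha> / 100)\<^sup>2 * real p))" if "p \<ge> 1" for p
      using covered_estimate_fail[of k \<alpha> r0 p] k \<alpha> r0 that by (auto simp: \<alpha>_def)
  qed
  show ?thesis
  proof (rule rare_mono[OF rare_Un[OF r1 r2]])
    have "inaccurate k p \<subseteq> radius_fail r0 p \<union> estimate_fail k r0 p" for p
      using k \<alpha> r0 by (auto simp: inaccurate_def radius_fail_def estimate_fail_def[of k \<alpha>] \<alpha>_def)
    then show "(\<Union>p\<in>{p. 1 \<le> p \<and> n \<le> 6 * p}. inaccurate k p) \<subseteq>
      (\<Union>p\<in>{p. 1 \<le> p \<and> n \<le> 6 * p}. radius_fail r0 p) \<union> (\<Union>p\<in>{p. 1 \<le> p \<and> n \<le> 6 * p}. estimate_fail k r0 p)" for n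
      by blast
  qed
qed

section \<open>Points that may trigger a request, and their density\<close>

definition hot :: "nat \<Rightarrow> (nat \<Rightarrow> 'a) \<Rightarrow> nat \<Rightarrow> 'a set" where
  "hot k X p = {x\<in>space M. 4/10 * core_mass (k - 1) \<le> link_mass k (Vs X p) x}"

lemma sets_hot: "(\<And>i. X i \<in> space M) \<Longrightarrow> hot k X p \<in> sets M"
proof -
  assume X: "\<And>i. X i \<in> space M"
  have [measurable]: "(\<lambda>x. link_mass k (Vs X p) x) \<in> borel_measurable M"
    by (rule measurable_link_mass[where X = "\<lambda>i _. X i" and x = "\<lambda>x. x"]) (simp_all only: measurable_const[OF X] measurable_ident_sets)
  show ?thesis unfolding hot_def by measurable
qed

lemma hot_antimono:
  assumes "\<And>i. X i \<in> space M" "p \<le> p'"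
  shows "hot k X p' \<subseteq> hot k X p"
proof
  fix x assume "x \<in> hot k X p'"
  then have x: "x \<in> space M" "4/10 * core_mass (k - 1) \<le> link_mass k (Vs X p') x" unfolding hot_def by blast+
  then have "4/10 * core_mass (k - 1) \<le> link_mass k (Vs X p) x"
    using link_mass_mono_Vs[of p p' x X k, OF assms(2) x(1) assms(1)] by linarith
  then show "x \<in> hot k X p" unfolding hot_def using x(1) by blast
qed

lemma measurable_hot_mass: "(\<lambda>\<omega>. measure P (hot k (Xc \<omega>) p)) \<in> borel_measurable \<Omega>"
proof -
  have [measurable]: "(\<lambda>q. link_mass k (Vs (Xc (fst q)) p) (snd q)) \<in> borel_measurable (\<Omega> \<Otimes>\<^sub>M P)"
    by (rule measurable_link_mass[where X = "\<lambda>i q. fst (fst q) i" and x = snd])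
      (simp_all only: measurable_compose[OF measurable_fst measurable_source(4)] measurable_compose[OF measurable_snd measurable_ident_sets[OF sets_P]])
  have "{q \<in> space (\<Omega> \<Otimes>\<^sub>M P). 4/10 * core_mass (k - 1) \<le> link_mass k (Vs (Xc (fst q)) p) (snd q)} \<in> sets (\<Omega> \<Otimes>\<^sub>M P)"
    by measurable
  then have "{q \<in> space (\<Omega> \<Otimes>\<^sub>M P). snd q \<in> hot k (Xc (fst q)) p} \<in> sets (\<Omega> \<Otimes>\<^sub>M P)"
    by (rule back_subst[of "\<lambda>A. A \<in> sets _"]) (auto simp: hot_def space_pair_measure)
  moreover have "hot k X p \<in> sets P" if "X \<in> space S" for X using sets_hot[OF space_S[OF that]] by simp
  ultimately show ?thesis by (intro P.measurable_measure) (auto simp: hot_def)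
qed

lemma pred_hot:
  assumes "\<xi> \<in> measurable \<Omega> M"
  shows "Measurable.pred \<Omega> (\<lambda>\<omega>. \<xi> \<omega> \<in> hot k (Xc \<omega>) p)"
proof -
  have [measurable]: "(\<lambda>\<omega>. link_mass k (Vs (Xc \<omega>) p) (\<xi> \<omega>)) \<in> borel_measurable \<Omega>"
    by (rule measurable_link_mass[OF measurable_source(4) assms])
  have "Measurable.pred \<Omega> (\<lambda>\<omega>. 4/10 * core_mass (k - 1) \<le> link_mass k (Vs (Xc \<omega>) p) (\<xi> \<omega>))" by measurable
  then show ?thesis using measurable_space[OF assms] unfolding hot_def by (simp cong: measurable_cong)
qed

definition density_fail :: "nat \<Rightarrow> nat \<Rightarrow> 'a source set" where
  "density_fail k p = {\<omega>\<in>space \<Omega>. 1 / real p * real (p^3) \<le>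
     \<bar>real (card {i\<in>{1..p^3}. W1c \<omega> i \<in> hot k (Xc \<omega>) p}) - measure P (hot k (Xc \<omega>) p) * real (p^3)\<bar>}"

definition density_fail_fixed :: "'a set \<Rightarrow> nat \<Rightarrow> 'a source set" where
  "density_fail_fixed D p = {\<omega>\<in>space \<Omega>. 1 / real p * real (p^3) \<le>
     \<bar>real (card {i\<in>{1..p^3}. W1c \<omega> i \<in> D}) - measure P D * real (p^3)\<bar>}"

text \<open>A deviation of 1 / p in a sample of size p ^ 3 has Hoeffding exponent 2 p. The summand 2
  / m in \<open>Delta_hat_set\<close> covers such a deviation with 1 / p to spare.\<close>

lemma dev_simp: "p \<ge> 1 \<Longrightarrow> 2 * exp (- 2 * (1 / real p)\<^sup>2 * real (p ^ 3)) = 2 * exp (- 2 * real p)"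
  by (simp add: power2_eq_square power3_eq_cube)

lemma covered_density_fail:
  assumes p: "p \<ge> 1"
  shows "covered (density_fail k p) (2 * exp (- 2 * real p))"
  unfolding density_fail_def
proof (rule coveredI)
  have "(\<lambda>\<omega>. card {i\<in>{1..p^3}. W1c \<omega> i \<in> hot k (Xc \<omega>) p}) \<in> measurable \<Omega> (count_space UNIV)"
    by (intro measurable_card_Collect pred_hot measurable_source) simp
  then have [measurable]: "(\<lambda>\<omega>. real (card {i\<in>{1..p^3}. W1c \<omega> i \<in> hot k (Xc \<omega>) p})) \<in> borel_measurable \<Omega>"
    by (rule measurable_compose) simp
  note [measurable] = measurable_hot_mass
  show m: "Measurable.pred \<Omega> (\<lambda>\<omega>. 1 / real p * real (p^3) \<le>
     \<bar>real (card {i\<in>{1..p^3}. W1c \<omega> i \<in> hot k (Xc \<omega>) p}) - measure P (hot k (Xc \<omega>) p) * real (p^3)\<bar>)"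
    by measurable
  show "emeasure \<Omega> {\<omega>\<in>space \<Omega>. 1 / real p * real (p^3) \<le>
     \<bar>real (card {i\<in>{1..p^3}. W1c \<omega> i \<in> hot k (Xc \<omega>) p}) - measure P (hot k (Xc \<omega>) p) * real (p^3)\<bar>} \<le> ennreal (2 * exp (- 2 * real p))"
  proof (rule section_W1[OF m])
    fix X W2 :: "nat \<Rightarrow> 'a" and U :: "nat \<Rightarrow> real" assume X: "X \<in> space S"
    have "emeasure S {W\<in>space S. 1 / real p * real (p^3) \<le> \<bar>real (card {i\<in>{1..p^3}. W i \<in> hot k X p}) - measure P (hot k X p) * real (p^3)\<bar>}
      \<le> ennreal (2 * exp (- 2 * (1 / real p)\<^sup>2 * real (p ^ 3)))"
      by (rule hoeffding_coord[OF sets_hot[OF space_S[OF X]]]) (use p in auto)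
    then show "emeasure S {W1\<in>space S. 1 / real p * real (p^3) \<le>
     \<bar>real (card {i\<in>{1..p^3}. W1c (X, W1, W2, U) i \<in> hot k (Xc (X, W1, W2, U)) p}) - measure P (hot k (Xc (X, W1, W2, U)) p) * real (p^3)\<bar>} \<le> ennreal (2 * exp (- 2 * real p))"
      unfolding dev_simp[OF p] fst_conv snd_conv .
  qed
qed

lemma covered_density_fail_fixed:
  assumes p: "p \<ge> 1" and D: "D \<in> sets M"
  shows "covered (density_fail_fixed D p) (2 * exp (- 2 * real p))"
  unfolding density_fail_fixed_def
proof (rule coveredI)
  have "(\<lambda>\<omega>. card {i\<in>{1..p^3}. W1c \<omega> i \<in> D}) \<in> measurable \<Omega> (count_space UNIV)"
    by (intro measurable_card_Collect pred_sets2[OF D measurable_source(5)]) simp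
  then have [measurable]: "(\<lambda>\<omega>. real (card {i\<in>{1..p^3}. W1c \<omega> i \<in> D})) \<in> borel_measurable \<Omega>"
    by (rule measurable_compose) simp
  show m: "Measurable.pred \<Omega> (\<lambda>\<omega>. 1 / real p * real (p^3) \<le>
     \<bar>real (card {i\<in>{1..p^3}. W1c \<omega> i \<in> D}) - measure P D * real (p^3)\<bar>)"
    by measurable
  show "emeasure \<Omega> {\<omega>\<in>space \<Omega>. 1 / real p * real (p^3) \<le>
     \<bar>real (card {i\<in>{1..p^3}. W1c \<omega> i \<in> D}) - measure P D * real (p^3)\<bar>} \<le> ennreal (2 * exp (- 2 * real p))"
  proof (rule section_W1[OF m])
    fix X W2 :: "nat \<Rightarrow> 'a" and U :: "nat \<Rightarrow> real"
    have "emeasure S {W\<in>space S. 1 / real p * real (p^3) \<le> \<bar>real (card {i\<in>{1..p^3}. W i \<in> D}) - measure P D * real (p^3)\<bar>}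
      \<le> ennreal (2 * exp (- 2 * (1 / real p)\<^sup>2 * real (p ^ 3)))"
      by (rule hoeffding_coord[OF D]) (use p in auto)
    then show "emeasure S {W1\<in>space S. 1 / real p * real (p^3) \<le>
     \<bar>real (card {i\<in>{1..p^3}. W1c (X, W1, W2, U) i \<in> D}) - measure P D * real (p^3)\<bar>} \<le> ennreal (2 * exp (- 2 * real p))"
      unfolding dev_simp[OF p] fst_conv snd_conv .
  qed
qed

lemma rare_density_fail: "rare (\<lambda>n. \<Union>p\<in>{p. 1 \<le> p \<and> n \<le> 6 * p}. density_fail k p)"
  by (rule rare_tail[of 2 2]) (auto intro: covered_density_fail[simplified])

text \<open>The set will depend on \<epsilon>, so the constants have to be fixed before it.\<close>

lemma covered_density_fail_fixed_tail:
  obtains K g where "0 \<le> K" "0 < g"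
    "\<And>D n. D \<in> sets M \<Longrightarrow> covered (\<Union>p\<in>{p. 1 \<le> p \<and> n \<le> 6 * p}. density_fail_fixed D p) (K * exp (- g * real n))"
proof -
  have "covered (\<Union>p\<in>{p. 1 \<le> p \<and> n \<le> 6 * p}. density_fail_fixed D p) (2 / (1 - exp (- 2 / 2)) * exp (- (2 / 12) * real n))"
    if D: "D \<in> sets M" for D n
    by (rule covered_tail[of 2 2]) (auto intro: covered_density_fail_fixed[OF _ D, simplified])
  then show ?thesis by (intro that[of "2 / (1 - exp (- 2 / 2))" "2 / 12"]) auto
qed

section \<open>Requests in the two loops, and failures of the selection\<close>

definition first_loop_fail :: "(nat \<Rightarrow> 'a set) \<Rightarrow> nat \<Rightarrow> real \<Rightarrow> 'a source set" where
  "first_loop_fail D m a = {\<omega>\<in>space \<Omega>. a \<le> real (card {j\<in>{..<m}. Xc \<omega> (Suc j) \<in> D j})}"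

text \<open>The sets are deterministic, so hits at different coordinates are independent and the
  Chernoff bound with l = 1 applies. In the application they are level sets of deterministic balls
  that enclose the version spaces.\<close>

lemma covered_first_loop_fail:
  assumes D: "\<And>j. D j \<in> sets M" and B: "(\<Sum>j<m. measure P (D j)) \<le> B"
  shows "covered (first_loop_fail D m a) (exp ((exp 1 - 1) * B - a))"
  unfolding first_loop_fail_def
proof (rule coveredI)
  have "(\<lambda>\<omega>. card {j\<in>{..<m}. Xc \<omega> (Suc j) \<in> D j}) \<in> measurable \<Omega> (count_space UNIV)"
    by (intro measurable_card_Collect pred_sets2[OF D measurable_source(4)]) simp
  then have [measurable]: "(\<lambda>\<omega>. real (card {j\<in>{..<m}. Xc \<omega> (Suc j) \<in> D j})) \<in> borel_measurable \<Omega>"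
    by (rule measurable_compose) simp
  show m: "Measurable.pred \<Omega> (\<lambda>\<omega>. a \<le> real (card {j\<in>{..<m}. Xc \<omega> (Suc j) \<in> D j}))" by measurable
  show "emeasure \<Omega> {\<omega>\<in>space \<Omega>. a \<le> real (card {j\<in>{..<m}. Xc \<omega> (Suc j) \<in> D j})} \<le> ennreal (exp ((exp 1 - 1) * B - a))"
  proof (rule section_X[OF m])
    fix W1 W2 :: "nat \<Rightarrow> 'a" and U :: "nat \<Rightarrow> real"
    have inj: "inj_on Suc A" for A by simp
    have "card {j\<in>{..<m}. X (Suc j) \<in> D j} = card {i\<in>Suc ` {..<m}. X i \<in> D (i - 1)}" for X
    proof -
      have "{i\<in>Suc ` {..<m}. X i \<in> D (i - 1)} = Suc ` {j\<in>{..<m}. X (Suc j) \<in> D j}" by auto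
      then show ?thesis by (simp add: card_image)
    qed
    moreover have "emeasure S {X\<in>space S. a \<le> real (card {i\<in>Suc ` {..<m}. X i \<in> D (i - 1)})} \<le> ennreal (exp ((exp 1 - 1) * B - 1 * a))"
      by (rule chernoff_upper) (use D B in \<open>auto simp: sum.reindex\<close>)
    ultimately show "emeasure S {X\<in>space S. a \<le> real (card {j\<in>{..<m}. Xc (X, W1, W2, U) (Suc j) \<in> D j})} \<le> ennreal (exp ((exp 1 - 1) * B - a))"
      by simp
  qed
qed

text \<open>The threshold T / 2 - 2 is what the quota leaves to the second loop: the floor of 3 T /
  4, less the at most T / 4 requests of the first loop, both up to rounding.\<close>

definition second_loop_fail :: "nat \<Rightarrow> nat \<Rightarrow> real \<Rightarrow> 'a source set" where
  "second_loop_fail n k T0 = {\<omega>\<in>space \<Omega>. case \<omega> of (X, W1, W2, U) \<Rightarrow>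
     T0 \<le> real (Tk X W1 W2 n k) \<and> real (Jk X W1 W2 n k) * measure P (hot k X (pos (mid X W1 W2 n k))) \<le> real (Tk X W1 W2 n k) / 3 \<and>
     real (Tk X W1 W2 n k) / 2 - 2 \<le> real (card {i\<in>{pos (mid X W1 W2 n k)..<pos (mid X W1 W2 n k) + Jk X W1 W2 n k}.
       X (Suc i) \<in> hot k X (pos (mid X W1 W2 n k))})}"

text \<open>Hot set, quota and length are fixed when the loop starts, and the points after it are
  fresh. The mean number of hits is at most T / 3, so the Chernoff bound with l = 1/2 has exponent
  (exp (1/2) - 1) T / 3 - T / 4 + 1 \<le> 1 - T / 30.\<close>

lemma covered_second_loop_fail:
  assumes k: "k \<ge> 1"
  shows "covered (second_loop_fail n k T0) (exp (1 - T0 / 30))"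
proof -
  define Q where "Q = (\<lambda>p J T \<omega>. T0 \<le> real T \<and> real J * measure P (hot k (Xc \<omega>) p) \<le> real T / 3 \<and>
     real T / 2 - 2 \<le> real (card {i\<in>{p..<p + J}. Xc \<omega> (Suc i) \<in> hot k (Xc \<omega>) p}))"
  have "Measurable.pred \<Omega> (Q p J T)" for p J T
  proof -
    have "(\<lambda>\<omega>. card {i\<in>{p..<p + J}. Xc \<omega> (Suc i) \<in> hot k (Xc \<omega>) p}) \<in> measurable \<Omega> (count_space UNIV)"
      by (intro measurable_card_Collect pred_hot measurable_source) simp
    then have [measurable]: "(\<lambda>\<omega>. real (card {i\<in>{p..<p + J}. Xc \<omega> (Suc i) \<in> hot k (Xc \<omega>) p})) \<in> borel_measurable \<Omega>"
      by (rule measurable_compose) simp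
    note [measurable] = measurable_hot_mass
    show ?thesis unfolding Q_def by measurable
  qed
  then have "Measurable.pred \<Omega> (\<lambda>\<omega>. Q (pos (mid (Xc \<omega>) (W1c \<omega>) (W2c \<omega>) n k)) (Jk (Xc \<omega>) (W1c \<omega>) (W2c \<omega>) n k) (Tk (Xc \<omega>) (W1c \<omega>) (W2c \<omega>) n k) \<omega>)"
    by (rule measurable_compose_countable[OF measurable_compose_countable[OF measurable_compose_countable[OF _ measurable_Tk] measurable_Jk] measurable_mid])
  then have Rm: "Measurable.pred \<Omega> (\<lambda>(X, W1, W2, U). Q (pos (mid X W1 W2 n k)) (Jk X W1 W2 n k) (Tk X W1 W2 n k) (X, W1, W2, U))" (is "Measurable.pred \<Omega> ?R")
    by (simp only: case_prod_unfold prod.collapse)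
  define \<tau> where "\<tau> = (\<lambda>(X, W1, W2, U :: nat \<Rightarrow> real). pos (mid X W1 W2 n k))"
  have "\<tau> \<in> measurable \<Omega> (count_space UNIV)"
    unfolding \<tau>_def case_prod_beta by (rule measurable_mid)
  then have \<tau>_meas: "\<tau> \<in> measurable (S \<Otimes>\<^sub>M rest) (count_space UNIV)" by (simp only: \<Omega>_rest)
  have "emeasure \<Omega> {\<omega>\<in>space \<Omega>. ?R \<omega>} = (\<integral>\<^sup>+\<omega>. indicator {\<omega>. ?R \<omega>} \<omega> \<partial>\<Omega>)"
    by (rule emeasure_pred[OF Rm])
  also have "\<dots> \<le> ennreal (exp (1 - T0 / 30))"
    unfolding \<Omega>_rest
  proof (rule nn_integral_restart[OF prob_space_rest \<tau>_meas])
    fix X X' :: "nat \<Rightarrow> 'a" and y :: "(nat \<Rightarrow> 'a) \<times> (nat \<Rightarrow> 'a) \<times> (nat \<Rightarrow> real)"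
    obtain W1 W2 U where y: "y = (W1, W2, U)" by (cases y) auto
    assume "\<And>i. i \<le> \<tau> (X, y) \<Longrightarrow> X i = X' i"
    then show "\<tau> (X', y) = \<tau> (X, y)" using mid_causal(1)[OF k, of X W1 W2 n X'] by (simp add: \<tau>_def y)
  next
    have "(\<lambda>\<omega>. indicator {\<omega>. ?R \<omega>} \<omega> :: ennreal) \<in> borel_measurable (S \<Otimes>\<^sub>M rest)"
      using Rm unfolding \<Omega>_rest by (intro borel_measurable_indicator') (simp add: pred_def)
    then show "(indicator {\<omega>. ?R \<omega>} :: _ \<Rightarrow> ennreal) \<in> borel_measurable (S \<Otimes>\<^sub>M rest)" by simp
  next
    fix X y assume X: "X \<in> space S" and ys: "y \<in> space rest"
    obtain W1 W2 U where y: "y = (W1, W2, U)" by (cases y) auto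
    define t J T where "t = pos (mid X W1 W2 n k)" and "J = Jk X W1 W2 n k" and "T = Tk X W1 W2 n k"
    define E where "E = hot k X t"
    have E: "E \<in> sets M" unfolding E_def by (rule sets_hot) (rule space_S[OF X])
    have mid: "mid (comb_seq (Suc t) X X') W1 W2 n k = mid X W1 W2 n k" "Jk (comb_seq (Suc t) X X') W1 W2 n k = J"
      "Tk (comb_seq (Suc t) X X') W1 W2 n k = T" for X'
      using mid_causal[OF k, of X W1 W2 n "comb_seq (Suc t) X X'"] comb_agrees[of _ t X X'] by (auto simp: t_def J_def T_def)
    have hot: "hot k (comb_seq (Suc t) X X') t = E" for X'
      using Vs_cong[of t X "comb_seq (Suc t) X X'"] comb_agrees[of _ t X X'] by (simp add: hot_def E_def)
    have card: "card {i\<in>{t..<t + J}. comb_seq (Suc t) X X' (Suc i) \<in> E} = card {i\<in>{..<J}. X' i \<in> E}" for X'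
    proof -
      have "comb_seq (Suc t) X X' (Suc (i + t)) = X' i" for i using comb_seq_add[of "Suc t" X X' i] by simp
      then have "{i\<in>{t..<t + J}. comb_seq (Suc t) X X' (Suc i) \<in> E} = (\<lambda>i. i + t) ` {i\<in>{..<J}. X' i \<in> E}"
        by (auto simp: image_iff) (metis add.commute add_diff_inverse_nat add_less_cancel_left not_le)
      then show ?thesis by (simp add: card_image)
    qed
    have R: "?R (comb_seq (Suc t) X X', y) \<longleftrightarrow> T0 \<le> real T \<and> real J * measure P E \<le> real T / 3 \<and> real T / 2 - 2 \<le> real (card {i\<in>{..<J}. X' i \<in> E})" for X'
      by (simp only: y Q_def prod.case fst_conv snd_conv mid t_def[symmetric] hot card)
    have "(\<integral>\<^sup>+X'. indicator {\<omega>. ?R \<omega>} (comb_seq (Suc (\<tau> (X, y))) X X', y) \<partial>S) =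
      (\<integral>\<^sup>+X'. indicator {X'. T0 \<le> real T \<and> real J * measure P E \<le> real T / 3 \<and> real T / 2 - 2 \<le> real (card {i\<in>{..<J}. X' i \<in> E})} X' \<partial>S)"
    proof (rule nn_integral_cong)
      fix X'
      have "\<tau> (X, y) = t" by (simp add: \<tau>_def y t_def)
      then show "indicator {\<omega>. ?R \<omega>} (comb_seq (Suc (\<tau> (X, y))) X X', y) =
        (indicator {X'. T0 \<le> real T \<and> real J * measure P E \<le> real T / 3 \<and> real T / 2 - 2 \<le> real (card {i\<in>{..<J}. X' i \<in> E})} X' :: ennreal)"
        unfolding indicator_def mem_Collect_eq by (simp only: R)
    qed
    also have "\<dots> \<le> ennreal (exp (1 - T0 / 30))"
    proof (cases "T0 \<le> real T \<and> real J * measure P E \<le> real T / 3")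
      case True
      have "(\<lambda>X'. card {i\<in>{..<J}. X' i \<in> E}) \<in> measurable S (count_space UNIV)"
        using E by (intro measurable_card_hits) auto
      then have [measurable]: "(\<lambda>X'. real (card {i\<in>{..<J}. X' i \<in> E})) \<in> borel_measurable S"
        by (rule measurable_compose) simp
      have "(\<integral>\<^sup>+X'. indicator {X'. T0 \<le> real T \<and> real J * measure P E \<le> real T / 3 \<and> real T / 2 - 2 \<le> real (card {i\<in>{..<J}. X' i \<in> E})} X' \<partial>S)
        = (\<integral>\<^sup>+X'. indicator {X'. real T / 2 - 2 \<le> real (card {i\<in>{..<J}. X' i \<in> E})} X' \<partial>S)" using True by simp
      also have "\<dots> = emeasure S {X'\<in>space S. real T / 2 - 2 \<le> real (card {i\<in>{..<J}. X' i \<in> E})}"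
        by (rule emeasure_pred[symmetric]) measurable
      also have "\<dots> \<le> ennreal (exp ((exp (1/2) - 1) * (real T / 3) - 1/2 * (real T / 2 - 2)))"
        by (rule chernoff_upper) (use E True in auto)
      also have "\<dots> \<le> ennreal (exp (1 - T0 / 30))"
      proof (intro ennreal_leI, simp only: exp_le_cancel_iff)
        \<comment> \<open>From e < 2.72 < 1.65^2; the factor 0.65 is just small enough for 0.65 / 3
          - 1/4 = - 1/30.\<close>
        have "exp (1/2 :: real) \<le> 165/100"
        proof (rule power2_le_imp_le)
          have "(exp (1/2 :: real))\<^sup>2 = exp 1" by (simp flip: exp_of_nat_mult exp_add add: power2_eq_square)
          also have "\<dots> < 272/100" by (rule e_less_272)
          finally show "(exp (1/2 :: real))\<^sup>2 \<le> (165/100)\<^sup>2" by (simp add: power2_eq_square)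
        qed simp
        then have "(exp (1/2) - 1) * (real T / 3) \<le> 65/100 * (real T / 3)" by (intro mult_right_mono) auto
        then show "(exp (1/2) - 1) * (real T / 3) - 1/2 * (real T / 2 - 2) \<le> 1 - T0 / 30"
          using True[THEN conjunct1] by (simp add: field_simps)
      qed
      finally show ?thesis .
    next
      case False
      then have "{X'. T0 \<le> real T \<and> real J * measure P E \<le> real T / 3 \<and> real T / 2 - 2 \<le> real (card {i\<in>{..<J}. X' i \<in> E})} = {}" by blast
      then show ?thesis by (simp only:) simp
    qed
    finally show "(\<integral>\<^sup>+X'. indicator {\<omega>. ?R \<omega>} (comb_seq (Suc (\<tau> (X, y))) X X', y) \<partial>S) \<le> ennreal (exp (1 - T0 / 30))" .
  qed
  finally have "covered {\<omega>\<in>space \<Omega>. ?R \<omega>} (exp (1 - T0 / 30))" by (rule coveredI[OF Rm])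
  moreover have "second_loop_fail n k T0 = {\<omega>\<in>space \<Omega>. ?R \<omega>}"
    unfolding second_loop_fail_def Q_def by (auto split: prod.splits)
  ultimately show ?thesis by simp
qed

definition select_fail :: "nat \<Rightarrow> 'a source set" where
  "select_fail n = {\<omega>\<in>space \<Omega>. case \<omega> of (X, W1, W2, U) \<Rightarrow> \<exists>k\<in>{1..Suc d}. \<exists>j\<in>{1..<k}.
     misjudged X (pos (fin X W1 W2 n (Suc d))) (budget (Suc d) (n div 3) j) (Hk X W1 W2 n j) (Hk X W1 W2 n k)}"

text \<open>For fixed d the denominator of the budget is at most the constant \<open>c0\<close>, so
  each of the finitely many tests gets a number of requests linear in n.\<close>

lemma rare_select_fail: "rare select_fail"
proof -
  define c0 where "c0 = real (Suc d) * real (Suc d) * ln (exp 1 * real (Suc d))"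
  have ln1: "ln (exp 1 * real (Suc d)) \<ge> 1" 
    by (subst ln_ge_iff) auto
  have c0: "c0 > 0" unfolding c0_def using ln1 by (intro mult_pos_pos) linarith+
  define B where "B j k n = {\<omega>\<in>space \<Omega>. case \<omega> of (X, W1, W2, U) \<Rightarrow>
     misjudged X (pos (fin X W1 W2 n (Suc d))) (budget (Suc d) (n div 3) j) (Hk X W1 W2 n j) (Hk X W1 W2 n k)}" for j k n
  have "rare (\<lambda>n. B j k n)" if jk: "k \<in> {1..Suc d}" "j \<in> {1..<k}" for j k
  proof (rule rareI[of "exp (rate * (1 / c0 + 1))" "rate / (3 * c0)"])
    show "0 < rate / (3 * c0)" using rate_pos c0 by simp
    fix n :: nat
    have b: "real n / (3 * c0) - (1 / c0 + 1) \<le> budget (Suc d) (n div 3) j"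
    proof -
      define c where "c = real j * real (Suc d - j) * ln (exp 1 * real (Suc d))"
      have "0 < c" unfolding c_def
      proof (intro mult_pos_pos)
        show "0 < ln (exp 1 * real (Suc d))" using ln1 by linarith
      qed (use jk in auto)
      have "c \<le> c0" unfolding c_def c0_def using jk order_trans[OF zero_le_one ln1] by (intro mult_mono mult_nonneg_nonneg) (simp_all del: of_nat_Suc)
      have "real n / 3 - 1 \<le> real (n div 3)" by linarith
      then have "(real n / 3 - 1) / c0 \<le> real (n div 3) / c0" using c0 by (intro divide_right_mono) auto
      also have "\<dots> \<le> real (n div 3) / c" using \<open>0 < c\<close> \<open>c \<le> c0\<close> by (intro divide_left_mono) auto
      also have "\<dots> \<le> real (budget (Suc d) (n div 3) j) + 1" unfolding budget_def c_def[symmetric] by linarith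
      finally show ?thesis using c0 by (simp add: field_simps)
    qed
    have "covered (B j k n) (exp (- rate * budget (Suc d) (n div 3) j))"
      unfolding B_def using jk by (intro coveredI select_misjudged_prob) auto
    moreover have "exp (- rate * budget (Suc d) (n div 3) j) \<le> exp (rate * (1 / c0 + 1)) * exp (- (rate / (3 * c0)) * real n)"
    proof -
      have "rate * (real n / (3 * c0) - (1 / c0 + 1)) \<le> rate * budget (Suc d) (n div 3) j"
        using b rate_pos by (intro mult_left_mono) auto
      then have "- rate * budget (Suc d) (n div 3) j \<le> rate * (1 / c0 + 1) + - (rate / (3 * c0)) * real n"
        by (simp add: algebra_simps)
      then show ?thesis by (simp only: exp_add[symmetric] exp_le_cancel_iff)
    qed
    ultimately show "covered (B j k n) (exp (rate * (1 / c0 + 1)) * exp (- (rate / (3 * c0)) * real n))"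
      by (rule covered_mono[OF _ order_refl])
  qed simp
  then have "rare (\<lambda>n. \<Union>k\<in>{1..Suc d}. \<Union>j\<in>{1..<k}. B j k n)" by (intro rare_UN) auto
  then show ?thesis by (rule rare_mono) (auto simp: select_fail_def B_def split: prod.splits)
qed

end

section \<open>The rounds up to the critical one\<close>

context target
begin

text \<open>A round uses at most three quarters of its quota, so all quotas are at least \<open>kappa * n\<close>.\<close>

definition kappa :: real where "kappa = 2 / (3 * 4 ^ d)"

lemma kappa_pos: "kappa > 0" by (simp add: kappa_def)

text \<open>The exceptional events that do not depend on \<epsilon>; those that do are added in the
  final estimate.\<close>

definition bad :: "nat \<Rightarrow> 'a source set" where
  "bad n = ({\<omega>\<in>space \<Omega>. \<not> cores_shattered (Xc \<omega>) (W2c \<omega>)} \<union> select_fail n) \<union>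
     (\<Union>k\<in>{1..dt}. ((\<Union>p\<in>{p. 1 \<le> p \<and> n \<le> 6 * p}. inaccurate k p) \<union> (\<Union>p\<in>{p. 1 \<le> p \<and> n \<le> 6 * p}. density_fail k p)) \<union>
       second_loop_fail n k (kappa * n))"

lemma rare_bad: "rare bad"
proof -
  have 1: "rare (\<lambda>n. {\<omega>\<in>space \<Omega>. \<not> cores_shattered (Xc \<omega>) (W2c \<omega>)})"
    by (rule rareI[of 1 1]) (auto intro: covered_mono[OF covered_cores])
  have 2: "rare (\<lambda>n. second_loop_fail n k (kappa * n))" if "k \<in> {1..dt}" for k
  proof (rule rareI[of "exp 1" "kappa / 30"])
    show "covered (second_loop_fail n k (kappa * n)) (exp 1 * exp (- (kappa / 30) * real n))" for n
      using covered_second_loop_fail[of k n "kappa * n"] that by (simp flip: exp_add)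
  qed (use kappa_pos in auto)
  have "rare (\<lambda>n. ({\<omega>\<in>space \<Omega>. \<not> cores_shattered (Xc \<omega>) (W2c \<omega>)} \<union> select_fail n) \<union>
     (\<Union>k\<in>{1..dt}. ((\<Union>p\<in>{p. 1 \<le> p \<and> n \<le> 6 * p}. inaccurate k p) \<union> (\<Union>p\<in>{p. 1 \<le> p \<and> n \<le> 6 * p}. density_fail k p)) \<union>
       second_loop_fail n k (kappa * n)))"
    by (intro rare_Un[OF rare_Un[OF 1 rare_select_fail]] rare_UN rare_Un rare_inaccurate rare_density_fail 2) auto
  then show ?thesis by (rule rare_mono) (simp only: bad_def order_refl)
qed

text \<open>The 3 / q is 2 / q from the definition of the estimate plus 1 / q of sampling
  error.\<close>

lemma Delta_hat_set_le:
  assumes q: "q \<ge> 1" and sub: "\<And>i. i \<in> {1..q^3} \<Longrightarrow> 1/8 \<le> Delta_hat W2 k q (W1 i) H \<Longrightarrow> W1 i \<in> D"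
    and W1: "\<bar>real (card {i\<in>{1..q^3}. W1 i \<in> D}) - measure P D * real (q^3)\<bar> < 1 / real q * real (q^3)"
  shows "Delta_hat_set W1 W2 k q H \<le> measure P D + 3 / real q"
proof -
  have q3: "real (q^3) > 0" using q by simp
  have "card {i\<in>{1..q^3}. 1/8 \<le> Delta_hat W2 k q (W1 i) H} \<le> card {i\<in>{1..q^3}. W1 i \<in> D}"
    using sub by (intro card_mono) auto
  then have "real (card {i\<in>{1..q^3}. 1/8 \<le> Delta_hat W2 k q (W1 i) H}) \<le> (measure P D + 1 / real q) * real (q^3)"
    using W1 unfolding distrib_right by linarith
  then have "real (card {i\<in>{1..q^3}. 1/8 \<le> Delta_hat W2 k q (W1 i) H}) / real (q^3) \<le> measure P D + 1 / real q"
    using q3 by (simp only: pos_divide_le_eq)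
  then show ?thesis unfolding Delta_hat_set_def of_nat_power by linarith
qed

section \<open>A round outside the exceptional event\<close>

context
  fixes X W1 W2 :: "nat \<Rightarrow> 'a" and U :: "nat \<Rightarrow> real" and n :: nat
  assumes w: "(X, W1, W2, U) \<in> space \<Omega>" and ok: "(X, W1, W2, U) \<notin> bad n" and n: "n \<ge> 1"
begin

lemma points: "X i \<in> space M" "W1 i \<in> space M"
  using measurable_space[OF measurable_source(4) w, of i] measurable_space[OF measurable_source(5) w, of i] by auto

lemma good_events:
  "cores_shattered X W2" "(X, W1, W2, U) \<notin> select_fail n"
  "k \<in> {1..dt} \<Longrightarrow> p \<ge> 1 \<Longrightarrow> n \<le> 6 * p \<Longrightarrow> accurate X W2 k p (Suc p) (X (Suc p))"
  "k \<in> {1..dt} \<Longrightarrow> p \<ge> 1 \<Longrightarrow> n \<le> 6 * p \<Longrightarrow> i \<in> {1..p^3} \<Longrightarrow> accurate X W2 k p p (W1 i)"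
  "k \<in> {1..dt} \<Longrightarrow> p \<ge> 1 \<Longrightarrow> n \<le> 6 * p \<Longrightarrow>
     \<bar>real (card {i\<in>{1..p^3}. W1 i \<in> hot k X p}) - measure P (hot k X p) * real (p^3)\<bar> < 1 / real p * real (p^3)"
  "k \<in> {1..dt} \<Longrightarrow> (X, W1, W2, U) \<notin> second_loop_fail n k (kappa * n)"
proof -
  show "cores_shattered X W2" "(X, W1, W2, U) \<notin> select_fail n"
    "k \<in> {1..dt} \<Longrightarrow> (X, W1, W2, U) \<notin> second_loop_fail n k (kappa * n)"
    using w ok by (auto simp: bad_def)
  assume k: "k \<in> {1..dt}" and p: "p \<ge> 1" "n \<le> 6 * p"
  then have i: "(X, W1, W2, U) \<notin> inaccurate k p" and dn: "(X, W1, W2, U) \<notin> density_fail k p"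
    using ok by (auto simp: bad_def)
  from i w show "accurate X W2 k p (Suc p) (X (Suc p))" by (simp add: inaccurate_def)
  from i w show "i \<in> {1..p^3} \<Longrightarrow> accurate X W2 k p p (W1 i)" by (simp add: inaccurate_def)
  from dn w show "\<bar>real (card {i\<in>{1..p^3}. W1 i \<in> hot k X p}) - measure P (hot k X p) * real (p^3)\<bar> < 1 / real p * real (p^3)"
    by (simp only: density_fail_def mem_Collect_eq fst_conv snd_conv not_le[symmetric]) blast
qed

lemma queried_hot:
  assumes "accurate X W2 k p (Suc p) (X (Suc p))" "k \<in> {1..dt}" "queried X W2 k p" "p' \<le> p"
  shows "X (Suc p) \<in> hot k X p'"
proof -
  have "4/10 * core_mass (k - 1) \<le> link_mass k (Vs X p) (X (Suc p))"
    using assms core_mass_pos[of "k - 1"] good_events(1) unfolding queried_def by (intro Delta_hat_ge_half) auto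
  then have "X (Suc p) \<in> hot k X p" using points by (simp add: hot_def)
  then show ?thesis using hot_antimono[of X p' p k, OF points(1) assms(4)] by blast
qed

text \<open>The invariant at the start of round k + 1. The lower bound on the position makes the
  estimators reliable; for k = 0 its place is taken by \<open>accurate_1\<close>.\<close>

definition round_start :: "nat \<Rightarrow> bool" where
  "round_start k \<longleftrightarrow> vspace (fin X W1 W2 n k) = Vs X (pos (fin X W1 W2 n k)) \<and> (k = 0 \<or> n \<le> 6 * pos (fin X W1 W2 n k)) \<and>
     2 * real n / 3 / 4 ^ k \<le> real (Tk X W1 W2 n (Suc k))"

context
  fixes k :: nat
  assumes k: "k < dt" and start: "round_start k"
begin

private abbreviation "s0 \<equiv> fin X W1 W2 n k"
private abbreviation "s1 \<equiv> mid X W1 W2 n (Suc k)"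
private abbreviation "s2 \<equiv> fin X W1 W2 n (Suc k)"
private abbreviation "T \<equiv> Tk X W1 W2 n (Suc k)"
private abbreviation "J \<equiv> Jk X W1 W2 n (Suc k)"

lemma round_T: "kappa * n \<le> real T"
proof -
  have "k \<le> d" using k dt_le by simp
  then have "(4 :: real) ^ k \<le> 4 ^ d" by (intro power_increasing) auto
  then have "2 * real n / 3 / 4 ^ d \<le> 2 * real n / 3 / 4 ^ k" by (intro divide_left_mono) auto
  then show ?thesis using start by (simp add: round_start_def kappa_def)
qed

lemma round_accurate:
  assumes "p \<ge> pos s0"
  shows "accurate X W2 (Suc k) p (Suc p) (X (Suc p))"
proof (cases "k = 0")
  case False
  then have "n \<le> 6 * p" using start assms by (auto simp: round_start_def)
  then show ?thesis using k n by (intro good_events) auto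
qed (simp add: accurate_1[simplified])

lemma round_explore:
  "pos s0 \<le> pos s1" "vspace s1 = Vs X (pos s1)" "labeled s1 = []"
  "used s1 = card {p\<in>{pos s0..<pos s1}. queried X W2 (Suc k) p}" "int (used s1) \<le> \<lceil>real T / 4\<rceil>"
proof -
  have "pos (s0\<lparr>used := 0, labeled := []\<rparr>) \<le> pos s1 \<and> vspace s1 = Vs X (pos s1) \<and> labeled s1 = [] \<and>
    used s1 = card {p\<in>{pos (s0\<lparr>used := 0, labeled := []\<rparr>)..<pos s1}. queried X W2 (Suc k) p} \<and> int (used s1) \<le> \<lceil>real T / 4\<rceil>"
    unfolding mid_def explored_def diff_Suc_1
    by (rule explore_guarded_correct[where ?p0.0 = "pos s0"])
      (use start round_accurate good_events(1) core_mass_pos[OF k] in \<open>auto simp: round_start_def\<close>)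
  then show "pos s0 \<le> pos s1" "vspace s1 = Vs X (pos s1)" "labeled s1 = []"
    "used s1 = card {p\<in>{pos s0..<pos s1}. queried X W2 (Suc k) p}" "int (used s1) \<le> \<lceil>real T / 4\<rceil>" by simp_all
qed

lemma round_stops: "int (used s1) \<ge> \<lceil>real T / 4\<rceil> \<or> pos s1 > 2 ^ n"
proof -
  have "\<not> guard n (Suc k) T s1" unfolding mid_def by (rule explored_stops)
  moreover have "2 ^ n \<le> Suc k * 2 ^ n" by simp
  ultimately show ?thesis unfolding guard_def by linarith
qed

text \<open>If the first loop of round 1 stops because of its quota, it has made at least T / 4
  \<ge> (2 n / 3) / 4 = n / 6 requests, each at a new point. Otherwise its position exceeds 2 ^ n.
  Later rounds inherit the bound.\<close>

lemma round_pos: "n \<le> 6 * pos s1"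
proof (cases "k = 0")
  case False
  then show ?thesis using start round_explore(1) by (simp add: round_start_def)
next
  case True
  show ?thesis
  proof (cases "pos s1 > 2 ^ n")
    case True
    then show ?thesis using less_exp[of n] by linarith
  next
    case False
    have "used s1 \<le> card {pos s0..<pos s1}" unfolding round_explore(4) by (rule card_mono) auto
    then have "used s1 \<le> pos s1" by simp
    moreover have "real T / 4 \<le> real (used s1)" using round_stops False by linarith
    moreover have "2 * real n / 3 \<le> real T" using start \<open>k = 0\<close> by (simp add: round_start_def)
    ultimately have "real n \<le> 6 * real (pos s1)" by linarith
    then show ?thesis by linarith
  qed
qed

lemma round_pos': "pos s1 \<ge> 1" using round_pos n by linarith

text \<open>Hot points are counted by the estimate. Sampling loses at most 1 / p of the extra 2 / p,
  and the remaining 1 / p keeps the estimate positive even if the hot set is null.\<close>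

lemma round_Delta: "measure P (hot (Suc k) X (pos s1)) + 1 / real (pos s1) \<le> Delta_hat_set W1 W2 (Suc k) (pos s1) (vspace s1)"
proof -
  define p where "p = pos s1"
  have p: "p \<ge> 1" "n \<le> 6 * p" using round_pos round_pos' by (auto simp: p_def)
  have "Delta_hat_set W1 W2 (Suc k) p (Vs X p) \<ge> measure P (hot (Suc k) X p) + 1 / real p"
  proof -
    have q3: "real (p^3) > 0" using p by simp
    let ?D = "hot (Suc k) X p"
    have "card {i\<in>{1..p^3}. W1 i \<in> ?D} \<le> card {i\<in>{1..p^3}. 1/8 \<le> Delta_hat W2 (Suc k) p (W1 i) (Vs X p)}"
    proof (intro card_mono subsetI)
      fix i assume i: "i \<in> {i\<in>{1..p^3}. W1 i \<in> ?D}"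
      then have "1/8 \<le> Delta_hat W2 (Suc k) p (W1 i) (Vs X p)"
        using good_events(1) good_events(4)[of "Suc k" p i] core_mass_pos[OF k] k p
        by (intro Delta_hat_ge_eighth) (auto simp: hot_def)
      then show "i \<in> {i\<in>{1..p^3}. 1/8 \<le> Delta_hat W2 (Suc k) p (W1 i) (Vs X p)}" using i by simp
    qed simp
    then have "(measure P ?D - 1 / real p) * real (p^3) \<le> real (card {i\<in>{1..p^3}. 1/8 \<le> Delta_hat W2 (Suc k) p (W1 i) (Vs X p)})"
      using good_events(5)[of "Suc k" p] k p unfolding left_diff_distrib by simp
    then have "measure P ?D - 1 / real p \<le> real (card {i\<in>{1..p^3}. 1/8 \<le> Delta_hat W2 (Suc k) p (W1 i) (Vs X p)}) / real (p^3)"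
      using q3 by (simp only: pos_le_divide_eq)
    then show ?thesis unfolding Delta_hat_set_def of_nat_power by linarith
  qed
  then show ?thesis by (simp only: p_def round_explore(2))
qed

lemma round_J: "J = nat \<lfloor>real T / (3 * Delta_hat_set W1 W2 (Suc k) (pos s1) (vspace s1))\<rfloor>"
  by (simp only: Jk_def n_collect_def)

lemma round_J_hot: "real J * measure P (hot (Suc k) X (pos s1)) \<le> real T / 3"
proof -
  let ?\<Delta> = "Delta_hat_set W1 W2 (Suc k) (pos s1) (vspace s1)"
  have "1 / real (pos s1) > 0" using round_pos' by simp
  then have \<Delta>: "?\<Delta> > 0" "measure P (hot (Suc k) X (pos s1)) \<le> ?\<Delta>"
    using round_Delta measure_nonneg[of P "hot (Suc k) X (pos s1)"] by linarith+
  have "real T / (3 * ?\<Delta>) \<ge> 0" using \<Delta> by simp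
  then have "real J \<le> real T / (3 * ?\<Delta>)" unfolding round_J by linarith
  then have "real J * measure P (hot (Suc k) X (pos s1)) \<le> real T / (3 * ?\<Delta>) * ?\<Delta>" using \<Delta> by (intro mult_mono) auto
  then show ?thesis using \<Delta> by simp
qed

text \<open>The version space only shrinks during the loop, so all queried points lie in the set
  that was hot at its start. It is this fixed set that \<open>second_loop_fail\<close> speaks
  of.\<close>

lemma round_requests: "int (used s1 + card {p\<in>{pos s1..<pos s1 + J}. queried X W2 (Suc k) p}) < \<lfloor>3 * real T / 4\<rfloor>"
proof -
  have "(X, W1, W2, U) \<notin> second_loop_fail n (Suc k) (kappa * n)" using k by (intro good_events) auto
  then have "real (card {i\<in>{pos s1..<pos s1 + J}. X (Suc i) \<in> hot (Suc k) X (pos s1)}) < real T / 2 - 2"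
    using w round_T round_J_hot by (simp only: second_loop_fail_def mem_Collect_eq prod.case simp_thms not_le)
  moreover have "card {p\<in>{pos s1..<pos s1 + J}. queried X W2 (Suc k) p} \<le> card {i\<in>{pos s1..<pos s1 + J}. X (Suc i) \<in> hot (Suc k) X (pos s1)}"
  proof (intro card_mono subsetI)
    fix p assume "p \<in> {p\<in>{pos s1..<pos s1 + J}. queried X W2 (Suc k) p}"
    then have p: "p \<in> {pos s1..<pos s1 + J}" "queried X W2 (Suc k) p" by auto
    have "X (Suc p) \<in> hot (Suc k) X (pos s1)"
      using p round_explore(1) k by (intro queried_hot[OF round_accurate]) auto
    then show "p \<in> {i\<in>{pos s1..<pos s1 + J}. X (Suc i) \<in> hot (Suc k) X (pos s1)}" using p by simp
  qed simp
  ultimately show ?thesis using round_explore(5) by linarith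
qed

lemma round_collect:
  "pos s2 = pos s1 + J" "vspace s2 = Vs X (pos s2)"
  "labeled s2 = map (\<lambda>i. (X i, f (X i))) [Suc (pos s1)..<Suc (pos s1 + J)]" "real (used s2) \<le> 3 * real T / 4"
proof -
  have "pos s2 = pos s1 + J \<and> vspace s2 = Vs X (pos s2) \<and>
    labeled s2 = map (\<lambda>i. (X i, f (X i))) [Suc (pos s1)..<Suc (pos s1 + J)] \<and>
    used s2 = used s1 + card {p\<in>{pos s1..<pos s1 + J}. queried X W2 (Suc k) p}"
    unfolding fin_Suc Jk_def[symmetric]
    by (rule collect_correct[where ?p0.0 = "pos s0"])
      (use round_accurate good_events(1) core_mass_pos[OF k] round_explore round_requests in auto)
  moreover from this have "real (used s2) \<le> 3 * real T / 4" using round_requests by linarith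
  ultimately show "pos s2 = pos s1 + J" "vspace s2 = Vs X (pos s2)"
    "labeled s2 = map (\<lambda>i. (X i, f (X i))) [Suc (pos s1)..<Suc (pos s1 + J)]" "real (used s2) \<le> 3 * real T / 4" by blast+
qed

lemma round_Hk: "Hk X W1 W2 n (Suc k) = ideal X W1 W2 n (Suc k)"
  by (simp only: Hk_def ideal_def round_collect(3))

lemma round_next: "round_start (Suc k)"
proof -
  have "2 * real n / 3 / 4 ^ Suc k = 2 * real n / 3 / 4 ^ k / 4" by simp
  also have "\<dots> \<le> real T / 4" using start by (intro divide_right_mono) (auto simp: round_start_def)
  also have "\<dots> \<le> real (Tk X W1 W2 n (Suc (Suc k)))"
    unfolding Tk_Suc[of X W1 W2 n "Suc k"] using round_collect(4) by linarith
  finally have "2 * real n / 3 / 4 ^ Suc k \<le> real (Tk X W1 W2 n (Suc (Suc k)))" .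
  then show ?thesis unfolding round_start_def using round_collect(1,2) round_pos by simp
qed

end

lemma round_start: "k < dt \<Longrightarrow> round_start k"
proof (induction k)
  case 0
  have "used (fin X W1 W2 n 0) = 0" "pos (fin X W1 W2 n 0) = 0" "vspace (fin X W1 W2 n 0) = C" "Tk X W1 W2 n 0 = nat \<lceil>2 * real n / 3\<rceil>"
    by (simp_all add: fin_def Tk_def)
  moreover have "2 * real n / 3 \<le> real (nat \<lceil>2 * real n / 3\<rceil>)" by linarith
  ultimately show ?case unfolding round_start_def Tk_Suc by (simp add: Vs_0)
next
  case (Suc k)
  then show ?case by (intro round_next) auto
qed

lemma err_meta_le:
  "err P f (meta_algorithm M C (halving_learner C) n (X, W1, W2, U) (lab X)) \<le> 2 * err P f (ideal X W1 W2 n dt)"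
proof -
  obtain k where k: "dt = Suc k" using dt_pos by (cases dt) auto
  have "(X, W1, W2, U) \<notin> select_fail n" by (rule good_events)
  then have "err P f (active_select X (lab X) (pos (fin X W1 W2 n (Suc d))) (Suc d) (n div 3) (Hk X W1 W2 n)) \<le> 2 * err P f (Hk X W1 W2 n dt)"
    using w dt_pos dt_le by (intro active_select_good) (auto simp: select_fail_def)
  moreover have "Hk X W1 W2 n dt = ideal X W1 W2 n dt" unfolding k using round_start[of k] k by (intro round_Hk) auto
  ultimately show ?thesis by (simp only: meta_algorithm_eq)
qed

text \<open>If the loop stopped before m, all its requests would lie in the level sets of the balls.
  These are fewer than kappa n / 4 and hence below T / 4, so the quota cannot have stopped the loop;
  nor can the position limit, since m is at most 2 ^ n.\<close>

lemma explore_far: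
  assumes rad: "\<And>p. p < m \<Longrightarrow> Vs X p \<subseteq> ball (r p)" and m: "m \<le> 2 ^ n"
    and few: "(X, W1, W2, U) \<notin> first_loop_fail (\<lambda>j. {x\<in>space M. 4/10 * core_mass (dt - 1) \<le> link_mass dt (ball (r j)) x}) m (kappa * n / 4)"
  shows "m \<le> pos (mid X W1 W2 n dt)"
proof (rule ccontr)
  obtain k where k: "dt = Suc k" using dt_pos by (cases dt) auto
  have k': "k < dt" and st: "round_start k" using k round_start[of k] by auto
  let ?s0 = "fin X W1 W2 n k" and ?s1 = "mid X W1 W2 n dt" and ?T = "Tk X W1 W2 n dt"
  assume far: "\<not> m \<le> pos ?s1"
  have "used ?s1 = card {p\<in>{pos ?s0..<pos ?s1}. queried X W2 dt p}" using round_explore(4)[OF k' st] by (simp only: k)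
  also have "\<dots> \<le> card {j\<in>{..<m}. X (Suc j) \<in> {x\<in>space M. 4/10 * core_mass (dt - 1) \<le> link_mass dt (ball (r j)) x}}"
  proof (intro card_mono subsetI)
    fix p assume "p \<in> {p\<in>{pos ?s0..<pos ?s1}. queried X W2 dt p}"
    then have p: "pos ?s0 \<le> p" "p < m" "queried X W2 dt p" using far by auto
    have "X (Suc p) \<in> hot dt X p"
      using p(3) dt_pos round_accurate[OF k' st p(1)] by (intro queried_hot[of dt p p]) (auto simp: k)
    then have "4/10 * core_mass (dt - 1) \<le> link_mass dt (Vs X p) (X (Suc p))" by (simp add: hot_def)
    also have "\<dots> \<le> link_mass dt (ball (r p)) (X (Suc p))" by (rule link_mass_mono_ball[OF rad[OF p(2)] points(1)])
    finally show "p \<in> {j\<in>{..<m}. X (Suc j) \<in> {x\<in>space M. 4/10 * core_mass (dt - 1) \<le> link_mass dt (ball (r j)) x}}"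
      using p(2) points(1) by simp
  qed simp
  finally have "real (used ?s1) < kappa * n / 4"
    using few w by (simp only: first_loop_fail_def mem_Collect_eq fst_conv simp_thms not_le of_nat_le_iff[symmetric, where 'a = real])
  moreover have "kappa * n \<le> real ?T" using round_T[OF k' st] by (simp only: k)
  ultimately have "int (used ?s1) < \<lceil>real ?T / 4\<rceil>" by linarith
  moreover have "int (used ?s1) \<ge> \<lceil>real ?T / 4\<rceil> \<or> pos ?s1 > 2 ^ n" using round_stops[OF k' st] by (simp only: k)
  ultimately show False using m far by linarith
qed

text \<open>A point with estimate at least 1/8 has link mass at least 1/10 of the core mass, for the
  version space and so for the ball. Hence the estimated density is at most that of the fixed set
  \<open>D\<close> plus 3 / m. The final 1 is lost to rounding.\<close>

lemma collect_many:
  assumes far: "m \<le> pos (mid X W1 W2 n dt)" and m: "m \<ge> 1" and rad: "Vs X m \<subseteq> ball r"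
    and D: "D = {x\<in>space M. 1/10 * core_mass (dt - 1) \<le> link_mass dt (ball r) x}"
    and dens: "\<And>p. 1 \<le> p \<Longrightarrow> n \<le> 6 * p \<Longrightarrow> (X, W1, W2, U) \<notin> density_fail_fixed D p"
  shows "kappa * n / (3 * (measure P D + 3 / real m)) - 1 \<le> real (Jk X W1 W2 n dt)"
proof -
  obtain k where k: "dt = Suc k" using dt_pos by (cases dt) auto
  have k': "k < dt" and st: "round_start k" using k round_start[of k] by auto
  define p where "p = pos (mid X W1 W2 n dt)"
  have p: "p \<ge> 1" "n \<le> 6 * p" "m \<le> p" using round_pos[OF k' st] round_pos'[OF k' st] far by (simp_all only: p_def k)
  have V: "vspace (mid X W1 W2 n dt) = Vs X p" using round_explore(2)[OF k' st] by (simp only: p_def k)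
  let ?\<Delta> = "Delta_hat_set W1 W2 dt p (Vs X p)"
  have "?\<Delta> \<le> measure P D + 3 / real p"
  proof (rule Delta_hat_set_le[OF p(1)])
    fix i assume i: "i \<in> {1..p^3}" "1/8 \<le> Delta_hat W2 dt p (W1 i) (Vs X p)"
    have "1/10 * core_mass (dt - 1) \<le> link_mass dt (Vs X p) (W1 i)"
      using good_events(1) good_events(4)[of dt p i] dt_pos core_mass_pos[of "dt - 1"] p i
      by (intro Delta_hat_ge_eighth_imp) auto
    also have "\<dots> \<le> link_mass dt (ball r) (W1 i)"
      using Vs_antimono[OF p(3), of X] rad by (intro link_mass_mono_ball points) auto
    finally show "W1 i \<in> D" using points by (simp add: D)
  next
    show "\<bar>real (card {i\<in>{1..p^3}. W1 i \<in> D}) - measure P D * real (p^3)\<bar> < 1 / real p * real (p^3)"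
      using dens[OF p(1,2)] w by (simp only: density_fail_fixed_def mem_Collect_eq fst_conv snd_conv simp_thms not_le)
  qed
  also have "\<dots> \<le> measure P D + 3 / real m" using m p by (intro add_mono divide_left_mono) auto
  finally have \<Delta>: "?\<Delta> \<le> measure P D + 3 / real m" .
  have "1 / real p > 0" using p by simp
  then have pos: "?\<Delta> > 0"
    using round_Delta[OF k' st] measure_nonneg[of P "hot dt X p"] unfolding V[symmetric] unfolding p_def k by linarith
  have "kappa * n / (3 * (measure P D + 3 / real m)) \<le> kappa * n / (3 * ?\<Delta>)"
    using pos \<Delta> kappa_pos by (intro divide_left_mono mult_pos_pos) auto
  also have "\<dots> \<le> real (Tk X W1 W2 n dt) / (3 * ?\<Delta>)"
    using pos round_T[OF k' st] by (intro divide_right_mono) (simp_all add: k)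
  finally have "kappa * n / (3 * (measure P D + 3 / real m)) \<le> real (Tk X W1 W2 n dt) / (3 * ?\<Delta>)" .
  moreover have "Jk X W1 W2 n dt = nat \<lfloor>real (Tk X W1 W2 n dt) / (3 * ?\<Delta>)\<rfloor>"
    unfolding V[symmetric] unfolding p_def using round_J[OF k' st] by (simp only: k)
  ultimately show ?thesis by linarith
qed

end

end

section \<open>The expected error\<close>

lemma harmonic_le: "1 \<le> m \<Longrightarrow> (\<Sum>j<m. 1 / (real j + 1)) \<le> 1 + ln (real m)"
proof (induction m rule: nat_induct_at_least)
  case (Suc m)
  have "ln (real m / (real m + 1)) \<le> real m / (real m + 1) - 1" using Suc by (intro ln_le_minus_one) auto
  then have "1 / (real m + 1) \<le> ln (real m + 1) - ln (real m)" using Suc by (simp add: ln_div field_simps)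
  then show ?case using Suc by (simp add: add.commute)
qed simp

text \<open>With x = J + 1, write ln (2 x) = ln (2 x \<epsilon> / c) + ln c + L and use ln y \<le> y
  - 1: the logarithm is at most a small multiple of x \<epsilon>. The constants make the
  contributions 2 / c and (1 + ln c) / G both equal to 1 / (64 (d + 1)).\<close>

lemma log_quotient_le:
  fixes d J :: nat and \<epsilon> L c G :: real
  defines "c \<equiv> 128 * (real d + 1)" and "G \<equiv> 64 * (real d + 1) * (1 + ln c)"
  assumes \<epsilon>: "\<epsilon> > 0" "L = ln (1 / \<epsilon>)" "L \<ge> 1" and J: "G * L / \<epsilon> \<le> real J"
  shows "2 * real d * log 2 (real J + 2) / (real J + 1) \<le> \<epsilon> / 8"
proof -
  define x where "x = real J + 1"
  have c: "c \<ge> 128" "ln c \<ge> 0" by (auto simp: c_def)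
  have G: "G > 0" unfolding G_def
  proof (intro mult_pos_pos)
    show "0 < 1 + ln c" using c(2) by linarith
  qed auto
  have x: "x \<ge> 1" "G * L / \<epsilon> \<le> x" using J by (auto simp: x_def)
  then have Lx: "L \<le> x * \<epsilon> / G" using \<epsilon> G by (simp add: field_simps)
  have "ln (real J + 2) \<le> ln (2 * x)" using x by (simp add: x_def)
  also have "\<dots> = ln (2 * x * \<epsilon> / c) + ln c + L"
    using \<epsilon> c x by (simp add: ln_mult_pos ln_div)
  also have "ln (2 * x * \<epsilon> / c) \<le> 2 * x * \<epsilon> / c - 1" using \<epsilon> c x by (intro ln_le_minus_one) auto
  finally have "ln (real J + 2) \<le> 2 * x * \<epsilon> / c + ln c * 1 + L" by simp
  also have "ln c * 1 \<le> ln c * L" using c(2) \<epsilon>(3) by (intro mult_left_mono)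
  finally have "ln (real J + 2) \<le> 2 * x * \<epsilon> / c + (1 + ln c) * L" by (simp add: distrib_right)
  also have "\<dots> \<le> 2 * x * \<epsilon> / c + (1 + ln c) * (x * \<epsilon> / G)" using Lx c by (intro add_left_mono mult_left_mono) auto
  also have "\<dots> = x * \<epsilon> * (2 / c + (1 + ln c) / G)" by (simp add: algebra_simps)
  also have "(1 + ln c) / G = 1 / (64 * (real d + 1))"
  proof -
    have "1 + ln c \<noteq> 0" using c(2) by linarith
    then show ?thesis by (simp add: G_def)
  qed
  also have "2 / c + 1 / (64 * (real d + 1)) = 1 / (32 * (real d + 1))"
  proof -
    have "2 / (128 * y) + 1 / (64 * y) = 1 / (32 * y)" if "y > 0" for y :: real using that by (simp add: field_simps)
    note this[of "real d + 1"]
    moreover have "real d + 1 > 0" by simp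
    ultimately show ?thesis unfolding c_def by blast
  qed
  finally have *: "ln (real J + 2) \<le> x * \<epsilon> / (32 * (real d + 1))" by simp
  have "log 2 (real J + 2) \<le> 2 * ln (real J + 2)"
  proof -
    have "1/2 \<le> ln (2 :: real)" using ln2_ge_two_thirds by simp
    then have "ln (real J + 2) / ln 2 \<le> ln (real J + 2) / (1/2)" by (intro divide_left_mono) auto
    then show ?thesis by (simp add: log_def)
  qed
  also have "\<dots> \<le> 2 * (x * \<epsilon> / (32 * (real d + 1)))" using * by simp
  finally have "2 * real d * log 2 (real J + 2) \<le> 2 * real d * (2 * (x * \<epsilon> / (32 * (real d + 1))))"
    by (rule mult_left_mono) simp
  also have "\<dots> = (real d / (real d + 1)) * (x * \<epsilon> / 8)" by (simp add: field_simps)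
  also have "\<dots> \<le> 1 * (x * \<epsilon> / 8)" using x \<epsilon> by (intro mult_right_mono) auto
  finally show ?thesis using x by (simp add: x_def[symmetric] divide_le_eq mult.commute)
qed

context target
begin

lemma err_le_1: "err P f h \<le> 1" and err_nonneg: "0 \<le> err P f h"
  by (simp_all add: err_def)

text \<open>On the exceptional set the error is at most 1, elsewhere at most twice that of
  \<open>ideal\<close>, whose mean over runs with at least J0 labels is at most \<delta>.\<close>

lemma integral_err_le:
  assumes B: "covered B p" and p: "p \<ge> 0" and \<delta>: "\<And>J :: nat. J \<ge> J0 \<Longrightarrow> 2 * real d * log 2 (real J + 2) / (real J + 1) \<le> \<delta>"
    and good: "\<And>X W1 W2 U. (X, W1, W2, U) \<in> space \<Omega> \<Longrightarrow> (X, W1, W2, U) \<notin> B \<Longrightarrow>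
      J0 \<le> Jk X W1 W2 n dt \<and> err P f (meta_algorithm M C (halving_learner C) n (X, W1, W2, U) (lab X)) \<le> 2 * err P f (ideal X W1 W2 n dt)"
  shows "integral\<^sup>L \<Omega> (\<lambda>\<omega>. err P f (meta_algorithm M C (halving_learner C) n \<omega> (\<lambda>i. f (fst \<omega> i)))) \<le> p + 2 * \<delta>"
proof -
  have "0 \<le> 2 * real d * log 2 (real J0 + 2) / (real J0 + 1)" by (intro divide_nonneg_nonneg mult_nonneg_nonneg) auto
  then have \<delta>0: "\<delta> \<ge> 0" using \<delta>[OF order_refl] by (rule order_trans)
  have \<delta>': "real (2 * d) * log 2 (real (J + 2)) / real (J + 1) \<le> \<delta>" if "J \<ge> J0" for J
    using \<delta>[OF that] by (simp add: add.commute)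
  obtain N where N: "N \<in> sets \<Omega>" "B \<subseteq> N" "emeasure \<Omega> N \<le> ennreal p" using B by (auto simp: covered_def)
  let ?F = "\<lambda>\<omega>. err P f (meta_algorithm M C (halving_learner C) n \<omega> (\<lambda>i. f (fst \<omega> i)))"
  let ?G = "\<lambda>\<omega>. (case \<omega> of (X, W1, W2, U) \<Rightarrow> ennreal (err P f (ideal X W1 W2 n dt)) * indicator {J0..} (Jk X W1 W2 n dt))"
  have [measurable]: "?G \<in> borel_measurable \<Omega>"
  proof -
    have "(\<lambda>\<omega>. ennreal (err P f (ideal (Xc \<omega>) (W1c \<omega>) (W2c \<omega>) n dt)) * indicator {J0..} (Jk (Xc \<omega>) (W1c \<omega>) (W2c \<omega>) n dt)) \<in> borel_measurable \<Omega>"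
      by (intro borel_measurable_times_ennreal measurable_compose[OF measurable_err_ideal measurable_ennreal]
          measurable_compose[OF measurable_Jk]) simp
    then show ?thesis by (simp only: case_prod_unfold)
  qed
  have "(\<integral>\<^sup>+\<omega>. ennreal (?F \<omega>) \<partial>\<Omega>) \<le> (\<integral>\<^sup>+\<omega>. indicator N \<omega> + 2 * ?G \<omega> \<partial>\<Omega>)"
  proof (rule nn_integral_mono)
    fix \<omega> :: "'a source" assume w: "\<omega> \<in> space \<Omega>"
    obtain X W1 W2 U where e: "\<omega> = (X, W1, W2, U)" by (cases \<omega>)
    show "ennreal (?F \<omega>) \<le> indicator N \<omega> + 2 * ?G \<omega>"
    proof (cases "\<omega> \<in> N")
      case True
      have "ennreal (?F \<omega>) \<le> 1 + 0" using err_le_1 by (simp flip: ennreal_1 add: ennreal_leI)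
      also have "\<dots> \<le> indicator N \<omega> + 2 * ?G \<omega>" using True by (intro add_mono) auto
      finally show ?thesis .
    next
      case False
      then have "J0 \<le> Jk X W1 W2 n dt" "?F \<omega> \<le> 2 * err P f (ideal X W1 W2 n dt)"
        using good[of X W1 W2 U] w N(2) unfolding e by auto
      then have "ennreal (?F \<omega>) \<le> ennreal (2 * err P f (ideal X W1 W2 n dt)) " by (intro ennreal_leI)
      also have "\<dots> = 2 * ?G \<omega>" using \<open>J0 \<le> Jk X W1 W2 n dt\<close> err_nonneg by (simp add: e ennreal_mult)
      finally show ?thesis using False by simp
    qed
  qed
  also have "\<dots> = emeasure \<Omega> N + 2 * (\<integral>\<^sup>+\<omega>. ?G \<omega> \<partial>\<Omega>)"
    using N(1) by (subst nn_integral_add) (simp_all add: nn_integral_cmult)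
  also have "\<dots> \<le> ennreal p + 2 * ennreal \<delta>"
    using ideal_error[OF dt_pos \<delta>'] N(3) by (intro add_mono mult_left_mono) auto
  also have "\<dots> = ennreal (p + 2 * \<delta>)" using p \<delta>0 by (simp add: ennreal_mult ennreal_plus)
  finally show ?thesis using p \<delta>0 err_nonneg by (intro integral_real_bounded) auto
qed

section \<open>Bounds that depend on \<epsilon>, and the choice of the constants\<close>

definition thet :: "real \<Rightarrow> real" where "thet \<epsilon> = real_of_ereal (theta_tilde P C f \<epsilon>)"

text \<open>The constant \<open>A\<close> is chosen such that \<open>exp (- A * L / 8) = \<epsilon> ^ (3 * d + 6)\<close>, which beats the
  \<open>\<epsilon>\<close>-dependence of the growth function and of the union over \<open>p \<le> m\<close>.\<close>

lemma covered_radii: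
  fixes m :: nat and L A \<epsilon> :: real
  defines "A \<equiv> 8 * (3 * real d + 6)"
  assumes \<epsilon>: "0 < \<epsilon>" "\<epsilon> < 1" "L = ln (1 / \<epsilon>)" "L \<ge> 1" and m: "real m \<le> A * L / (2 * \<epsilon>)"
  shows "covered (\<Union>p\<in>{1..m}. radius_fail (A * L / (real p + 1)) p) ((A + 2) ^ (d + 1) * \<epsilon>\<^sup>2)"
proof -
  have A: "A \<ge> 48" by (simp add: A_def)
  have L1: "L \<le> 1 / \<epsilon>" using ln_le_minus_one[of "1 / \<epsilon>"] \<epsilon> by simp
  have e: "\<epsilon> = exp (- L)" using \<epsilon> by (simp add: ln_div)
  define b where "b = 2 * real ((2 * m + 2) ^ d) * exp (- A * L / 8)"
  have c: "covered (radius_fail (A * L / (real p + 1)) p) b" if p: "p \<in> {1..m}" for p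
  proof -
    have p1: "1/2 \<le> real p / (real p + 1)" using p by (simp add: field_simps)
    then have "A * L * (1/2) \<le> A * L * (real p / (real p + 1))" using A \<epsilon> by (intro mult_left_mono) auto
    then have h: "A * L / 2 \<le> A * L / (real p + 1) * real p" by simp
    have "48 * 1 \<le> A * L" using A \<epsilon> by (intro mult_mono) auto
    then have "covered (radius_fail (A * L / (real p + 1)) p) (2 * real ((2 * p + 2) ^ d) * exp (- (A * L / (real p + 1)) * p / 4))"
      using h by (intro covered_radius_fail) linarith
    moreover have "real ((2 * p + 2) ^ d) \<le> real ((2 * m + 2) ^ d)" using p by (intro of_nat_mono power_mono) auto
    moreover have "exp (- (A * L / (real p + 1)) * p / 4) \<le> exp (- A * L / 8)"
    proof -
      have "- (A * L / (real p + 1)) * p / 4 = - (A * L / (real p + 1) * real p) / 4" by simp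
      also have "\<dots> \<le> - (A * L / 2) / 4" by (rule divide_right_mono[OF le_imp_neg_le[OF h]]) simp
      also have "\<dots> = - A * L / 8" by simp
      finally show ?thesis by (simp only: exp_le_cancel_iff)
    qed
    ultimately show ?thesis unfolding b_def by (elim covered_mono) (auto intro!: mult_mono)
  qed
  have "covered (\<Union>p\<in>{1..m}. radius_fail (A * L / (real p + 1)) p) (\<Sum>p\<in>{1..m}. b)"
    using c by (intro covered_UN) (auto simp: b_def)
  moreover have "(\<Sum>p\<in>{1..m}. b) \<le> (A + 2) ^ (d + 1) * \<epsilon>\<^sup>2"
  proof -
    have "2 * real m \<le> A * L / \<epsilon>" using m \<epsilon> by (simp add: field_simps)
    also have "\<dots> \<le> A * (1 / \<epsilon>) / \<epsilon>" using L1 A \<epsilon> by (intro divide_right_mono mult_left_mono) auto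
    also have "\<dots> = A / \<epsilon>\<^sup>2" by (simp add: power2_eq_square)
    finally have "2 * real m \<le> A / \<epsilon>\<^sup>2" .
    moreover have "2 \<le> 2 / \<epsilon>\<^sup>2" using \<epsilon> by (simp add: field_simps power_le_one)
    ultimately have mm: "2 * real m + 2 \<le> (A + 2) / \<epsilon>\<^sup>2" by (simp add: add_divide_distrib)
    have "(\<Sum>p\<in>{1..m}. b) = (2 * real m) * (2 * real m + 2) ^ d * exp (- A * L / 8)" by (simp add: b_def add.commute[of 2])
    also have "\<dots> \<le> (2 * real m + 2) * (2 * real m + 2) ^ d * exp (- A * L / 8)" by (intro mult_right_mono) auto
    also have "\<dots> = (2 * real m + 2) ^ (d + 1) * exp (- A * L / 8)" by simp
    also have "\<dots> \<le> ((A + 2) / \<epsilon>\<^sup>2) ^ (d + 1) * exp (- A * L / 8)" using mm by (intro mult_right_mono power_mono) auto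
    also have "exp (- A * L / 8) = \<epsilon> ^ (3 * d + 6)"
    proof -
      have "- A * L / 8 = real (3 * d + 6) * - L" by (simp add: A_def field_simps)
      then show ?thesis unfolding e by (simp only: exp_of_nat_mult)
    qed
    also have "\<epsilon> ^ (3 * d + 6) = (\<epsilon>\<^sup>2) ^ (d + 1) * \<epsilon> ^ (d + 4)"
    proof -
      \<comment> \<open>The first 2 (d + 1) factors cancel the denominators of ((A + 2) /
        \<epsilon>^2) ^ (d + 1); of the remaining d + 4 only two are kept.\<close>
      have "3 * d + 6 = 2 * (d + 1) + (d + 4)" by simp
      then show ?thesis by (simp only: power_mult power_add)
    qed
    also have "((A + 2) / \<epsilon>\<^sup>2) ^ (d + 1) * ((\<epsilon>\<^sup>2) ^ (d + 1) * \<epsilon> ^ (d + 4)) = (A + 2) ^ (d + 1) * \<epsilon> ^ (d + 4)"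
      using \<epsilon> by (simp add: power_divide)
    also have "\<dots> \<le> (A + 2) ^ (d + 1) * \<epsilon>\<^sup>2" using \<epsilon> A by (intro mult_left_mono power_decreasing) auto
    finally show ?thesis .
  qed
  ultimately show ?thesis by (rule covered_mono[OF _ order_refl])
qed

lemma sets_link_level: "{x\<in>space M. a \<le> link_mass k (ball r) x} \<in> sets M"
  by measurable

text \<open>Markov's inequality at radius A L / (j + 1) bounds the j-th level set by a multiple of
  \<theta> L / (j + 1); the harmonic sum contributes the second factor L, as m is polynomial in 1 /
  \<epsilon>.\<close>

lemma sum_levels_le:
  fixes m :: nat and L A \<epsilon> \<alpha> :: real
  assumes \<epsilon>: "0 < \<epsilon>" "L = ln (1 / \<epsilon>)" "L \<ge> 1" and m: "1 \<le> m" "real m \<le> A * L / (2 * \<epsilon>)" and A: "A \<ge> 1" and \<alpha>: "\<alpha> > 0"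
  shows "(\<Sum>j<m. measure P {x\<in>space M. 4/10 * \<alpha> \<le> link_mass dt (ball (A * L / (real j + 1))) x}) \<le> A * (3 + ln A) / (4/10 * \<alpha>) * thet \<epsilon> * L\<^sup>2"
proof -
  have \<theta>: "thet \<epsilon> \<ge> 1" unfolding thet_def by (rule shatter_mass_le_theta(2)[of \<epsilon> "2 * \<epsilon>"]) (use \<epsilon> in auto)
  have L1: "L \<le> 1 / \<epsilon>" using ln_le_minus_one[of "1 / \<epsilon>"] \<epsilon> by simp
  have "measure P {x\<in>space M. 4/10 * \<alpha> \<le> link_mass dt (ball (A * L / (real j + 1))) x} \<le> thet \<epsilon> * A * L / (4/10 * \<alpha>) * (1 / (real j + 1))" if j: "j < m" for j
  proof -
    \<comment> \<open>The supremum in theta ranges over radii above \<epsilon> only, which is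
      ensured by the upper bound on m.\<close>
    have r: "A * L / (real j + 1) > \<epsilon>"
    proof -
      have "real j + 1 \<le> A * L / (2 * \<epsilon>)" using j m by linarith
      then have "2 * \<epsilon> * (real j + 1) \<le> A * L" using \<epsilon> by (simp add: field_simps)
      moreover have "\<epsilon> * (real j + 1) > 0" using \<epsilon> by simp
      ultimately have "\<epsilon> * (real j + 1) < A * L" by linarith
      then show ?thesis by (simp add: field_simps)
    qed
    have "measure P {x\<in>space P. 4/10 * \<alpha> \<le> link_mass dt (ball (A * L / (real j + 1))) x} \<le> shatter_mass dt (A * L / (real j + 1)) / (4/10 * \<alpha>)"
      using \<alpha> dt_pos by (intro link_mass_markov) auto
    also have "\<dots> \<le> (thet \<epsilon> * (A * L / (real j + 1))) / (4/10 * \<alpha>)"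
      unfolding thet_def using \<alpha> r \<epsilon> by (intro divide_right_mono shatter_mass_le_theta) auto
    finally show ?thesis by (simp add: field_simps)
  qed
  then have "(\<Sum>j<m. measure P {x\<in>space M. 4/10 * \<alpha> \<le> link_mass dt (ball (A * L / (real j + 1))) x}) \<le> (\<Sum>j<m. thet \<epsilon> * A * L / (4/10 * \<alpha>) * (1 / (real j + 1)))"
    by (intro sum_mono) auto
  also have "\<dots> = thet \<epsilon> * A * L / (4/10 * \<alpha>) * (\<Sum>j<m. 1 / (real j + 1))" by (simp only: sum_distrib_left)
  also have "\<dots> \<le> thet \<epsilon> * A * L / (4/10 * \<alpha>) * ((3 + ln A) * L)"
  proof (rule mult_left_mono)
    have "A * L / (2 * \<epsilon>) \<le> A * (1 / \<epsilon>) / \<epsilon>"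
      using L1 A \<epsilon> by (intro frac_le mult_left_mono) auto
    then have "ln (real m) \<le> ln (A * (1 / \<epsilon>) * (1 / \<epsilon>))" using m A \<epsilon> by (subst ln_le_cancel_iff) auto
    also have "\<dots> = ln A + 2 * L" using A \<epsilon> by (simp add: ln_mult_pos ln_div)
    finally have "1 + ln (real m) \<le> 1 + ln A + 2 * L" by simp
    also have "\<dots> \<le> (3 + ln A) * L" using A \<epsilon> mult_left_mono[of 1 L "1 + ln A"] by (simp add: algebra_simps)
    finally show "(\<Sum>j<m. 1 / (real j + 1)) \<le> (3 + ln A) * L" using harmonic_le[OF m(1)] by linarith
    show "0 \<le> thet \<epsilon> * A * L / (4/10 * \<alpha>)"
      using \<theta> A \<epsilon>(3) \<alpha> by (intro divide_nonneg_nonneg mult_nonneg_nonneg) auto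
  qed
  also have "\<dots> = A * (3 + ln A) / (4/10 * \<alpha>) * thet \<epsilon> * L\<^sup>2" by (simp add: power2_eq_square)
  finally show ?thesis .
qed

lemma integral_err_le_eps:
  obtains c where "c \<ge> 0" "\<forall>\<^sub>F \<epsilon> in at_right 0. \<forall>n. c * thet \<epsilon> * (ln (1 / \<epsilon>))\<^sup>2 \<le> real n \<longrightarrow>
    integral\<^sup>L \<Omega> (\<lambda>\<omega>. err P f (meta_algorithm M C (halving_learner C) n \<omega> (\<lambda>i. f (fst \<omega> i)))) \<le> \<epsilon>"
proof -
  define \<alpha> where "\<alpha> = core_mass (dt - 1)"
  have \<alpha>: "\<alpha> > 0" unfolding \<alpha>_def using dt_pos by (intro core_mass_pos) auto
  obtain K1 g1 where 1: "0 \<le> K1" "0 < g1" "\<And>n. covered (bad n) (K1 * exp (- g1 * real n))"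
    using rare_bad unfolding rare_def by blast
  obtain K2 g2 where 2: "0 \<le> K2" "0 < g2"
    "\<And>D n. D \<in> sets M \<Longrightarrow> covered (\<Union>p\<in>{p. 1 \<le> p \<and> n \<le> 6 * p}. density_fail_fixed D p) (K2 * exp (- g2 * real n))"
    using covered_density_fail_fixed_tail by blast
  define A where "A = 8 * (3 * real d + 6)"
  \<comment> \<open>The summand 20 / \<alpha> is Markov's inequality at level \<alpha> / 10 and
    radius 2 \<epsilon>; the summand 1 pays for 3 / m, which is at most \<theta> \<epsilon>.\<close>
  define B where "B = 1 + 20 / \<alpha>"
  define C7 where "C7 = A * (3 + ln A) / (4/10 * \<alpha>)"
  define c1 where "c1 = 128 * (real d + 1)"
  define G where "G = 64 * (real d + 1) * (1 + ln c1)"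
  \<comment> \<open>Each summand secures one requirement: the first two keep the requests of the
    first loop below the quota except with probability \<epsilon>^2, the next two bring the other
    exponential tails down to order \<epsilon>^2, the fifth lets the second loop collect enough
    labels, and the sixth keeps m below the position limit 2 ^ n.\<close>
  define c where "c = 16 * C7 / kappa + 16 / kappa + 2 / g1 + 2 / g2 + 3 * B * (G + 1) / kappa + 2 * (ln A + 2) + 1"
  define K where "K = K1 + (A + 2) ^ (d + 1) + 1 + K2"
  have A: "A \<ge> 48" by (simp add: A_def)
  have lnA: "ln A \<ge> 0" using A by simp
  have B: "B > 0" using \<alpha> by (simp add: B_def add_pos_pos)
  have C7: "C7 \<ge> 0" unfolding C7_def using A lnA \<alpha> by (intro divide_nonneg_nonneg mult_nonneg_nonneg) auto
  have "ln c1 \<ge> 0" by (simp add: c1_def)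
  then have G: "G > 0" unfolding G_def by (intro mult_pos_pos) auto
  have nn: "16 * C7 / kappa \<ge> 0" "16 / kappa \<ge> 0" "2 / g1 \<ge> 0" "2 / g2 \<ge> 0" "3 * B * (G + 1) / kappa \<ge> 0"
    using C7 kappa_pos 1 2 B G by auto
  have part: "u1 \<le> s \<and> u2 \<le> s \<and> u3 \<le> s \<and> u4 \<le> s \<and> u5 \<le> s \<and> 2 * (l + 2) \<le> s \<and> 1 \<le> s"
    if "u1 \<ge> 0" "u2 \<ge> 0" "u3 \<ge> 0" "u4 \<ge> 0" "u5 \<ge> 0" "l \<ge> 0" "s = u1 + u2 + u3 + u4 + u5 + 2 * (l + 2) + 1" for u1 u2 u3 u4 u5 l s :: real
    using that by auto
  have c: "16 * C7 / kappa \<le> c" "16 / kappa \<le> c" "2 / g1 \<le> c" "2 / g2 \<le> c" "3 * B * (G + 1) / kappa \<le> c" "2 * (ln A + 2) \<le> c" "1 \<le> c"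
    using part[OF nn lnA c_def] by blast+
  have K: "K > 0" unfolding K_def using 1 2 A by (intro add_nonneg_pos add_pos_nonneg) auto
  have main: "integral\<^sup>L \<Omega> (\<lambda>\<omega>. err P f (meta_algorithm M C (halving_learner C) n \<omega> (\<lambda>i. f (fst \<omega> i)))) \<le> \<epsilon>"
    if \<epsilon>: "0 < \<epsilon>" "\<epsilon> < exp (- 1)" "K * \<epsilon> \<le> 1 / 2" and nc: "c * thet \<epsilon> * (ln (1 / \<epsilon>))\<^sup>2 \<le> real n" for \<epsilon> n
  proof -
    define L where "L = ln (1 / \<epsilon>)"
    have eL: "\<epsilon> = exp (- L)" using \<epsilon>(1) by (simp add: L_def ln_div)
    have L: "L \<ge> 1" using \<epsilon>(2) unfolding eL by simp
    have \<epsilon>1: "\<epsilon> < 1" using L unfolding eL by simp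
    define \<theta> where "\<theta> = thet \<epsilon>"
    have \<theta>: "\<theta> \<ge> 1" unfolding \<theta>_def thet_def by (rule shatter_mass_le_theta(2)[of \<epsilon> "2 * \<epsilon>"]) (use \<epsilon> in auto)
    have L2: "L \<le> L\<^sup>2" using L by (simp add: power2_eq_square)
    have "1 * L\<^sup>2 \<le> \<theta> * L\<^sup>2" using \<theta> by (intro mult_right_mono) auto
    then have \<theta>L: "L \<le> \<theta> * L\<^sup>2" using L2 by linarith
    have nc': "c * (\<theta> * L\<^sup>2) \<le> real n" using nc by (simp add: \<theta>_def L_def mult.assoc)
    have "c * L \<le> c * (\<theta> * L\<^sup>2)" using c \<theta>L by (intro mult_left_mono) auto
    then have ncL: "c * L \<le> real n" using nc' by linarith
    have n1: "n \<ge> 1"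
    proof -
      have "1 * 1 \<le> c * L" using c L by (intro mult_mono) auto
      then have "1 \<le> real n" using ncL by linarith
      then show ?thesis by simp
    qed
    have decay: "exp (- g * real n) \<le> \<epsilon>\<^sup>2" if g: "0 < g" "2 / g \<le> c" for g :: real
    proof -
      have "2 \<le> g * c" using g by (simp add: field_simps)
      then have "2 * L \<le> g * c * L" using L by (intro mult_right_mono) auto
      also have "\<dots> = g * (c * L)" by (simp only: mult.assoc)
      also have "\<dots> \<le> g * real n" using ncL g by (intro mult_left_mono) auto
      finally have "exp (- g * real n) \<le> exp (- (2 * L))" by simp
      also have "\<dots> = \<epsilon>\<^sup>2" unfolding eL by (simp flip: exp_of_nat_mult)
      finally show ?thesis .
    qed
    \<comment> \<open>The largest m for which all radii A L / (j + 1) with j < m are at least 2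
      \<epsilon>; the radius at m itself is at most 2 \<epsilon>.\<close>
    define m where "m = nat \<lfloor>A * L / (2 * \<epsilon>)\<rfloor>"
    have AL: "48 * 1 \<le> A * L" using A L by (intro mult_mono) auto
    have Le: "L / \<epsilon> \<ge> 1" using L \<epsilon>1 \<epsilon>(1) by (simp add: field_simps)
    have ALe: "24 * (L / \<epsilon>) \<le> A * L / (2 * \<epsilon>)" using A L \<epsilon>(1) by (simp add: field_simps)
    have m: "real m \<le> A * L / (2 * \<epsilon>)" "A * L / (2 * \<epsilon>) < real m + 1"
      unfolding m_def using ALe Le by linarith+
    have m3: "3 * (L / \<epsilon>) \<le> real m" using m(2) ALe Le by linarith
    have m1: "m \<ge> 1" using m3 Le by linarith
    have r2: "A * L / (real m + 1) \<le> 2 * \<epsilon>" using m(2) \<epsilon>(1) by (simp add: field_simps)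
    define r where "r j = A * L / (real j + 1)" for j :: nat
    define D where "D j = {x\<in>space M. 4/10 * core_mass (dt - 1) \<le> link_mass dt (ball (r j)) x}" for j
    define E where "E = {x\<in>space M. 1/10 * core_mass (dt - 1) \<le> link_mass dt (ball (2 * \<epsilon>)) x}"
    define RF where "RF = (\<Union>p\<in>{1..m}. radius_fail (r p) p)"
    define FL where "FL = first_loop_fail D m (kappa * n / 4)"
    define DF where "DF = (\<Union>p\<in>{p. 1 \<le> p \<and> n \<le> 6 * p}. density_fail_fixed E p)"
    have cRF: "covered RF ((A + 2) ^ (d + 1) * \<epsilon>\<^sup>2)"
      unfolding RF_def r_def A_def using \<epsilon>(1) \<epsilon>1 L m(1) unfolding L_def A_def by (intro covered_radii) auto
    have cFL: "covered FL (\<epsilon>\<^sup>2)"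
    proof -
      have "(\<Sum>j<m. measure P (D j)) \<le> C7 * \<theta> * L\<^sup>2"
        unfolding D_def r_def C7_def \<theta>_def \<alpha>_def[symmetric] using \<epsilon>(1) L m m1 A \<alpha>
        by (intro sum_levels_le[where \<epsilon> = \<epsilon>]) (simp_all add: L_def)
      then have "covered FL (exp ((exp 1 - 1) * (C7 * \<theta> * L\<^sup>2) - kappa * n / 4))"
        unfolding FL_def by (intro covered_first_loop_fail) (auto simp: D_def sets_link_level)
      moreover have "exp ((exp 1 - 1) * (C7 * \<theta> * L\<^sup>2) - kappa * n / 4) \<le> \<epsilon>\<^sup>2"
      proof -
        \<comment> \<open>One half of kappa n / 4 pays for the mean number of hits, the other half
          remains as decay.\<close>
        have "exp 1 - 1 \<le> (2 :: real)" using e_less_272 by linarith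
        moreover have "0 \<le> C7 * \<theta> * L\<^sup>2" using C7 \<theta> by auto
        ultimately have "(exp 1 - 1) * (C7 * \<theta> * L\<^sup>2) \<le> 2 * (C7 * \<theta> * L\<^sup>2)" by (rule mult_right_mono)
        moreover have "16 * C7 \<le> kappa * c" using c(1) kappa_pos by (simp add: field_simps)
        then have "16 * C7 * (\<theta> * L\<^sup>2) \<le> kappa * c * (\<theta> * L\<^sup>2)" using \<theta> by (intro mult_right_mono) auto
        moreover have "kappa * (c * (\<theta> * L\<^sup>2)) \<le> kappa * real n" using nc' kappa_pos by (intro mult_left_mono) auto
        ultimately have "(exp 1 - 1) * (C7 * \<theta> * L\<^sup>2) - kappa * n / 4 \<le> - (kappa / 8) * real n"
          by (simp add: mult.assoc)
        then have "exp ((exp 1 - 1) * (C7 * \<theta> * L\<^sup>2) - kappa * n / 4) \<le> exp (- (kappa / 8) * real n)" by simp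
        also have "\<dots> \<le> \<epsilon>\<^sup>2" using c(2) kappa_pos by (intro decay) auto
        finally show ?thesis .
      qed
      ultimately show ?thesis by (rule covered_mono[OF _ order_refl])
    qed
    have cDF: "covered DF (K2 * \<epsilon>\<^sup>2)"
    proof -
      have "covered DF (K2 * exp (- g2 * real n))" unfolding DF_def E_def by (intro 2(3) sets_link_level)
      moreover have "K2 * exp (- g2 * real n) \<le> K2 * \<epsilon>\<^sup>2" using 2 c(4) by (intro mult_left_mono decay) auto
      ultimately show ?thesis by (rule covered_mono[OF _ order_refl])
    qed
    have cbad: "covered (bad n) (K1 * \<epsilon>\<^sup>2)"
    proof -
      have "K1 * exp (- g1 * real n) \<le> K1 * \<epsilon>\<^sup>2" using 1 c(3) by (intro mult_left_mono decay) auto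
      then show ?thesis by (rule covered_mono[OF 1(3) order_refl])
    qed
    have "covered (((bad n \<union> RF) \<union> FL) \<union> DF) (((K1 * \<epsilon>\<^sup>2 + (A + 2) ^ (d + 1) * \<epsilon>\<^sup>2) + \<epsilon>\<^sup>2) + K2 * \<epsilon>\<^sup>2)"
      using 1(1) 2(1) A by (intro covered_Un cbad cRF cFL cDF add_nonneg_nonneg mult_nonneg_nonneg) auto
    moreover have "((K1 * \<epsilon>\<^sup>2 + (A + 2) ^ (d + 1) * \<epsilon>\<^sup>2) + \<epsilon>\<^sup>2) + K2 * \<epsilon>\<^sup>2 \<le> \<epsilon> / 2"
    proof -
      \<comment> \<open>All failure probabilities are of order \<epsilon>^2, so their sum is at most
        \<epsilon> / 2 for small \<epsilon>.\<close>
      have "((K1 * \<epsilon>\<^sup>2 + (A + 2) ^ (d + 1) * \<epsilon>\<^sup>2) + \<epsilon>\<^sup>2) + K2 * \<epsilon>\<^sup>2 = K * \<epsilon> * \<epsilon>"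
        by (simp add: K_def power2_eq_square algebra_simps)
      also have "\<dots> \<le> 1 / 2 * \<epsilon>" using \<epsilon> by (intro mult_right_mono) auto
      finally show ?thesis by simp
    qed
    ultimately have cov: "covered (((bad n \<union> RF) \<union> FL) \<union> DF) (\<epsilon> / 2)" by (rule covered_mono[OF _ order_refl])
    define J0 where "J0 = nat \<lceil>G * L / \<epsilon>\<rceil>"
    have "integral\<^sup>L \<Omega> (\<lambda>\<omega>. err P f (meta_algorithm M C (halving_learner C) n \<omega> (\<lambda>i. f (fst \<omega> i)))) \<le> \<epsilon> / 2 + 2 * (\<epsilon> / 8)"
    proof (rule integral_err_le[OF cov])
      show "2 * real d * log 2 (real J + 2) / (real J + 1) \<le> \<epsilon> / 8" if "J \<ge> J0" for J
      proof (rule log_quotient_le[OF \<epsilon>(1) L_def L])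
        have "G * L / \<epsilon> \<le> real J" using that unfolding J0_def by linarith
        then show "64 * (real d + 1) * (1 + ln (128 * (real d + 1))) * L / \<epsilon> \<le> real J" by (simp only: G_def c1_def)
      qed
    next
      fix X W1 W2 U assume w: "(X, W1, W2, U) \<in> space \<Omega>" and "(X, W1, W2, U) \<notin> ((bad n \<union> RF) \<union> FL) \<union> DF"
      then have ok: "(X, W1, W2, U) \<notin> bad n" and rf: "(X, W1, W2, U) \<notin> RF" and fl: "(X, W1, W2, U) \<notin> FL" and df: "(X, W1, W2, U) \<notin> DF"
        by auto
      have rad: "Vs X p \<subseteq> ball (r p)" if "p \<le> m" for p
      proof (cases "p = 0")
        \<comment> \<open>Before the first point the radius is A L, at least 48, and the ball is the
          whole class.\<close>
        case True
        have "ball (r p) = C" using True AL err_le_1 by (force simp: concept_ball_def r_def intro: order_trans)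
        then show ?thesis by (auto simp: Vs_def)
      next
        case False
        then show ?thesis using rf w that by (auto simp: RF_def radius_fail_def)
      qed
      have far: "m \<le> pos (mid X W1 W2 n dt)"
      proof (rule explore_far[OF w ok n1])
        show "Vs X p \<subseteq> ball (r p)" if "p < m" for p using rad that by simp
        show "(X, W1, W2, U) \<notin> first_loop_fail (\<lambda>j. {x\<in>space M. 4/10 * core_mass (dt - 1) \<le> link_mass dt (ball (r j)) x}) m (kappa * n / 4)"
          using fl unfolding FL_def D_def .
        \<comment> \<open>m is polynomial in 1 / \<epsilon>, while n is at least a large multiple of
          ln (1 / \<epsilon>); hence the exponential position limit is no obstruction.\<close>
        have "A * L / (2 * \<epsilon>) \<le> A * (1 / \<epsilon>) / \<epsilon>"
          using ln_le_minus_one[of "1 / \<epsilon>"] A \<epsilon>(1) L by (intro frac_le mult_left_mono) (auto simp: L_def)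
        then have "real m \<le> A * (1 / \<epsilon>) * (1 / \<epsilon>)" using m by simp
        also have "1 / \<epsilon> = exp L" unfolding eL by (simp add: exp_minus divide_inverse)
        also have "A * exp L * exp L = exp (ln A + 2 * L)"
        proof -
          have "exp (ln A) = A" using A by simp
          then show ?thesis by (simp only: exp_add mult_2 mult.assoc)
        qed
        also have "\<dots> \<le> exp (ln 2 * real n)"
        proof -
          have "ln A + 2 * L \<le> (ln A + 2) * L" using lnA L mult_left_mono[of 1 L "ln A"] by (simp add: algebra_simps)
          also have "\<dots> \<le> (c / 2) * L" using c(6) L by (intro mult_right_mono) auto
          also have "\<dots> \<le> 1 / 2 * real n" using ncL by simp
          also have "\<dots> \<le> ln 2 * real n" using ln2_ge_two_thirds by (intro mult_right_mono) auto
          finally show ?thesis by simp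
        qed
        also have "\<dots> = 2 ^ n" by (simp only: mult.commute[of "ln 2"] exp_of_nat_mult exp_ln zero_less_numeral)
        finally have "real m \<le> real (2 ^ n)" by simp
        then show "m \<le> 2 ^ n" by (simp only: of_nat_le_iff)
      qed
      have "kappa * n / (3 * (measure P E + 3 / real m)) - 1 \<le> real (Jk X W1 W2 n dt)"
      proof (rule collect_many[OF w ok n1 far m1 _ E_def])
        show "Vs X m \<subseteq> ball (2 * \<epsilon>)" using rad[of m] ball_mono[of "r m" "2 * \<epsilon>"] r2 by (auto simp: r_def)
        show "(X, W1, W2, U) \<notin> density_fail_fixed E p" if "1 \<le> p" "n \<le> 6 * p" for p using df that by (auto simp: DF_def)
      qed
      \<comment> \<open>The additional L / \<epsilon>, which is at least 1, makes up for the
        rounding loss in \<open>collect_many\<close>.\<close>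
      moreover have "(G + 1) * L / \<epsilon> \<le> kappa * n / (3 * (measure P E + 3 / real m))"
      proof -
        have "measure P E \<le> shatter_mass dt (2 * \<epsilon>) / (1/10 * \<alpha>)"
          using link_mass_markov[of "1/10 * \<alpha>" dt "2 * \<epsilon>"] \<alpha> dt_pos by (simp add: E_def \<alpha>_def)
        also have "\<dots> \<le> \<theta> * (2 * \<epsilon>) / (1/10 * \<alpha>)"
          unfolding \<theta>_def thet_def using \<alpha> \<epsilon>(1) by (intro divide_right_mono shatter_mass_le_theta) auto
        also have "\<dots> = 20 / \<alpha> * (\<theta> * \<epsilon>)" by simp
        finally have PE: "measure P E \<le> 20 / \<alpha> * (\<theta> * \<epsilon>)" .
        have "3 / real m \<le> 3 / (3 * (L / \<epsilon>))" using m3 Le by (intro frac_le) linarith+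
        also have "\<dots> = \<epsilon> / L" by simp
        also have "\<dots> \<le> \<epsilon>" using L \<epsilon>(1) by (simp add: field_simps)
        also have "\<dots> \<le> \<theta> * \<epsilon>" using \<theta> \<epsilon>(1) by simp
        finally have q: "measure P E + 3 / real m \<le> B * (\<theta> * \<epsilon>)" using PE by (simp add: B_def distrib_right)
        have pos: "3 * (measure P E + 3 / real m) > 0" using m1 by (simp add: add_nonneg_pos)
        have Bc: "3 * B * (G + 1) \<le> kappa * c" using c(5) kappa_pos by (simp add: field_simps)
        have "(G + 1) * L / \<epsilon> * (3 * (measure P E + 3 / real m)) \<le> (G + 1) * L / \<epsilon> * (3 * (B * (\<theta> * \<epsilon>)))"
          using q G L \<epsilon>(1) by (intro mult_left_mono) auto
        also have "\<dots> = 3 * B * (G + 1) * (\<theta> * L)" using \<epsilon>(1) by simp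
        also have "\<dots> \<le> kappa * c * (\<theta> * L\<^sup>2)" using L2 \<theta> L kappa_pos c(7)
          by (intro mult_mono[OF Bc] mult_left_mono mult_nonneg_nonneg) linarith+
        also have "\<dots> = kappa * (c * (\<theta> * L\<^sup>2))" by (simp only: mult.assoc)
        also have "\<dots> \<le> kappa * real n" using nc' kappa_pos by (intro mult_left_mono) auto
        finally show ?thesis using pos by (simp only: pos_le_divide_eq)
      qed
      ultimately have "G * L / \<epsilon> \<le> real (Jk X W1 W2 n dt)" using Le by (simp add: distrib_right add_divide_distrib)
      then have "J0 \<le> Jk X W1 W2 n dt" unfolding J0_def by linarith
      then show "J0 \<le> Jk X W1 W2 n dt \<and> err P f (meta_algorithm M C (halving_learner C) n (X, W1, W2, U) (lab X)) \<le> 2 * err P f (ideal X W1 W2 n dt)"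
        using err_meta_le[OF w ok n1] by blast
    qed (use \<epsilon> in auto)
    then show ?thesis using \<epsilon>(1) by simp
  qed
  have "\<forall>\<^sub>F \<epsilon> in at_right 0. 0 < \<epsilon> \<and> \<epsilon> < min (exp (- 1)) (1 / (2 * K))"
    using K by (intro eventually_at_rightI[of 0 "min (exp (- 1)) (1 / (2 * K))"]) auto
  then have "\<forall>\<^sub>F \<epsilon> in at_right 0. \<forall>n. c * thet \<epsilon> * (ln (1 / \<epsilon>))\<^sup>2 \<le> real n \<longrightarrow>
    integral\<^sup>L \<Omega> (\<lambda>\<omega>. err P f (meta_algorithm M C (halving_learner C) n \<omega> (\<lambda>i. f (fst \<omega> i)))) \<le> \<epsilon>"
  proof (rule eventually_mono)
    fix \<epsilon> assume e: "0 < \<epsilon> \<and> \<epsilon> < min (exp (- 1)) (1 / (2 * K))"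
    then have "K * \<epsilon> \<le> 1 / 2" using K by (simp add: field_simps)
    then show "\<forall>n. c * thet \<epsilon> * (ln (1 / \<epsilon>))\<^sup>2 \<le> real n \<longrightarrow>
      integral\<^sup>L \<Omega> (\<lambda>\<omega>. err P f (meta_algorithm M C (halving_learner C) n \<omega> (\<lambda>i. f (fst \<omega> i)))) \<le> \<epsilon>"
      using main e by auto
  qed
  moreover have "c \<ge> 0" using c(7) by simp
  ultimately show ?thesis using that by blast
qed

text \<open>Rounding up and ensuring N \<ge> 1 costs at most 2, which the constant absorbs because
  \<theta> L^2 is at least 1.\<close>

lemma label_complexity:
  obtains c where "\<forall>\<^sub>F \<epsilon> in at_right 0. \<exists>N::nat. 1 \<le> N \<and> ereal (real N) \<le> ereal c * theta_tilde P C f \<epsilon> * ereal ((ln (1 / \<epsilon>))\<^sup>2) \<and>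
    (\<forall>n\<ge>N. integral\<^sup>L \<Omega> (\<lambda>\<omega>. err P f (meta_algorithm M C (halving_learner C) n \<omega> (\<lambda>i. f (fst \<omega> i)))) \<le> \<epsilon>)"
proof -
  obtain c where c: "c \<ge> 0" and ev: "\<forall>\<^sub>F \<epsilon> in at_right 0. \<forall>n. c * thet \<epsilon> * (ln (1 / \<epsilon>))\<^sup>2 \<le> real n \<longrightarrow>
    integral\<^sup>L \<Omega> (\<lambda>\<omega>. err P f (meta_algorithm M C (halving_learner C) n \<omega> (\<lambda>i. f (fst \<omega> i)))) \<le> \<epsilon>"
    by (rule integral_err_le_eps)
  have small: "\<forall>\<^sub>F \<epsilon> in at_right 0. 0 < \<epsilon> \<and> \<epsilon> < exp (- 1 :: real)"
    by (intro eventually_at_rightI[of 0 "exp (- 1)"]) auto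
  have "\<forall>\<^sub>F \<epsilon> in at_right 0. \<exists>N::nat. 1 \<le> N \<and> ereal (real N) \<le> ereal (c + 2) * theta_tilde P C f \<epsilon> * ereal ((ln (1 / \<epsilon>))\<^sup>2) \<and>
    (\<forall>n\<ge>N. integral\<^sup>L \<Omega> (\<lambda>\<omega>. err P f (meta_algorithm M C (halving_learner C) n \<omega> (\<lambda>i. f (fst \<omega> i)))) \<le> \<epsilon>)"
    using ev small
  proof eventually_elim
    case (elim \<epsilon>)
    define L where "L = ln (1 / \<epsilon>)"
    have "\<epsilon> = exp (- L)" using elim(2) by (simp add: L_def ln_div)
    then have L: "L \<ge> 1" using elim(2) by simp
    have th: "1 \<le> thet \<epsilon>" "ereal (thet \<epsilon>) = theta_tilde P C f \<epsilon>"
      unfolding thet_def by (rule shatter_mass_le_theta(2,3)[of \<epsilon> "2 * \<epsilon>"]; use elim(2) in simp)+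
    define z where "z = thet \<epsilon> * L\<^sup>2"
    have "1 * 1 \<le> thet \<epsilon> * L\<^sup>2" using th(1) L by (intro mult_mono) auto
    then have z: "z \<ge> 1" by (simp add: z_def)
    define N where "N = nat \<lceil>c * z\<rceil> + 1"
    have cz: "c * z \<ge> 0" using c z by simp
    have "c * z \<le> real N" unfolding N_def by linarith
    then have "integral\<^sup>L \<Omega> (\<lambda>\<omega>. err P f (meta_algorithm M C (halving_learner C) n \<omega> (\<lambda>i. f (fst \<omega> i)))) \<le> \<epsilon>" if "n \<ge> N" for n
      using elim(1) that by (auto simp: z_def L_def mult.assoc)
    moreover have "real N \<le> c * z + 2" unfolding N_def using cz by linarith
    then have "real N \<le> (c + 2) * z" using z by (simp add: distrib_right)
    then have "ereal (real N) \<le> ereal (c + 2) * theta_tilde P C f \<epsilon> * ereal ((ln (1 / \<epsilon>))\<^sup>2)"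
      by (simp add: th(2)[symmetric] z_def L_def mult.assoc)
    ultimately show ?case by (intro exI[of _ N]) (simp add: N_def)
  qed
  then show ?thesis using that by blast
qed

end

theorem corollary17:
  fixes M :: "'a measure" and C :: "('a \<Rightarrow> bool) set"
  assumes "standard_borel M"
    and "vc_class M C"
    and "measurable_realizations M C"
  shows "\<exists>A. passive_algorithm M A \<and>
    (\<exists>\<Lambda>. achieves_label_complexity M C (meta_algorithm M C A) \<Lambda> \<and>
      (\<forall>f\<in>C. \<forall>P\<in>distributions M. \<exists>c::real. \<forall>\<^sub>F \<epsilon> in at_right 0.
         ereal_of_enat (\<Lambda> \<epsilon> f P) \<le> ereal c * theta_tilde P C f \<epsilon> * ereal ((ln (1/\<epsilon>))\<^sup>2)))"
proof -
  interpret vc_setting M C using assms(2,3) by unfold_locales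
  define good where "good \<epsilon> f P N \<longleftrightarrow> 1 \<le> N \<and> (\<forall>n\<ge>N. integral\<^sup>L (source_measure P)
      (\<lambda>\<omega>. err P f (meta_algorithm M C (halving_learner C) n \<omega> (\<lambda>i. f (fst \<omega> i)))) \<le> \<epsilon>)" for \<epsilon> f P and N :: nat
  \<comment> \<open>One function has to serve all f and P, so it is taken minimal: the least budget
    from which on the expected error stays at most \<epsilon>. The infimum over the empty set is
    \<infinity>.\<close>
  define \<Lambda> where "\<Lambda> \<epsilon> f P = (INF N\<in>{N. good \<epsilon> f P N}. enat N)" for \<epsilon> f P
  have "achieves_label_complexity M C (meta_algorithm M C (halving_learner C)) \<Lambda>"
    unfolding achieves_label_complexity_def Let_def
  proof (intro conjI allI ballI impI)
    show "1 \<le> \<Lambda> \<epsilon> f P" for \<epsilon> f P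
      unfolding \<Lambda>_def by (intro INF_greatest) (simp add: good_def one_enat_def)
  next
    fix f P \<epsilon> n assume f: "f \<in> C" and P: "P \<in> distributions M" and le: "\<Lambda> \<epsilon> f P \<le> enat n"
    interpret target M C f P using f P by unfold_locales
    show "(\<lambda>\<omega>. err P f (meta_algorithm M C (halving_learner C) n \<omega> (\<lambda>i. f (fst \<omega> i)))) \<in> borel_measurable (source_measure P)"
      by (rule measurable_err_meta)
    \<comment> \<open>Passing to a strict inequality with \<open>Suc n\<close> turns the infimum
      into a witness that is at most n.\<close>
    have "\<Lambda> \<epsilon> f P < enat (Suc n)" using le by (simp add: order_le_less_trans)
    then obtain N where "good \<epsilon> f P N" "enat N < enat (Suc n)" unfolding \<Lambda>_def INF_less_iff by auto
    then show "integral\<^sup>L (source_measure P) (\<lambda>\<omega>. err P f (meta_algorithm M C (halving_learner C) n \<omega> (\<lambda>i. f (fst \<omega> i)))) \<le> \<epsilon>"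
      by (auto simp: good_def)
  qed
  moreover have "\<exists>c::real. \<forall>\<^sub>F \<epsilon> in at_right 0. ereal_of_enat (\<Lambda> \<epsilon> f P) \<le> ereal c * theta_tilde P C f \<epsilon> * ereal ((ln (1/\<epsilon>))\<^sup>2)"
    if f: "f \<in> C" and P: "P \<in> distributions M" for f P
  proof -
    interpret target M C f P using f P by unfold_locales
    obtain c where "\<forall>\<^sub>F \<epsilon> in at_right 0. \<exists>N::nat. 1 \<le> N \<and> ereal (real N) \<le> ereal c * theta_tilde P C f \<epsilon> * ereal ((ln (1 / \<epsilon>))\<^sup>2) \<and>
      (\<forall>n\<ge>N. integral\<^sup>L (source_measure P) (\<lambda>\<omega>. err P f (meta_algorithm M C (halving_learner C) n \<omega> (\<lambda>i. f (fst \<omega> i)))) \<le> \<epsilon>)"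
      by (rule label_complexity)
    then have "\<forall>\<^sub>F \<epsilon> in at_right 0. ereal_of_enat (\<Lambda> \<epsilon> f P) \<le> ereal c * theta_tilde P C f \<epsilon> * ereal ((ln (1/\<epsilon>))\<^sup>2)"
    proof (rule eventually_mono)
      fix \<epsilon> assume "\<exists>N::nat. 1 \<le> N \<and> ereal (real N) \<le> ereal c * theta_tilde P C f \<epsilon> * ereal ((ln (1 / \<epsilon>))\<^sup>2) \<and>
        (\<forall>n\<ge>N. integral\<^sup>L (source_measure P) (\<lambda>\<omega>. err P f (meta_algorithm M C (halving_learner C) n \<omega> (\<lambda>i. f (fst \<omega> i)))) \<le> \<epsilon>)"
      then obtain N where N: "good \<epsilon> f P N" "ereal (real N) \<le> ereal c * theta_tilde P C f \<epsilon> * ereal ((ln (1 / \<epsilon>))\<^sup>2)"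
        unfolding good_def by blast
      have "\<Lambda> \<epsilon> f P \<le> enat N" unfolding \<Lambda>_def using N(1) by (intro INF_lower) simp
      then have "ereal_of_enat (\<Lambda> \<epsilon> f P) \<le> ereal_of_enat (enat N)" by (simp only: ereal_of_enat_le_iff)
      then show "ereal_of_enat (\<Lambda> \<epsilon> f P) \<le> ereal c * theta_tilde P C f \<epsilon> * ereal ((ln (1/\<epsilon>))\<^sup>2)"
        using N(2) by simp
    qed
    then show ?thesis by blast
  qed
  ultimately show ?thesis using passive_halving_learner by blast
qed

end
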